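(* Let $\mathcal{C}$ be either the category $\mathcal{LRF}$ of labeled rooted forests or the category $\mathcal{LFG}$ of labeled Feynman graphs. For $f,g\in \mathrm{H}_{\mathcal{C}}$ put $$g\bullet f:=\pi_{q*}(\pi_1^*(f)\,\pi_2^*(g)),\qquad g\,\Box\, f:=\pi_{2*}(\pi_q^*(f)\,\pi_1^*(g)),\qquad f\star g:=\pi_{1*}(\pi_q^*(f)\,\pi_2^*(g)).$$ Then for all $A,B\in\mathrm{Iso}(\mathcal{C})$: $$\delta_B\bullet\delta_A=\sum_{N\subset B,\ N\simeq A}\delta_{B/N},\qquad \delta_B\,\Box\,\delta_A=\sum_{E\in\mathrm{Iso}(\mathcal{C})}\ \sum_{N\subset E,\ N\simeq B,\ E/N\simeq A}\delta_E,\qquad \delta_A\star\delta_B=\sum_{N\subset B,\ B/N\simeq A}\delta_N .$$ Moreover: (1) $\bullet$ is a right action of $\mathrm{H}_{\mathcal{C}}$ on itself; after identifying $\mathrm{H}_{\mathcal{C}}$ with its restricted dual $\mathrm{H}^*_{\mathcal{C}}$ via $\delta_A\leftrightarrow\phi_A$ and switching from right to left actions (that is, $X\cdot g:=-\,g\bullet X$ for $X\in\mathfrak{n}_{\mathcal{C}}$), it coincides with the elimination representation $\mathrm{H}^*_{elim}$ of $\mathfrak{n}_{\mathcal{C}}$. (2) $\Box$ is a right action of $\mathrm{H}_{\mathcal{C}}$ on itself (with $f$ acting on $g$), and it coincides with the top insertion action; viewed instead as a left action of $\mathrm{H}_{\mathcal{C}}$ on itself (with $g$ acting on $f$), it coincides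 with the insertion action. (3) $\star$ is a left action of $\mathrm{H}_{\mathcal{C}}$ on itself; after identifying $\mathrm{H}_{\mathcal{C}}$ with $\mathrm{H}^*_{\mathcal{C}}$ via $\delta_A\leftrightarrow\phi_A$ and switching the right top elimination action to a left action (that is, $X\cdot\phi:=-\,\phi\cdot X$ for $X\in\mathfrak{n}_{\mathcal{C}}$), it coincides on $\mathfrak{n}_{\mathcal{C}}$ with the top elimination representation.
   Context: **Category $\mathcal{LRF}$.** Fix an infinite label set $S$. A labeled rooted tree is a finite tree $T$ with a distinguished root and an injection $V(T)\hookrightarrow S$; a labeled rooted forest is a finite set of labeled rooted trees with pairwise disjoint label sets. An admissible cut of a tree $T$ is a subset of $E(T)$ containing at most one edge on any path from a leaf to the root; removing the cut edges gives a forest $P_C(T)$ (the components not containing the root) and a tree $R_C(T)$ (the component containing the root). The empty cut $C_{null}$ (with $P=\emptyset$, $R=T$) and the formal full cut $C_{full}$ (with $P=T$, $R=\emptyset$) are admissible. A cut $C$ of a forest $F$ is a choice of cut of each tree, with $P_C(F)$, $R_C(F)$ the unions of the corresponding parts. Isomorphisms of forests are bijections of trees and of their vertices preserving roots and incidences (labels are ignored). Objects are labeled rooted forests and the empty forest $\emptyset$ (zero object); $\mathrm{Hom}(F_1,F_2)$ is the set of triples $(C_1,C_2,f)$ with $C_i$ an admissible cut of $F_i$ and $f:R_{C_1}(F_1)\cong P_{C_2}(F_2)$. A subobject of $F$ is $N=P_C(F)$ for an admissible cut $C$, with quotient $F/N=R_C(F)$; different cuts give different subobjects. **Category $\mathcal{LFG}$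 ($\phi^3$ theory).** A graph has half-edges $H$ and vertices $V$; each half-edge is adjacent to exactly one vertex and at most one other half-edge. Half-edges not adjacent to another half-edge are external edges; pairs of adjacent half-edges are internal edges. A Feynman graph is a (possibly disconnected) graph in which each vertex has exactly three half-edges, and each connected component has 2 or 3 external edges and at least one loop. A labeled Feynman graph has its half-edges labeled bijectively by a set. Isomorphisms are bijections of vertices and half-edges preserving incidences (labels are ignored). A subgraph $\gamma\subset\Gamma$ is a Feynman graph with $V(\gamma)\subset V(\Gamma)$, $H(\gamma)\subset H(\Gamma)$, containing all half-edges at its vertices, with incidences inherited from $\Gamma$. For $\gamma$ connected, $\Gamma/\gamma$ is obtained as follows: if $\gamma$ has 3 external edges, replace $\gamma$ by a single new trivalent vertex to which the external half-edges of $\gamma$ are attached; if $\gamma$ has 2 external edges, delete all vertices and half-edges of $\gamma$ and join the half-edges to which its two external half-edges were joined. For general $\gamma$ take successive quotients by components. The quotient of a connected component by itself is empty; in particular $\Gamma/\Gamma=\emptyset$. Objects are labeled Feynman graphs and the empty graph $\emptyset$ (zero object); $\mathrm{Hom}(\Gamma_1,\Gamma_2)$ is the set of triples $(\gamma_1,\gamma_2,f)$ with $\gamma_i\subset\Gamma_i$ subgraphs (possibly $\emptyset$ or $\Gamma_i$) and $f:\Gamma_1/\gamma_1\cong\gamma_2$. Subobjects of $\Gamma$ are its subgraphs $\gamma$ (including $\emptyset$, $\Gamma$), with quotient $\Gamma/\gamma$. **Known facts on $\mathcal{C}$.** $\oplus$ denotes disjoint union. For $A\subset B$ there is an inclusion-preserving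 bijection between subobjects $S$ of $B$ containing $A$ and subobjects $\overline S$ of $B/A$, with $(B/A)/\overline S\cong B/S$. An object is decomposable if it is of the form $A\oplus B$ with $A,B\ne\emptyset$, and indecomposable otherwise. **Hall algebra.** $\mathrm{Iso}(\mathcal{C})$ is the set of isomorphism classes. $\mathrm{H}_{\mathcal{C}}$ is the $\mathbb{Q}$-vector space of finitely supported functions $\mathrm{Iso}(\mathcal{C})\to\mathbb{Q}$, with basis of delta functions $\delta_A$, product $(f\times g)(M)=\sum_{N\subset M}f(N)g(M/N)$ (sum over subobjects of a representative of $M$) and coproduct $\Delta(f)(M,N)=f(M\oplus N)$. It is a cocommutative Hopf algebra, isomorphic to $U(\mathfrak{n}_{\mathcal{C}})$, where $\mathfrak{n}_{\mathcal{C}}$ is its Lie algebra of primitive elements, with basis the $X_A:=\delta_A$ for $A$ nonempty indecomposable. $\mathrm{H}^*_{\mathcal{C}}$ is the restricted dual, with basis $\{\phi_A\}$ dual to $\{\delta_A\}$. **Representations.** For $A,B\in\mathrm{Iso}(\mathcal{C})$: the insertion action is the left action $X_A\cdot\delta_B=\delta_A\times\delta_B$; the top insertion action is the right action $\delta_B\cdot X_A=\delta_B\times\delta_A$. For $X_A\in\mathfrak{n}_{\mathcal{C}}$ (in the formulas $N$ runs over subobjects of a representative of $B$): the elimination representation $\mathrm{H}^*_{elim}$ is $\mathrm{H}^*_{\mathcal{C}}$ with the left action $X_A\cdot\phi_B=-\sum_{N\subset B,\,N\simeq A}\phi_{B/N}$; the top elimination action is the right action $\phi_B\cdot X_A=-\sum_{N\subset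 B,\,B/N\simeq A}\phi_N$. **Hecke correspondence.** $\mathcal{H}ecke_{\mathcal{C}}=\{(A,B)\mid B\in\mathrm{Iso}(\mathcal{C}),\ A\subset B\}$ is the set of pairs of an isomorphism class $B$ (with a fixed representative) and a subobject $A$ of it. The maps $\pi_1,\pi_2,\pi_q:\mathcal{H}ecke_{\mathcal{C}}\to\mathrm{Iso}(\mathcal{C})$ send $(A,B)$ to the classes of $A$, $B$, $B/A$ respectively. $\pi_r^*$ is pullback of functions, products of functions on $\mathcal{H}ecke_{\mathcal{C}}$ are pointwise, and $\pi_{r*}(f)(y)=\sum_{x\in\pi_r^{-1}(y)}f(x)$ (the sums occurring in the claim have only finitely many nonzero terms).
   Formalization: Components of Feynman graphs must also satisfy: removing one internal edge never separates their external edges (otherwise a quotient can be undefined or the subobject bijection fails). An edge of Γ may join two external half-edges of a subgraph γ. *)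

theory Defs
  imports Complex_Main "HOL-Library.Disjoint_Sets" "HOL-Library.Function_Algebras"
begin

text \<open>
  The Hall algebra and the Hecke correspondence only use the following data of the category:
  objects, isomorphisms, the zero object, subobjects (as distinguished representatives),
  quotients, and disjoint unions of objects whose label sets are disjoint.
\<close>

record 'x cat_data =
  objs :: "'x set"
  isom :: "'x \<Rightarrow> 'x \<Rightarrow> bool"
  zero_obj :: "'x"
  subobjs :: "'x \<Rightarrow> 'x set"
  quotient_obj :: "'x \<Rightarrow> 'x \<Rightarrow> 'x"
  apart :: "'x \<Rightarrow> 'x \<Rightarrow> bool"
  join :: "'x \<Rightarrow> 'x \<Rightarrow> 'x"


section \<open>Labeled rooted forests\<close>

text \<open>
  A vertex is identified with its label, so that \<open>V(T)\<close> is a subset of the label set \<open>S\<close>.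
  An edge is written as the pair (lower end, end nearer to the root).
\<close>

record 's ltree =
  tverts :: "'s set"
  tedges :: "('s \<times> 's) set"
  troot :: 's

definition rooted_tree :: "'s set \<Rightarrow> 's ltree \<Rightarrow> bool" where
  "rooted_tree S T \<longleftrightarrow>
     finite (tverts T) \<and> tverts T \<subseteq> S \<and> troot T \<in> tverts T \<and>
     tedges T \<subseteq> tverts T \<times> tverts T \<and>
     (\<forall>u. (troot T, u) \<notin> tedges T) \<and>
     (\<forall>v \<in> tverts T - {troot T}. \<exists>!u. (v, u) \<in> tedges T) \<and>
     (\<forall>v \<in> tverts T. (v, troot T) \<in> (tedges T)\<^sup>*)"

type_synonym 's lforest = "'s ltree set"

definition rooted_forest :: "'s set \<Rightarrow> 's lforest \<Rightarrow> bool" where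
  "rooted_forest S F \<longleftrightarrow>
     finite F \<and> (\<forall>T\<in>F. rooted_tree S T) \<and> pairwise (\<lambda>T T'. disjnt (tverts T) (tverts T')) F"

definition fverts :: "'s lforest \<Rightarrow> 's set" where
  "fverts F = (\<Union>T\<in>F. tverts T)"

definition forest_iso :: "'s lforest \<Rightarrow> 's lforest \<Rightarrow> bool" where
  "forest_iso F G \<longleftrightarrow>
     (\<exists>\<beta> \<phi>. bij_betw \<beta> F G \<and> bij_betw \<phi> (fverts F) (fverts G) \<and>
        (\<forall>T\<in>F. \<phi> ` tverts T = tverts (\<beta> T) \<and> \<phi> (troot T) = troot (\<beta> T) \<and>
           (\<forall>x\<in>tverts T. \<forall>y\<in>tverts T. (x, y) \<in> tedges T \<longleftrightarrow> (\<phi> x, \<phi> y) \<in> tedges (\<beta> T))))"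

text \<open>\<open>EdgeCut {}\<close> is the empty cut and \<open>FullCut\<close> the formal full cut.\<close>

datatype 's tree_cut = FullCut | EdgeCut "('s \<times> 's) set"

definition leaves :: "'s ltree \<Rightarrow> 's set" where
  "leaves T = {l \<in> tverts T. \<forall>x. (x, l) \<notin> tedges T}"

text \<open>The path from the vertex \<open>v\<close> to the root consists of the edges whose lower end is reachable from \<open>v\<close>.\<close>

definition root_path :: "'s ltree \<Rightarrow> 's \<Rightarrow> ('s \<times> 's) set" where
  "root_path T v = {e \<in> tedges T. (v, fst e) \<in> (tedges T)\<^sup>*}"

fun admissible_cut :: "'s ltree \<Rightarrow> 's tree_cut \<Rightarrow> bool" where
  "admissible_cut T FullCut \<longleftrightarrow> True"
| "admissible_cut T (EdgeCut C) \<longleftrightarrow>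
     C \<subseteq> tedges T \<and> (\<forall>l \<in> leaves T. card (C \<inter> root_path T l) \<le> 1)"

text \<open>
  The component of \<open>T\<close> without the edges \<open>C\<close> whose vertex nearest to the root is \<open>v\<close>.
  The components not containing the root are those with \<open>v\<close> the lower end of an edge in \<open>C\<close>.
\<close>

definition cut_component :: "'s ltree \<Rightarrow> ('s \<times> 's) set \<Rightarrow> 's \<Rightarrow> 's ltree" where
  "cut_component T C v =
     (let W = {u \<in> tverts T. (u, v) \<in> (tedges T - C)\<^sup>*}
      in \<lparr>tverts = W, tedges = (tedges T - C) \<inter> W \<times> W, troot = v\<rparr>)"

fun tree_P :: "'s ltree \<Rightarrow> 's tree_cut \<Rightarrow> 's lforest" where
  "tree_P T FullCut = {T}"
| "tree_P T (EdgeCut C) = cut_component T C ` fst ` C"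

fun tree_R :: "'s ltree \<Rightarrow> 's tree_cut \<Rightarrow> 's lforest" where
  "tree_R T FullCut = {}"
| "tree_R T (EdgeCut C) = {cut_component T C (troot T)}"

definition forest_cut :: "'s lforest \<Rightarrow> ('s ltree \<Rightarrow> 's tree_cut) \<Rightarrow> bool" where
  "forest_cut F c \<longleftrightarrow> (\<forall>T\<in>F. admissible_cut T (c T))"

definition forest_P :: "'s lforest \<Rightarrow> ('s ltree \<Rightarrow> 's tree_cut) \<Rightarrow> 's lforest" where
  "forest_P F c = (\<Union>T\<in>F. tree_P T (c T))"

definition forest_R :: "'s lforest \<Rightarrow> ('s ltree \<Rightarrow> 's tree_cut) \<Rightarrow> 's lforest" where
  "forest_R F c = (\<Union>T\<in>F. tree_R T (c T))"

text \<open>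
  Different cuts have different \<open>P\<close>-parts, so a subobject determines its cut and hence
  its quotient.
\<close>

definition LRF :: "'s set \<Rightarrow> 's lforest cat_data" where
  "LRF S = \<lparr>
     objs = {F. rooted_forest S F},
     isom = forest_iso,
     zero_obj = {},
     subobjs = (\<lambda>F. {forest_P F c | c. forest_cut F c}),
     quotient_obj = (\<lambda>F N. THE Q. \<exists>c. forest_cut F c \<and> N = forest_P F c \<and> Q = forest_R F c),
     apart = (\<lambda>F G. fverts F \<inter> fverts G = {}),
     join = (\<lambda>F G. F \<union> G)\<rparr>"


section \<open>Labeled Feynman graphs\<close>

text \<open>
  Half-edges are identified with their labels, a vertex with the (three-element) set of
  half-edges adjacent to it, and an internal edge with the pair of half-edges forming it.
\<close>

record 's lgraph =
  halfs :: "'s set"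
  gverts :: "'s set set"
  gedges :: "'s set set"

definition external :: "'s lgraph \<Rightarrow> 's set" where
  "external G = halfs G - \<Union>(gedges G)"

definition linked :: "'s lgraph \<Rightarrow> ('s \<times> 's) set" where
  "linked G = {(h, k). \<exists>x \<in> gverts G \<union> gedges G. h \<in> x \<and> k \<in> x}"

definition induced :: "'s lgraph \<Rightarrow> 's set \<Rightarrow> 's lgraph" where
  "induced G K = \<lparr>halfs = K, gverts = {v \<in> gverts G. v \<subseteq> K}, gedges = {e \<in> gedges G. e \<subseteq> K}\<rparr>"

definition components :: "'s lgraph \<Rightarrow> 's lgraph set" where
  "components G = induced G ` (halfs G // (linked G)\<^sup>*)"

text \<open>First Betti number of a connected graph.\<close>

definition loop_number :: "'s lgraph \<Rightarrow> int" where
  "loop_number G = int (card (gedges G)) - int (card (gverts G)) + 1"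

text \<open>
  Removing a single internal edge does not separate the external edges of a component, i.e. no
  graph with two external edges is attached to an external edge.  Every 1PI graph has this
  property.  Graphs violating it have to be excluded: let \<open>K\<close> consist of two parts \<open>c\<close> and \<open>a\<close>
  linked by a single edge, where \<open>a\<close> has two external edges.  If \<open>c\<close> is a single vertex, then
  \<open>K/a\<close> has no loop and is not a Feynman graph.  If \<open>c\<close> is also a Feynman graph, then
  \<open>c \<oplus> a\<close> and \<open>K\<close> are two subgraphs of \<open>K\<close> containing \<open>a\<close> with the same image \<open>c = K/a\<close>, and
  subobjects of \<open>K\<close> containing \<open>a\<close> do not correspond to subobjects of \<open>K/a\<close>.
\<close>

definition legs_inseparable :: "'s lgraph \<Rightarrow> bool" where
  "legs_inseparable K \<longleftrightarrow>
     (\<forall>e \<in> gedges K. \<forall>h \<in> external K. \<forall>k \<in> external K.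
        (h, k) \<in> (linked (K\<lparr>gedges := gedges K - {e}\<rparr>))\<^sup>*)"

definition feynman :: "'s set \<Rightarrow> 's lgraph \<Rightarrow> bool" where
  "feynman S G \<longleftrightarrow>
     finite (halfs G) \<and> halfs G \<subseteq> S \<and>
     partition_on (halfs G) (gverts G) \<and> (\<forall>v \<in> gverts G. card v = 3) \<and>
     disjoint (gedges G) \<and> (\<forall>e \<in> gedges G. e \<subseteq> halfs G \<and> card e = 2) \<and>
     (\<forall>K \<in> components G.
        card (external K) \<in> {2, 3} \<and> loop_number K \<ge> 1 \<and> legs_inseparable K)"

definition graph_iso :: "'s lgraph \<Rightarrow> 's lgraph \<Rightarrow> bool" where
  "graph_iso G G' \<longleftrightarrow>
     (\<exists>\<phi>. bij_betw \<phi> (halfs G) (halfs G') \<and>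
          (`) \<phi> ` gverts G = gverts G' \<and> (`) \<phi> ` gedges G = gedges G')"

text \<open>
  Half-edges that are adjacent in \<open>\<gamma>\<close> are adjacent in \<open>G\<close>, but an internal edge of \<open>G\<close> may join
  two external half-edges of \<open>\<gamma>\<close>.  For instance, two disjoint subgraphs of \<open>G\<close> with three
  external edges each form a subgraph \<open>\<gamma>\<^sub>1 \<oplus> \<gamma>\<^sub>2\<close> even if an edge of \<open>G\<close> joins them; it
  corresponds to the subgraph \<open>\<gamma>\<^sub>2\<close> of \<open>G/\<gamma>\<^sub>1\<close>.
\<close>

definition subgraphs :: "'s set \<Rightarrow> 's lgraph \<Rightarrow> 's lgraph set" where
  "subgraphs S G = {\<gamma>. feynman S \<gamma> \<and> halfs \<gamma> \<subseteq> halfs G \<and> gverts \<gamma> \<subseteq> gverts G \<and>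
     gedges \<gamma> \<subseteq> gedges G}"

text \<open>
  The half-edges of \<open>G\<close> outside \<open>\<gamma>\<close> to which external half-edges of \<open>\<gamma>\<close> are joined.
  There are exactly two of them if \<open>\<gamma>\<close> is a proper connected subgraph of a component and has two
  external edges, by \<open>legs_inseparable\<close>.
\<close>

definition neighbours :: "'s lgraph \<Rightarrow> 's lgraph \<Rightarrow> 's set" where
  "neighbours G \<gamma> = {k \<in> halfs G - halfs \<gamma>. \<exists>h \<in> external \<gamma>. {h, k} \<in> gedges G}"

definition contract :: "'s lgraph \<Rightarrow> 's lgraph \<Rightarrow> 's lgraph" where
  "contract G \<gamma> =
     (if \<gamma> \<in> components G then induced G (halfs G - halfs \<gamma>)
      else if card (external \<gamma>) = 3 then
        \<lparr>halfs = (halfs G - halfs \<gamma>) \<union> external \<gamma>,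
         gverts = (gverts G - gverts \<gamma>) \<union> {external \<gamma>},
         gedges = gedges G - gedges \<gamma>\<rparr>
      else
        \<lparr>halfs = halfs G - halfs \<gamma>,
         gverts = gverts G - gverts \<gamma>,
         gedges = {e \<in> gedges G. e \<inter> halfs \<gamma> = {}} \<union> {neighbours G \<gamma>}\<rparr>)"

text \<open>The result of the successive contractions does not depend on their order.\<close>

definition graph_quotient :: "'s lgraph \<Rightarrow> 's lgraph \<Rightarrow> 's lgraph" where
  "graph_quotient G \<gamma> = Finite_Set.fold (\<lambda>\<delta> G'. contract G' \<delta>) G (components \<gamma>)"

definition LFG :: "'s set \<Rightarrow> 's lgraph cat_data" where
  "LFG S = \<lparr>
     objs = {G. feynman S G},
     isom = graph_iso,
     zero_obj = \<lparr>halfs = {}, gverts = {}, gedges = {}\<rparr>,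
     subobjs = subgraphs S,
     quotient_obj = graph_quotient,
     apart = (\<lambda>G G'. halfs G \<inter> halfs G' = {}),
     join = (\<lambda>G G'. \<lparr>halfs = halfs G \<union> halfs G', gverts = gverts G \<union> gverts G',
                      gedges = gedges G \<union> gedges G'\<rparr>)\<rparr>"


section \<open>Isomorphism classes\<close>

definition iso_class :: "'x cat_data \<Rightarrow> 'x \<Rightarrow> 'x set" where
  "iso_class C X = {Y \<in> objs C. isom C X Y}"

definition Iso :: "'x cat_data \<Rightarrow> 'x set set" where
  "Iso C = iso_class C ` objs C"

definition rep :: "'x set \<Rightarrow> 'x" where
  "rep M = (SOME X. X \<in> M)"

definition zero_class :: "'x cat_data \<Rightarrow> 'x set" where
  "zero_class C = iso_class C (zero_obj C)"

definition oplus :: "'x cat_data \<Rightarrow> 'x set \<Rightarrow> 'x set \<Rightarrow> 'x set" where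
  "oplus C M N = {Y \<in> objs C. \<exists>A\<in>M. \<exists>B\<in>N. apart C A B \<and> isom C (join C A B) Y}"

definition decomposable :: "'x cat_data \<Rightarrow> 'x set \<Rightarrow> bool" where
  "decomposable C M \<longleftrightarrow>
     (\<exists>A \<in> Iso C - {zero_class C}. \<exists>B \<in> Iso C - {zero_class C}. M = oplus C A B)"

definition Indec :: "'x cat_data \<Rightarrow> 'x set set" where
  "Indec C = {M \<in> Iso C - {zero_class C}. \<not> decomposable C M}"

text \<open>Subobjects and quotients of (the fixed representative of) an isomorphism class.\<close>

abbreviation Sub :: "'x cat_data \<Rightarrow> 'x set \<Rightarrow> 'x set" where
  "Sub C B \<equiv> subobjs C (rep B)"

abbreviation quot_class :: "'x cat_data \<Rightarrow> 'x set \<Rightarrow> 'x \<Rightarrow> 'x set" where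
  "quot_class C B N \<equiv> iso_class C (quotient_obj C (rep B) N)"


section \<open>The Hall algebra\<close>

text \<open>
  Functions on \<open>Iso C\<close> are extended by zero.  \<open>sum'\<close> denotes the sum over the finitely many
  nonzero terms; sums, products and negatives of functions are pointwise.
\<close>

definition hall :: "'x cat_data \<Rightarrow> ('x set \<Rightarrow> rat) set" where
  "hall C = {f. finite {M. f M \<noteq> 0} \<and> {M. f M \<noteq> 0} \<subseteq> Iso C}"

definition delta :: "'x cat_data \<Rightarrow> 'x set \<Rightarrow> 'x set \<Rightarrow> rat" where
  "delta C A = (\<lambda>M. if M \<in> Iso C \<and> M = A then 1 else 0)"

definition hall_one :: "'x cat_data \<Rightarrow> 'x set \<Rightarrow> rat" where
  "hall_one C = delta C (zero_class C)"

definition hall_mult ::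
  "'x cat_data \<Rightarrow> ('x set \<Rightarrow> rat) \<Rightarrow> ('x set \<Rightarrow> rat) \<Rightarrow> 'x set \<Rightarrow> rat" where
  "hall_mult C f g =
     (\<lambda>M. if M \<in> Iso C then \<Sum>N\<in>Sub C M. f (iso_class C N) * g (quot_class C M N) else 0)"

definition coproduct :: "'x cat_data \<Rightarrow> ('x set \<Rightarrow> rat) \<Rightarrow> 'x set \<Rightarrow> 'x set \<Rightarrow> rat" where
  "coproduct C f M N = f (oplus C M N)"

text \<open>The primitive elements: \<open>\<Delta>(f) = f \<otimes> 1 + 1 \<otimes> f\<close>.\<close>

definition primitives :: "'x cat_data \<Rightarrow> ('x set \<Rightarrow> rat) set" where
  "primitives C = {f \<in> hall C. \<forall>M \<in> Iso C. \<forall>N \<in> Iso C.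
     coproduct C f M N = f M * hall_one C N + hall_one C M * f N}"

definition scale :: "rat \<Rightarrow> ('a \<Rightarrow> rat) \<Rightarrow> 'a \<Rightarrow> rat" where
  "scale c f = (\<lambda>x. c * f x)"

definition bilinear_on ::
  "('a \<Rightarrow> rat) set \<Rightarrow> (('a \<Rightarrow> rat) \<Rightarrow> ('a \<Rightarrow> rat) \<Rightarrow> 'a \<Rightarrow> rat) \<Rightarrow> bool" where
  "bilinear_on U act \<longleftrightarrow>
     (\<forall>f\<in>U. \<forall>g\<in>U. act f g \<in> U) \<and>
     (\<forall>f\<in>U. \<forall>f'\<in>U. \<forall>g\<in>U. act (f + f') g = act f g + act f' g) \<and>
     (\<forall>f\<in>U. \<forall>g\<in>U. \<forall>g'\<in>U. act f (g + g') = act f g + act f g') \<and>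
     (\<forall>c. \<forall>f\<in>U. \<forall>g\<in>U. act (scale c f) g = scale c (act f g) \<and>
                         act f (scale c g) = scale c (act f g))"

text \<open>In \<open>left_action\<close> the first argument of \<open>act\<close> acts on the second, in \<open>right_action\<close>
  the second on the first.\<close>

definition left_action ::
  "'x cat_data \<Rightarrow> (('x set \<Rightarrow> rat) \<Rightarrow> ('x set \<Rightarrow> rat) \<Rightarrow> 'x set \<Rightarrow> rat) \<Rightarrow> bool" where
  "left_action C act \<longleftrightarrow> bilinear_on (hall C) act \<and>
     (\<forall>g \<in> hall C. act (hall_one C) g = g) \<and>
     (\<forall>f \<in> hall C. \<forall>f' \<in> hall C. \<forall>g \<in> hall C. act (hall_mult C f f') g = act f (act f' g))"

definition right_action ::
  "'x cat_data \<Rightarrow> (('x set \<Rightarrow> rat) \<Rightarrow> ('x set \<Rightarrow> rat) \<Rightarrow> 'x set \<Rightarrow> rat) \<Rightarrow> bool" where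
  "right_action C act \<longleftrightarrow> bilinear_on (hall C) act \<and>
     (\<forall>g \<in> hall C. act g (hall_one C) = g) \<and>
     (\<forall>f \<in> hall C. \<forall>f' \<in> hall C. \<forall>g \<in> hall C. act g (hall_mult C f f') = act (act g f) f')"


section \<open>The representations\<close>

text \<open>
  The bilinear extension of a map \<open>\<beta>\<close> given on basis vectors indexed by \<open>I\<close> and \<open>J\<close>; here \<open>x\<close>
  and \<open>y\<close> are the coefficient families.
\<close>

definition bilin ::
  "'i set \<Rightarrow> 'j set \<Rightarrow> ('i \<Rightarrow> 'j \<Rightarrow> 'k \<Rightarrow> rat) \<Rightarrow> ('i \<Rightarrow> rat) \<Rightarrow> ('j \<Rightarrow> rat) \<Rightarrow> 'k \<Rightarrow> rat" where
  "bilin I J \<beta> x y = (\<lambda>z. sum' (\<lambda>i. sum' (\<lambda>j. x i * y j * \<beta> i j z) J) I)"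

definition insertion ::
  "'x cat_data \<Rightarrow> ('x set \<Rightarrow> rat) \<Rightarrow> ('x set \<Rightarrow> rat) \<Rightarrow> 'x set \<Rightarrow> rat" where
  "insertion C = bilin (Iso C) (Iso C) (\<lambda>A B. hall_mult C (delta C A) (delta C B))"

definition top_insertion ::
  "'x cat_data \<Rightarrow> ('x set \<Rightarrow> rat) \<Rightarrow> ('x set \<Rightarrow> rat) \<Rightarrow> 'x set \<Rightarrow> rat" where
  "top_insertion C = bilin (Iso C) (Iso C) (\<lambda>B A. hall_mult C (delta C B) (delta C A))"

text \<open>
  The restricted dual consists of linear functionals on \<open>hall C\<close>; \<open>dual_basis C A\<close> is
  \<open>\<phi>\<^sub>A\<close>, and \<open>dual_iso\<close> is the linear map with \<open>\<delta>\<^sub>A \<mapsto> \<phi>\<^sub>A\<close>.  The coefficient of \<open>\<phi>\<^sub>B\<close> in a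
  functional \<open>\<psi>\<close> of the restricted dual is \<open>\<psi> (\<delta>\<^sub>B)\<close>.
\<close>

type_synonym 'x functional = "('x set \<Rightarrow> rat) \<Rightarrow> rat"

definition dual_basis :: "'x cat_data \<Rightarrow> 'x set \<Rightarrow> 'x functional" where
  "dual_basis C A = (\<lambda>f. if A \<in> Iso C then f A else 0)"

definition dual_iso :: "'x cat_data \<Rightarrow> ('x set \<Rightarrow> rat) \<Rightarrow> 'x functional" where
  "dual_iso C g = (\<lambda>f. sum' (\<lambda>A. g A * dual_basis C A f) (Iso C))"

definition dual_coeff :: "'x cat_data \<Rightarrow> 'x functional \<Rightarrow> 'x set \<Rightarrow> rat" where
  "dual_coeff C \<psi> B = \<psi> (delta C B)"

text \<open>
  \<open>elimination C X \<psi>\<close> is \<open>X \<cdot> \<psi>\<close> and \<open>top_elimination C \<psi> X\<close> is \<open>\<psi> \<cdot> X\<close>, for \<open>X\<close> in the Lie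
  algebra of primitive elements, which has the basis \<open>X\<^sub>A = \<delta>\<^sub>A\<close> for \<open>A\<close> in \<open>Indec C\<close>.
\<close>

definition elimination ::
  "'x cat_data \<Rightarrow> ('x set \<Rightarrow> rat) \<Rightarrow> 'x functional \<Rightarrow> 'x functional" where
  "elimination C X \<psi> = bilin (Indec C) (Iso C)
     (\<lambda>A B. - (\<Sum>N\<in>{N \<in> Sub C B. iso_class C N = A}. dual_basis C (quot_class C B N)))
     X (dual_coeff C \<psi>)"

definition top_elimination ::
  "'x cat_data \<Rightarrow> 'x functional \<Rightarrow> ('x set \<Rightarrow> rat) \<Rightarrow> 'x functional" where
  "top_elimination C \<psi> X = bilin (Iso C) (Indec C)
     (\<lambda>B A. - (\<Sum>N\<in>{N \<in> Sub C B. quot_class C B N = A}. dual_basis C (iso_class C N)))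
     (dual_coeff C \<psi>) X"


section \<open>The Hecke correspondence\<close>

definition Hecke :: "'x cat_data \<Rightarrow> ('x \<times> 'x set) set" where
  "Hecke C = {(A, B). B \<in> Iso C \<and> A \<in> Sub C B}"

definition pi1 :: "'x cat_data \<Rightarrow> 'x \<times> 'x set \<Rightarrow> 'x set" where
  "pi1 C = (\<lambda>(A, B). iso_class C A)"

definition pi2 :: "'x cat_data \<Rightarrow> 'x \<times> 'x set \<Rightarrow> 'x set" where
  "pi2 C = (\<lambda>(A, B). B)"

definition piq :: "'x cat_data \<Rightarrow> 'x \<times> 'x set \<Rightarrow> 'x set" where
  "piq C = (\<lambda>(A, B). quot_class C B A)"

definition pullback ::
  "('x \<times> 'x set \<Rightarrow> 'x set) \<Rightarrow> ('x set \<Rightarrow> rat) \<Rightarrow> 'x \<times> 'x set \<Rightarrow> rat" where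
  "pullback p f = f \<circ> p"

definition pushforward ::
  "'x cat_data \<Rightarrow> ('x \<times> 'x set \<Rightarrow> 'x set) \<Rightarrow> ('x \<times> 'x set \<Rightarrow> rat) \<Rightarrow> 'x set \<Rightarrow> rat" where
  "pushforward C p F = (\<lambda>y. if y \<in> Iso C then sum' F {x \<in> Hecke C. p x = y} else 0)"

definition bullet ::
  "'x cat_data \<Rightarrow> ('x set \<Rightarrow> rat) \<Rightarrow> ('x set \<Rightarrow> rat) \<Rightarrow> 'x set \<Rightarrow> rat" where
  "bullet C g f = pushforward C (piq C) (pullback (pi1 C) f * pullback (pi2 C) g)"

definition box ::
  "'x cat_data \<Rightarrow> ('x set \<Rightarrow> rat) \<Rightarrow> ('x set \<Rightarrow> rat) \<Rightarrow> 'x set \<Rightarrow> rat" where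
  "box C g f = pushforward C (pi2 C) (pullback (piq C) f * pullback (pi1 C) g)"

definition star ::
  "'x cat_data \<Rightarrow> ('x set \<Rightarrow> rat) \<Rightarrow> ('x set \<Rightarrow> rat) \<Rightarrow> 'x set \<Rightarrow> rat" where
  "star C f g = pushforward C (pi1 C) (pullback (piq C) f * pullback (pi2 C) g)"

end

theory Submission
  imports Defs
begin

text \<open>
  All claims hold for any category with finitely many subobjects per object in which the subobjects
  of \<open>B\<close> containing \<open>A\<close> correspond to those of \<open>B/A\<close> with \<open>(B/A)/(N/A) = B/N\<close>: both sides of each
  associativity law sum over flags \<open>A \<subset> N \<subset> B\<close>, described once as a subobject \<open>A\<close> of \<open>N \<subset> B\<close> and
  once as a subobject of \<open>B/A\<close>.

  For forests, cuts of \<open>F\<close> are the same as descendant-closed sets \<open>D\<close> of vertices, with \<open>P\<close> and \<open>R\<close> the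
  restrictions of \<open>F\<close> to \<open>D\<close> and to its complement, which makes these properties evident.

  For Feynman graphs, everything reduces to contracting a single connected \<open>\<delta>\<close>.  The conditions on
  components are restated through connectivity of half-edges, which contraction preserves because
  mapping \<open>\<delta>\<close> to one of its legs (or to the half-edge joined to a leg) sends paths to paths; removing
  one edge is compatible with this since the legs of \<open>\<delta>\<close> are inseparable.  Hence \<open>G\<close> is a Feynman
  graph if and only if \<open>G/\<delta>\<close> is one, and a subgraph of \<open>G/\<delta>\<close> lifts uniquely to one of \<open>G\<close> containing \<open>\<delta>\<close>.
  Contractions of disjoint subgraphs commute and \<open>(G/\<delta>)/(\<sigma>/\<delta>) = G/\<sigma>\<close> for \<open>\<delta> \<subset> \<sigma>\<close> connected, so
  that general quotients are handled by induction on the number of components.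
\<close>

section \<open>Hall algebras of abstract categories\<close>

text \<open>Objects are labeled and quotients keep labels, so the relations between subobjects and
  quotients hold as equalities and flags can be reindexed by genuine bijections; passing to classes
  only requires that sums over subobjects do not depend on the representative. \<open>box\<close> is
  the Hall product, so associativity settles it. \<open>bullet\<close> and \<open>star\<close>
  exchange the roles of \<open>pi1\<close> and \<open>piq\<close> and are handled together.

  For graphs the obstacle is the definition by folding contractions. These commute only for disjoint
  subgraphs of a Feynman graph, so the fold is shown to be well defined together with the Feynman
  property of every intermediate graph. The delicate case is a two-legged subgraph that is not a
  component: its contraction is a graph only if both legs lead outside, which the conditions on
  components guarantee, and it may be attached to another two-legged subgraph. Contraction must also
  reflect the Feynman property, since only this makes the lift of a subgraph of
  \<open>G/\<delta>\<close> an object.\<close>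

lemma sum'_eq_sum_support:
  assumes "finite T" "T \<subseteq> I" "\<And>x. x \<in> I \<Longrightarrow> x \<notin> T \<Longrightarrow> f x = 0"
  shows "sum' f I = sum f T"
proof -
  have "sum' f T = sum' f I" using assms by (intro sum.mono_neutral_left') auto
  then show ?thesis using assms(1) by simp
qed

text \<open>Besides flags, the axioms record three separate needs: \<open>isom_subobjs\<close> makes
  sums over \<open>Sub\<close> independent of the representative, \<open>finite_extensions\<close>
  gives products finite support, and \<open>oplus_zero\<close> makes primitive elements vanish at
  the zero class.\<close>

locale hall_category =
  fixes C :: "'x cat_data"
  assumes isom_refl: "X \<in> objs C \<Longrightarrow> isom C X X"
    and isom_sym: "X \<in> objs C \<Longrightarrow> Y \<in> objs C \<Longrightarrow> isom C X Y \<Longrightarrow> isom C Y X"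
    and isom_trans: "X \<in> objs C \<Longrightarrow> Y \<in> objs C \<Longrightarrow> Z \<in> objs C \<Longrightarrow>
      isom C X Y \<Longrightarrow> isom C Y Z \<Longrightarrow> isom C X Z"
    and zero_in_objs: "zero_obj C \<in> objs C"
    and sub_in_objs: "X \<in> objs C \<Longrightarrow> N \<in> subobjs C X \<Longrightarrow> N \<in> objs C"
    and quot_in_objs: "X \<in> objs C \<Longrightarrow> N \<in> subobjs C X \<Longrightarrow> quotient_obj C X N \<in> objs C"
    and finite_subobjs: "X \<in> objs C \<Longrightarrow> finite (subobjs C X)"
    and zero_sub: "X \<in> objs C \<Longrightarrow> zero_obj C \<in> subobjs C X"
    and quot_zero: "X \<in> objs C \<Longrightarrow> quotient_obj C X (zero_obj C) = X"
    and self_sub: "X \<in> objs C \<Longrightarrow> X \<in> subobjs C X"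
    and quot_self: "X \<in> objs C \<Longrightarrow> quotient_obj C X X = zero_obj C"
    and isom_zeroD: "X \<in> objs C \<Longrightarrow> isom C (zero_obj C) X \<Longrightarrow> X = zero_obj C"
    and isom_subobjs: "X \<in> objs C \<Longrightarrow> Y \<in> objs C \<Longrightarrow> isom C X Y \<Longrightarrow>
      \<exists>h. bij_betw h (subobjs C X) (subobjs C Y) \<and>
        (\<forall>N\<in>subobjs C X. isom C N (h N) \<and> isom C (quotient_obj C X N) (quotient_obj C Y (h N)))"
    and sub_trans: "B \<in> objs C \<Longrightarrow> N \<in> subobjs C B \<Longrightarrow> A \<in> subobjs C N \<Longrightarrow> A \<in> subobjs C B"
    and sub_quot: "B \<in> objs C \<Longrightarrow> A \<in> subobjs C B \<Longrightarrow>
      bij_betw (\<lambda>N. quotient_obj C N A) {N \<in> subobjs C B. A \<in> subobjs C N}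
        (subobjs C (quotient_obj C B A))"
    and quot_quot: "B \<in> objs C \<Longrightarrow> A \<in> subobjs C B \<Longrightarrow> N \<in> subobjs C B \<Longrightarrow> A \<in> subobjs C N \<Longrightarrow>
      quotient_obj C (quotient_obj C B A) (quotient_obj C N A) = quotient_obj C B N"
    and finite_extensions: "A \<in> objs C \<Longrightarrow> B \<in> objs C \<Longrightarrow>
      finite {iso_class C E | E. E \<in> objs C \<and>
        (\<exists>N\<in>subobjs C E. isom C A N \<and> isom C B (quotient_obj C E N))}"
    and oplus_zero: "oplus C (zero_class C) (zero_class C) = zero_class C"
begin

section \<open>Isomorphism classes, representatives and flags\<close>

lemma iso_class_eq_iff:
  "X \<in> objs C \<Longrightarrow> Y \<in> objs C \<Longrightarrow> iso_class C X = iso_class C Y \<longleftrightarrow> isom C X Y"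
  unfolding iso_class_def using isom_refl isom_sym isom_trans by blast

lemma iso_class_in_Iso: "X \<in> objs C \<Longrightarrow> iso_class C X \<in> Iso C"
  by (simp add: Iso_def)

lemma rep_props:
  assumes "M \<in> Iso C"
  shows rep_in_objs: "rep M \<in> objs C" and iso_class_rep: "iso_class C (rep M) = M"
proof -
  obtain X where X: "X \<in> objs C" "M = iso_class C X" using assms by (auto simp: Iso_def)
  then have "X \<in> M" using isom_refl by (simp add: iso_class_def)
  then have r: "rep M \<in> M" unfolding rep_def by (rule someI)
  then show 1: "rep M \<in> objs C" using X by (simp add: iso_class_def)
  show "iso_class C (rep M) = M" using r X 1 iso_class_eq_iff[of X "rep M"] by (simp add: iso_class_def)
qed

lemma zero_class_in_Iso: "zero_class C \<in> Iso C"
  unfolding zero_class_def by (simp add: iso_class_in_Iso zero_in_objs)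

lemma iso_class_eq_zero_iff: "X \<in> objs C \<Longrightarrow> iso_class C X = zero_class C \<longleftrightarrow> X = zero_obj C"
  unfolding zero_class_def using iso_class_eq_iff isom_zeroD zero_in_objs by metis

text \<open>Both N and X contain N and have zero quotient by it, and taking the quotient by N is
  injective on the subobjects containing N.\<close>

lemma quot_eq_zeroD:
  assumes "X \<in> objs C" "N \<in> subobjs C X" "quotient_obj C X N = zero_obj C"
  shows "N = X"
proof -
  have "inj_on (\<lambda>N'. quotient_obj C N' N) {N' \<in> subobjs C X. N \<in> subobjs C N'}"
    using sub_quot assms bij_betw_def by blast
  moreover have "quotient_obj C N N = quotient_obj C X N"
    using assms quot_self sub_in_objs by simp
  ultimately show ?thesis
    using assms self_sub[of X] self_sub[of N] sub_in_objs[of X N]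
      inj_onD[of "\<lambda>N'. quotient_obj C N' N" _ N X] by simp
qed

lemma Sub_class_props:
  assumes "B \<in> Iso C" "N \<in> Sub C B"
  shows Sub_class_in_Iso: "iso_class C N \<in> Iso C" and quot_class_in_Iso: "quot_class C B N \<in> Iso C"
  using sub_in_objs[OF rep_in_objs] quot_in_objs[OF rep_in_objs] iso_class_in_Iso assms by blast+

lemma finite_Sub: "B \<in> Iso C \<Longrightarrow> finite (Sub C B)"
  using rep_in_objs finite_subobjs by auto

text \<open>The fixed representative of the class of X is only isomorphic to X; the bijection of
  \<open>isom_subobjs\<close> preserves the classes of subobject and quotient, hence the sum. This
  is how subobjects and quotients, which are not chosen representatives themselves, can be fed into
  a further product.\<close>

lemma sum_subobjs_isom:
  fixes F :: "'x set \<Rightarrow> 'x set \<Rightarrow> 'a::comm_monoid_add"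
  assumes "X \<in> objs C"
  shows "(\<Sum>N\<in>Sub C (iso_class C X). F (iso_class C N) (quot_class C (iso_class C X) N)) =
    (\<Sum>N\<in>subobjs C X. F (iso_class C N) (iso_class C (quotient_obj C X N)))"
proof -
  let ?Y = "rep (iso_class C X)"
  have Y: "?Y \<in> objs C" "iso_class C ?Y = iso_class C X"
    using assms rep_props iso_class_in_Iso by auto
  then have "isom C X ?Y" using iso_class_eq_iff assms by metis
  then obtain h where h: "bij_betw h (subobjs C X) (subobjs C ?Y)"
    "\<And>N. N\<in>subobjs C X \<Longrightarrow> isom C N (h N) \<and> isom C (quotient_obj C X N) (quotient_obj C ?Y (h N))"
    using isom_subobjs assms Y by blast
  have mem: "h N \<in> subobjs C ?Y" if "N \<in> subobjs C X" for N
    using h(1) that bij_betwE by blast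
  show ?thesis
  proof (rule sum.reindex_bij_betw[OF h(1), symmetric, THEN trans], rule sum.cong[OF refl])
    fix N assume N: "N \<in> subobjs C X"
    have "iso_class C N = iso_class C (h N)"
      using h(2) N mem sub_in_objs assms Y iso_class_eq_iff by blast
    moreover have "iso_class C (quotient_obj C X N) = iso_class C (quotient_obj C ?Y (h N))"
      using h(2) N mem quot_in_objs assms Y iso_class_eq_iff by blast
    ultimately show "F (iso_class C (h N)) (quot_class C (iso_class C X) (h N)) =
      F (iso_class C N) (iso_class C (quotient_obj C X N))" by simp
  qed
qed

text \<open>The arguments of F are the classes of the three layers A, N/A and X/N of a flag. With F
  arbitrary, one exchange of summation serves the product, \<open>bullet\<close> and
  \<open>star\<close>, which weight or prescribe different layers.\<close>

lemma sum_flags: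
  fixes F :: "'x set \<Rightarrow> 'x set \<Rightarrow> 'x set \<Rightarrow> 'a::comm_monoid_add"
  assumes X: "X \<in> objs C"
  shows "(\<Sum>N\<in>subobjs C X. \<Sum>A\<in>subobjs C N.
      F (iso_class C A) (iso_class C (quotient_obj C N A)) (iso_class C (quotient_obj C X N))) =
    (\<Sum>A\<in>subobjs C X. \<Sum>L\<in>subobjs C (quotient_obj C X A).
      F (iso_class C A) (iso_class C L) (iso_class C (quotient_obj C (quotient_obj C X A) L)))"
    (is "?L = ?R")
proof -
  let ?f = "\<lambda>N A. F (iso_class C A) (iso_class C (quotient_obj C N A)) (iso_class C (quotient_obj C X N))"
  have fin: "finite (subobjs C X)" using X finite_subobjs by blast
  have "?L = (\<Sum>N\<in>subobjs C X. \<Sum>A | A \<in> subobjs C X \<and> A \<in> subobjs C N. ?f N A)"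
  proof (rule sum.cong[OF refl])
    fix N assume "N \<in> subobjs C X"
    then have "subobjs C N = {A. A \<in> subobjs C X \<and> A \<in> subobjs C N}" using sub_trans X by blast
    then show "(\<Sum>A\<in>subobjs C N. ?f N A) = (\<Sum>A | A \<in> subobjs C X \<and> A \<in> subobjs C N. ?f N A)" by simp
  qed
  also have "\<dots> = (\<Sum>A\<in>subobjs C X. \<Sum>N | N \<in> subobjs C X \<and> A \<in> subobjs C N. ?f N A)"
    using fin by (rule sum.swap_restrict[OF _ fin])
  also have "\<dots> = ?R"
  proof (rule sum.cong[OF refl])
    fix A assume A: "A \<in> subobjs C X"
    have "(\<Sum>N | N \<in> subobjs C X \<and> A \<in> subobjs C N. ?f N A) =
      (\<Sum>N | N \<in> subobjs C X \<and> A \<in> subobjs C N. F (iso_class C A) (iso_class C (quotient_obj C N A))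
          (iso_class C (quotient_obj C (quotient_obj C X A) (quotient_obj C N A))))"
      using quot_quot X A by (intro sum.cong) auto
    also have "\<dots> = (\<Sum>L\<in>subobjs C (quotient_obj C X A).
      F (iso_class C A) (iso_class C L) (iso_class C (quotient_obj C (quotient_obj C X A) L)))"
      using sum.reindex_bij_betw[OF sub_quot[OF X A]] .
    finally show "(\<Sum>N | N \<in> subobjs C X \<and> A \<in> subobjs C N. ?f N A) = \<dots>" .
  qed
  finally show ?thesis .
qed

subsection \<open>The product\<close>

lemma hallD:
  assumes "f \<in> hall C"
  shows hall_finite: "finite {M. f M \<noteq> 0}" and hall_support: "{M. f M \<noteq> 0} \<subseteq> Iso C"
  using assms by (auto simp: hall_def)

lemma hall_outside: "f \<in> hall C \<Longrightarrow> M \<notin> Iso C \<Longrightarrow> f M = 0"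
  by (auto simp: hall_def)

lemma hallI:
  assumes "finite T" "\<And>M. f M \<noteq> 0 \<Longrightarrow> M \<in> T \<and> M \<in> Iso C"
  shows "f \<in> hall C"
proof -
  have "finite {M. f M \<noteq> 0}" by (rule finite_subset[OF _ assms(1)]) (use assms(2) in auto)
  then show ?thesis using assms(2) by (auto simp: hall_def)
qed

lemma hall_one_eq: "X \<in> objs C \<Longrightarrow> hall_one C (iso_class C X) = (if X = zero_obj C then 1 else 0)"
  by (simp add: hall_one_def delta_def iso_class_in_Iso iso_class_eq_zero_iff)

lemma hall_mult_iso_class:
  assumes "X \<in> objs C"
  shows "hall_mult C f g (iso_class C X) =
    (\<Sum>N\<in>subobjs C X. f (iso_class C N) * g (iso_class C (quotient_obj C X N)))"
  using assms sum_subobjs_isom[OF assms, of "\<lambda>a b. f a * g b"]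
  by (simp add: hall_mult_def iso_class_in_Iso)

lemma finite_hall_mult_support:
  assumes "A \<in> Iso C" "B \<in> Iso C"
  shows "finite {M \<in> Iso C. \<exists>N\<in>Sub C M. iso_class C N = A \<and> quot_class C M N = B}"
proof (rule finite_subset[OF _ finite_extensions[OF rep_in_objs[OF assms(1)] rep_in_objs[OF assms(2)]]],
    clarify)
  fix M N assume M: "M \<in> Iso C" and N: "N \<in> Sub C M" and eq: "A = iso_class C N" "B = quot_class C M N"
  have o: "rep M \<in> objs C" "N \<in> objs C" "quotient_obj C (rep M) N \<in> objs C"
    using M N rep_in_objs sub_in_objs quot_in_objs by auto
  have "iso_class C (rep A) = iso_class C N" "iso_class C (rep B) = quot_class C M N"
    using iso_class_rep assms eq by auto
  then have "isom C (rep A) N" "isom C (rep B) (quotient_obj C (rep M) N)"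
    using o assms rep_in_objs iso_class_eq_iff by blast+
  then show "\<exists>E. M = iso_class C E \<and> E \<in> objs C \<and> (\<exists>Na\<in>subobjs C E.
    isom C (rep (iso_class C N)) Na \<and> isom C (rep (quot_class C M N)) (quotient_obj C E Na))"
    using o N M iso_class_rep eq by (metis (no_types))
qed

lemma hall_mult_in_hall:
  assumes f: "f \<in> hall C" and g: "g \<in> hall C"
  shows "hall_mult C f g \<in> hall C"
proof -
  let ?T = "\<Union>A\<in>{M. f M \<noteq> 0}. \<Union>B\<in>{M. g M \<noteq> 0}.
    {M \<in> Iso C. \<exists>N\<in>Sub C M. iso_class C N = A \<and> quot_class C M N = B}"
  show ?thesis
  proof (rule hallI[of ?T])
    show "finite ?T"
      using hallD[OF f] hallD[OF g] finite_hall_mult_support by auto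
    fix M assume nz: "hall_mult C f g M \<noteq> 0"
    then have M: "M \<in> Iso C" by (auto simp: hall_mult_def split: if_splits)
    with nz have "(\<Sum>N\<in>Sub C M. f (iso_class C N) * g (quot_class C M N)) \<noteq> 0"
      by (simp add: hall_mult_def)
    then obtain N where "N \<in> Sub C M" "f (iso_class C N) * g (quot_class C M N) \<noteq> 0"
      by (meson sum.not_neutral_contains_not_neutral)
    then show "M \<in> ?T \<and> M \<in> Iso C" using M by auto
  qed
qed

lemma hall_eqI:
  assumes "\<And>M. M \<notin> Iso C \<Longrightarrow> f M = g M"
    and "\<And>X. X \<in> objs C \<Longrightarrow> f (iso_class C X) = g (iso_class C X)"
  shows "f = g"
proof
  fix M show "f M = g M" using assms by (cases "M \<in> Iso C") (auto simp: Iso_def)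
qed

lemma hall_mult_one_left:
  assumes "f \<in> hall C"
  shows "hall_mult C (hall_one C) f = f"
proof (rule hall_eqI)
  show "hall_mult C (hall_one C) f M = f M" if "M \<notin> Iso C" for M
    using that assms by (simp add: hall_mult_def hall_outside)
  fix X assume X: "X \<in> objs C"
  have "hall_mult C (hall_one C) f (iso_class C X) =
    (\<Sum>N\<in>subobjs C X. if zero_obj C = N then f (iso_class C (quotient_obj C X N)) else 0)"
    using X sub_in_objs by (simp add: hall_mult_iso_class hall_one_eq) (intro sum.cong, auto)
  also have "\<dots> = f (iso_class C X)"
    using X zero_sub quot_zero finite_subobjs by (simp add: sum.delta')
  finally show "hall_mult C (hall_one C) f (iso_class C X) = f (iso_class C X)" .
qed

lemma hall_mult_one_right:
  assumes "f \<in> hall C"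
  shows "hall_mult C f (hall_one C) = f"
proof (rule hall_eqI)
  show "hall_mult C f (hall_one C) M = f M" if "M \<notin> Iso C" for M
    using that assms by (simp add: hall_mult_def hall_outside)
  fix X assume X: "X \<in> objs C"
  have "hall_mult C f (hall_one C) (iso_class C X) =
    (\<Sum>N\<in>subobjs C X. if X = N then f (iso_class C N) else 0)"
    using X quot_in_objs quot_self
    by (simp add: hall_mult_iso_class hall_one_eq) (intro sum.cong, auto dest: quot_eq_zeroD[OF X])
  also have "\<dots> = f (iso_class C X)"
    using X self_sub finite_subobjs by (simp add: sum.delta')
  finally show "hall_mult C f (hall_one C) (iso_class C X) = f (iso_class C X)" .
qed

lemma hall_mult_assoc: "hall_mult C (hall_mult C f g) h = hall_mult C f (hall_mult C g h)"
proof (rule hall_eqI)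
  show "hall_mult C (hall_mult C f g) h M = hall_mult C f (hall_mult C g h) M" if "M \<notin> Iso C" for M
    using that by (simp add: hall_mult_def)
  fix X assume X: "X \<in> objs C"
  show "hall_mult C (hall_mult C f g) h (iso_class C X) = hall_mult C f (hall_mult C g h) (iso_class C X)"
    using sum_flags[OF X, of "\<lambda>a b c. f a * g b * h c"] X sub_in_objs quot_in_objs
    by (simp add: hall_mult_iso_class sum_distrib_left sum_distrib_right mult.assoc)
qed

lemma bilinear_on_hall_mult: "bilinear_on (hall C) (hall_mult C)"
  unfolding bilinear_on_def
proof (intro conjI ballI allI)
  fix c f f' g g'
  show "hall_mult C (f + f') g = hall_mult C f g + hall_mult C f' g"
    by (auto simp: hall_mult_def fun_eq_iff distrib_right sum.distrib)
  show "hall_mult C f (g + g') = hall_mult C f g + hall_mult C f g'"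
    by (auto simp: hall_mult_def fun_eq_iff distrib_left sum.distrib)
  show "hall_mult C (scale c f) g = scale c (hall_mult C f g)"
    by (auto simp: hall_mult_def scale_def fun_eq_iff sum_distrib_left mult.assoc)
  show "hall_mult C f (scale c g) = scale c (hall_mult C f g)"
    by (auto simp: hall_mult_def scale_def fun_eq_iff sum_distrib_left mult.left_commute)
qed (rule hall_mult_in_hall)

subsection \<open>Hecke operators\<close>

text \<open>The fibre of \<open>pi2\<close> over M is a copy of \<open>Sub C M\<close>, so the
  pushforward is the defining sum of the product. Associativity and units then give the right and
  the left action at once.\<close>

lemma box_eq_hall_mult: "box C g f = hall_mult C g f"
proof (rule ext)
  fix M
  show "box C g f M = hall_mult C g f M"
  proof (cases "M \<in> Iso C")
    case True
    have eq: "{x \<in> Hecke C. pi2 C x = M} = (\<lambda>N. (N, M)) ` Sub C M"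
      using True by (auto simp: Hecke_def pi2_def)
    have "box C g f M = sum (pullback (piq C) f * pullback (pi1 C) g) ((\<lambda>N. (N, M)) ` Sub C M)"
      using True finite_Sub unfolding box_def pushforward_def eq by simp
    also have "\<dots> = hall_mult C g f M"
      using True by (subst sum.reindex) (auto simp: inj_on_def hall_mult_def pullback_def pi1_def piq_def mult.commute)
    finally show ?thesis .
  qed (simp add: box_def pushforward_def hall_mult_def)
qed

text \<open>Common form of \<open>bullet\<close> and \<open>star\<close>: g is the function acted on
  and always lives on the larger object, f is evaluated along r, and p selects the layer on which
  the result lives.\<close>

definition hecke_op where
  "hecke_op p r f g = pushforward C p (pullback r f * pullback (pi2 C) g)"

lemma bullet_eq_hecke_op: "bullet C g f = hecke_op (piq C) (pi1 C) f g"
  by (simp add: bullet_def hecke_op_def)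

lemma star_eq_hecke_op: "star C f g = hecke_op (pi1 C) (piq C) f g"
  by (simp add: star_def hecke_op_def)

text \<open>Finite support of g cuts the fibre of p down to finitely many pairs, since every B has
  finitely many subobjects. T may exceed the support of g, so that two functions can be compared
  over one index set.\<close>

lemma hecke_op_eq:
  assumes "finite T" "T \<subseteq> Iso C" "{B. g B \<noteq> 0} \<subseteq> T" "M \<in> Iso C"
  shows "hecke_op p r f g M =
    (\<Sum>B\<in>T. g B * (\<Sum>N\<in>Sub C B. if p (N, B) = M then f (r (N, B)) else 0))"
proof -
  let ?F = "\<lambda>x. f (r x) * g (pi2 C x)"
  let ?S = "prod.swap ` Sigma T (Sub C)"
  have fS: "finite ?S" using assms finite_Sub by (auto intro!: finite_SigmaI)
  have mem: "(N, B) \<in> ?S \<longleftrightarrow> B \<in> T \<and> N \<in> Sub C B" for N B by force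
  have "hecke_op p r f g M = sum' ?F {x \<in> Hecke C. p x = M}"
    using assms(4) by (simp add: hecke_op_def pushforward_def pullback_def times_fun_def)
  also have "\<dots> = sum ?F {x \<in> ?S. p x = M}"
  proof (rule sum'_eq_sum_support)
    show "{x \<in> ?S. p x = M} \<subseteq> {x \<in> Hecke C. p x = M}"
      using assms by (auto simp: Hecke_def)
    fix x assume x: "x \<in> {x \<in> Hecke C. p x = M}" "x \<notin> {x \<in> ?S. p x = M}"
    obtain N B where NB: "x = (N, B)" by (cases x)
    have "B \<notin> T" using x unfolding NB mem mem_Collect_eq Hecke_def by simp
    then have "g B = 0" using assms(3) by blast
    then show "?F x = 0" by (simp add: NB pi2_def)
  qed (use fS in simp)
  also have "\<dots> = (\<Sum>x\<in>?S. if p x = M then ?F x else 0)"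
    using fS by (simp add: sum.inter_filter)
  also have "\<dots> = (\<Sum>x\<in>Sigma T (Sub C). if p (prod.swap x) = M then ?F (prod.swap x) else 0)"
    by (subst sum.reindex[OF inj_swap]) (simp only: o_def)
  also have "\<dots> = (\<Sum>(B, N)\<in>Sigma T (Sub C). if p (N, B) = M then f (r (N, B)) * g B else 0)"
    by (rule sum.cong[OF refl], clarify, simp only: pi2_def swap_simp prod.case)
  also have "\<dots> = (\<Sum>B\<in>T. \<Sum>N\<in>Sub C B. if p (N, B) = M then f (r (N, B)) * g B else 0)"
    by (rule sum.Sigma[symmetric]) (use assms finite_Sub in auto)
  also have "\<dots> = (\<Sum>B\<in>T. g B * (\<Sum>N\<in>Sub C B. if p (N, B) = M then f (r (N, B)) else 0))"
    unfolding sum_distrib_left by (intro sum.cong refl) simp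
  finally show ?thesis .
qed

lemma hecke_op_outside: "M \<notin> Iso C \<Longrightarrow> hecke_op p r f g M = 0"
  by (simp add: hecke_op_def pushforward_def)

lemma hecke_op_support:
  assumes "finite T" "T \<subseteq> Iso C" "{B. g B \<noteq> 0} \<subseteq> T" "hecke_op p r f g M \<noteq> 0"
  shows "M \<in> p ` prod.swap ` Sigma T (Sub C) \<and> M \<in> Iso C"
proof -
  have M: "M \<in> Iso C" using assms(4) hecke_op_outside by blast
  from assms(4) obtain B where B: "B \<in> T"
    "g B * (\<Sum>N\<in>Sub C B. if p (N, B) = M then f (r (N, B)) else 0) \<noteq> 0"
    unfolding hecke_op_eq[OF assms(1-3) M] by (rule sum.not_neutral_contains_not_neutral)
  from B(2) have "(\<Sum>N\<in>Sub C B. if p (N, B) = M then f (r (N, B)) else 0) \<noteq> 0" by (rule contrapos_nn) simp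
  then obtain N where N: "N \<in> Sub C B" "(if p (N, B) = M then f (r (N, B)) else 0) \<noteq> 0"
    by (rule sum.not_neutral_contains_not_neutral)
  have "p (prod.swap (B, N)) \<in> p ` prod.swap ` Sigma T (Sub C)"
    by (intro imageI SigmaI B N)
  moreover have "p (prod.swap (B, N)) = M" using N(2) by (simp split: if_splits)
  ultimately show ?thesis using M by (simp only:)
qed

lemma hecke_op_in_hall:
  assumes "g \<in> hall C"
  shows "hecke_op p r f g \<in> hall C"
proof (rule hallI)
  show "finite (p ` prod.swap ` Sigma {B. g B \<noteq> 0} (Sub C))"
    using hallD[OF assms] finite_Sub by (auto intro!: finite_SigmaI)
  show "M \<in> p ` prod.swap ` Sigma {B. g B \<noteq> 0} (Sub C) \<and> M \<in> Iso C" if "hecke_op p r f g M \<noteq> 0" for M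
    by (rule hecke_op_support[OF hallD[OF assms] subset_refl that])
qed

lemma hecke_op_add_left:
  assumes g: "g \<in> hall C"
  shows "hecke_op p r (f + f') g = hecke_op p r f g + hecke_op p r f' g"
proof
  note eq = hecke_op_eq[OF hallD[OF g] subset_refl]
  fix M show "hecke_op p r (f + f') g M = (hecke_op p r f g + hecke_op p r f' g) M"
  proof (cases "M \<in> Iso C")
    case True
    have "(\<Sum>N\<in>Sub C B. if p (N, B) = M then (f + f') (r (N, B)) else 0) =
      (\<Sum>N\<in>Sub C B. if p (N, B) = M then f (r (N, B)) else 0) +
      (\<Sum>N\<in>Sub C B. if p (N, B) = M then f' (r (N, B)) else 0)" for B
      unfolding sum.distrib[symmetric] by (rule sum.cong) auto
    then show ?thesis by (simp only: eq[OF True] plus_fun_apply distrib_left sum.distrib)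
  qed (simp add: hecke_op_outside)
qed

lemma hecke_op_scale_left:
  assumes g: "g \<in> hall C"
  shows "hecke_op p r (scale c f) g = scale c (hecke_op p r f g)"
proof
  note eq = hecke_op_eq[OF hallD[OF g] subset_refl]
  fix M show "hecke_op p r (scale c f) g M = scale c (hecke_op p r f g) M"
  proof (cases "M \<in> Iso C")
    case True
    have "(\<Sum>N\<in>Sub C B. if p (N, B) = M then scale c f (r (N, B)) else 0) =
      c * (\<Sum>N\<in>Sub C B. if p (N, B) = M then f (r (N, B)) else 0)" for B
      unfolding sum_distrib_left by (rule sum.cong) (auto simp: scale_def)
    then have "hecke_op p r (scale c f) g M = (\<Sum>B | g B \<noteq> 0. c * (g B *
      (\<Sum>N\<in>Sub C B. if p (N, B) = M then f (r (N, B)) else 0)))"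
      by (simp only: eq[OF True] mult.left_commute[of _ c])
    then show ?thesis
      by (simp only: eq[OF True] scale_def[of c "hecke_op p r f g"] sum_distrib_left[of c, symmetric])
  qed (simp add: hecke_op_outside scale_def)
qed

lemma hecke_op_add_right:
  assumes g: "g \<in> hall C" and g': "g' \<in> hall C"
  shows "hecke_op p r f (g + g') = hecke_op p r f g + hecke_op p r f g'"
proof
  let ?T = "{B. g B \<noteq> 0} \<union> {B. g' B \<noteq> 0}"
  have T: "finite ?T" "?T \<subseteq> Iso C" using hallD[OF g] hallD[OF g'] by auto
  have supp: "{B. g B \<noteq> 0} \<subseteq> ?T" "{B. g' B \<noteq> 0} \<subseteq> ?T" "{B. (g + g') B \<noteq> 0} \<subseteq> ?T" by auto
  note eq = supp[THEN hecke_op_eq[OF T]]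
  fix M show "hecke_op p r f (g + g') M = (hecke_op p r f g + hecke_op p r f g') M"
    by (cases "M \<in> Iso C") (simp_all add: eq hecke_op_outside sum.distrib distrib_right)
qed

lemma hecke_op_scale_right:
  assumes g: "g \<in> hall C"
  shows "hecke_op p r f (scale c g) = scale c (hecke_op p r f g)"
proof
  have supp: "{B. scale c g B \<noteq> 0} \<subseteq> {B. g B \<noteq> 0}" by (auto simp: scale_def)
  fix M show "hecke_op p r f (scale c g) M = scale c (hecke_op p r f g) M"
  proof (cases "M \<in> Iso C")
    case True
    show ?thesis
      by (subst hecke_op_eq[OF hallD[OF g] supp True],
          simp only: scale_def hecke_op_eq[OF hallD[OF g] subset_refl True] sum_distrib_left mult.assoc)
  qed (simp add: hecke_op_outside scale_def)
qed

text \<open>The inner function is supported on the finite set \<open>?T'\<close> of classes arising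
  from the support of g. Summing over these classes and collapsing the indicator of
  \<open>p (N, B) = B'\<close> eliminates the intermediate class and leaves a sum over two
  successive subobjects.\<close>

lemma hecke_op_hecke_op:
  assumes g: "g \<in> hall C" and M: "M \<in> Iso C"
    and p: "\<And>x. x \<in> Hecke C \<Longrightarrow> p x \<in> Iso C"
  shows "hecke_op p r f' (hecke_op p r f g) M =
    (\<Sum>B | g B \<noteq> 0. g B * (\<Sum>N\<in>Sub C B. f (r (N, B)) *
      (\<Sum>L\<in>Sub C (p (N, B)). if p (L, p (N, B)) = M then f' (r (L, p (N, B))) else 0)))"
proof -
  let ?T = "{B. g B \<noteq> 0}"
  let ?T' = "p ` prod.swap ` Sigma ?T (Sub C)"
  let ?U = "\<lambda>B. \<Sum>L\<in>Sub C B. if p (L, B) = M then f' (r (L, B)) else 0"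
  have T: "finite ?T" "?T \<subseteq> Iso C" using hallD[OF g] by auto
  have T': "finite ?T'" "?T' \<subseteq> Iso C"
    using T finite_Sub p by (auto intro!: finite_SigmaI simp: Hecke_def)
  have supp: "{B. hecke_op p r f g B \<noteq> 0} \<subseteq> ?T'"
    using hecke_op_support[OF T subset_refl] by blast
  have "hecke_op p r f' (hecke_op p r f g) M = (\<Sum>B'\<in>?T'. hecke_op p r f g B' * ?U B')"
    by (rule hecke_op_eq[OF T' supp M])
  also have "\<dots> = (\<Sum>B'\<in>?T'. \<Sum>B\<in>?T. \<Sum>N\<in>Sub C B. if p (N, B) = B' then g B * f (r (N, B)) * ?U B' else 0)"
  proof (intro sum.cong refl)
    fix B' assume "B' \<in> ?T'"
    then have B': "B' \<in> Iso C" using T'(2) by blast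
    show "hecke_op p r f g B' * ?U B' =
        (\<Sum>B\<in>?T. \<Sum>N\<in>Sub C B. if p (N, B) = B' then g B * f (r (N, B)) * ?U B' else 0)"
      unfolding hecke_op_eq[OF T subset_refl B'] sum_distrib_right[where r = "?U B'"] sum_distrib_left[where r = "g _"]
      by (intro sum.cong refl) simp
  qed
  also have "\<dots> = (\<Sum>B\<in>?T. \<Sum>N\<in>Sub C B. \<Sum>B'\<in>?T'. if p (N, B) = B' then g B * f (r (N, B)) * ?U B' else 0)"
    by (subst sum.swap, rule sum.cong[OF refl], subst sum.swap, rule refl)
  also have "\<dots> = (\<Sum>B\<in>?T. \<Sum>N\<in>Sub C B. g B * f (r (N, B)) * ?U (p (N, B)))"
  proof (intro sum.cong refl)
    fix B N assume "B \<in> ?T" "N \<in> Sub C B"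
    then have "(B, N) \<in> Sigma ?T (Sub C)" by simp
    then have "p (prod.swap (B, N)) \<in> ?T'" by blast
    then have "p (N, B) \<in> ?T'" by simp
    then show "(\<Sum>B'\<in>?T'. if p (N, B) = B' then g B * f (r (N, B)) * ?U B' else 0) =
      g B * f (r (N, B)) * ?U (p (N, B))"
      by (subst sum.delta'[OF T'(1)]) (simp only: if_True)
  qed
  also have "\<dots> = (\<Sum>B\<in>?T. g B * (\<Sum>N\<in>Sub C B. f (r (N, B)) * ?U (p (N, B))))"
    by (simp add: sum_distrib_left mult.assoc)
  finally show ?thesis .
qed

lemma pi_in_Iso:
  assumes "x \<in> Hecke C"
  shows pi1_in_Iso: "pi1 C x \<in> Iso C" and piq_in_Iso: "piq C x \<in> Iso C"
  using assms Sub_class_props by (auto simp: Hecke_def pi1_def piq_def)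

text \<open>Acting by f passes from B to B/A, acting by f' from B/A to B/N by removing N/A. The
  product evaluated at N weights A by f and N/A by f', so for each B both sides run over the same
  flags with B/N in the prescribed class.\<close>

lemma bullet_hall_mult:
  assumes g: "g \<in> hall C"
  shows "bullet C g (hall_mult C f f') = bullet C (bullet C g f) f'"
proof
  fix M
  show "bullet C g (hall_mult C f f') M = bullet C (bullet C g f) f' M"
  proof (cases "M \<in> Iso C")
    case True
    have "(\<Sum>N\<in>Sub C B. if quot_class C B N = M then hall_mult C f f' (iso_class C N) else 0) =
      (\<Sum>N\<in>Sub C B. f (iso_class C N) * (\<Sum>L\<in>Sub C (quot_class C B N).
        if quot_class C (quot_class C B N) L = M then f' (iso_class C L) else 0))" (is "?l = ?r")
      if "g B \<noteq> 0" for B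
    proof -
      let ?X = "rep B"
      have X: "?X \<in> objs C" using that g hall_outside rep_in_objs by blast
      have "?l = (\<Sum>N\<in>subobjs C ?X. \<Sum>A\<in>subobjs C N. if iso_class C (quotient_obj C ?X N) = M then
          f (iso_class C A) * f' (iso_class C (quotient_obj C N A)) else 0)"
        using X sub_in_objs by (intro sum.cong) (auto simp: hall_mult_iso_class)
      also have "\<dots> = (\<Sum>A\<in>subobjs C ?X. \<Sum>L\<in>subobjs C (quotient_obj C ?X A).
          if iso_class C (quotient_obj C (quotient_obj C ?X A) L) = M then
          f (iso_class C A) * f' (iso_class C L) else 0)"
        by (rule sum_flags[OF X, of "\<lambda>a b c. if c = M then f a * f' b else 0"])
      also have "\<dots> = ?r"
      proof (intro sum.cong refl)
        fix A assume A: "A \<in> subobjs C ?X"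
        show "(\<Sum>L\<in>subobjs C (quotient_obj C ?X A).
            if iso_class C (quotient_obj C (quotient_obj C ?X A) L) = M then
            f (iso_class C A) * f' (iso_class C L) else 0) = f (iso_class C A) *
            (\<Sum>L\<in>Sub C (quot_class C B A).
              if quot_class C (quot_class C B A) L = M then f' (iso_class C L) else 0)"
          unfolding sum_subobjs_isom[OF quot_in_objs[OF X A], of "\<lambda>a b. if b = M then f' a else 0"]
          by (simp add: sum_distrib_left if_distrib cong: if_cong)
      qed
      finally show ?thesis .
    qed
    note inner = this
    show ?thesis
      unfolding bullet_eq_hecke_op hecke_op_hecke_op[OF g True, of "piq C", simplified piq_in_Iso, simplified]
        hecke_op_eq[OF hallD[OF g] subset_refl True]
      unfolding piq_def pi1_def prod.case
      by (rule sum.cong[OF refl], rule arg_cong[where f = "(*) (g _)"], rule inner) simp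
  qed (simp add: bullet_eq_hecke_op hecke_op_outside)
qed

text \<open>Here the operator passes from B to a subobject: f' is read at B/N on the way from B to
  N, then f at N/A on the way from N to A. The product is evaluated at B/A, whose subobject N/A
  carries f, so the later operator is the left factor and the action is a left one.\<close>

lemma star_hall_mult:
  assumes g: "g \<in> hall C"
  shows "star C (hall_mult C f f') g = star C f (star C f' g)"
proof
  fix M
  show "star C (hall_mult C f f') g M = star C f (star C f' g) M"
  proof (cases "M \<in> Iso C")
    case True
    have "(\<Sum>N\<in>Sub C B. if iso_class C N = M then hall_mult C f f' (quot_class C B N) else 0) =
      (\<Sum>N\<in>Sub C B. f' (quot_class C B N) * (\<Sum>L\<in>Sub C (iso_class C N).
        if iso_class C L = M then f (quot_class C (iso_class C N) L) else 0))" (is "?l = ?r")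
      if "g B \<noteq> 0" for B
    proof -
      let ?X = "rep B"
      have X: "?X \<in> objs C" using that g hall_outside rep_in_objs by blast
      have "?l = (\<Sum>A\<in>subobjs C ?X. \<Sum>L\<in>subobjs C (quotient_obj C ?X A). if iso_class C A = M then
          f (iso_class C L) * f' (iso_class C (quotient_obj C (quotient_obj C ?X A) L)) else 0)"
        using X quot_in_objs by (intro sum.cong) (auto simp: hall_mult_iso_class)
      also have "\<dots> = (\<Sum>N\<in>subobjs C ?X. \<Sum>A\<in>subobjs C N. if iso_class C A = M then
          f (iso_class C (quotient_obj C N A)) * f' (iso_class C (quotient_obj C ?X N)) else 0)"
        by (rule sum_flags[OF X, of "\<lambda>a b c. if a = M then f b * f' c else 0", symmetric])
      also have "\<dots> = ?r"
      proof (intro sum.cong refl)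
        fix N assume N: "N \<in> subobjs C ?X"
        show "(\<Sum>A\<in>subobjs C N. if iso_class C A = M then
            f (iso_class C (quotient_obj C N A)) * f' (iso_class C (quotient_obj C ?X N)) else 0) =
            f' (quot_class C B N) * (\<Sum>L\<in>Sub C (iso_class C N).
              if iso_class C L = M then f (quot_class C (iso_class C N) L) else 0)"
          unfolding sum_subobjs_isom[OF sub_in_objs[OF X N], of "\<lambda>a b. if a = M then f b else 0"]
          by (simp add: sum_distrib_left if_distrib mult.commute cong: if_cong)
      qed
      finally show ?thesis .
    qed
    note inner = this
    show ?thesis
      unfolding star_eq_hecke_op hecke_op_hecke_op[OF g True, of "pi1 C", simplified pi1_in_Iso, simplified]
        hecke_op_eq[OF hallD[OF g] subset_refl True]
      unfolding piq_def pi1_def prod.case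
      by (rule sum.cong[OF refl], rule arg_cong[where f = "(*) (g _)"], rule inner) simp
  qed (simp add: star_eq_hecke_op hecke_op_outside)
qed

lemma bullet_one:
  assumes g: "g \<in> hall C"
  shows "bullet C g (hall_one C) = g"
proof
  fix M
  show "bullet C g (hall_one C) M = g M"
  proof (cases "M \<in> Iso C")
    case True
    have "(\<Sum>N\<in>Sub C B. if quot_class C B N = M then hall_one C (iso_class C N) else 0) =
      (if B = M then 1 else 0)" if "g B \<noteq> 0" for B
    proof -
      have B: "B \<in> Iso C" using that g hall_outside by blast
      have "(\<Sum>N\<in>Sub C B. if quot_class C B N = M then hall_one C (iso_class C N) else 0) =
        (\<Sum>N\<in>Sub C B. if zero_obj C = N then (if quot_class C B N = M then 1 else 0) else 0)"
        using sub_in_objs rep_in_objs[OF B] by (intro sum.cong) (auto simp: hall_one_eq)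
      also have "\<dots> = (if B = M then 1 else 0)"
        using finite_Sub[OF B] rep_in_objs[OF B] by (simp add: sum.delta' zero_sub quot_zero iso_class_rep B)
      finally show ?thesis .
    qed
    note inner = this
    have "bullet C g (hall_one C) M = (\<Sum>B | g B \<noteq> 0. g B * (if B = M then 1 else 0))"
      unfolding bullet_eq_hecke_op hecke_op_eq[OF hallD[OF g] subset_refl True]
      unfolding piq_def pi1_def prod.case
      by (rule sum.cong[OF refl], rule arg_cong[where f = "(*) (g _)"], rule inner) simp
    also have "\<dots> = (\<Sum>B | g B \<noteq> 0. if B = M then g B else 0)"
      by (intro sum.cong) auto
    also have "\<dots> = g M" using hallD[OF g] by (simp add: sum.delta)
    finally show ?thesis .
  qed (simp add: bullet_eq_hecke_op hecke_op_outside hall_outside g)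
qed

lemma star_one:
  assumes g: "g \<in> hall C"
  shows "star C (hall_one C) g = g"
proof
  fix M
  show "star C (hall_one C) g M = g M"
  proof (cases "M \<in> Iso C")
    case True
    have "(\<Sum>N\<in>Sub C B. if iso_class C N = M then hall_one C (quot_class C B N) else 0) =
      (if B = M then 1 else 0)" if "g B \<noteq> 0" for B
    proof -
      have B: "B \<in> Iso C" using that g hall_outside by blast
      have "(\<Sum>N\<in>Sub C B. if iso_class C N = M then hall_one C (quot_class C B N) else 0) =
        (\<Sum>N\<in>Sub C B. if rep B = N then (if iso_class C N = M then 1 else 0) else 0)"
        using quot_in_objs quot_self rep_in_objs[OF B]
        by (intro sum.cong) (auto simp: hall_one_eq zero_in_objs dest: quot_eq_zeroD[OF rep_in_objs[OF B]])
      also have "\<dots> = (if B = M then 1 else 0)"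
        using finite_Sub[OF B] rep_in_objs[OF B] by (simp add: sum.delta' self_sub iso_class_rep B)
      finally show ?thesis .
    qed
    note inner = this
    have "star C (hall_one C) g M = (\<Sum>B | g B \<noteq> 0. g B * (if B = M then 1 else 0))"
      unfolding star_eq_hecke_op hecke_op_eq[OF hallD[OF g] subset_refl True]
      unfolding piq_def pi1_def prod.case
      by (rule sum.cong[OF refl], rule arg_cong[where f = "(*) (g _)"], rule inner) simp
    also have "\<dots> = (\<Sum>B | g B \<noteq> 0. if B = M then g B else 0)"
      by (intro sum.cong) auto
    also have "\<dots> = g M" using hallD[OF g] by (simp add: sum.delta)
    finally show ?thesis .
  qed (simp add: star_eq_hecke_op hecke_op_outside hall_outside g)
qed

lemma right_action_bullet: "right_action C (bullet C)"
  unfolding right_action_def bilinear_on_def bullet_eq_hecke_op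
  by (intro conjI ballI allI hecke_op_in_hall hecke_op_add_left hecke_op_add_right hecke_op_scale_left
      hecke_op_scale_right bullet_one[unfolded bullet_eq_hecke_op]
      bullet_hall_mult[unfolded bullet_eq_hecke_op])

lemma left_action_star: "left_action C (star C)"
  unfolding left_action_def bilinear_on_def star_eq_hecke_op
  by (intro conjI ballI allI hecke_op_in_hall hecke_op_add_left hecke_op_add_right hecke_op_scale_left
      hecke_op_scale_right star_one[unfolded star_eq_hecke_op]
      star_hall_mult[unfolded star_eq_hecke_op])

lemma box_eq: "box C = hall_mult C"
  by (intro ext) (simp add: box_eq_hall_mult)

lemma right_action_box: "right_action C (box C)"
  unfolding right_action_def box_eq
  by (intro conjI ballI bilinear_on_hall_mult hall_mult_one_right hall_mult_assoc[symmetric])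

lemma left_action_box: "left_action C (box C)"
  unfolding left_action_def box_eq
  by (intro conjI ballI bilinear_on_hall_mult hall_mult_one_left hall_mult_assoc)

subsection \<open>Comparison with the representations\<close>

lemma bilin_eq_sum:
  assumes "finite I'" "I' \<subseteq> I" "\<And>i. i \<in> I \<Longrightarrow> i \<notin> I' \<Longrightarrow> x i = 0"
    and "finite J'" "J' \<subseteq> J" "\<And>j. j \<in> J \<Longrightarrow> j \<notin> J' \<Longrightarrow> y j = 0"
  shows "bilin I J \<beta> x y z = (\<Sum>i\<in>I'. \<Sum>j\<in>J'. x i * y j * \<beta> i j z)"
proof -
  have inner: "sum' (\<lambda>j. x i * y j * \<beta> i j z) J = (\<Sum>j\<in>J'. x i * y j * \<beta> i j z)" for i
    using assms by (intro sum'_eq_sum_support) auto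
  show ?thesis unfolding bilin_def inner
    using assms by (intro sum'_eq_sum_support) auto
qed

lemma sum_delta_support:
  assumes "f \<in> hall C" "A \<in> Iso C"
  shows "(\<Sum>B | f B \<noteq> 0. f B * delta C B A) = f A"
proof -
  have "(\<Sum>B | f B \<noteq> 0. f B * delta C B A) = (\<Sum>B | f B \<noteq> 0. if B = A then f B else 0)"
    using assms by (intro sum.cong) (auto simp: delta_def)
  also have "\<dots> = f A" using hallD[OF assms(1)] by (simp add: sum.delta)
  finally show ?thesis .
qed

lemma insertion_eq_hall_mult:
  assumes f: "f \<in> hall C" and g: "g \<in> hall C"
  shows "insertion C f g = hall_mult C f g"
proof
  fix M
  have "insertion C f g M =
    (\<Sum>A | f A \<noteq> 0. \<Sum>B | g B \<noteq> 0. f A * g B * hall_mult C (delta C A) (delta C B) M)"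
    unfolding insertion_def using hallD[OF f] hallD[OF g] by (intro bilin_eq_sum) auto
  also have "\<dots> = hall_mult C f g M"
  proof (cases "M \<in> Iso C")
    case True
    have "(\<Sum>A | f A \<noteq> 0. \<Sum>B | g B \<noteq> 0. f A * g B * hall_mult C (delta C A) (delta C B) M) =
      (\<Sum>A | f A \<noteq> 0. \<Sum>B | g B \<noteq> 0. \<Sum>N\<in>Sub C M.
        (f A * delta C A (iso_class C N)) * (g B * delta C B (quot_class C M N)))"
      using True by (simp add: hall_mult_def sum_distrib_left mult_ac)
    also have "\<dots> = (\<Sum>A | f A \<noteq> 0. \<Sum>N\<in>Sub C M. \<Sum>B | g B \<noteq> 0.
        (f A * delta C A (iso_class C N)) * (g B * delta C B (quot_class C M N)))"
      by (rule sum.cong[OF refl], rule sum.swap)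
    also have "\<dots> = (\<Sum>N\<in>Sub C M. \<Sum>A | f A \<noteq> 0. \<Sum>B | g B \<noteq> 0.
        (f A * delta C A (iso_class C N)) * (g B * delta C B (quot_class C M N)))"
      by (rule sum.swap)
    also have "\<dots> = (\<Sum>N\<in>Sub C M. (\<Sum>A | f A \<noteq> 0. f A * delta C A (iso_class C N)) *
        (\<Sum>B | g B \<noteq> 0. g B * delta C B (quot_class C M N)))"
      by (simp only: sum_product)
    also have "\<dots> = hall_mult C f g M"
      using True Sub_class_props[OF True] by (simp add: hall_mult_def sum_delta_support f g)
    finally show ?thesis .
  qed (simp add: hall_mult_def)
  finally show "insertion C f g M = hall_mult C f g M" .
qed

lemma top_insertion_eq_hall_mult:
  "f \<in> hall C \<Longrightarrow> g \<in> hall C \<Longrightarrow> top_insertion C f g = hall_mult C f g"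
  using insertion_eq_hall_mult by (simp add: insertion_def top_insertion_def)

text \<open>\<open>elimination\<close> and \<open>top_elimination\<close> sum over
  \<open>Indec C\<close> only; this lemma ensures that no coefficient of X is lost there. On a sum
  of two nonzero classes the primitivity equation has zero right-hand side.\<close>

lemma primitives_support:
  assumes X: "X \<in> primitives C" and nz: "X M \<noteq> 0"
  shows "M \<in> Indec C"
proof -
  have prim: "X (oplus C A B) = X A * hall_one C B + hall_one C A * X B"
    if "A \<in> Iso C" "B \<in> Iso C" for A B
    using X that by (auto simp: primitives_def coproduct_def)
  have one: "hall_one C A = (if A = zero_class C then 1 else 0)" if "A \<in> Iso C" for A
    using that by (simp add: hall_one_def delta_def)
  have M: "M \<in> Iso C" using X nz hall_outside by (auto simp: primitives_def)
  \<comment> \<open>At the pair of zero classes the primitivity equation reads x = x + x.\<close>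
  have "X (zero_class C) = 0"
    using prim[of "zero_class C" "zero_class C"] one zero_class_in_Iso oplus_zero by simp
  moreover have "X (oplus C A B) = 0" if "A \<in> Iso C - {zero_class C}" "B \<in> Iso C - {zero_class C}" for A B
    using prim[of A B] one that by simp
  ultimately show ?thesis using M nz by (auto simp: Indec_def decomposable_def)
qed

lemma dual_iso_apply:
  assumes "finite T" "T \<subseteq> Iso C" "\<And>M. g M \<noteq> 0 \<Longrightarrow> M \<in> T"
  shows "dual_iso C g f = (\<Sum>A\<in>T. g A * f A)"
proof -
  have "dual_iso C g f = (\<Sum>A\<in>T. g A * dual_basis C A f)"
    unfolding dual_iso_def using assms by (intro sum'_eq_sum_support) auto
  also have "\<dots> = (\<Sum>A\<in>T. g A * f A)"
    using assms by (intro sum.cong) (auto simp: dual_basis_def)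
  finally show ?thesis .
qed

lemma dual_coeff_dual_iso:
  assumes g: "g \<in> hall C" and B: "B \<in> Iso C"
  shows "dual_coeff C (dual_iso C g) B = g B"
proof -
  have "dual_coeff C (dual_iso C g) B = (\<Sum>A | g A \<noteq> 0. g A * delta C B A)"
    unfolding dual_coeff_def using hallD[OF g] by (intro dual_iso_apply) auto
  also have "\<dots> = (\<Sum>A | g A \<noteq> 0. g A * delta C A B)"
    using hallD[OF g] B by (intro sum.cong) (auto simp: delta_def)
  finally show ?thesis using sum_delta_support[OF g B] by simp
qed

text \<open>Projection formula: pairing a pushforward along p with h amounts to summing h composed
  with p over the Hecke correspondence, so the class in the target disappears.\<close>

lemma dual_iso_hecke_op:
  assumes g: "g \<in> hall C" and p: "\<And>x. x \<in> Hecke C \<Longrightarrow> p x \<in> Iso C"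
  shows "dual_iso C (hecke_op p r f g) h =
    (\<Sum>B | g B \<noteq> 0. g B * (\<Sum>N\<in>Sub C B. f (r (N, B)) * h (p (N, B))))"
proof -
  let ?T = "{B. g B \<noteq> 0}"
  let ?T' = "p ` prod.swap ` Sigma ?T (Sub C)"
  have T: "finite ?T" "?T \<subseteq> Iso C" using hallD[OF g] by auto
  have T': "finite ?T'" "?T' \<subseteq> Iso C"
    using T finite_Sub p by (auto intro!: finite_SigmaI simp: Hecke_def)
  have "dual_iso C (hecke_op p r f g) h = (\<Sum>M\<in>?T'. hecke_op p r f g M * h M)"
    using hecke_op_support[OF T subset_refl] by (intro dual_iso_apply T') blast
  also have "\<dots> = (\<Sum>M\<in>?T'. \<Sum>B\<in>?T. \<Sum>N\<in>Sub C B. if p (N, B) = M then g B * f (r (N, B)) * h M else 0)"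
  proof (intro sum.cong refl)
    fix M assume "M \<in> ?T'"
    then have M: "M \<in> Iso C" using T'(2) by blast
    show "hecke_op p r f g M * h M =
        (\<Sum>B\<in>?T. \<Sum>N\<in>Sub C B. if p (N, B) = M then g B * f (r (N, B)) * h M else 0)"
      unfolding hecke_op_eq[OF T subset_refl M] sum_distrib_right[where r = "h M"] sum_distrib_left[where r = "g _"]
      by (intro sum.cong refl) simp
  qed
  also have "\<dots> = (\<Sum>B\<in>?T. \<Sum>N\<in>Sub C B. \<Sum>M\<in>?T'. if p (N, B) = M then g B * f (r (N, B)) * h M else 0)"
    by (subst sum.swap, rule sum.cong[OF refl], subst sum.swap, rule refl)
  also have "\<dots> = (\<Sum>B\<in>?T. \<Sum>N\<in>Sub C B. g B * f (r (N, B)) * h (p (N, B)))"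
  proof (intro sum.cong refl)
    fix B N assume "B \<in> ?T" "N \<in> Sub C B"
    then have "(B, N) \<in> Sigma ?T (Sub C)" by simp
    then have "p (prod.swap (B, N)) \<in> ?T'" by blast
    then have "p (N, B) \<in> ?T'" by simp
    then show "(\<Sum>M\<in>?T'. if p (N, B) = M then g B * f (r (N, B)) * h M else 0) =
      g B * f (r (N, B)) * h (p (N, B))"
      by (subst sum.delta'[OF T'(1)]) (simp only: if_True)
  qed
  finally show ?thesis by (simp add: sum_distrib_left mult.assoc)
qed

lemma sum_fun_apply: "(\<Sum>i\<in>I. F i) x = (\<Sum>i\<in>I. F i x :: rat)"
  by (induction I rule: infinite_finite_induct) auto

lemma sum_support_classify:
  assumes "X \<in> hall C" "finite K" "\<And>N. N \<in> K \<Longrightarrow> r N \<in> Iso C"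
  shows "(\<Sum>A | X A \<noteq> 0. X A * (\<Sum>N | N \<in> K \<and> r N = A. h N)) = (\<Sum>N\<in>K. X (r N) * h N)"
proof -
  have fin: "finite {A. X A \<noteq> 0}" using hallD assms by blast
  have "(\<Sum>A | X A \<noteq> 0. X A * (\<Sum>N | N \<in> K \<and> r N = A. h N)) =
    (\<Sum>A | X A \<noteq> 0. \<Sum>N\<in>K. if r N = A then X A * h N else 0)"
    using assms by (simp add: sum_distrib_left sum.inter_filter if_distrib[of "(*) _"] cong: if_cong)
  also have "\<dots> = (\<Sum>N\<in>K. \<Sum>A | X A \<noteq> 0. if r N = A then X A * h N else 0)"
    by (rule sum.swap)
  also have "\<dots> = (\<Sum>N\<in>K. X (r N) * h N)"
    using fin by (intro sum.cong) (auto simp: sum.delta')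
  finally show ?thesis .
qed

text \<open>The coefficient of \<open>\<phi>\<^sub>B\<close> in \<open>dual_iso C g\<close> is g B,
  and X vanishes outside \<open>Indec C\<close>, so the bilinear extension is a finite sum.
  Collecting the subobjects N of B by their class turns the coefficients of X into values at the
  class of N; the sign of the elimination representation is the one from exchanging sides.\<close>

lemma elimination_dual_iso:
  assumes X: "X \<in> primitives C" and g: "g \<in> hall C"
  shows "elimination C X (dual_iso C g) = dual_iso C (- bullet C g X)"
proof
  fix h
  have Xh: "X \<in> hall C" using X by (simp add: primitives_def)
  have "elimination C X (dual_iso C g) h = (\<Sum>A | X A \<noteq> 0. \<Sum>B | g B \<noteq> 0.
    X A * dual_coeff C (dual_iso C g) B *
      (- (\<Sum>N\<in>{N \<in> Sub C B. iso_class C N = A}. dual_basis C (quot_class C B N))) h)"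
    unfolding elimination_def using hallD[OF Xh] hallD[OF g] primitives_support[OF X]
    by (intro bilin_eq_sum) (auto simp: dual_coeff_dual_iso[OF g])
  also have "\<dots> = (\<Sum>A | X A \<noteq> 0. \<Sum>B | g B \<noteq> 0. - (g B * (X A *
      (\<Sum>N | N \<in> Sub C B \<and> iso_class C N = A. h (quot_class C B N)))))"
    using hallD[OF g]
    by (intro sum.cong refl) (auto simp: dual_coeff_dual_iso[OF g] sum_fun_apply dual_basis_def
        quot_class_in_Iso subset_iff)
  also have "\<dots> = (\<Sum>B | g B \<noteq> 0. - (g B * (\<Sum>A | X A \<noteq> 0. X A *
      (\<Sum>N | N \<in> Sub C B \<and> iso_class C N = A. h (quot_class C B N)))))"
    by (subst sum.swap) (simp add: sum_distrib_left sum_negf)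
  also have "\<dots> = (\<Sum>B | g B \<noteq> 0. - (g B * (\<Sum>N\<in>Sub C B. X (iso_class C N) * h (quot_class C B N))))"
    using hallD[OF g] finite_Sub Sub_class_in_Iso
    by (intro sum.cong refl arg_cong[where f = uminus] arg_cong[where f = "(*) _"] sum_support_classify[OF Xh]) auto
  also have "\<dots> = - dual_iso C (bullet C g X) h"
    unfolding bullet_eq_hecke_op by (subst dual_iso_hecke_op[OF g piq_in_Iso])
      (auto simp: pi1_def piq_def sum_negf)
  also have "\<dots> = dual_iso C (- bullet C g X) h"
  proof -
    have b: "bullet C g X \<in> hall C" by (simp add: bullet_eq_hecke_op hecke_op_in_hall g)
    show ?thesis
      by (subst (1 2) dual_iso_apply[of "{M. bullet C g X M \<noteq> 0}"])
        (use hallD[OF b] in \<open>auto simp: sum_negf\<close>)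
  qed
  finally show "elimination C X (dual_iso C g) h = dual_iso C (- bullet C g X) h" .
qed

lemma top_elimination_dual_iso:
  assumes X: "X \<in> primitives C" and g: "g \<in> hall C"
  shows "- top_elimination C (dual_iso C g) X = dual_iso C (star C X g)"
proof
  fix h
  have Xh: "X \<in> hall C" using X by (simp add: primitives_def)
  have "top_elimination C (dual_iso C g) X h = (\<Sum>B | g B \<noteq> 0. \<Sum>A | X A \<noteq> 0.
    dual_coeff C (dual_iso C g) B * X A *
      (- (\<Sum>N\<in>{N \<in> Sub C B. quot_class C B N = A}. dual_basis C (iso_class C N))) h)"
    unfolding top_elimination_def using hallD[OF Xh] hallD[OF g] primitives_support[OF X]
    by (intro bilin_eq_sum) (auto simp: dual_coeff_dual_iso[OF g])
  also have "\<dots> = (\<Sum>B | g B \<noteq> 0. \<Sum>A | X A \<noteq> 0. - (g B * (X A *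
      (\<Sum>N | N \<in> Sub C B \<and> quot_class C B N = A. h (iso_class C N)))))"
    using hallD[OF g]
    by (intro sum.cong refl) (auto simp: dual_coeff_dual_iso[OF g] sum_fun_apply dual_basis_def
        Sub_class_in_Iso subset_iff)
  also have "\<dots> = (\<Sum>B | g B \<noteq> 0. - (g B * (\<Sum>A | X A \<noteq> 0. X A *
      (\<Sum>N | N \<in> Sub C B \<and> quot_class C B N = A. h (iso_class C N)))))"
    by (simp add: sum_distrib_left sum_negf)
  also have "\<dots> = (\<Sum>B | g B \<noteq> 0. - (g B * (\<Sum>N\<in>Sub C B. X (quot_class C B N) * h (iso_class C N))))"
    using hallD[OF g] finite_Sub quot_class_in_Iso
    by (intro sum.cong refl arg_cong[where f = uminus] arg_cong[where f = "(*) _"] sum_support_classify[OF Xh]) auto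
  also have "\<dots> = - dual_iso C (star C X g) h"
    unfolding star_eq_hecke_op by (subst dual_iso_hecke_op[OF g pi1_in_Iso])
      (auto simp: pi1_def piq_def sum_negf)
  finally show "(- top_elimination C (dual_iso C g) X) h = dual_iso C (star C X g) h" by simp
qed

subsection \<open>Values on delta functions\<close>

lemma hecke_op_delta:
  assumes A: "A \<in> Iso C" and B: "B \<in> Iso C" and p: "\<And>x. x \<in> Hecke C \<Longrightarrow> p x \<in> Iso C"
  shows "hecke_op p r (delta C A) (delta C B) = (\<Sum>N | N \<in> Sub C B \<and> r (N, B) = A. delta C (p (N, B)))"
proof
  fix M
  show "hecke_op p r (delta C A) (delta C B) M = (\<Sum>N | N \<in> Sub C B \<and> r (N, B) = A. delta C (p (N, B))) M"
  proof (cases "M \<in> Iso C")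
    case True
    have "{B'. delta C B B' \<noteq> 0} \<subseteq> {B}" by (auto simp: delta_def)
    then have "hecke_op p r (delta C A) (delta C B) M =
      (\<Sum>N\<in>Sub C B. if p (N, B) = M then delta C A (r (N, B)) else 0)"
      using B by (subst hecke_op_eq[of "{B}", OF _ _ _ True]) (auto simp: delta_def)
    also have "\<dots> = (\<Sum>N\<in>Sub C B. if r (N, B) = A then delta C (p (N, B)) M else 0)"
      using A True by (intro sum.cong) (auto simp: delta_def)
    finally show ?thesis using finite_Sub[OF B] by (subst sum_fun_apply) (simp add: sum.inter_filter)
  next
    case False
    then show ?thesis by (simp add: hecke_op_outside sum_fun_apply delta_def)
  qed
qed

lemma bullet_delta:
  assumes "A \<in> Iso C" "B \<in> Iso C"
  shows "bullet C (delta C B) (delta C A) =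
    (\<Sum>N\<in>{N \<in> Sub C B. iso_class C N = A}. delta C (quot_class C B N))"
  using hecke_op_delta[OF assms, of "piq C" "pi1 C"] piq_in_Iso
  unfolding bullet_eq_hecke_op pi1_def piq_def prod.case by simp

lemma star_delta:
  assumes "A \<in> Iso C" "B \<in> Iso C"
  shows "star C (delta C A) (delta C B) =
    (\<Sum>N\<in>{N \<in> Sub C B. quot_class C B N = A}. delta C (iso_class C N))"
  using hecke_op_delta[OF assms, of "pi1 C" "piq C"] pi1_in_Iso
  unfolding star_eq_hecke_op pi1_def piq_def prod.case by simp

text \<open>Both sides count, at a class M, the subobjects with class B and quotient class A. Only
  finitely many extensions contribute, which makes \<open>sum'\<close> in the function space a
  genuine finite sum.\<close>

lemma box_delta:
  assumes A: "A \<in> Iso C" and B: "B \<in> Iso C"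
  shows "box C (delta C B) (delta C A) =
    sum' (\<lambda>E. \<Sum>N\<in>{N \<in> Sub C E. iso_class C N = B \<and> quot_class C E N = A}. delta C E) (Iso C)"
proof
  fix M
  let ?T = "{M \<in> Iso C. \<exists>N\<in>Sub C M. iso_class C N = B \<and> quot_class C M N = A}"
  let ?K = "\<lambda>E. {N \<in> Sub C E. iso_class C N = B \<and> quot_class C E N = A}"
  have fin: "finite ?T" by (rule finite_hall_mult_support[OF B A])
  have empty: "?K E = {}" if "E \<in> Iso C" "E \<notin> ?T" for E using that by blast
  have "sum' (\<lambda>E. \<Sum>N\<in>?K E. delta C E) (Iso C) = (\<Sum>E\<in>?T. \<Sum>N\<in>?K E. delta C E)"
  proof (rule sum'_eq_sum_support[OF fin])
    show "(\<Sum>N\<in>?K E. delta C E) = 0" if "E \<in> Iso C" "E \<notin> ?T" for E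
      unfolding empty[OF that] by simp
  qed blast
  then have "sum' (\<lambda>E. \<Sum>N\<in>?K E. delta C E) (Iso C) M = (\<Sum>E\<in>?T. \<Sum>N\<in>?K E. delta C E M)"
    by (simp only: sum_fun_apply)
  also have "\<dots> = (\<Sum>E\<in>?T. if E = M then (\<Sum>N\<in>?K M. 1) else 0)"
    by (rule sum.cong[OF refl]) (clarsimp simp: delta_def)
  also have "\<dots> = (if M \<in> ?T then (\<Sum>N\<in>?K M. 1) else 0)"
    by (rule sum.delta[OF fin])
  also have "\<dots> = (if M \<in> Iso C then (\<Sum>N\<in>?K M. 1) else 0)"
  proof (cases "M \<in> Iso C \<and> M \<notin> ?T")
    case True
    then have "?K M = {}" using empty by blast
    then show ?thesis using True by (simp only: sum.empty if_False if_True)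
  qed auto
  also have "\<dots> = hall_mult C (delta C B) (delta C A) M"
  proof (cases "M \<in> Iso C")
    case True
    have "(\<Sum>N\<in>?K M. 1) = (\<Sum>N\<in>Sub C M. if iso_class C N = B \<and> quot_class C M N = A then 1 else 0 :: rat)"
      using finite_Sub[OF True] by (rule sum.inter_filter)
    also have "\<dots> = hall_mult C (delta C B) (delta C A) M"
      using True A B unfolding hall_mult_def delta_def by (simp only: if_True) (rule sum.cong, auto)
    finally show ?thesis using True by simp
  qed (simp add: hall_mult_def)
  finally show "box C (delta C B) (delta C A) M = sum' (\<lambda>E. \<Sum>N\<in>?K E. delta C E) (Iso C) M"
    by (simp only: box_eq_hall_mult)
qed

lemma hecke_correspondence:
  "(\<forall>A \<in> Iso C. \<forall>B \<in> Iso C.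
       bullet C (delta C B) (delta C A)
         = (\<Sum>N\<in>{N \<in> Sub C B. iso_class C N = A}. delta C (quot_class C B N)) \<and>
       box C (delta C B) (delta C A)
         = sum' (\<lambda>E. \<Sum>N\<in>{N \<in> Sub C E. iso_class C N = B \<and> quot_class C E N = A}. delta C E)
                (Iso C) \<and>
       star C (delta C A) (delta C B)
         = (\<Sum>N\<in>{N \<in> Sub C B. quot_class C B N = A}. delta C (iso_class C N))) \<and>
   right_action C (bullet C) \<and>
   (\<forall>X \<in> primitives C. \<forall>g \<in> hall C.
       dual_iso C (- bullet C g X) = elimination C X (dual_iso C g)) \<and>
   right_action C (box C) \<and>
   (\<forall>f \<in> hall C. \<forall>g \<in> hall C. box C g f = top_insertion C g f) \<and>
   left_action C (box C) \<and>
   (\<forall>f \<in> hall C. \<forall>g \<in> hall C. box C g f = insertion C g f) \<and>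
   left_action C (star C) \<and>
   (\<forall>X \<in> primitives C. \<forall>g \<in> hall C.
       dual_iso C (star C X g) = - top_elimination C (dual_iso C g) X)"
  by (intro conjI ballI bullet_delta box_delta star_delta right_action_bullet right_action_box left_action_box
      left_action_star elimination_dual_iso[symmetric] top_elimination_dual_iso[symmetric])
    (simp_all only: box_eq insertion_eq_hall_mult top_insertion_eq_hall_mult)

end

section \<open>Rooted forests as graphs\<close>

text \<open>The relation sends a vertex to its parent. Single-valuedness gives at most one parent; a
  reachable sink for every vertex excludes cycles and provides the root of its tree.\<close>

definition forest_graph :: "'s set \<Rightarrow> ('s \<times> 's) set \<Rightarrow> bool" where
  "forest_graph W E \<longleftrightarrow> finite W \<and> E \<subseteq> W \<times> W \<and> single_valued E \<and>
     (\<forall>v\<in>W. \<exists>r. (v, r) \<in> E\<^sup>* \<and> r \<notin> Domain E)"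

definition subtree :: "'s set \<Rightarrow> ('s \<times> 's) set \<Rightarrow> 's \<Rightarrow> 's ltree" where
  "subtree W E r = (let U = {u\<in>W. (u, r) \<in> E\<^sup>*} in \<lparr>tverts = U, tedges = E \<inter> U \<times> U, troot = r\<rparr>)"

text \<open>Inverse to passing from a forest to its vertex set and edge set; the roots are the sinks
  of E. Encoding a forest by one relation makes restriction to a set of vertices a plain
  intersection, with no bookkeeping of trees.\<close>

definition trees :: "'s set \<Rightarrow> ('s \<times> 's) set \<Rightarrow> 's lforest" where
  "trees W E = subtree W E ` (W - Domain E)"

definition fedges :: "'s lforest \<Rightarrow> ('s \<times> 's) set" where
  "fedges F = (\<Union>T\<in>F. tedges T)"

lemma subtree_simps [simp]:
  "tverts (subtree W E r) = {u\<in>W. (u, r) \<in> E\<^sup>*}"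
  "tedges (subtree W E r) = E \<inter> {u\<in>W. (u, r) \<in> E\<^sup>*} \<times> {u\<in>W. (u, r) \<in> E\<^sup>*}"
  "troot (subtree W E r) = r"
  by (simp_all add: subtree_def Let_def)

lemma rtrancl_stays: "(u, v) \<in> E\<^sup>* \<Longrightarrow> E \<subseteq> W \<times> W \<Longrightarrow> u \<in> W \<Longrightarrow> v \<in> W"
  by (induction rule: rtrancl_induct) auto

lemma single_valued_rtrancl_sink:
  assumes "single_valued E" "(v, r) \<in> E\<^sup>*" "r \<notin> Domain E" "(v, w) \<in> E\<^sup>*"
  shows "(w, r) \<in> E\<^sup>*"
  using assms(4)
proof (induction rule: rtrancl_induct)
  case (step y z)
  from step.IH step.hyps(2) assms(3) obtain z' where "(y, z') \<in> E" "(z', r) \<in> E\<^sup>*"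
    by (metis DomainI converse_rtranclE)
  then show ?case using step.hyps(2) assms(1) by (metis single_valuedD)
qed (rule assms)

lemma single_valued_sink_unique:
  assumes "single_valued E" "(v, r) \<in> E\<^sup>*" "r \<notin> Domain E" "(v, s) \<in> E\<^sup>*" "s \<notin> Domain E"
  shows "r = s"
  using single_valued_rtrancl_sink[OF assms(1-4)] assms(5) by (metis DomainI converse_rtranclE)

text \<open>Follow the parents of v towards its root: the last vertex before the path first leaves D
  has no parent in D and is a root of the restriction.\<close>

lemma forest_graph_restrict:
  assumes "forest_graph W E" "D \<subseteq> W"
  shows "forest_graph D (E \<inter> D \<times> D)"
proof -
  have sv: "single_valued E" using assms by (simp add: forest_graph_def)
  have "\<exists>r'. (v, r') \<in> (E \<inter> D \<times> D)\<^sup>* \<and> r' \<notin> Domain (E \<inter> D \<times> D)"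
    if "(v, r) \<in> E\<^sup>*" "r \<notin> Domain E" "v \<in> D" for v r
    using that
  proof (induction rule: converse_rtrancl_induct)
    case (step v y)
    show ?case
    proof (cases "y \<in> D")
      case True
      then show ?thesis using step by (meson IntI SigmaI converse_rtrancl_into_rtrancl)
    next
      case False
      then have "v \<notin> Domain (E \<inter> D \<times> D)" using step.hyps(1) sv by (auto dest: single_valuedD)
      then show ?thesis by blast
    qed
  qed blast
  moreover have "single_valued (E \<inter> D \<times> D)" using sv by (auto simp: single_valued_def)
  moreover have "\<exists>r. (v, r) \<in> E\<^sup>* \<and> r \<notin> Domain E" if "v \<in> D" for v
    using assms that unfolding forest_graph_def by blast
  moreover have "finite D" using assms finite_subset unfolding forest_graph_def by blast
  ultimately show ?thesis unfolding forest_graph_def by blast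
qed

lemma rooted_tree_forest_graph:
  assumes "rooted_tree S T"
  shows "forest_graph (tverts T) (tedges T)"
proof -
  have "single_valued (tedges T)"
  proof (rule single_valuedI)
    fix v x y assume "(v, x) \<in> tedges T" "(v, y) \<in> tedges T"
    moreover from this have "v \<in> tverts T - {troot T}" using assms by (auto simp: rooted_tree_def)
    then have "\<exists>!u. (v, u) \<in> tedges T" using assms unfolding rooted_tree_def by blast
    ultimately show "x = y" by blast
  qed
  moreover have "troot T \<notin> Domain (tedges T)" using assms by (auto simp: rooted_tree_def)
  ultimately show ?thesis using assms unfolding forest_graph_def rooted_tree_def by blast
qed

lemma rooted_tree_eq_subtree:
  assumes "rooted_tree S T"
  shows "T = subtree (tverts T) (tedges T) (troot T)" and "tverts T - Domain (tedges T) = {troot T}"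
proof -
  have "{u \<in> tverts T. (u, troot T) \<in> (tedges T)\<^sup>*} = tverts T" "tedges T \<subseteq> tverts T \<times> tverts T"
    using assms by (auto simp: rooted_tree_def)
  then show "T = subtree (tverts T) (tedges T) (troot T)" by (simp add: subtree_def Int_absorb2)
  show "tverts T - Domain (tedges T) = {troot T}" using assms by (auto simp: rooted_tree_def)
qed

lemma trees_rooted_tree: "rooted_tree S T \<Longrightarrow> trees (tverts T) (tedges T) = {T}"
  using rooted_tree_eq_subtree[of S T] by (simp add: trees_def)

lemma trees_empty [simp]: "trees {} E = {}"
  by (simp add: trees_def)

text \<open>Disjoint vertex sets isolate the blocks: a path ending in \<open>W i\<close> uses only
  vertices and edges of block i, so reachability and roots can be computed blockwise.\<close>

lemma trees_UN:
  assumes disj: "\<And>i j. i \<in> I \<Longrightarrow> j \<in> I \<Longrightarrow> i \<noteq> j \<Longrightarrow> W i \<inter> W j = {}"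
    and sub: "\<And>i. i \<in> I \<Longrightarrow> E i \<subseteq> W i \<times> W i"
  shows "trees (\<Union>i\<in>I. W i) (\<Union>i\<in>I. E i) = (\<Union>i\<in>I. trees (W i) (E i))"
proof -
  let ?W = "\<Union>i\<in>I. W i" and ?E = "\<Union>i\<in>I. E i"
  have loc: "(u, r) \<in> E i" if "(u, r) \<in> ?E" "i \<in> I" "u \<in> W i \<or> r \<in> W i" for u r i
  proof -
    obtain j where j: "j \<in> I" "(u, r) \<in> E j" using \<open>(u, r) \<in> ?E\<close> by blast
    then have "u \<in> W j" "r \<in> W j" using sub by blast+
    then have "j = i" using disj[OF j(1) \<open>i \<in> I\<close>] that(3) by blast
    then show ?thesis using j by simp
  qed
  have star: "(u, r) \<in> (E i)\<^sup>* \<and> u \<in> W i" if "(u, r) \<in> ?E\<^sup>*" "i \<in> I" "r \<in> W i" for u r i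
    using that(1)
  proof (induction rule: converse_rtrancl_induct)
    case (step y z)
    then have "(y, z) \<in> E i" using loc[OF step.hyps(1) that(2)] by blast
    then show ?case using step.IH sub[OF that(2)] by (meson converse_rtrancl_into_rtrancl mem_Sigma_iff subsetD)
  qed (use that in simp)
  have mono: "(E i)\<^sup>* \<subseteq> ?E\<^sup>*" if "i \<in> I" for i using that by (intro rtrancl_mono) blast
  have sub_eq: "subtree ?W ?E r = subtree (W i) (E i) r" if "i \<in> I" "r \<in> W i" for i r
  proof -
    have U: "{u \<in> ?W. (u, r) \<in> ?E\<^sup>*} = {u \<in> W i. (u, r) \<in> (E i)\<^sup>*}"
      using star[OF _ that] mono[OF that(1)] that(1) by blast
    have "?E \<inter> U \<times> U = E i \<inter> U \<times> U" if "U \<subseteq> W i" for U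
    proof (intro subset_antisym subsetI)
      fix x assume "x \<in> ?E \<inter> U \<times> U"
      then show "x \<in> E i \<inter> U \<times> U" using loc[OF _ \<open>i \<in> I\<close>, of "fst x" "snd x"] that by auto
    qed (use \<open>i \<in> I\<close> in blast)
    then have "?E \<inter> {u \<in> W i. (u, r) \<in> (E i)\<^sup>*} \<times> {u \<in> W i. (u, r) \<in> (E i)\<^sup>*} =
      E i \<inter> {u \<in> W i. (u, r) \<in> (E i)\<^sup>*} \<times> {u \<in> W i. (u, r) \<in> (E i)\<^sup>*}" by blast
    then show ?thesis unfolding subtree_def U Let_def by simp
  qed
  have roots: "?W - Domain ?E = (\<Union>i\<in>I. W i - Domain (E i))"
  proof (intro subset_antisym subsetI)
    fix v assume "v \<in> (\<Union>i\<in>I. W i - Domain (E i))"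
    then obtain i where i: "i \<in> I" "v \<in> W i" "v \<notin> Domain (E i)" by blast
    then have "v \<notin> Domain ?E" using loc[OF _ i(1)] by (metis DomainE DomainI)
    then show "v \<in> ?W - Domain ?E" using i by blast
  qed blast
  have "subtree ?W ?E ` (W i - Domain (E i)) = subtree (W i) (E i) ` (W i - Domain (E i))"
    if "i \<in> I" for i
    using sub_eq[OF that] by (intro image_cong refl) blast
  then show ?thesis unfolding trees_def roots image_UN by simp
qed

lemma forest_graph_trees:
  assumes "forest_graph W E"
  shows fverts_trees: "fverts (trees W E) = W" and fedges_trees: "fedges (trees W E) = E"
proof -
  have E: "E \<subseteq> W \<times> W" "single_valued E" using assms by (auto simp: forest_graph_def)
  have root: "\<exists>r\<in>W - Domain E. (v, r) \<in> E\<^sup>*" if "v \<in> W" for v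
  proof -
    obtain r where "(v, r) \<in> E\<^sup>*" "r \<notin> Domain E"
      using assms \<open>v \<in> W\<close> unfolding forest_graph_def by blast
    then show ?thesis using rtrancl_stays[OF _ E(1)] that by blast
  qed
  have "fverts (trees W E) = (\<Union>r\<in>W - Domain E. {u\<in>W. (u, r) \<in> E\<^sup>*})"
    by (simp add: fverts_def trees_def)
  then show "fverts (trees W E) = W" using root by blast
  have fe: "fedges (trees W E) =
    (\<Union>r\<in>W - Domain E. E \<inter> {u\<in>W. (u, r) \<in> E\<^sup>*} \<times> {u\<in>W. (u, r) \<in> E\<^sup>*})"
    by (simp add: fedges_def trees_def)
  have "(x, y) \<in> fedges (trees W E)" if "(x, y) \<in> E" for x y
  proof -
    have "x \<in> W" "y \<in> W" using that E by auto
    then obtain r where r: "r \<in> W - Domain E" "(x, r) \<in> E\<^sup>*" using root by blast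
    then have "(y, r) \<in> E\<^sup>*" using single_valued_rtrancl_sink[OF E(2) r(2)] that by blast
    then show ?thesis using r that \<open>x \<in> W\<close> \<open>y \<in> W\<close>
      unfolding fe by blast
  qed
  moreover have "fedges (trees W E) \<subseteq> E" unfolding fe by blast
  ultimately show "fedges (trees W E) = E" by auto
qed

lemma rooted_forest_trees:
  assumes g: "forest_graph W E" and S: "W \<subseteq> S"
  shows "rooted_forest S (trees W E)"
proof -
  have E: "finite W" "E \<subseteq> W \<times> W" "single_valued E" using g by (auto simp: forest_graph_def)
  have tree: "rooted_tree S (subtree W E r)" if r: "r \<in> W - Domain E" for r
  proof -
    let ?U = "{u\<in>W. (u, r) \<in> E\<^sup>*}"
    have parent: "\<exists>!u. (v, u) \<in> E \<inter> ?U \<times> ?U" if v: "v \<in> ?U - {r}" for v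
    proof -
      obtain u where u: "(v, u) \<in> E" "(u, r) \<in> E\<^sup>*" using v by (auto elim: converse_rtranclE)
      then have "(v, u) \<in> E \<inter> ?U \<times> ?U" using v E by auto
      moreover have "u' = u" if "(v, u') \<in> E \<inter> ?U \<times> ?U" for u'
        using that u(1) E(3) by (auto dest: single_valuedD)
      ultimately show ?thesis by blast
    qed
    have reach: "(v, r) \<in> (E \<inter> ?U \<times> ?U)\<^sup>*" if "(v, r) \<in> E\<^sup>*" for v
      using that
    proof (induction rule: converse_rtrancl_induct)
      case (step y z)
      then have "(y, z) \<in> E \<inter> ?U \<times> ?U" using E by (auto intro: converse_rtrancl_into_rtrancl)
      then show ?case using step.IH by (rule converse_rtrancl_into_rtrancl)
    qed simp
    show ?thesis unfolding rooted_tree_def subtree_simps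
    proof (intro conjI)
      show "finite ?U" "?U \<subseteq> S" "r \<in> ?U" using E S r by auto
      show "\<forall>u. (r, u) \<notin> E \<inter> ?U \<times> ?U" using r by auto
    qed (use parent reach in auto)
  qed
  have "disjnt (tverts (subtree W E r)) (tverts (subtree W E s))"
    if "r \<in> W - Domain E" "s \<in> W - Domain E" "r \<noteq> s" for r s
    using single_valued_sink_unique[OF E(3)] that by (auto simp: disjnt_iff)
  then have "pairwise (\<lambda>T T'. disjnt (tverts T) (tverts T')) (trees W E)"
    unfolding trees_def pairwise_def by blast
  then show ?thesis using tree E(1) unfolding rooted_forest_def trees_def by auto
qed

lemma rooted_forestD:
  assumes "rooted_forest S F"
  shows forest_graph_rooted_forest: "forest_graph (fverts F) (fedges F)"
    and fverts_subset: "fverts F \<subseteq> S"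
    and trees_rooted_forest: "trees (fverts F) (fedges F) = F"
proof -
  have T: "rooted_tree S T" if "T \<in> F" for T using that assms by (simp add: rooted_forest_def)
  have disj: "tverts T \<inter> tverts T' = {}" if "T \<in> F" "T' \<in> F" "T \<noteq> T'" for T T'
    using that assms unfolding rooted_forest_def pairwise_def disjnt_def by blast
  have sub: "tedges T \<subseteq> tverts T \<times> tverts T" if "T \<in> F" for T
    using T[OF that] by (simp add: rooted_tree_def)
  show "fverts F \<subseteq> S" using T unfolding fverts_def rooted_tree_def by blast
  show "trees (fverts F) (fedges F) = F"
    unfolding fverts_def fedges_def by (subst trees_UN) (auto simp: disj sub trees_rooted_tree[OF T])
  have fg: "forest_graph (tverts T) (tedges T)" if "T \<in> F" for T
    using rooted_tree_forest_graph[OF T[OF that]] .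
  have loc: "(u, r) \<in> tedges T" if "(u, r) \<in> fedges F" "T \<in> F" "u \<in> tverts T" for u r T
    using that disj sub unfolding fedges_def by blast
  have "single_valued (fedges F)"
  proof (rule single_valuedI)
    fix v x y assume xy: "(v, x) \<in> fedges F" "(v, y) \<in> fedges F"
    then obtain T where "T \<in> F" "v \<in> tverts T" using sub by (fastforce simp: fedges_def)
    then show "x = y" using loc[OF xy(1)] loc[OF xy(2)] fg[of T] by (auto simp: forest_graph_def dest: single_valuedD)
  qed
  moreover have "\<exists>r. (v, r) \<in> (fedges F)\<^sup>* \<and> r \<notin> Domain (fedges F)" if "v \<in> fverts F" for v
  proof -
    obtain T where t: "T \<in> F" "v \<in> tverts T" using \<open>v \<in> fverts F\<close> by (auto simp: fverts_def)
    then obtain r where r: "(v, r) \<in> (tedges T)\<^sup>*" "r \<notin> Domain (tedges T)"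
      using fg unfolding forest_graph_def by blast
    then have "r \<in> tverts T" using t sub rtrancl_stays by metis
    then have "r \<notin> Domain (fedges F)" using loc t r by blast
    moreover have "(tedges T)\<^sup>* \<subseteq> (fedges F)\<^sup>*" using t by (intro rtrancl_mono) (auto simp: fedges_def)
    ultimately show ?thesis using r by blast
  qed
  moreover have "finite (fverts F)" using assms by (auto simp: fverts_def rooted_forest_def rooted_tree_def)
  moreover have "fedges F \<subseteq> fverts F \<times> fverts F" using sub unfolding fverts_def fedges_def by fast
  ultimately show "forest_graph (fverts F) (fedges F)" unfolding forest_graph_def by simp
qed

text \<open>A cycle through v contains the only parent of v, so it could be pushed along the path to
  a sink, and a sink lies on no cycle.\<close>

lemma forest_graph_acyclic:
  assumes "forest_graph W E"
  shows "acyclic E"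
proof -
  have "(v, v) \<notin> E\<^sup>+" if "(v, r) \<in> E\<^sup>*" "r \<notin> Domain E" for v r
    using that
  proof (induction rule: converse_rtrancl_induct)
    case base
    then show ?case by (metis DomainI tranclD)
  next
    case (step v y)
    show ?case
    proof
      assume "(v, v) \<in> E\<^sup>+"
      then obtain z where "(v, z) \<in> E" "(z, v) \<in> E\<^sup>*" by (meson tranclD)
      then have "(y, v) \<in> E\<^sup>*" using assms step.hyps(1) by (metis forest_graph_def single_valuedD)
      then show False using step by (meson rtrancl_into_trancl1)
    qed
  qed
  moreover have "v \<in> W" if "(v, v) \<in> E\<^sup>+" for v
    using that assms by (metis (no_types) forest_graph_def mem_Sigma_iff subsetD tranclD)
  ultimately show ?thesis using assms unfolding acyclic_def forest_graph_def by metis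
qed

section \<open>Cuts as descendant-closed vertex sets\<close>

definition desc_closed :: "'s set \<Rightarrow> ('s \<times> 's) set \<Rightarrow> 's set \<Rightarrow> bool" where
  "desc_closed W E D \<longleftrightarrow> D \<subseteq> W \<and> (\<forall>(u, v)\<in>E. v \<in> D \<longrightarrow> u \<in> D)"

abbreviation restr :: "('s \<times> 's) set \<Rightarrow> 's set \<Rightarrow> 's lforest" where
  "restr E D \<equiv> trees D (E \<inter> D \<times> D)"

text \<open>Admissibility speaks only of paths starting at leaves. A leaf below a given vertex
  allows it to be applied to two cut edges lying one above the other.\<close>

lemma leaf_below:
  assumes T: "rooted_tree S T" and v: "v \<in> tverts T"
  shows "\<exists>l\<in>leaves T. (l, v) \<in> (tedges T)\<^sup>*"
proof -
  have g: "forest_graph (tverts T) (tedges T)" by (rule rooted_tree_forest_graph[OF T])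
  then have "finite (tedges T)" by (auto simp: forest_graph_def intro: finite_subset)
  then have wf: "wf (tedges T)" using forest_graph_acyclic[OF g] finite_acyclic_wf by blast
  show ?thesis using v
  proof (induction v rule: wf_induct_rule[OF wf])
    case (1 v)
    show ?case
    proof (cases "v \<in> leaves T")
      case False
      then obtain x where x: "(x, v) \<in> tedges T" using 1 by (auto simp: leaves_def)
      then have "x \<in> tverts T" using g by (auto simp: forest_graph_def)
      then show ?thesis using 1(1)[OF x] x by (meson rtrancl.rtrancl_into_rtrancl)
    qed blast
  qed
qed

text \<open>The descendant-closed set belonging to a cut is the set of vertices of its \<open>P\<close>-part.\<close>

lemma edge_cut_desc_closed:
  fixes T :: "'s ltree"
  assumes T: "rooted_tree S T" and C: "admissible_cut T (EdgeCut C)"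
  defines "E \<equiv> tedges T" and "D \<equiv> {u \<in> tverts T. \<exists>v\<in>fst ` C. (u, v) \<in> (tedges T - C)\<^sup>*}"
  shows "desc_closed (tverts T) E D" "tree_P T (EdgeCut C) = restr E D"
    "tree_R T (EdgeCut C) = restr E (tverts T - D)"
proof -
  let ?W = "tverts T"
  have g: "forest_graph ?W E" unfolding E_def by (rule rooted_tree_forest_graph[OF T])
  have E: "E \<subseteq> ?W \<times> ?W" "single_valued E" using g by (auto simp: forest_graph_def)
  have CE: "C \<subseteq> E" using C by (simp add: E_def)
  have star_mono: "(E - C)\<^sup>* \<subseteq> E\<^sup>*" by (rule rtrancl_mono) blast
  \<comment> \<open>Two cut edges, one above the other, lie on the path from a common leaf and hence
    coincide; the connecting path would then close up to a cycle.\<close>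
  have no_return: "(w, v') \<notin> (E - C)\<^sup>*" if "(v, w) \<in> C" "(v', w') \<in> C" for v w v' w'
  proof
    assume r: "(w, v') \<in> (E - C)\<^sup>*"
    have v: "v \<in> ?W" "(v, w) \<in> E" using that CE E by auto
    obtain l where l: "l \<in> leaves T" "(l, v) \<in> E\<^sup>*" using leaf_below[OF T v(1)] by (auto simp: E_def)
    have lw: "(l, w) \<in> E\<^sup>*" using l v by (meson rtrancl.rtrancl_into_rtrancl)
    then have "(l, v') \<in> E\<^sup>*" using r star_mono by (meson rtrancl_trans subsetD)
    then have mem: "(v, w) \<in> C \<inter> root_path T l" "(v', w') \<in> C \<inter> root_path T l"
      using that CE l by (auto simp: root_path_def E_def)
    have "finite (?W \<times> ?W)" using g by (simp add: forest_graph_def)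
    then have "finite (C \<inter> root_path T l)"
      using E(1) CE by (meson finite_subset inf_le1 order_trans)
    moreover have "card (C \<inter> root_path T l) \<le> 1" using C l(1) by simp
    ultimately have "(v, w) = (v', w')" using mem by (metis One_nat_def card_le_Suc0_iff_eq)
    then have "(w, v) \<in> (E - C)\<^sup>*" using r by simp
    then have "(w, v) \<in> E\<^sup>*" by (rule subsetD[OF star_mono])
    then have "(v, v) \<in> E\<^sup>+" by (rule rtrancl_into_trancl2[OF v(2)])
    then show False using forest_graph_acyclic[OF g] by (auto simp: acyclic_def)
  qed
  have D: "D = {u \<in> ?W. \<exists>v\<in>fst ` C. (u, v) \<in> (E - C)\<^sup>*}" by (simp add: D_def E_def)
  have targets: "w \<notin> D" if "(v, w) \<in> C" for v w using no_return that by (force simp: D)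
  have sources: "v \<in> D" if "(v, w) \<in> C" for v w
  proof -
    have "v \<in> fst ` C" using that by (metis fst_conv image_eqI)
    moreover have "v \<in> ?W" using that CE E by blast
    ultimately show ?thesis unfolding D mem_Collect_eq
      by (intro conjI bexI[of _ v] rtrancl.rtrancl_refl)
  qed
  have EDC: "E \<inter> D \<times> D \<subseteq> E - C" using targets by blast
  have closed: "u \<in> D" if "(u, v) \<in> E" "v \<in> D" for u v
  proof -
    have "(u, v) \<in> E - C" using that targets by blast
    then show ?thesis using that E by (fastforce simp: D intro: converse_rtrancl_into_rtrancl)
  qed
  then show "desc_closed ?W E D" by (auto simp: desc_closed_def D)
  have roots: "D - Domain (E \<inter> D \<times> D) = fst ` C"
  proof
    show "fst ` C \<subseteq> D - Domain (E \<inter> D \<times> D)"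
      using sources targets CE E(2) by (fastforce dest: single_valuedD)
    show "D - Domain (E \<inter> D \<times> D) \<subseteq> fst ` C"
    proof
      fix u assume u: "u \<in> D - Domain (E \<inter> D \<times> D)"
      then obtain v where v: "v \<in> fst ` C" "(u, v) \<in> (E - C)\<^sup>*" by (auto simp: D)
      from v(2) show "u \<in> fst ` C"
      proof (cases rule: converse_rtranclE)
        case (step x)
        then have "x \<in> D" using v E by (auto simp: D)
        then show ?thesis using u step by blast
      qed (use v in simp)
    qed
  qed
  have sub: "subtree D (E \<inter> D \<times> D) v = cut_component T C v" if v: "v \<in> fst ` C" for v
  proof -
    have stay: "(u, v) \<in> (E \<inter> D \<times> D)\<^sup>* \<and> u \<in> D" if "(u, v) \<in> (E - C)\<^sup>*" for u
      using that
    proof (induction rule: converse_rtrancl_induct)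
      case base
      then show ?case using v sources by auto
    next
      case (step y z)
      then show ?case using closed by (blast intro: converse_rtrancl_into_rtrancl)
    qed
    have mono: "(E \<inter> D \<times> D)\<^sup>* \<subseteq> (E - C)\<^sup>*" using EDC by (rule rtrancl_mono)
    have U: "{u \<in> D. (u, v) \<in> (E \<inter> D \<times> D)\<^sup>*} = {u \<in> ?W. (u, v) \<in> (E - C)\<^sup>*}"
      using stay mono by (auto simp: D)
    have "E \<inter> D \<times> D \<inter> {u \<in> ?W. (u, v) \<in> (E - C)\<^sup>*} \<times> {u \<in> ?W. (u, v) \<in> (E - C)\<^sup>*} =
      (E - C) \<inter> {u \<in> ?W. (u, v) \<in> (E - C)\<^sup>*} \<times> {u \<in> ?W. (u, v) \<in> (E - C)\<^sup>*}"
      using stay EDC by blast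
    then show ?thesis unfolding subtree_def cut_component_def Let_def U E_def[symmetric] by simp
  qed
  show "tree_P T (EdgeCut C) = restr E D"
    unfolding trees_def roots using sub by (auto simp: image_iff)
  let ?U = "?W - D"
  let ?r = "troot T"
  have r: "?r \<in> ?W" "?r \<notin> Domain E" using T by (auto simp: rooted_tree_def E_def)
  have rU: "?r \<in> ?U"
  proof -
    have "?r \<notin> D"
    proof
      assume "?r \<in> D"
      then obtain v where v: "v \<in> fst ` C" "(?r, v) \<in> (E - C)\<^sup>*" by (auto simp: D)
      then have "?r = v" using r by (auto elim: converse_rtranclE)
      then show False using v CE r by auto
    qed
    then show ?thesis using r by simp
  qed
  have EUC: "E \<inter> ?U \<times> ?U \<subseteq> E - C" using sources by blast
  have reach: "(u, ?r) \<in> (E \<inter> ?U \<times> ?U)\<^sup>*" if "u \<in> ?U" for u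
  proof -
    have "(u, ?r) \<in> E\<^sup>*" using that T by (auto simp: rooted_tree_def E_def)
    then show ?thesis using that
    proof (induction rule: converse_rtrancl_induct)
      case (step y z)
      then have "(y, z) \<in> E \<inter> ?U \<times> ?U" using closed E by blast
      then show ?case using step.IH by (meson IntE SigmaE2 converse_rtrancl_into_rtrancl)
    qed simp
  qed
  have rootsU: "?U - Domain (E \<inter> ?U \<times> ?U) = {?r}"
  proof (intro subset_antisym subsetI)
    fix u assume "u \<in> ?U - Domain (E \<inter> ?U \<times> ?U)"
    then have "u = ?r" using reach[of u] by (metis DiffE DiffI DomainI converse_rtranclE)
    then show "u \<in> {?r}" by simp
  qed (use rU r in auto)
  \<comment> \<open>If y were in D, it would reach the lower end of a cut edge by uncut edges.
    Parents being unique, that path passes through z, so z would be in D as well.\<close>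
  have upward: "u \<in> ?U" if "(u, ?r) \<in> (E - C)\<^sup>*" for u
    using that
  proof (induction rule: converse_rtrancl_induct)
    case (step y z)
    have "y \<notin> D"
    proof
      assume "y \<in> D"
      then obtain v where v: "v \<in> fst ` C" "(y, v) \<in> (E - C)\<^sup>*" by (auto simp: D)
      have "y \<noteq> v" using v step.hyps CE E(2) by (auto dest: single_valuedD)
      then obtain z' where "(y, z') \<in> E - C" "(z', v) \<in> (E - C)\<^sup>*" using v by (meson converse_rtranclE)
      then have "(z, v) \<in> (E - C)\<^sup>*" using step.hyps E(2) by (auto dest: single_valuedD)
      then show False using step.IH v by (auto simp: D)
    qed
    then show ?case using step E by blast
  qed (rule rU)
  have U1: "{u \<in> ?W. (u, ?r) \<in> (E - C)\<^sup>*} = ?U"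
  proof -
    have "(E \<inter> ?U \<times> ?U)\<^sup>* \<subseteq> (E - C)\<^sup>*" using EUC by (rule rtrancl_mono)
    then show ?thesis using upward reach by blast
  qed
  have U2: "{u \<in> ?U. (u, ?r) \<in> (E \<inter> ?U \<times> ?U)\<^sup>*} = ?U" using reach by blast
  have "(E - C) \<inter> ?U \<times> ?U = E \<inter> ?U \<times> ?U \<inter> ?U \<times> ?U" using EUC by blast
  then show "tree_R T (EdgeCut C) = restr E ?U"
    unfolding trees_def rootsU tree_R.simps subtree_def cut_component_def E_def[symmetric] image_insert
      U1 U2 Let_def by simp
qed

lemma tree_cut_desc_closed:
  assumes T: "rooted_tree S T" and c: "admissible_cut T c"
  shows "\<exists>D. desc_closed (tverts T) (tedges T) D \<and> tree_P T c = restr (tedges T) D \<and>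
    tree_R T c = restr (tedges T) (tverts T - D)"
proof (cases c)
  case FullCut
  have "tedges T \<inter> tverts T \<times> tverts T = tedges T" using T by (auto simp: rooted_tree_def)
  then show ?thesis using FullCut T
    by (intro exI[of _ "tverts T"]) (auto simp: desc_closed_def trees_rooted_tree rooted_tree_def)
next
  case (EdgeCut C)
  then show ?thesis using edge_cut_desc_closed[OF T] c by blast
qed

text \<open>The cut consists of the edges leaving D. If D contains the root, closure makes it all of
  T; this is the case of the formal full cut.\<close>

lemma desc_closed_tree_cut:
  assumes T: "rooted_tree S T" and D: "desc_closed (tverts T) (tedges T) D"
  shows "\<exists>c. admissible_cut T c \<and> tree_P T c = restr (tedges T) D \<and>
    tree_R T c = restr (tedges T) (tverts T - D)"
proof (cases "troot T \<in> D")
  case True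
  have "u \<in> D" if "(u, troot T) \<in> (tedges T)\<^sup>*" for u
    using that by (induction rule: converse_rtrancl_induct) (use True D in \<open>auto simp: desc_closed_def\<close>)
  then have "D = tverts T" using D T by (auto simp: desc_closed_def rooted_tree_def)
  moreover have "tedges T \<inter> tverts T \<times> tverts T = tedges T" using T by (auto simp: rooted_tree_def)
  ultimately show ?thesis using T by (intro exI[of _ FullCut]) (auto simp: trees_rooted_tree)
next
  case False
  let ?E = "tedges T"
  let ?C = "?E \<inter> D \<times> (tverts T - D)"
  have g: "forest_graph (tverts T) ?E" by (rule rooted_tree_forest_graph[OF T])
  have E: "?E \<subseteq> tverts T \<times> tverts T" "single_valued ?E" using g by (auto simp: forest_graph_def)
  have closed: "u \<in> D" if "(u, v) \<in> ?E" "v \<in> D" for u v using D that by (auto simp: desc_closed_def)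
  have closed_star: "u \<in> D" if "(u, v) \<in> ?E\<^sup>*" "v \<in> D" for u v
    using that by (induction rule: converse_rtrancl_induct) (auto intro: closed)
  \<comment> \<open>The lower ends of two such edges on one path are comparable. After the first
    edge the path is outside D, and it cannot come back because D contains all descendants of its
    elements.\<close>
  have eq: "e = e'" if e: "e \<in> ?C \<inter> root_path T l" "e' \<in> ?C \<inter> root_path T l" for e e' l
  proof -
    obtain a b a' b' where ab: "e = (a, b)" "e' = (a', b')" by (cases e, cases e')
    have p: "(l, a) \<in> ?E\<^sup>*" "(l, a') \<in> ?E\<^sup>*" using e ab by (auto simp: root_path_def)
    then consider "(a, a') \<in> ?E\<^sup>*" | "(a', a) \<in> ?E\<^sup>*"
      using single_valued_confluent[OF E(2)] by blast
    moreover have "x = x'" if xy: "(x, y) \<in> ?C" "(x', y') \<in> ?C" "(x, x') \<in> ?E\<^sup>*" for x y x' y'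
    proof (rule ccontr)
      assume "x \<noteq> x'"
      then obtain z where "(x, z) \<in> ?E" "(z, x') \<in> ?E\<^sup>*" using xy by (meson converse_rtranclE)
      moreover have "z = y" using calculation xy E(2) by (auto dest: single_valuedD)
      ultimately show False using closed_star xy by blast
    qed
    ultimately have "a = a'" using e ab by blast
    then show ?thesis using e ab E(2) by (auto dest: single_valuedD)
  qed
  have "finite ?C" using g by (auto simp: forest_graph_def intro: finite_subset)
  then have "card (?C \<inter> root_path T l) \<le> 1" for l
    unfolding One_nat_def by (subst card_le_Suc0_iff_eq) (use eq in blast)+
  then have adm: "admissible_cut T (EdgeCut ?C)" by auto
  have "{u \<in> tverts T. \<exists>v\<in>fst ` ?C. (u, v) \<in> (?E - ?C)\<^sup>*} = D"
  proof (intro subset_antisym subsetI)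
    fix u assume "u \<in> {u \<in> tverts T. \<exists>v\<in>fst ` ?C. (u, v) \<in> (?E - ?C)\<^sup>*}"
    then obtain v where "v \<in> D" "(u, v) \<in> (?E - ?C)\<^sup>*" by auto
    moreover have "(?E - ?C)\<^sup>* \<subseteq> ?E\<^sup>*" by (rule rtrancl_mono) blast
    ultimately show "u \<in> D" using closed_star by blast
  next
    fix u assume u: "u \<in> D"
    then have uW: "u \<in> tverts T" using D by (auto simp: desc_closed_def)
    then have "(u, troot T) \<in> ?E\<^sup>*" using T by (auto simp: rooted_tree_def)
    \<comment> \<open>The root is outside D, so the path from u to the root leaves D along an edge
      of the cut.\<close>
    then have "\<exists>v\<in>fst ` ?C. (u, v) \<in> (?E - ?C)\<^sup>*" using u
    proof (induction rule: converse_rtrancl_induct)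
      case base
      then show ?case using False by simp
    next
      case (step y z)
      show ?case
      proof (cases "z \<in> D")
        case True
        then have "(y, z) \<in> ?E - ?C" using step by blast
        then show ?thesis using step.IH[OF True] by (meson converse_rtrancl_into_rtrancl)
      next
        case False
        then have "(y, z) \<in> ?C" using step E by blast
        then have "y \<in> fst ` ?C" by (metis fst_conv image_eqI)
        then show ?thesis by blast
      qed
    qed
    then show "u \<in> {u \<in> tverts T. \<exists>v\<in>fst ` ?C. (u, v) \<in> (?E - ?C)\<^sup>*}" using uW by blast
  qed
  then show ?thesis using edge_cut_desc_closed[OF T adm] adm by metis
qed

section \<open>From cuts of trees to cuts of forests\<close>

lemma forest_edges_local:
  assumes "rooted_forest S F" "T \<in> F" "(u, v) \<in> fedges F" "u \<in> tverts T \<or> v \<in> tverts T"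
  shows "(u, v) \<in> tedges T"
proof -
  obtain T' where T': "T' \<in> F" "(u, v) \<in> tedges T'" using assms(3) by (auto simp: fedges_def)
  then have "u \<in> tverts T'" "v \<in> tverts T'"
    using assms(1) by (auto simp: rooted_forest_def rooted_tree_def)
  then have "T' = T" using T'(1) assms unfolding rooted_forest_def pairwise_def disjnt_iff by metis
  then show ?thesis using T' by simp
qed

lemma forest_tverts_disjoint:
  "rooted_forest S F \<Longrightarrow> T \<in> F \<Longrightarrow> T' \<in> F \<Longrightarrow> T \<noteq> T' \<Longrightarrow> tverts T \<inter> tverts T' = {}"
  unfolding rooted_forest_def pairwise_def disjnt_def by simp

lemma restr_UN:
  assumes F: "rooted_forest S F" and D: "\<And>T. T \<in> F \<Longrightarrow> D T \<subseteq> tverts T"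
  shows "restr (fedges F) (\<Union>T\<in>F. D T) = (\<Union>T\<in>F. restr (tedges T) (D T))"
proof -
  let ?D = "\<Union>T\<in>F. D T"
  have "fedges F \<inter> ?D \<times> ?D = (\<Union>T\<in>F. tedges T \<inter> D T \<times> D T)"
  proof (intro subset_antisym subsetI)
    fix e assume e: "e \<in> fedges F \<inter> ?D \<times> ?D"
    obtain u v where uv: "e = (u, v)" by (cases e)
    then obtain T T' where T: "T \<in> F" "u \<in> D T" "T' \<in> F" "v \<in> D T'" using e by auto
    then have "(u, v) \<in> tedges T" using forest_edges_local[OF F T(1)] e uv D[OF T(1)] by auto
    then have "v \<in> tverts T" using F T(1) by (auto simp: rooted_forest_def rooted_tree_def)
    then have "T = T'" using forest_tverts_disjoint[OF F T(1,3)] D[OF T(3)] T(4) by auto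
    then show "e \<in> (\<Union>T\<in>F. tedges T \<inter> D T \<times> D T)" using T uv \<open>(u, v) \<in> tedges T\<close> by auto
  qed (auto simp: fedges_def)
  moreover have "trees (\<Union>T\<in>F. D T) (\<Union>T\<in>F. tedges T \<inter> D T \<times> D T) =
    (\<Union>T\<in>F. trees (D T) (tedges T \<inter> D T \<times> D T))"
  proof (rule trees_UN)
    show "D T \<inter> D T' = {}" if "T \<in> F" "T' \<in> F" "T \<noteq> T'" for T T'
      using forest_tverts_disjoint[OF F that] D[OF that(1)] D[OF that(2)] by auto
  qed auto
  ultimately show ?thesis by simp
qed

lemma forest_cut_desc_closed:
  assumes F: "rooted_forest S F" and c: "forest_cut F c"
  shows "\<exists>D. desc_closed (fverts F) (fedges F) D \<and> forest_P F c = restr (fedges F) D \<and>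
    forest_R F c = restr (fedges F) (fverts F - D)"
proof -
  have "\<forall>T\<in>F. \<exists>D. desc_closed (tverts T) (tedges T) D \<and> tree_P T (c T) = restr (tedges T) D \<and>
    tree_R T (c T) = restr (tedges T) (tverts T - D)"
  proof
    fix T assume "T \<in> F"
    then have "rooted_tree S T" "admissible_cut T (c T)"
      using F c by (auto simp: rooted_forest_def forest_cut_def)
    then show "\<exists>D. desc_closed (tverts T) (tedges T) D \<and> tree_P T (c T) = restr (tedges T) D \<and>
      tree_R T (c T) = restr (tedges T) (tverts T - D)" by (rule tree_cut_desc_closed)
  qed
  then obtain D where D: "\<And>T. T \<in> F \<Longrightarrow> desc_closed (tverts T) (tedges T) (D T)"
    "\<And>T. T \<in> F \<Longrightarrow> tree_P T (c T) = restr (tedges T) (D T)"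
    "\<And>T. T \<in> F \<Longrightarrow> tree_R T (c T) = restr (tedges T) (tverts T - D T)"
    by metis
  let ?D = "\<Union>T\<in>F. D T"
  have sub: "D T \<subseteq> tverts T" if "T \<in> F" for T using D(1)[OF that] by (simp add: desc_closed_def)
  have "u \<in> ?D" if uv: "(u, v) \<in> fedges F" "v \<in> ?D" for u v
  proof -
    obtain T where T: "T \<in> F" "v \<in> D T" using uv by auto
    then have "(u, v) \<in> tedges T" using forest_edges_local[OF F T(1) uv(1)] sub by blast
    then have "u \<in> D T" using D(1)[OF T(1)] T(2) unfolding desc_closed_def by blast
    then show ?thesis using T(1) by blast
  qed
  then have "desc_closed (fverts F) (fedges F) ?D"
    using sub unfolding desc_closed_def fverts_def by blast
  moreover have "forest_P F c = restr (fedges F) ?D"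
    using restr_UN[of S F D, OF F] sub D(2) by (simp add: forest_P_def)
  moreover have "fverts F - ?D = (\<Union>T\<in>F. tverts T - D T)"
  proof (intro subset_antisym subsetI)
    fix x assume "x \<in> (\<Union>T\<in>F. tverts T - D T)"
    then obtain T where T: "T \<in> F" "x \<in> tverts T" "x \<notin> D T" by blast
    have "x \<notin> D T'" if "T' \<in> F" for T'
      using that T sub[OF that] forest_tverts_disjoint[OF F T(1) that] by blast
    then show "x \<in> fverts F - ?D" using T by (auto simp: fverts_def)
  qed (auto simp: fverts_def)
  then have "forest_R F c = restr (fedges F) (fverts F - ?D)"
    using restr_UN[of _ _ "\<lambda>T. tverts T - D T", OF F] D(3) by (simp add: forest_R_def)
  ultimately show ?thesis by blast
qed

lemma desc_closed_forest_cut: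
  assumes F: "rooted_forest S F" and D: "desc_closed (fverts F) (fedges F) D"
  shows "\<exists>c. forest_cut F c \<and> forest_P F c = restr (fedges F) D \<and>
    forest_R F c = restr (fedges F) (fverts F - D)"
proof -
  have "\<forall>T\<in>F. \<exists>c. admissible_cut T c \<and> tree_P T c = restr (tedges T) (D \<inter> tverts T) \<and>
    tree_R T c = restr (tedges T) (tverts T - D \<inter> tverts T)"
  proof
    fix T assume T: "T \<in> F"
    then have rt: "rooted_tree S T" using F by (simp add: rooted_forest_def)
    then have "desc_closed (tverts T) (tedges T) (D \<inter> tverts T)"
      using D T unfolding desc_closed_def fedges_def rooted_tree_def by blast
    then show "\<exists>c. admissible_cut T c \<and> tree_P T c = restr (tedges T) (D \<inter> tverts T) \<and>
      tree_R T c = restr (tedges T) (tverts T - D \<inter> tverts T)" by (rule desc_closed_tree_cut[OF rt])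
  qed
  then obtain c where c: "\<And>T. T \<in> F \<Longrightarrow> admissible_cut T (c T)"
    "\<And>T. T \<in> F \<Longrightarrow> tree_P T (c T) = restr (tedges T) (D \<inter> tverts T)"
    "\<And>T. T \<in> F \<Longrightarrow> tree_R T (c T) = restr (tedges T) (tverts T - D \<inter> tverts T)"
    by metis
  have 1: "(\<Union>T\<in>F. D \<inter> tverts T) = D" using D by (auto simp: desc_closed_def fverts_def)
  have 2: "(\<Union>T\<in>F. tverts T - D \<inter> tverts T) = fverts F - D" by (auto simp: fverts_def)
  have "forest_P F c = restr (fedges F) D"
    using restr_UN[of _ _ "\<lambda>T. D \<inter> tverts T", OF F] c(2) unfolding 1 by (simp add: forest_P_def)
  moreover have "forest_R F c = restr (fedges F) (fverts F - D)"
    using restr_UN[of _ _ "\<lambda>T. tverts T - D \<inter> tverts T", OF F] c(3) unfolding 2 by (simp add: forest_R_def)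
  ultimately show ?thesis using c(1) by (auto simp: forest_cut_def)
qed

section \<open>Subobjects and quotients as restrictions to vertex sets\<close>

lemma forest_graph_restr:
  assumes "rooted_forest S F" "D \<subseteq> fverts F"
  shows "forest_graph D (fedges F \<inter> D \<times> D)"
  using forest_graph_restrict[OF forest_graph_rooted_forest[OF assms(1)] assms(2)] .

lemma restr_props:
  assumes "rooted_forest S F" "D \<subseteq> fverts F"
  shows fverts_restr: "fverts (restr (fedges F) D) = D"
    and fedges_restr: "fedges (restr (fedges F) D) = fedges F \<inter> D \<times> D"
    and rooted_forest_restr: "rooted_forest S (restr (fedges F) D)"
  using forest_graph_restr[OF assms] fverts_subset[OF assms(1)] assms(2)
  by (auto simp: fverts_trees fedges_trees intro!: rooted_forest_trees)

lemma restr_restr: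
  assumes "rooted_forest S F" "D \<subseteq> fverts F" "D' \<subseteq> D"
  shows "restr (fedges (restr (fedges F) D)) D' = restr (fedges F) D'"
proof -
  have "fedges F \<inter> D \<times> D \<inter> D' \<times> D' = fedges F \<inter> D' \<times> D'" using assms(3) by blast
  then show ?thesis using fedges_restr[OF assms(1,2)] by simp
qed

lemma restr_fverts: "rooted_forest S F \<Longrightarrow> restr (fedges F) (fverts F) = F"
  using forest_graph_rooted_forest[of S F] trees_rooted_forest[of S F]
  by (simp add: forest_graph_def Int_absorb2)

lemma restr_inj:
  "rooted_forest S F \<Longrightarrow> D \<subseteq> fverts F \<Longrightarrow> D' \<subseteq> fverts F \<Longrightarrow>
    restr (fedges F) D = restr (fedges F) D' \<longleftrightarrow> D = D'"
  using fverts_restr by metis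

lemma subobjs_LRF:
  assumes "rooted_forest S F"
  shows "subobjs (LRF S) F = restr (fedges F) ` {D. desc_closed (fverts F) (fedges F) D}"
  using forest_cut_desc_closed[OF assms] desc_closed_forest_cut[OF assms] unfolding LRF_def
  by (simp, fastforce)

text \<open>The P-part determines its vertex set D, so all cuts with this P-part have the same
  R-part and the definite description is satisfied by exactly one forest.\<close>

lemma quotient_LRF:
  assumes F: "rooted_forest S F" and D: "desc_closed (fverts F) (fedges F) D"
  shows "quotient_obj (LRF S) F (restr (fedges F) D) = restr (fedges F) (fverts F - D)"
proof -
  have "(THE Q. \<exists>c. forest_cut F c \<and> restr (fedges F) D = forest_P F c \<and> Q = forest_R F c) =
    restr (fedges F) (fverts F - D)"
  proof (rule the_equality)
    show "\<exists>c. forest_cut F c \<and> restr (fedges F) D = forest_P F c \<and>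
      restr (fedges F) (fverts F - D) = forest_R F c"
      using desc_closed_forest_cut[OF assms] by metis
    fix Q assume "\<exists>c. forest_cut F c \<and> restr (fedges F) D = forest_P F c \<and> Q = forest_R F c"
    then obtain c where c: "forest_cut F c" "restr (fedges F) D = forest_P F c" "Q = forest_R F c" by blast
    obtain D' where D': "desc_closed (fverts F) (fedges F) D'" "forest_P F c = restr (fedges F) D'"
      "forest_R F c = restr (fedges F) (fverts F - D')" using forest_cut_desc_closed[OF F c(1)] by blast
    then have "D = D'" using c(2) restr_inj[OF F] D D'(1) by (auto simp: desc_closed_def)
    then show "Q = restr (fedges F) (fverts F - D)" using c(3) D'(3) by simp
  qed
  then show ?thesis by (simp add: LRF_def)
qed

section \<open>Isomorphisms of forests\<close>

text \<open>This is an isomorphism of parent relations; that it respects trees and roots is the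
  content of \<open>forest_iso_iff\<close>.\<close>

definition forest_hom :: "('s \<Rightarrow> 's) \<Rightarrow> 's lforest \<Rightarrow> 's lforest \<Rightarrow> bool" where
  "forest_hom \<phi> F G \<longleftrightarrow> bij_betw \<phi> (fverts F) (fverts G) \<and>
     (\<forall>x\<in>fverts F. \<forall>y\<in>fverts F. (x, y) \<in> fedges F \<longleftrightarrow> (\<phi> x, \<phi> y) \<in> fedges G)"

definition map_tree :: "('s \<Rightarrow> 's) \<Rightarrow> 's ltree \<Rightarrow> 's ltree" where
  "map_tree \<phi> T = \<lparr>tverts = \<phi> ` tverts T, tedges = map_prod \<phi> \<phi> ` tedges T, troot = \<phi> (troot T)\<rparr>"

lemma trees_image:
  assumes inj: "inj_on \<phi> W" and E: "E \<subseteq> W \<times> W"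
  shows "trees (\<phi> ` W) (map_prod \<phi> \<phi> ` E) = map_tree \<phi> ` trees W E"
proof -
  let ?E = "map_prod \<phi> \<phi> ` E"
  have edge: "(\<phi> x, \<phi> y) \<in> ?E \<longleftrightarrow> (x, y) \<in> E" if "x \<in> W" "y \<in> W" for x y
  proof
    assume "(\<phi> x, \<phi> y) \<in> ?E"
    then obtain a b where "(a, b) \<in> E" "\<phi> x = \<phi> a" "\<phi> y = \<phi> b" by auto
    moreover have "a \<in> W" "b \<in> W" using E calculation(1) by auto
    ultimately show "(x, y) \<in> E" using inj_onD[OF inj] that by metis
  qed (metis map_prod_simp image_eqI)
  have E': "?E \<subseteq> \<phi> ` W \<times> \<phi> ` W" using E by auto
  have star1: "(\<phi> x, \<phi> y) \<in> ?E\<^sup>*" if "(x, y) \<in> E\<^sup>*" for x y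
    using that
  proof (induction rule: rtrancl_induct)
    case (step y z)
    then have "(\<phi> y, \<phi> z) \<in> ?E" by (metis map_prod_simp image_eqI)
    then show ?case using step.IH by (meson rtrancl.rtrancl_into_rtrancl)
  qed simp
  have star2: "\<exists>x\<in>W. a = \<phi> x \<and> (x, r) \<in> E\<^sup>*" if "(a, \<phi> r) \<in> ?E\<^sup>*" "r \<in> W" for a r
    using that(1)
  proof (induction rule: converse_rtrancl_induct)
    case (step b c)
    from step.IH obtain y where y: "y \<in> W" "c = \<phi> y" "(y, r) \<in> E\<^sup>*" by blast
    have "b \<in> \<phi> ` W" using subsetD[OF E' step.hyps(1)] by simp
    then obtain x where x: "x \<in> W" "b = \<phi> x" by (rule imageE)
    have "(x, y) \<in> E" using step.hyps(1) edge[OF x(1) y(1)] x y by simp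
    then have "(x, r) \<in> E\<^sup>*" using y(3) by (rule converse_rtrancl_into_rtrancl)
    then show ?case using x by auto
  qed (use that in auto)
  have star: "(\<phi> x, \<phi> r) \<in> ?E\<^sup>* \<longleftrightarrow> (x, r) \<in> E\<^sup>*" if "x \<in> W" "r \<in> W" for x r
    using star1[of x r] star2[OF _ that(2), of "\<phi> x"] inj_onD[OF inj _ that(1)] by blast
  have roots: "\<phi> ` W - Domain ?E = \<phi> ` (W - Domain E)"
  proof (intro subset_antisym subsetI)
    fix a assume "a \<in> \<phi> ` W - Domain ?E"
    then obtain x where "x \<in> W" "a = \<phi> x" "\<phi> x \<notin> Domain ?E" by blast
    moreover have "x \<notin> Domain E" using calculation(3) by force
    ultimately show "a \<in> \<phi> ` (W - Domain E)" by blast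
  next
    fix a assume "a \<in> \<phi> ` (W - Domain E)"
    then obtain x where x: "x \<in> W" "a = \<phi> x" "x \<notin> Domain E" by blast
    have "a \<notin> Domain ?E"
    proof
      assume "a \<in> Domain ?E"
      then obtain b where b: "(a, b) \<in> ?E" by (rule DomainE)
      then have "b \<in> \<phi> ` W" using subsetD[OF E' b] by simp
      then obtain y where y: "y \<in> W" "b = \<phi> y" by (rule imageE)
      then have "(x, y) \<in> E" using b edge[OF x(1) y(1)] x(2) by simp
      then show False using x(3) by (simp add: Domain.DomainI)
    qed
    then show "a \<in> \<phi> ` W - Domain ?E" using x by blast
  qed
  have "subtree (\<phi> ` W) ?E (\<phi> r) = map_tree \<phi> (subtree W E r)" if r: "r \<in> W" for r
  proof -
    let ?U = "{u\<in>W. (u, r) \<in> E\<^sup>*}"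
    have U: "{u\<in>\<phi> ` W. (u, \<phi> r) \<in> ?E\<^sup>*} = \<phi> ` ?U" using star r by auto
    have "?E \<inter> \<phi> ` ?U \<times> \<phi> ` ?U = map_prod \<phi> \<phi> ` (E \<inter> ?U \<times> ?U)"
    proof (intro subset_antisym subsetI)
      fix e assume e: "e \<in> ?E \<inter> \<phi> ` ?U \<times> \<phi> ` ?U"
      then obtain x y where xy: "x \<in> ?U" "y \<in> ?U" "e = (\<phi> x, \<phi> y)" by auto
      then have "(\<phi> x, \<phi> y) \<in> ?E" using e by (simp only: Int_iff)
      then have "(x, y) \<in> E" using edge[of x y] xy(1,2) by (simp only: mem_Collect_eq)
      then have "(x, y) \<in> E \<inter> ?U \<times> ?U" using xy(1,2) by (simp only: Int_iff mem_Sigma_iff)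
      then have "map_prod \<phi> \<phi> (x, y) \<in> map_prod \<phi> \<phi> ` (E \<inter> ?U \<times> ?U)" by (rule imageI)
      then show "e \<in> map_prod \<phi> \<phi> ` (E \<inter> ?U \<times> ?U)" by (simp only: xy(3) map_prod_simp)
    qed auto
    then show ?thesis unfolding subtree_def Let_def U map_tree_def by simp
  qed
  then show ?thesis unfolding trees_def roots image_image by (intro image_cong) auto
qed

text \<open>Trees and roots can be read off the parent relation, so the bijection of trees is
  recovered from the vertex map as \<open>map_tree \<phi>\<close>. Isomorphisms thereby become
  single maps, which are easy to compose, invert and restrict.\<close>

lemma forest_iso_iff:
  assumes F: "rooted_forest S F" and G: "rooted_forest S G"
  shows "forest_iso F G \<longleftrightarrow> (\<exists>\<phi>. forest_hom \<phi> F G)"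
proof
  assume "forest_iso F G"
  then obtain \<beta> \<phi> where \<beta>: "bij_betw \<beta> F G" and \<phi>: "bij_betw \<phi> (fverts F) (fverts G)"
    and T: "\<And>T. T \<in> F \<Longrightarrow> \<phi> ` tverts T = tverts (\<beta> T)"
      "\<And>T x y. T \<in> F \<Longrightarrow> x \<in> tverts T \<Longrightarrow> y \<in> tverts T \<Longrightarrow>
        (x, y) \<in> tedges T \<longleftrightarrow> (\<phi> x, \<phi> y) \<in> tedges (\<beta> T)"
    unfolding forest_iso_def by metis
  have sub: "tedges T \<subseteq> tverts T \<times> tverts T" if "rooted_forest S H" "T \<in> H" for T H
    using that by (simp add: rooted_forest_def rooted_tree_def)
  have "(x, y) \<in> fedges F \<longleftrightarrow> (\<phi> x, \<phi> y) \<in> fedges G" if xy: "x \<in> fverts F" "y \<in> fverts F" for x y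
  proof
    assume "(x, y) \<in> fedges F"
    then obtain U where U: "U \<in> F" "(x, y) \<in> tedges U" by (auto simp: fedges_def)
    then have "(\<phi> x, \<phi> y) \<in> tedges (\<beta> U)" using T(2) sub[OF F U(1)] by blast
    moreover have "\<beta> U \<in> G" using \<beta> U by (auto simp: bij_betw_def)
    ultimately show "(\<phi> x, \<phi> y) \<in> fedges G" by (auto simp: fedges_def)
  next
    assume "(\<phi> x, \<phi> y) \<in> fedges G"
    then obtain U where U: "U \<in> F" "(\<phi> x, \<phi> y) \<in> tedges (\<beta> U)"
      using \<beta> by (auto simp: fedges_def bij_betw_def)
    then have "\<beta> U \<in> G" using \<beta> by (auto simp: bij_betw_def)
    then have "\<phi> x \<in> \<phi> ` tverts U" "\<phi> y \<in> \<phi> ` tverts U" using sub[OF G] U T(1) by auto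
    moreover have "tverts U \<subseteq> fverts F" using U by (auto simp: fverts_def)
    ultimately have "x \<in> tverts U" "y \<in> tverts U"
      using inj_on_image_mem_iff[of \<phi> "fverts F" _ "tverts U"] \<phi> xy unfolding bij_betw_def by blast+
    then show "(x, y) \<in> fedges F" using U T(2) by (auto simp: fedges_def)
  qed
  then show "\<exists>\<phi>. forest_hom \<phi> F G" using \<phi> by (auto simp: forest_hom_def)
next
  assume "\<exists>\<phi>. forest_hom \<phi> F G"
  then obtain \<phi> where \<phi>: "bij_betw \<phi> (fverts F) (fverts G)"
    "\<And>x y. x\<in>fverts F \<Longrightarrow> y\<in>fverts F \<Longrightarrow> (x, y) \<in> fedges F \<longleftrightarrow> (\<phi> x, \<phi> y) \<in> fedges G"
    unfolding forest_hom_def by blast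
  have sub: "fedges F \<subseteq> fverts F \<times> fverts F" "fedges G \<subseteq> fverts G \<times> fverts G"
    using forest_graph_rooted_forest[OF F] forest_graph_rooted_forest[OF G]
    unfolding forest_graph_def by blast+
  have vG: "fverts G = \<phi> ` fverts F" using \<phi>(1) by (simp add: bij_betw_def)
  have inj: "inj_on \<phi> (fverts F)" using \<phi>(1) by (simp add: bij_betw_def)
  have "fedges G = map_prod \<phi> \<phi> ` fedges F"
  proof (intro subset_antisym subsetI)
    fix e assume e: "e \<in> fedges G"
    then obtain x y where xy: "x \<in> fverts F" "y \<in> fverts F" "e = (\<phi> x, \<phi> y)" using sub(2) vG by blast
    then have "(x, y) \<in> fedges F" using e \<phi>(2) by blast
    then show "e \<in> map_prod \<phi> \<phi> ` fedges F" using xy(3) by (metis map_prod_simp image_eqI)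
  next
    fix e assume "e \<in> map_prod \<phi> \<phi> ` fedges F"
    then obtain x y where "(x, y) \<in> fedges F" "e = (\<phi> x, \<phi> y)" by auto
    then show "e \<in> fedges G" using sub(1) \<phi>(2) by blast
  qed
  then have G_eq: "G = map_tree \<phi> ` F"
    using trees_image[OF inj sub(1)] trees_rooted_forest[OF F] trees_rooted_forest[OF G] vG by simp
  have "inj_on (map_tree \<phi>) F"
  proof (rule inj_onI)
    fix T T' assume T: "T \<in> F" "T' \<in> F" "map_tree \<phi> T = map_tree \<phi> T'"
    have r: "troot T \<in> tverts T" "troot T' \<in> tverts T'"
      using F T by (auto simp: rooted_forest_def rooted_tree_def)
    then have "troot T \<in> fverts F" "troot T' \<in> fverts F" using T by (auto simp: fverts_def)
    then have "troot T = troot T'" using T(3) inj by (auto simp: map_tree_def dest: inj_onD)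
    then show "T = T'" using r forest_tverts_disjoint[OF F T(1,2)] by auto
  qed
  then have "bij_betw (map_tree \<phi>) F G" using G_eq by (simp add: bij_betw_def)
  moreover have "(x, y) \<in> tedges T \<longleftrightarrow> (\<phi> x, \<phi> y) \<in> tedges (map_tree \<phi> T)"
    if T: "T \<in> F" "x \<in> tverts T" "y \<in> tverts T" for T x y
  proof
    assume "(\<phi> x, \<phi> y) \<in> tedges (map_tree \<phi> T)"
    then obtain a b where ab: "(a, b) \<in> tedges T" "\<phi> x = \<phi> a" "\<phi> y = \<phi> b" by (auto simp: map_tree_def)
    then have "a \<in> tverts T" "b \<in> tverts T" using T F by (auto simp: rooted_forest_def rooted_tree_def)
    moreover have "inj_on \<phi> (tverts T)" using inj T(1) by (auto simp: fverts_def intro: inj_on_subset)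
    ultimately show "(x, y) \<in> tedges T" using ab T by (metis inj_onD)
  next
    assume "(x, y) \<in> tedges T"
    then have "map_prod \<phi> \<phi> (x, y) \<in> map_prod \<phi> \<phi> ` tedges T" by (rule imageI)
    then show "(\<phi> x, \<phi> y) \<in> tedges (map_tree \<phi> T)" by (simp add: map_tree_def)
  qed
  ultimately show "forest_iso F G"
    unfolding forest_iso_def
    by (intro exI[of _ "map_tree \<phi>"] exI[of _ \<phi>]) (use \<phi>(1) in \<open>simp add: map_tree_def\<close>)
qed

lemma forest_graph_image:
  assumes inj: "inj_on \<phi> W" and g: "forest_graph W E"
  shows "forest_graph (\<phi> ` W) (map_prod \<phi> \<phi> ` E)"
proof -
  let ?E = "map_prod \<phi> \<phi> ` E"
  have E: "E \<subseteq> W \<times> W" "single_valued E" "finite W" using g by (auto simp: forest_graph_def)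
  have "single_valued ?E"
  proof (rule single_valuedI)
    fix a b c assume "(a, b) \<in> ?E" "(a, c) \<in> ?E"
    then obtain x y x' z where e: "(x, y) \<in> E" "a = \<phi> x" "b = \<phi> y" "(x', z) \<in> E" "a = \<phi> x'" "c = \<phi> z"
      by auto
    then have "x = x'" using inj_onD[OF inj, of x x'] E(1) by auto
    then show "b = c" using e E(2) by (auto dest: single_valuedD)
  qed
  moreover have "\<exists>r. (\<phi> v, r) \<in> ?E\<^sup>* \<and> r \<notin> Domain ?E" if v: "v \<in> W" for v
  proof -
    obtain r where r: "(v, r) \<in> E\<^sup>*" "r \<notin> Domain E" using g v unfolding forest_graph_def by blast
    have rW: "r \<in> W" using rtrancl_stays[OF r(1) E(1) v] .
    have "(\<phi> v, \<phi> r) \<in> ?E\<^sup>*" using r(1)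
    proof (induction rule: rtrancl_induct)
      case (step y z)
      have "map_prod \<phi> \<phi> (y, z) \<in> ?E" using step.hyps(2) by (rule imageI)
      then show ?case using step.IH by (simp add: rtrancl.rtrancl_into_rtrancl)
    qed simp
    moreover have "\<phi> r \<notin> Domain ?E"
    proof
      assume "\<phi> r \<in> Domain ?E"
      then obtain x y where xy: "(x, y) \<in> E" "\<phi> r = \<phi> x" by auto
      then have "r = x" using inj_onD[OF inj, of r x] E(1) rW by auto
      then show False using xy(1) r(2) by auto
    qed
    ultimately show ?thesis by blast
  qed
  ultimately show ?thesis using E unfolding forest_graph_def by auto
qed

lemma forest_hom_id: "forest_hom id F F"
  by (simp add: forest_hom_def)

lemma forest_hom_inv:
  assumes "forest_hom \<phi> F G"
  shows "forest_hom (inv_into (fverts F) \<phi>) G F"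
proof -
  have b: "bij_betw \<phi> (fverts F) (fverts G)" using assms by (simp add: forest_hom_def)
  have "inv_into (fverts F) \<phi> x \<in> fverts F \<and> \<phi> (inv_into (fverts F) \<phi> x) = x" if "x \<in> fverts G" for x
    using b that by (simp add: bij_betw_def f_inv_into_f inv_into_into)
  note inv = this
  show ?thesis unfolding forest_hom_def
  proof (intro conjI ballI)
    fix x y assume xy: "x \<in> fverts G" "y \<in> fverts G"
    let ?i = "inv_into (fverts F) \<phi>"
    have "(?i x, ?i y) \<in> fedges F \<longleftrightarrow> (\<phi> (?i x), \<phi> (?i y)) \<in> fedges G"
      using assms inv xy unfolding forest_hom_def by blast
    then show "(x, y) \<in> fedges G \<longleftrightarrow> (?i x, ?i y) \<in> fedges F" using inv xy by simp
  qed (rule bij_betw_inv_into[OF b])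
qed

lemma forest_hom_comp:
  assumes "forest_hom \<phi> F G" "forest_hom \<psi> G H"
  shows "forest_hom (\<psi> \<circ> \<phi>) F H"
proof -
  have "\<phi> x \<in> fverts G" if "x \<in> fverts F" for x using assms(1) that by (auto simp: forest_hom_def bij_betw_def)
  then show ?thesis using assms bij_betw_trans[of \<phi> _ _ \<psi>] unfolding forest_hom_def o_def by blast
qed

lemma forest_hom_desc_closed:
  assumes h: "forest_hom \<phi> F G" and G: "rooted_forest S G"
    and D: "desc_closed (fverts F) (fedges F) D"
  shows "desc_closed (fverts G) (fedges G) (\<phi> ` D)"
  unfolding desc_closed_def
proof (intro conjI ballI, clarify)
  have b: "\<phi> ` fverts F = fverts G" using h by (simp add: forest_hom_def bij_betw_def)
  have DF: "D \<subseteq> fverts F" using D by (simp add: desc_closed_def)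
  show "\<phi> x \<in> fverts G" if "x \<in> D" for x using that DF b by blast
  fix e assume e: "e \<in> fedges G"
  show "case e of (u, v) \<Rightarrow> v \<in> \<phi> ` D \<longrightarrow> u \<in> \<phi> ` D"
  proof (clarsimp split: prod.split)
    fix u x assume ex: "e = (u, \<phi> x)" "x \<in> D"
    have "fedges G \<subseteq> fverts G \<times> fverts G"
      using forest_graph_rooted_forest[OF G] by (simp add: forest_graph_def)
    then have "u \<in> \<phi> ` fverts F" using e ex b by auto
    then obtain y where y: "y \<in> fverts F" "u = \<phi> y" by blast
    then have "(y, x) \<in> fedges F" using h e ex DF unfolding forest_hom_def by blast
    then show "u \<in> \<phi> ` D" using D ex(2) y(2) unfolding desc_closed_def by blast
  qed
qed

lemma forest_hom_restr:
  assumes h: "forest_hom \<phi> F G" and F: "rooted_forest S F" and G: "rooted_forest S G"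
    and D: "D \<subseteq> fverts F"
  shows "forest_hom \<phi> (restr (fedges F) D) (restr (fedges G) (\<phi> ` D))"
proof -
  have b: "inj_on \<phi> (fverts F)" "\<phi> ` fverts F = fverts G" using h by (auto simp: forest_hom_def bij_betw_def)
  have D': "\<phi> ` D \<subseteq> fverts G" using D b(2) by blast
  have "bij_betw \<phi> D (\<phi> ` D)" using inj_on_subset[OF b(1) D] by (simp add: bij_betw_def)
  then show ?thesis
    using h D unfolding forest_hom_def fverts_restr[OF F D] fedges_restr[OF F D]
      fverts_restr[OF G D'] fedges_restr[OF G D'] by blast
qed

section \<open>The Hall axioms for rooted forests\<close>

lemma desc_closed_empty: "desc_closed W E {}"
  by (simp add: desc_closed_def)

lemma desc_closed_fverts:
  assumes "rooted_forest S F"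
  shows "desc_closed (fverts F) (fedges F) (fverts F)"
  using forest_graph_rooted_forest[OF assms] unfolding desc_closed_def forest_graph_def by auto

lemma objs_LRF: "F \<in> objs (LRF S) \<longleftrightarrow> rooted_forest S F"
  by (simp add: LRF_def)

lemma isom_LRF: "isom (LRF S) = forest_iso"
  by (simp add: LRF_def)

lemma zero_LRF: "zero_obj (LRF S) = {}"
  by (simp add: LRF_def)

lemma subobjs_restr:
  assumes F: "rooted_forest S F" and D: "D \<subseteq> fverts F"
  shows "subobjs (LRF S) (restr (fedges F) D) =
    restr (fedges F) ` {D'. desc_closed D (fedges F \<inter> D \<times> D) D'}"
proof -
  have "restr (fedges (restr (fedges F) D)) D' = restr (fedges F) D'"
    if "desc_closed D (fedges F \<inter> D \<times> D) D'" for D'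
    using restr_restr[OF F D] that by (simp add: desc_closed_def)
  then show ?thesis
    unfolding subobjs_LRF[OF rooted_forest_restr[OF assms]] fverts_restr[OF assms]
    using fedges_restr[OF assms] by (intro image_cong) auto
qed

lemma quotient_restr:
  assumes F: "rooted_forest S F" and D: "D \<subseteq> fverts F"
    and D': "desc_closed D (fedges F \<inter> D \<times> D) D'"
  shows "quotient_obj (LRF S) (restr (fedges F) D) (restr (fedges F) D') = restr (fedges F) (D - D')"
proof -
  have "D' \<subseteq> D" using D' by (simp add: desc_closed_def)
  then have "restr (fedges (restr (fedges F) D)) D' = restr (fedges F) D'"
    "restr (fedges (restr (fedges F) D)) (D - D') = restr (fedges F) (D - D')"
    using restr_restr[OF F D] by simp_all
  moreover have "desc_closed (fverts (restr (fedges F) D)) (fedges (restr (fedges F) D)) D'"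
    using D' fverts_restr[OF F D] fedges_restr[OF F D] by simp
  ultimately show ?thesis
    using quotient_LRF[OF rooted_forest_restr[OF F D], of D'] fverts_restr[OF F D] by simp
qed

text \<open>Subobjects correspond to descendant-closed sets, and a vertex isomorphism transports
  such a set together with its complement.\<close>

lemma isom_subobjs_LRF:
  assumes F: "rooted_forest S F" and G: "rooted_forest S G" and iso: "forest_iso F G"
  shows "\<exists>h. bij_betw h (subobjs (LRF S) F) (subobjs (LRF S) G) \<and>
    (\<forall>N\<in>subobjs (LRF S) F. forest_iso N (h N) \<and>
      forest_iso (quotient_obj (LRF S) F N) (quotient_obj (LRF S) G (h N)))"
proof -
  obtain \<phi> where h: "forest_hom \<phi> F G" using iso forest_iso_iff[OF F G] by blast
  have b: "inj_on \<phi> (fverts F)" "\<phi> ` fverts F = fverts G" using h by (auto simp: forest_hom_def bij_betw_def)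
  let ?\<D> = "\<lambda>F. {D. desc_closed (fverts F) (fedges F) D}"
  have sub: "D \<subseteq> fverts F'" if "D \<in> ?\<D> F'" for D F' using that by (simp add: desc_closed_def)
  have bD: "bij_betw ((`) \<phi>) (?\<D> F) (?\<D> G)"
  proof (rule bij_betwI')
    show "(\<phi> ` D = \<phi> ` D') = (D = D')" if "D \<in> ?\<D> F" "D' \<in> ?\<D> F" for D D'
      by (rule inj_on_image_eq_iff[OF b(1) sub[OF that(1)] sub[OF that(2)]])
    show "\<phi> ` D \<in> ?\<D> G" if "D \<in> ?\<D> F" for D
      using forest_hom_desc_closed[OF h G] that by simp
    fix D' assume D': "D' \<in> ?\<D> G"
    let ?\<psi> = "inv_into (fverts F) \<phi>"
    have "?\<psi> ` D' \<in> ?\<D> F" using forest_hom_desc_closed[OF forest_hom_inv[OF h] F] D' by simp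
    moreover have "\<phi> ` ?\<psi> ` D' = D'" using image_inv_into_cancel[OF b(2) sub[OF D']] .
    ultimately show "\<exists>D\<in>?\<D> F. D' = \<phi> ` D" by (intro bexI[of _ "?\<psi> ` D'"]) simp_all
  qed
  \<comment> \<open>The vertex set of N recovers the closed set it comes from, so the map on
    subobjects involves no choice of a cut.\<close>
  let ?h = "\<lambda>N. restr (fedges G) (\<phi> ` fverts N)"
  have r: "fverts (restr (fedges F) D) = D" if "D \<in> ?\<D> F" for D using fverts_restr[OF F sub[OF that]] .
  have "bij_betw (restr (fedges F)) (?\<D> F) (subobjs (LRF S) F)"
    unfolding subobjs_LRF[OF F] by (intro bij_betw_imageI inj_onI) (use r in metis, simp)
  moreover have "bij_betw (restr (fedges G)) (?\<D> G) (subobjs (LRF S) G)"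
    unfolding subobjs_LRF[OF G] by (intro bij_betw_imageI inj_onI) (use fverts_restr[OF G sub] in metis, simp)
  then have "bij_betw (restr (fedges G) \<circ> (`) \<phi>) (?\<D> F) (subobjs (LRF S) G)"
    using bij_betw_trans[OF bD] by blast
  then have "bij_betw (?h \<circ> restr (fedges F)) (?\<D> F) (subobjs (LRF S) G)"
    by (rule bij_betw_cong[THEN iffD1, rotated]) (simp add: r)
  ultimately have "bij_betw ?h (subobjs (LRF S) F) (subobjs (LRF S) G)"
    using bij_betw_comp_iff by blast
  moreover have "forest_iso N (?h N) \<and> forest_iso (quotient_obj (LRF S) F N) (quotient_obj (LRF S) G (?h N))"
    if N: "N \<in> subobjs (LRF S) F" for N
  proof -
    obtain D where D: "D \<in> ?\<D> F" "N = restr (fedges F) D" using N subobjs_LRF[OF F] by blast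
    have D': "\<phi> ` D \<in> ?\<D> G" using bij_betwE[OF bD] D(1) by blast
    have hN: "?h N = restr (fedges G) (\<phi> ` D)" using D r by simp
    have c: "\<phi> ` (fverts F - D) = fverts G - \<phi> ` D"
      using inj_on_image_set_diff[OF b(1), of "fverts F" D] b(2) sub[OF D(1)] by simp
    have DF: "D \<subseteq> fverts F" "fverts F - D \<subseteq> fverts F" "\<phi> ` D \<subseteq> fverts G" "fverts G - \<phi> ` D \<subseteq> fverts G"
      using sub[OF D(1)] sub[OF D'] by auto
    have "quotient_obj (LRF S) F N = restr (fedges F) (fverts F - D)"
      using quotient_LRF[OF F] D by simp
    moreover have "quotient_obj (LRF S) G (?h N) = restr (fedges G) (fverts G - \<phi> ` D)"
      unfolding hN using quotient_LRF[OF G] D' by simp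
    ultimately show ?thesis unfolding hN D(2)
      using forest_hom_restr[OF h F G DF(1)] forest_hom_restr[OF h F G DF(2)] c
        forest_iso_iff[OF rooted_forest_restr[OF F DF(1)] rooted_forest_restr[OF G DF(3)]]
        forest_iso_iff[OF rooted_forest_restr[OF F DF(2)] rooted_forest_restr[OF G DF(4)]] D(2) r[OF D(1)]
      by auto
  qed
  ultimately show ?thesis by blast
qed

lemma card_fverts_iso:
  "rooted_forest S F \<Longrightarrow> rooted_forest S G \<Longrightarrow> forest_iso F G \<Longrightarrow> card (fverts F) = card (fverts G)"
  using forest_iso_iff bij_betw_same_card unfolding forest_hom_def by blast

text \<open>Every forest with n vertices can be moved onto one fixed n-element subset V of the label
  set, and there are only finitely many relations on V.\<close>

lemma finite_forest_classes:
  assumes S: "infinite S"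
  shows "finite {iso_class (LRF S) F | F. rooted_forest S F \<and> card (fverts F) = n}"
proof -
  obtain V where V: "V \<subseteq> S" "finite V" "card V = n" using infinite_arbitrarily_large[OF S] by blast
  have "{iso_class (LRF S) F | F. rooted_forest S F \<and> card (fverts F) = n} \<subseteq>
    iso_class (LRF S) ` trees V ` Pow (V \<times> V)"
  proof clarify
    fix F assume F: "rooted_forest S F" "n = card (fverts F)"
    have g: "forest_graph (fverts F) (fedges F)" using forest_graph_rooted_forest[OF F(1)] .
    then have fin: "finite (fverts F)" and sub: "fedges F \<subseteq> fverts F \<times> fverts F" by (auto simp: forest_graph_def)
    obtain \<phi> where \<phi>: "bij_betw \<phi> (fverts F) V"
      using fin V F(2) finite_same_card_bij by metis
    then have inj: "inj_on \<phi> (fverts F)" and img: "\<phi> ` fverts F = V" by (auto simp: bij_betw_def)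
    let ?E = "map_prod \<phi> \<phi> ` fedges F"
    have g': "forest_graph V ?E" using forest_graph_image[OF inj g] img by simp
    have F': "rooted_forest S (trees V ?E)" using rooted_forest_trees[OF g' V(1)] .
    have "(x, y) \<in> fedges F \<longleftrightarrow> (\<phi> x, \<phi> y) \<in> ?E" if "x \<in> fverts F" "y \<in> fverts F" for x y
    proof
      assume "(\<phi> x, \<phi> y) \<in> ?E"
      then obtain a b where ab: "(a, b) \<in> fedges F" "\<phi> x = \<phi> a" "\<phi> y = \<phi> b" by auto
      then show "(x, y) \<in> fedges F" using inj_onD[OF inj, of x a] inj_onD[OF inj, of y b] sub that by auto
    next
      assume "(x, y) \<in> fedges F"
      then have "map_prod \<phi> \<phi> (x, y) \<in> ?E" by (rule imageI)
      then show "(\<phi> x, \<phi> y) \<in> ?E" by simp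
    qed
    then have "forest_hom \<phi> F (trees V ?E)"
      unfolding forest_hom_def fverts_trees[OF g'] fedges_trees[OF g'] using \<phi> by simp
    then have iso: "forest_iso F (trees V ?E)" using forest_iso_iff[OF F(1) F'] by blast
    have tr: "forest_iso X Z" if "forest_iso X Y" "forest_iso Y Z" "rooted_forest S X" "rooted_forest S Y"
      "rooted_forest S Z" for X Y Z :: "'a lforest"
      using that forest_iso_iff forest_hom_comp by metis
    have sy: "forest_iso Y X" if "forest_iso X Y" "rooted_forest S X" "rooted_forest S Y" for X Y :: "'a lforest"
      using that forest_iso_iff forest_hom_inv by metis
    have "iso_class (LRF S) F = iso_class (LRF S) (trees V ?E)"
      unfolding iso_class_def objs_LRF isom_LRF using tr sy iso F(1) F' by blast
    moreover have "?E \<in> Pow (V \<times> V)" using g' by (simp add: forest_graph_def)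
    ultimately show "iso_class (LRF S) F \<in> iso_class (LRF S) ` trees V ` Pow (V \<times> V)" by blast
  qed
  then show ?thesis by (rule finite_subset) (simp add: V(2))
qed

lemma hall_category_LRF:
  assumes S: "infinite S"
  shows "hall_category (LRF S)"
proof (unfold_locales, unfold objs_LRF isom_LRF zero_LRF)
  fix X Y Z :: "'a lforest"
  assume X: "rooted_forest S X"
  have empty: "{} = restr (fedges X) {}" by simp
  show "forest_iso X X" using forest_iso_iff[OF X X] forest_hom_id by blast
  show "forest_iso Y X" if "rooted_forest S Y" "forest_iso X Y"
    using that X forest_iso_iff forest_hom_inv by metis
  show "forest_iso X Z" if "rooted_forest S Y" "rooted_forest S Z" "forest_iso X Y" "forest_iso Y Z"
    using that X forest_iso_iff forest_hom_comp by metis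
  show "finite (subobjs (LRF S) X)"
  proof -
    have "finite (fverts X)" using forest_graph_rooted_forest[OF X] by (simp add: forest_graph_def)
    then have "finite {D. desc_closed (fverts X) (fedges X) D}"
      by (rule finite_subset[rotated, OF finite_Pow_iff[THEN iffD2]]) (auto simp: desc_closed_def)
    then show ?thesis unfolding subobjs_LRF[OF X] by simp
  qed
  show "{} \<in> subobjs (LRF S) X"
    unfolding subobjs_LRF[OF X] using empty desc_closed_empty by blast
  show "quotient_obj (LRF S) X {} = X"
    using quotient_LRF[OF X desc_closed_empty] restr_fverts[OF X] by simp
  show "X \<in> subobjs (LRF S) X"
    unfolding subobjs_LRF[OF X]
    by (rule image_eqI[where x = "fverts X"]) (simp_all add: desc_closed_fverts[OF X] restr_fverts[OF X])
  show "quotient_obj (LRF S) X X = {}"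
    using quotient_LRF[OF X desc_closed_fverts[OF X]] restr_fverts[OF X] by simp
  show "X = {}" if "forest_iso {} X" using that by (auto simp: forest_iso_def bij_betw_def)
  show "\<exists>h. bij_betw h (subobjs (LRF S) X) (subobjs (LRF S) Y) \<and>
        (\<forall>N\<in>subobjs (LRF S) X. forest_iso N (h N) \<and>
          forest_iso (quotient_obj (LRF S) X N) (quotient_obj (LRF S) Y (h N)))"
    if "rooted_forest S Y" "forest_iso X Y"
    by (rule isom_subobjs_LRF[OF X that])
  have sub: "\<exists>D. N = restr (fedges X) D \<and> D \<subseteq> fverts X \<and> desc_closed (fverts X) (fedges X) D"
    if "N \<in> subobjs (LRF S) X" for N
    using that unfolding subobjs_LRF[OF X] by (auto simp: desc_closed_def)
  fix N assume N: "N \<in> subobjs (LRF S) X"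
  obtain D where D: "N = restr (fedges X) D" "D \<subseteq> fverts X" "desc_closed (fverts X) (fedges X) D"
    using sub[OF N] by blast
  have QN: "quotient_obj (LRF S) X N = restr (fedges X) (fverts X - D)" using quotient_LRF[OF X D(3)] D(1) by simp
  show "rooted_forest S N" using rooted_forest_restr[OF X D(2)] D(1) by simp
  show "rooted_forest S (quotient_obj (LRF S) X N)" unfolding QN by (rule rooted_forest_restr[OF X]) blast
  \<comment> \<open>D is itself closed, so a subset of D closed under descendants within D is closed
    in X, and conversely.\<close>
  have subN: "A \<in> subobjs (LRF S) N \<longleftrightarrow> (\<exists>D'. A = restr (fedges X) D' \<and> D' \<subseteq> D \<and>
    desc_closed (fverts X) (fedges X) D')" for A
  proof -
    have "desc_closed D (fedges X \<inter> D \<times> D) D' \<longleftrightarrow> D' \<subseteq> D \<and> desc_closed (fverts X) (fedges X) D'" for D'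
      using D(2,3) unfolding desc_closed_def by fast
    then show ?thesis unfolding D(1) subobjs_restr[OF X D(2)] by auto
  qed
  show "A \<in> subobjs (LRF S) X" if "A \<in> subobjs (LRF S) N" for A
    using that unfolding subN subobjs_LRF[OF X] by blast
  have closed_diff: "desc_closed (fverts X - D) (fedges X \<inter> (fverts X - D) \<times> (fverts X - D)) (D' - D)"
    if "desc_closed (fverts X) (fedges X) D'" for D'
    using that unfolding desc_closed_def by fast
  have quotN: "quotient_obj (LRF S) (restr (fedges X) D') N = restr (fedges X) (D' - D)"
    if D': "D' \<subseteq> fverts X" "D \<subseteq> D'" for D'
  proof -
    have "desc_closed D' (fedges X \<inter> D' \<times> D') D" using D(3) D' unfolding desc_closed_def by fast
    then show ?thesis unfolding D(1) by (rule quotient_restr[OF X D'(1)])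
  qed
  have above: "{N' \<in> subobjs (LRF S) X. N \<in> subobjs (LRF S) N'} =
    restr (fedges X) ` {D'. desc_closed (fverts X) (fedges X) D' \<and> D \<subseteq> D'}" (is "?l = ?r")
  proof -
    have "N \<in> subobjs (LRF S) (restr (fedges X) D') \<longleftrightarrow> D \<subseteq> D'"
      if D': "desc_closed (fverts X) (fedges X) D'" for D'
    proof -
      have D'X: "D' \<subseteq> fverts X" using D' by (simp add: desc_closed_def)
      have "N \<in> subobjs (LRF S) (restr (fedges X) D') \<longleftrightarrow>
        (\<exists>D''. restr (fedges X) D = restr (fedges X) D'' \<and> desc_closed D' (fedges X \<inter> D' \<times> D') D'')"
        unfolding D(1) subobjs_restr[OF X D'X] by blast
      also have "\<dots> \<longleftrightarrow> desc_closed D' (fedges X \<inter> D' \<times> D') D"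
      proof
        assume "\<exists>D''. restr (fedges X) D = restr (fedges X) D'' \<and> desc_closed D' (fedges X \<inter> D' \<times> D') D''"
        then obtain D'' where D'': "restr (fedges X) D = restr (fedges X) D''"
          "desc_closed D' (fedges X \<inter> D' \<times> D') D''" by blast
        then have "D'' \<subseteq> fverts X" using D'X by (auto simp: desc_closed_def)
        then have "D = D''" using restr_inj[OF X D(2), of D''] D''(1) by blast
        then show "desc_closed D' (fedges X \<inter> D' \<times> D') D" using D''(2) by simp
      qed (rule exI, rule conjI[OF refl])
      also have "\<dots> \<longleftrightarrow> D \<subseteq> D'" using D(3) D' unfolding desc_closed_def by fast
      finally show ?thesis .
    qed
    then have "{D'. desc_closed (fverts X) (fedges X) D' \<and> N \<in> subobjs (LRF S) (restr (fedges X) D')} =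
      {D'. desc_closed (fverts X) (fedges X) D' \<and> D \<subseteq> D'}" by (intro Collect_cong) metis
    then show ?thesis unfolding subobjs_LRF[OF X] by fast
  qed
  show "bij_betw (\<lambda>N'. quotient_obj (LRF S) N' N) {N' \<in> subobjs (LRF S) X. N \<in> subobjs (LRF S) N'}
        (subobjs (LRF S) (quotient_obj (LRF S) X N))"
  proof (rule bij_betwI')
    fix A assume "A \<in> {N' \<in> subobjs (LRF S) X. N \<in> subobjs (LRF S) N'}"
    then obtain D1 where D1: "A = restr (fedges X) D1" "desc_closed (fverts X) (fedges X) D1" "D \<subseteq> D1"
      unfolding above by blast
    then have D1X: "D1 \<subseteq> fverts X" by (simp add: desc_closed_def)
    show "quotient_obj (LRF S) A N \<in> subobjs (LRF S) (quotient_obj (LRF S) X N)"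
      unfolding D1(1) quotN[OF D1X D1(3)] QN subobjs_restr[OF X Diff_subset]
      using closed_diff[OF D1(2)] by blast
    fix B assume "B \<in> {N' \<in> subobjs (LRF S) X. N \<in> subobjs (LRF S) N'}"
    then obtain D2 where D2: "B = restr (fedges X) D2" "desc_closed (fverts X) (fedges X) D2" "D \<subseteq> D2"
      unfolding above by blast
    then have D2X: "D2 \<subseteq> fverts X" by (simp add: desc_closed_def)
    have "D1 - D \<subseteq> fverts X" "D2 - D \<subseteq> fverts X" using D1X D2X by auto
    then have "quotient_obj (LRF S) A N = quotient_obj (LRF S) B N \<longleftrightarrow> D1 - D = D2 - D"
      unfolding D1(1) D2(1) quotN[OF D1X D1(3)] quotN[OF D2X D2(3)] by (rule restr_inj[OF X])
    also have "\<dots> \<longleftrightarrow> D1 = D2" using D1(3) D2(3) by auto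
    also have "\<dots> \<longleftrightarrow> A = B" unfolding D1(1) D2(1) using restr_inj[OF X D1X D2X] by simp
    finally show "quotient_obj (LRF S) A N = quotient_obj (LRF S) B N \<longleftrightarrow> A = B" .
  next
    fix B assume "B \<in> subobjs (LRF S) (quotient_obj (LRF S) X N)"
    then obtain D' where D': "B = restr (fedges X) D'"
      "desc_closed (fverts X - D) (fedges X \<inter> (fverts X - D) \<times> (fverts X - D)) D'"
      unfolding QN subobjs_restr[OF X Diff_subset] by blast
    have E: "fedges X \<subseteq> fverts X \<times> fverts X"
      using forest_graph_rooted_forest[OF X] by (simp add: forest_graph_def)
    \<comment> \<open>A child of a vertex of D' lies in D or, by closure of D' within the complement
      of D, in D'.\<close>
    have "desc_closed (fverts X) (fedges X) (D' \<union> D)"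
      using D'(2) D(3) E unfolding desc_closed_def by fast
    moreover have "D' \<union> D \<subseteq> fverts X" using calculation by (simp add: desc_closed_def)
    moreover have "D' \<union> D - D = D'" using D'(2) unfolding desc_closed_def by blast
    ultimately show "\<exists>A\<in>{N' \<in> subobjs (LRF S) X. N \<in> subobjs (LRF S) N'}. B = quotient_obj (LRF S) A N"
      unfolding above D'(1) by (intro bexI[of _ "restr (fedges X) (D' \<union> D)"]) (simp_all add: quotN)
  qed
  fix M assume M: "M \<in> subobjs (LRF S) X" "N \<in> subobjs (LRF S) M"
  then have "M \<in> {N' \<in> subobjs (LRF S) X. N \<in> subobjs (LRF S) N'}" by simp
  then obtain D' where D': "M = restr (fedges X) D'" "desc_closed (fverts X) (fedges X) D'" "D \<subseteq> D'"
    unfolding above by blast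
  have D'X: "D' \<subseteq> fverts X" using D'(2) by (simp add: desc_closed_def)
  have "fverts X - D - (D' - D) = fverts X - D'" using D'(3) by blast
  then show "quotient_obj (LRF S) (quotient_obj (LRF S) X N) (quotient_obj (LRF S) M N) =
      quotient_obj (LRF S) X M"
    unfolding QN D'(1) quotN[OF D'X D'(3)] quotient_restr[OF X Diff_subset closed_diff[OF D'(2)]]
      quotient_LRF[OF X D'(2)] by simp
next
  fix A B :: "'a lforest"
  assume A: "rooted_forest S A" and B: "rooted_forest S B"
  \<comment> \<open>The P-part and the R-part partition the vertices, so the two ends of an
    extension determine its size.\<close>
  have "card (fverts E) = card (fverts A) + card (fverts B)"
    if E: "rooted_forest S E" "N \<in> subobjs (LRF S) E" "forest_iso A N" "forest_iso B (quotient_obj (LRF S) E N)" for E N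
  proof -
    obtain D where D: "N = restr (fedges E) D" "desc_closed (fverts E) (fedges E) D"
      using E(2) unfolding subobjs_LRF[OF E(1)] by blast
    have DE: "D \<subseteq> fverts E" using D(2) by (simp add: desc_closed_def)
    have "card (fverts A) = card D"
      using card_fverts_iso[OF A rooted_forest_restr[OF E(1) DE]] E(3) D(1) fverts_restr[OF E(1) DE] by simp
    moreover have "card (fverts B) = card (fverts E - D)"
      using card_fverts_iso[OF B rooted_forest_restr[OF E(1) Diff_subset]] E(4) D quotient_LRF[OF E(1) D(2)]
        fverts_restr[OF E(1) Diff_subset] by simp
    moreover have "finite (fverts E)" using forest_graph_rooted_forest[OF E(1)] by (simp add: forest_graph_def)
    ultimately show ?thesis using DE by (simp add: card_Diff_subset card_mono finite_subset)
  qed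
  then show "finite {iso_class (LRF S) E | E. rooted_forest S E \<and>
        (\<exists>N\<in>subobjs (LRF S) E. forest_iso A N \<and> forest_iso B (quotient_obj (LRF S) E N))}"
    by (intro finite_subset[OF _ finite_forest_classes[OF S, of "card (fverts A) + card (fverts B)"]]) blast
next
  show e: "rooted_forest S {}" by (simp add: rooted_forest_def)
  have z: "zero_class (LRF S) = {{}}"
    unfolding zero_class_def iso_class_def objs_LRF isom_LRF zero_LRF
    using e by (auto simp: forest_iso_def bij_betw_def fverts_def)
  show "oplus (LRF S) (zero_class (LRF S)) (zero_class (LRF S)) = zero_class (LRF S)"
    unfolding z oplus_def objs_LRF isom_LRF
    using e by (auto simp: LRF_def forest_iso_def bij_betw_def fverts_def)
qed

section \<open>Feynman graphs and their components\<close>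

abbreviation conn :: "'s lgraph \<Rightarrow> ('s \<times> 's) set" where
  "conn G \<equiv> (linked G)\<^sup>*"

abbreviation del_edges :: "'s lgraph \<Rightarrow> 's set set \<Rightarrow> 's lgraph" where
  "del_edges G D \<equiv> G\<lparr>gedges := gedges G - D\<rparr>"

text \<open>The incidence conditions of \<open>feynman\<close>, without those on components. Lifts
  of subgraphs are first known to be pregraphs; their Feynman property follows only afterwards from
  that of their contraction.\<close>

definition pregraph :: "'s lgraph \<Rightarrow> bool" where
  "pregraph G \<longleftrightarrow> finite (halfs G) \<and> partition_on (halfs G) (gverts G) \<and> (\<forall>v\<in>gverts G. card v = 3) \<and>
     disjoint (gedges G) \<and> (\<forall>e\<in>gedges G. e \<subseteq> halfs G \<and> card e = 2)"

definition gsub :: "'s lgraph \<Rightarrow> 's lgraph \<Rightarrow> bool" where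
  "gsub \<gamma> G \<longleftrightarrow> halfs \<gamma> \<subseteq> halfs G \<and> gverts \<gamma> \<subseteq> gverts G \<and> gedges \<gamma> \<subseteq> gedges G"

definition good_component :: "'s lgraph \<Rightarrow> bool" where
  "good_component K \<longleftrightarrow> card (external K) \<in> {2, 3} \<and> loop_number K \<ge> 1 \<and> legs_inseparable K"

text \<open>The conditions on components expressed by half-edges. The second clause takes the place
  of the loop condition: a connected graph without loops and with at most three legs is a single
  vertex, all of whose half-edges are external.\<close>

definition locally_feynman :: "'s lgraph \<Rightarrow> bool" where
  "locally_feynman G \<longleftrightarrow>
     (\<forall>h\<in>halfs G. card (external G \<inter> conn G `` {h}) \<in> {2, 3}) \<and>
     (\<forall>v\<in>gverts G. \<not> v \<subseteq> external G) \<and>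
     (\<forall>e\<in>gedges G. \<forall>h\<in>external G. \<forall>k\<in>external G.
        (h, k) \<in> conn G \<longrightarrow> (h, k) \<in> conn (del_edges G {e}))"

lemma feynman_iff_components:
  "feynman S G \<longleftrightarrow> pregraph G \<and> halfs G \<subseteq> S \<and> (\<forall>K\<in>components G. good_component K)"
  by (auto simp: feynman_def pregraph_def good_component_def)

lemma gsub_refl: "gsub G G" by (simp add: gsub_def)

lemma gsub_trans: "gsub A B \<Longrightarrow> gsub B C \<Longrightarrow> gsub A C" by (auto simp: gsub_def)

section \<open>Half-edges, vertices and edges of a trivalent graph\<close>

lemma pregraph_finite: "pregraph G \<Longrightarrow> finite (halfs G)"
  by (simp add: pregraph_def)

lemma pregraph_Union_verts: "pregraph G \<Longrightarrow> \<Union>(gverts G) = halfs G"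
  by (simp add: pregraph_def partition_on_def)

lemma pregraph_vert_eq:
  "pregraph G \<Longrightarrow> v \<in> gverts G \<Longrightarrow> w \<in> gverts G \<Longrightarrow> x \<in> v \<Longrightarrow> x \<in> w \<Longrightarrow> v = w"
  unfolding pregraph_def partition_on_def by (meson disjointD disjoint_iff)

lemma pregraph_edge_eq:
  "pregraph G \<Longrightarrow> e \<in> gedges G \<Longrightarrow> f \<in> gedges G \<Longrightarrow> x \<in> e \<Longrightarrow> x \<in> f \<Longrightarrow> e = f"
  unfolding pregraph_def disjoint_def by blast

lemma pregraph_edge_subset: "pregraph G \<Longrightarrow> e \<in> gedges G \<Longrightarrow> e \<subseteq> halfs G"
  by (simp add: pregraph_def)

lemma pregraph_vert_subset: "pregraph G \<Longrightarrow> v \<in> gverts G \<Longrightarrow> v \<subseteq> halfs G"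
  using pregraph_Union_verts by blast

lemma pregraph_vert_card: "pregraph G \<Longrightarrow> v \<in> gverts G \<Longrightarrow> card v = 3"
  by (simp add: pregraph_def)

lemma pregraph_vert_nonempty: "pregraph G \<Longrightarrow> v \<in> gverts G \<Longrightarrow> v \<noteq> {}"
  using pregraph_vert_card by fastforce

lemma pregraph_edgeE:
  assumes "pregraph G" "e \<in> gedges G" "x \<in> e"
  obtains y where "e = {x, y}" "x \<noteq> y" "y \<in> halfs G"
proof -
  have "card e = 2" "e \<subseteq> halfs G" using assms by (auto simp: pregraph_def)
  then obtain a b where ab: "e = {a, b}" "a \<noteq> b" by (meson card_2_iff)
  show thesis
  proof (cases "x = a")
    case True
    then show ?thesis using that[of b] ab \<open>e \<subseteq> halfs G\<close> by simp
  next
    case False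
    then have "x = b" using ab(1) assms(3) by simp
    then show ?thesis using that[of a] ab \<open>e \<subseteq> halfs G\<close> by (simp add: insert_commute)
  qed
qed

lemma pregraph_edge_nonempty: "pregraph G \<Longrightarrow> e \<in> gedges G \<Longrightarrow> e \<noteq> {}"
  unfolding pregraph_def by fastforce

lemma pregraph_mates_unique:
  assumes "pregraph G" "{x, y} \<in> gedges G" "{x, z} \<in> gedges G"
  shows "y = z"
proof -
  have "{x, y} = {x, z}" using pregraph_edge_eq[OF assms(1-3), of x] by simp
  then show ?thesis by (auto simp: doubleton_eq_iff)
qed

lemma pregraph_vertE:
  assumes "pregraph G" "x \<in> halfs G"
  obtains v where "v \<in> gverts G" "x \<in> v"
  using pregraph_Union_verts[OF assms(1)] assms(2) by blast

lemma pregraph_finite_edges: "pregraph G \<Longrightarrow> finite (gedges G)"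
proof -
  assume g: "pregraph G"
  then have "gedges G \<subseteq> Pow (halfs G)" using pregraph_edge_subset by blast
  then show ?thesis using pregraph_finite[OF g] by (meson finite_Pow_iff finite_subset)
qed

lemma pregraph_finite_verts: "pregraph G \<Longrightarrow> finite (gverts G)"
proof -
  assume g: "pregraph G"
  then have "gverts G \<subseteq> Pow (halfs G)" using pregraph_vert_subset by blast
  then show ?thesis using pregraph_finite[OF g] by (meson finite_Pow_iff finite_subset)
qed

lemma external_subset: "external G \<subseteq> halfs G"
  by (auto simp: external_def)

lemma external_iff: "x \<in> external G \<longleftrightarrow> x \<in> halfs G \<and> (\<forall>e\<in>gedges G. x \<notin> e)"
  by (auto simp: external_def)

lemma pregraph_subset:
  assumes G: "pregraph G" and V: "gverts U \<subseteq> gverts G" and E: "gedges U \<subseteq> gedges G"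
    and H: "\<Union>(gverts U) = halfs U" and e: "\<And>e. e \<in> gedges U \<Longrightarrow> e \<subseteq> halfs U"
  shows "pregraph U" "gsub U G"
proof -
  have "halfs U \<subseteq> halfs G" using pregraph_Union_verts[OF G] V H by blast
  then show "gsub U G" using V E by (simp add: gsub_def)
  have "finite (halfs U)" using \<open>halfs U \<subseteq> halfs G\<close> pregraph_finite[OF G] finite_subset by blast
  moreover have "partition_on (halfs U) (gverts U)"
    using G V H unfolding pregraph_def partition_on_def by (meson pairwise_subset subsetD)
  moreover have "disjoint (gedges U)" using G E unfolding pregraph_def by (auto intro: pairwise_subset)
  ultimately show "pregraph U" using G V E e unfolding pregraph_def by auto
qed

lemma gsub_feynman_iff: "\<gamma> \<in> subgraphs S G \<longleftrightarrow> feynman S \<gamma> \<and> gsub \<gamma> G"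
  by (auto simp: subgraphs_def gsub_def)

section \<open>Connectivity of half-edges and unions of components\<close>

lemma sym_linked: "sym (linked G)"
  unfolding linked_def sym_def by blast

lemma conn_sym: "(h, k) \<in> conn G \<Longrightarrow> (k, h) \<in> conn G"
  using sym_linked sym_rtrancl symD by metis

lemma linked_mono: "gverts A \<subseteq> gverts B \<Longrightarrow> gedges A \<subseteq> gedges B \<Longrightarrow> linked A \<subseteq> linked B"
  unfolding linked_def by blast

lemma conn_mono: "gverts A \<subseteq> gverts B \<Longrightarrow> gedges A \<subseteq> gedges B \<Longrightarrow> conn A \<subseteq> conn B"
  by (intro rtrancl_mono linked_mono)

lemma linkedI: "x \<in> gverts G \<union> gedges G \<Longrightarrow> h \<in> x \<Longrightarrow> k \<in> x \<Longrightarrow> (h, k) \<in> linked G"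
  unfolding linked_def by blast

lemma linkedE:
  assumes "(h, k) \<in> linked G"
  obtains x where "x \<in> gverts G" "h \<in> x" "k \<in> x" | x where "x \<in> gedges G" "h \<in> x" "k \<in> x"
  using assms unfolding linked_def by blast

text \<open>A union of connected components, described without paths.\<close>

definition closed_in :: "'s lgraph \<Rightarrow> 's set \<Rightarrow> bool" where
  "closed_in G U \<longleftrightarrow> U \<subseteq> halfs G \<and> (\<forall>x\<in>gverts G \<union> gedges G. x \<inter> U \<noteq> {} \<longrightarrow> x \<subseteq> U)"

lemma closed_in_conn:
  assumes "closed_in G U" "(h, k) \<in> conn G" "h \<in> U"
  shows "k \<in> U"
  using assms(2,3)
proof (induction rule: rtrancl_induct)
  case (step y z)
  then show ?case using assms(1) unfolding closed_in_def linked_def by blast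
qed

lemma pregraph_conn_halfs:
  assumes "pregraph G" "(h, k) \<in> conn G" "h \<in> halfs G"
  shows "k \<in> halfs G"
proof (rule closed_in_conn[OF _ assms(2,3)])
  show "closed_in G (halfs G)"
    using assms(1) pregraph_vert_subset pregraph_edge_subset by (fastforce simp: closed_in_def)
qed

lemma closed_in_class:
  assumes G: "pregraph G" and h: "h \<in> halfs G"
  shows "closed_in G (conn G `` {h})"
  unfolding closed_in_def
proof (intro conjI ballI impI subsetI)
  show "k \<in> halfs G" if "k \<in> conn G `` {h}" for k
    using that pregraph_conn_halfs[OF G _ h] by blast
  fix x k assume x: "x \<in> gverts G \<union> gedges G" "x \<inter> conn G `` {h} \<noteq> {}" "k \<in> x"
  then obtain l where l: "l \<in> x" "(h, l) \<in> conn G" by blast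
  have "(l, k) \<in> linked G" by (rule linkedI[OF x(1) l(1) x(3)])
  then have "(h, k) \<in> conn G" using l(2) by (rule rtrancl_into_rtrancl[rotated])
  then show "k \<in> conn G `` {h}" by blast
qed

lemma induced_simps [simp]:
  "halfs (induced G K) = K" "gverts (induced G K) = {v \<in> gverts G. v \<subseteq> K}"
  "gedges (induced G K) = {e \<in> gedges G. e \<subseteq> K}"
  by (simp_all add: induced_def)

lemma pregraph_induced:
  assumes G: "pregraph G" and U: "closed_in G U"
  shows "pregraph (induced G U)" "gsub (induced G U) G"
proof -
  have "\<Union>{v \<in> gverts G. v \<subseteq> U} = U"
  proof (intro subset_antisym subsetI)
    fix x assume x: "x \<in> U"
    then obtain v where v: "v \<in> gverts G" "x \<in> v"
      using G U pregraph_vertE unfolding closed_in_def by (metis subsetD)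
    then have "v \<subseteq> U" using U x unfolding closed_in_def by blast
    then show "x \<in> \<Union>{v \<in> gverts G. v \<subseteq> U}" using v by blast
  qed blast
  then show "pregraph (induced G U)" "gsub (induced G U) G"
    by (auto intro!: pregraph_subset[OF G])
qed

lemma linked_induced:
  assumes G: "pregraph G" and U: "closed_in G U"
  shows "linked (del_edges (induced G U) D) = linked (del_edges G D) \<inter> U \<times> U"
proof (intro subset_antisym subsetI)
  fix e assume "e \<in> linked (del_edges G D) \<inter> U \<times> U"
  then obtain h k where hk: "e = (h, k)" "(h, k) \<in> linked (del_edges G D)" "h \<in> U" "k \<in> U" by blast
  from hk(2) show "e \<in> linked (del_edges (induced G U) D)"
  proof (cases rule: linkedE)
    case (1 x)
    then have "x \<subseteq> U" using U hk(3) unfolding closed_in_def by auto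
    then show ?thesis using 1 hk(1) by (auto simp: linked_def)
  next
    case (2 x)
    then have "x \<subseteq> U" using U hk(3) unfolding closed_in_def by auto
    then show ?thesis using 2 hk(1) by (auto simp: linked_def)
  qed
qed (auto simp: linked_def)

text \<open>A path starting in a union of components stays there, also after edges have been
  deleted. The set D covers both plain connectivity and the removal of one edge in the condition on
  legs.\<close>

lemma conn_induced:
  assumes G: "pregraph G" and U: "closed_in G U" and h: "h \<in> U"
  shows "(h, k) \<in> conn (del_edges (induced G U) D) \<longleftrightarrow> (h, k) \<in> conn (del_edges G D)"
proof
  assume "(h, k) \<in> conn (del_edges (induced G U) D)"
  then show "(h, k) \<in> conn (del_edges G D)"
    unfolding linked_induced[OF G U] by (rule rtrancl_mono[THEN subsetD, rotated]) blast
next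
  assume "(h, k) \<in> conn (del_edges G D)"
  then have "k \<in> U \<and> (h, k) \<in> conn (del_edges (induced G U) D)"
  proof (induction rule: rtrancl_induct)
    case (step y z)
    have "closed_in (del_edges G D) U" using U by (auto simp: closed_in_def)
    then have "z \<in> U" using step by (meson closed_in_conn r_into_rtrancl)
    then have "(y, z) \<in> linked (del_edges (induced G U) D)"
      using step unfolding linked_induced[OF G U] by blast
    then show ?case using step.IH \<open>z \<in> U\<close> by (auto intro: rtrancl_into_rtrancl)
  qed (use h in simp)
  then show "(h, k) \<in> conn (del_edges (induced G U) D)" ..
qed

lemma del_edges_empty [simp]: "del_edges G {} = G"
  by simp

lemma conn_induced':
  assumes "pregraph G" "closed_in G U" "h \<in> U"
  shows "(h, k) \<in> conn (induced G U) \<longleftrightarrow> (h, k) \<in> conn G"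
  using conn_induced[OF assms, of k "{}"] unfolding del_edges_empty .

lemma external_induced:
  assumes U: "closed_in G U"
  shows "external (induced G U) = external G \<inter> U"
proof (intro subset_antisym subsetI)
  fix x assume x: "x \<in> external (induced G U)"
  then have "x \<in> U" by (simp add: external_def)
  moreover have "x \<notin> e" if "e \<in> gedges G" for e
  proof
    assume "x \<in> e"
    then have "e \<subseteq> U" using U that \<open>x \<in> U\<close> unfolding closed_in_def by blast
    then show False using x that \<open>x \<in> e\<close> by (auto simp: external_def)
  qed
  ultimately show "x \<in> external G \<inter> U" using U by (auto simp: external_def closed_in_def)
qed (auto simp: external_def)

section \<open>Counting half-edges, and the local form of the Feynman conditions\<close>

lemma card_halfs:
  assumes G: "pregraph G"
  shows "card (halfs G) = 3 * card (gverts G)" and "card (halfs G) = card (external G) + 2 * card (gedges G)"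
proof -
  have fv: "finite v" if "v \<in> gverts G" for v
    using pregraph_vert_subset[OF G that] pregraph_finite[OF G] finite_subset by blast
  have "card (\<Union>(gverts G)) = (\<Sum>v\<in>gverts G. card v)"
    using G fv unfolding pregraph_def partition_on_def by (intro card_Union_disjoint) auto
  then show "card (halfs G) = 3 * card (gverts G)"
    using pregraph_Union_verts[OF G] pregraph_vert_card[OF G] by simp
  have fe: "finite e" if "e \<in> gedges G" for e
    using pregraph_edge_subset[OF G that] pregraph_finite[OF G] finite_subset by blast
  have "card (\<Union>(gedges G)) = (\<Sum>e\<in>gedges G. card e)"
    using G fe unfolding pregraph_def by (intro card_Union_disjoint) auto
  also have "\<dots> = 2 * card (gedges G)" using G by (simp add: pregraph_def)
  finally have E: "card (\<Union>(gedges G)) = 2 * card (gedges G)" .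
  have sub: "\<Union>(gedges G) \<subseteq> halfs G" using pregraph_edge_subset[OF G] by blast
  then have "card (halfs G) = card (halfs G - \<Union>(gedges G)) + card (\<Union>(gedges G))"
    using pregraph_finite[OF G] by (metis card_Diff_subset card_mono diff_add finite_subset)
  then show "card (halfs G) = card (external G) + 2 * card (gedges G)"
    using E by (simp add: external_def)
qed

text \<open>Counting half-edges, a connected graph with at most three legs and no loop is a single vertex.\<close>

lemma loop_number_iff:
  assumes G: "pregraph G" and ne: "halfs G \<noteq> {}" and con: "\<And>h k. h \<in> halfs G \<Longrightarrow> k \<in> halfs G \<Longrightarrow> (h, k) \<in> conn G"
    and ext: "card (external G) \<in> {2, 3}"
  shows "loop_number G \<ge> 1 \<longleftrightarrow> (\<forall>v\<in>gverts G. \<not> v \<subseteq> external G)"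
proof -
  let ?V = "card (gverts G)" and ?E = "card (gedges G)" and ?X = "card (external G)"
  have count: "3 * ?V = ?X + 2 * ?E" using card_halfs[OF G] by simp
  have Vpos: "?V > 0"
    using ne pregraph_Union_verts[OF G] pregraph_finite_verts[OF G] by (auto simp: card_gt_0_iff)
  have "loop_number G \<ge> 1 \<longleftrightarrow> ?V \<le> ?E" by (auto simp: loop_number_def)
  also have "\<dots> \<longleftrightarrow> (\<forall>v\<in>gverts G. \<not> v \<subseteq> external G)"
  proof
    assume le: "?V \<le> ?E"
    show "\<forall>v\<in>gverts G. \<not> v \<subseteq> external G"
    proof (intro ballI notI)
      fix v assume v: "v \<in> gverts G" "v \<subseteq> external G"
      \<comment> \<open>No edge meets a vertex with only external half-edges, so v is a whole
        component, hence all of G. Then G has a vertex but no edge.\<close>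
      have "closed_in G v" unfolding closed_in_def
      proof (intro conjI ballI impI)
        show "v \<subseteq> halfs G" using pregraph_vert_subset[OF G v(1)] .
        fix x assume x: "x \<in> gverts G \<union> gedges G" "x \<inter> v \<noteq> {}"
        then have "x \<notin> gedges G" using v(2) by (auto simp: external_iff)
        then show "x \<subseteq> v" using x pregraph_vert_eq[OF G _ v(1)] by blast
      qed
      moreover obtain x where x: "x \<in> v" using pregraph_vert_nonempty[OF G v(1)] by blast
      ultimately have "halfs G \<subseteq> v"
        using closed_in_conn con pregraph_vert_subset[OF G v(1)] by (meson subsetD subsetI)
      then have hv: "halfs G = external G" using v(2) external_subset[of G] by blast
      have "gedges G = {}"
      proof (rule ccontr)
        assume "gedges G \<noteq> {}"
        then obtain e where e: "e \<in> gedges G" by blast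
        then obtain x where "x \<in> e" using pregraph_edge_nonempty[OF G] by blast
        moreover have "x \<in> external G" using pregraph_edge_subset[OF G e] \<open>x \<in> e\<close> hv by blast
        ultimately show False using e by (simp add: external_iff)
      qed
      then show False using le Vpos by simp
    qed
  next
    assume nv: "\<forall>v\<in>gverts G. \<not> v \<subseteq> external G"
    show "?V \<le> ?E"
    proof (rule ccontr)
      assume "\<not> ?V \<le> ?E"
      \<comment> \<open>From 3V = X + 2E and E < V follows V \<le> X - 2 \<le> 1, and then 3 = X +
        2E with X \<ge> 2 leaves only X = 3, E = 0.\<close>
      then have "?V = 1" "?E = 0" using count ext Vpos by auto
      then have "gedges G = {}" using pregraph_finite_edges[OF G] by simp
      then have "external G = halfs G" by (simp add: external_def)
      moreover obtain v where "gverts G = {v}" using \<open>?V = 1\<close> card_1_singletonE by blast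
      ultimately show False using nv pregraph_vert_subset[OF G] by auto
    qed
  qed
  finally show ?thesis .
qed

lemma components_eq:
  assumes "pregraph G"
  shows "components G = (\<lambda>h. induced G (conn G `` {h})) ` halfs G"
  unfolding components_def quotient_def by auto

text \<open>External half-edges and connectivity of a component are those of G restricted to a
  class, so a quantifier over components becomes one over half-edges. In this form the conditions
  can be compared between graphs whose components are different objects.\<close>

lemma feynman_iff: "feynman S G \<longleftrightarrow> pregraph G \<and> halfs G \<subseteq> S \<and> locally_feynman G"
proof (cases "pregraph G")
  case G: True
  let ?c = "\<lambda>h. conn G `` {h}"
  let ?K = "\<lambda>h. induced G (?c h)"
  have cl: "closed_in G (?c h)" if "h \<in> halfs G" for h using closed_in_class[OF G that] .
  have ext: "external (?K h) = external G \<inter> ?c h" if "h \<in> halfs G" for h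
    using external_induced[OF cl[OF that]] .
  have loops: "loop_number (?K h) \<ge> 1 \<longleftrightarrow> (\<forall>v\<in>gverts G. v \<subseteq> ?c h \<longrightarrow> \<not> v \<subseteq> external G)"
    if h: "h \<in> halfs G" "card (external (?K h)) \<in> {2, 3}" for h
  proof -
    have "loop_number (?K h) \<ge> 1 \<longleftrightarrow> (\<forall>v\<in>gverts (?K h). \<not> v \<subseteq> external (?K h))"
    proof (rule loop_number_iff[OF pregraph_induced(1)[OF G cl[OF h(1)]] _ _ h(2)])
      show "halfs (?K h) \<noteq> {}" by auto
      fix x y assume "x \<in> halfs (?K h)" "y \<in> halfs (?K h)"
      then have "(h, x) \<in> conn G" "(h, y) \<in> conn G" by auto
      then have "(x, y) \<in> conn G" using conn_sym by (metis rtrancl_trans)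
      then show "(x, y) \<in> conn (?K h)"
        using conn_induced'[OF G cl[OF h(1)], of x y] \<open>x \<in> halfs (?K h)\<close> by simp
    qed
    then show ?thesis unfolding ext[OF h(1)] by auto
  qed
  have insep: "legs_inseparable (?K h) \<longleftrightarrow> (\<forall>e\<in>gedges G. \<forall>x\<in>external G. \<forall>y\<in>external G.
      e \<subseteq> ?c h \<longrightarrow> x \<in> ?c h \<longrightarrow> y \<in> ?c h \<longrightarrow> (x, y) \<in> conn (del_edges G {e}))"
    if h: "h \<in> halfs G" for h
    unfolding legs_inseparable_def ext[OF h]
    using conn_induced[OF G cl[OF h]] by auto
  have F3: "(\<forall>h\<in>halfs G. legs_inseparable (?K h)) \<longleftrightarrow>
    (\<forall>e\<in>gedges G. \<forall>x\<in>external G. \<forall>y\<in>external G. (x, y) \<in> conn G \<longrightarrow> (x, y) \<in> conn (del_edges G {e}))"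
    (is "?l \<longleftrightarrow> ?r")
  proof
    assume l: ?l
    show ?r
    proof (intro ballI impI)
      fix e x y assume e: "e \<in> gedges G" and xy: "x \<in> external G" "y \<in> external G" "(x, y) \<in> conn G"
      have x: "x \<in> halfs G" by (rule subsetD[OF external_subset xy(1)])
      show "(x, y) \<in> conn (del_edges G {e})"
      proof (cases "e \<subseteq> ?c x")
        case True
        have "legs_inseparable (?K x)" using l x by blast
        then show ?thesis using insep[OF x] e xy True by blast
      next
        case False
        \<comment> \<open>An edge outside the component of x can be removed without changing that
          component.\<close>
        have "del_edges (?K x) {e} = ?K x" using False by (auto simp: induced_def)
        then have "(x, y) \<in> conn (del_edges (?K x) {e})"
          using conn_induced'[OF G cl[OF x], of x y] xy(3) by simp
        then show ?thesis using conn_induced[OF G cl[OF x]] by blast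
      qed
    qed
  next
    assume r: ?r
    show ?l
    proof
      fix h assume h: "h \<in> halfs G"
      show "legs_inseparable (?K h)" unfolding insep[OF h]
      proof (intro ballI impI)
        fix e x y assume e: "e \<in> gedges G" and xy: "x \<in> external G" "y \<in> external G" "x \<in> ?c h" "y \<in> ?c h"
        then have "(x, y) \<in> conn G" using conn_sym rtrancl_trans by (metis Image_singleton_iff)
        then show "(x, y) \<in> conn (del_edges G {e})" using r e xy by blast
      qed
    qed
  qed
  have F2: "(\<forall>h\<in>halfs G. \<forall>v\<in>gverts G. v \<subseteq> ?c h \<longrightarrow> \<not> v \<subseteq> external G) \<longleftrightarrow>
    (\<forall>v\<in>gverts G. \<not> v \<subseteq> external G)"
  proof
    assume l: "\<forall>h\<in>halfs G. \<forall>v\<in>gverts G. v \<subseteq> ?c h \<longrightarrow> \<not> v \<subseteq> external G"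
    show "\<forall>v\<in>gverts G. \<not> v \<subseteq> external G"
    proof
      fix v assume v: "v \<in> gverts G"
      then obtain h where h: "h \<in> v" using pregraph_vert_nonempty[OF G] by blast
      then have "h \<in> halfs G" using pregraph_vert_subset[OF G v] by blast
      moreover have "v \<subseteq> ?c h" using h v linkedI[of v G] by blast
      ultimately show "\<not> v \<subseteq> external G" using l v by blast
    qed
  qed blast
  have "(\<forall>K\<in>components G. good_component K) \<longleftrightarrow> (\<forall>h\<in>halfs G. good_component (?K h))"
    unfolding components_eq[OF G] by simp
  also have "\<dots> \<longleftrightarrow> (\<forall>h\<in>halfs G. card (external (?K h)) \<in> {2, 3} \<and>
      (\<forall>v\<in>gverts G. v \<subseteq> ?c h \<longrightarrow> \<not> v \<subseteq> external G) \<and> legs_inseparable (?K h))"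
    unfolding good_component_def by (intro ball_cong refl conj_cong loops)
  also have "\<dots> \<longleftrightarrow> locally_feynman G"
    unfolding locally_feynman_def F2[symmetric] F3[symmetric] using ext by auto
  finally show ?thesis unfolding feynman_iff_components by blast
next
  case False
  then show ?thesis by (simp add: feynman_iff_components)
qed

section \<open>Contracting a connected subgraph\<close>

definition connected_graph :: "'s lgraph \<Rightarrow> bool" where
  "connected_graph G \<longleftrightarrow> pregraph G \<and> halfs G \<noteq> {} \<and> (\<forall>h\<in>halfs G. \<forall>k\<in>halfs G. (h, k) \<in> conn G)"

lemma externalD: "x \<in> external G \<Longrightarrow> x \<in> halfs G"
  by (simp add: external_iff)

lemma externalI: "x \<in> halfs G \<Longrightarrow> (\<And>e. e \<in> gedges G \<Longrightarrow> x \<notin> e) \<Longrightarrow> x \<in> external G"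
  by (simp add: external_iff)

lemma external_edgeD: "x \<in> external G \<Longrightarrow> e \<in> gedges G \<Longrightarrow> x \<notin> e"
  by (simp add: external_iff)

text \<open>The map \<pi> plays the role of a retraction onto the contracted graph: it sends every
  link to a path and fixes the half-edges that are compared.\<close>

lemma conn_project:
  assumes "\<And>x y. (x, y) \<in> R \<Longrightarrow> (\<pi> x, \<pi> y) \<in> R'\<^sup>*" and "\<And>x y. (x, y) \<in> R' \<Longrightarrow> (x, y) \<in> R\<^sup>*"
    and "\<pi> h = h" "\<pi> k = k"
  shows "(h, k) \<in> R\<^sup>* \<longleftrightarrow> (h, k) \<in> R'\<^sup>*"
proof
  have *: "(\<pi> x, \<pi> y) \<in> R'\<^sup>*" if "(x, y) \<in> R\<^sup>*" for x y
    using that by (induction rule: rtrancl_induct) (use assms(1) rtrancl_trans in fast)+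
  assume "(h, k) \<in> R\<^sup>*"
  then show "(h, k) \<in> R'\<^sup>*" using *[of h k] assms(3,4) by simp
next
  assume "(h, k) \<in> R'\<^sup>*"
  then show "(h, k) \<in> R\<^sup>*" by (induction rule: rtrancl_induct) (use assms(2) rtrancl_trans in fast)+
qed

text \<open>An abstract comparison of G with a contraction G', applied to the three-legged and to
  the two-legged case. The hypothesis \<open>edges\<close> has two branches because an edge of G
  either has a counterpart in G', or lies inside the contracted part, where its removal is invisible
  in G'. The converse hypothesis \<open>edges'\<close> provides for reflection of the condition on
  legs.\<close>

lemma locally_feynman_transfer:
  assumes ext: "external G' = external G" and H: "halfs G' \<subseteq> halfs G"
    and con: "\<And>h k. h \<in> halfs G' \<Longrightarrow> k \<in> halfs G' \<Longrightarrow> (h, k) \<in> conn G \<longleftrightarrow> (h, k) \<in> conn G'"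
    and cover: "\<And>h. h \<in> halfs G \<Longrightarrow> \<exists>k\<in>halfs G'. (h, k) \<in> conn G"
    and verts: "(\<forall>v\<in>gverts G. \<not> v \<subseteq> external G) \<longleftrightarrow> (\<forall>v\<in>gverts G'. \<not> v \<subseteq> external G)"
    and edges: "\<And>e. e \<in> gedges G \<Longrightarrow>
      (\<exists>e'\<in>gedges G'. \<forall>h\<in>halfs G'. \<forall>k\<in>halfs G'.
        (h, k) \<in> conn (del_edges G {e}) \<longleftrightarrow> (h, k) \<in> conn (del_edges G' {e'})) \<or>
      (\<forall>h\<in>halfs G'. \<forall>k\<in>halfs G'. (h, k) \<in> conn (del_edges G {e}) \<longleftrightarrow> (h, k) \<in> conn G')"
    and edges': "\<And>e'. e' \<in> gedges G' \<Longrightarrow> \<exists>e\<in>gedges G. \<forall>h\<in>halfs G'. \<forall>k\<in>halfs G'.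
        (h, k) \<in> conn (del_edges G {e}) \<longleftrightarrow> (h, k) \<in> conn (del_edges G' {e'})"
  shows "locally_feynman G \<longleftrightarrow> locally_feynman G'"
proof -
  have extH: "x \<in> halfs G'" if "x \<in> external G" for x using externalD[of x G'] ext that by simp
  have cls: "external G \<inter> conn G `` {h} = external G' \<inter> conn G' `` {k}"
    if k: "k \<in> halfs G'" "(h, k) \<in> conn G" for h k
  proof -
    have "(h, x) \<in> conn G \<longleftrightarrow> (k, x) \<in> conn G'" if "x \<in> external G" for x
      using con[OF k(1) extH[OF that]] k(2) conn_sym rtrancl_trans by metis
    then show ?thesis unfolding ext by auto
  qed
  have F1: "(\<forall>h\<in>halfs G. card (external G \<inter> conn G `` {h}) \<in> {2, 3}) \<longleftrightarrow>
    (\<forall>h\<in>halfs G'. card (external G' \<inter> conn G' `` {h}) \<in> {2, 3})" (is "?l \<longleftrightarrow> ?r")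
  proof
    assume l: ?l
    show ?r
    proof
      fix h assume h: "h \<in> halfs G'"
      then have "card (external G \<inter> conn G `` {h}) \<in> {2, 3}" using l H by blast
      then show "card (external G' \<inter> conn G' `` {h}) \<in> {2, 3}" using cls[OF h rtrancl.rtrancl_refl] by simp
    qed
  next
    assume r: ?r
    show ?l
    proof
      fix h assume "h \<in> halfs G"
      then obtain k where "k \<in> halfs G'" "(h, k) \<in> conn G" using cover by blast
      then show "card (external G \<inter> conn G `` {h}) \<in> {2, 3}" using cls r by simp
    qed
  qed
  have F3: "(\<forall>e\<in>gedges G. \<forall>h\<in>external G. \<forall>k\<in>external G.
        (h, k) \<in> conn G \<longrightarrow> (h, k) \<in> conn (del_edges G {e})) \<longleftrightarrow>
    (\<forall>e\<in>gedges G'. \<forall>h\<in>external G'. \<forall>k\<in>external G'.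
        (h, k) \<in> conn G' \<longrightarrow> (h, k) \<in> conn (del_edges G' {e}))" (is "?l \<longleftrightarrow> ?r")
  proof
    assume l: ?l
    show ?r
    proof (intro ballI impI)
      fix e' h k assume e': "e' \<in> gedges G'" and hk: "h \<in> external G'" "k \<in> external G'" "(h, k) \<in> conn G'"
      have hk': "h \<in> halfs G'" "k \<in> halfs G'" using hk(1,2) extH ext by auto
      obtain e where e: "e \<in> gedges G"
        "(h, k) \<in> conn (del_edges G {e}) \<longleftrightarrow> (h, k) \<in> conn (del_edges G' {e'})"
        using edges'[OF e'] hk' by blast
      have "(h, k) \<in> conn G" using con[OF hk'] hk(3) by simp
      then show "(h, k) \<in> conn (del_edges G' {e'})" using l e hk(1,2) ext by blast
    qed
  next
    assume r: ?r
    show ?l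
    proof (intro ballI impI)
      fix e h k assume e: "e \<in> gedges G" and hk: "h \<in> external G" "k \<in> external G" "(h, k) \<in> conn G"
      have hk': "h \<in> halfs G'" "k \<in> halfs G'" using hk(1,2) extH by auto
      have c': "(h, k) \<in> conn G'" using con[OF hk'] hk(3) by simp
      from edges[OF e] show "(h, k) \<in> conn (del_edges G {e})"
      proof
        assume "\<exists>e'\<in>gedges G'. \<forall>h\<in>halfs G'. \<forall>k\<in>halfs G'.
          (h, k) \<in> conn (del_edges G {e}) \<longleftrightarrow> (h, k) \<in> conn (del_edges G' {e'})"
        then obtain e' where "e' \<in> gedges G'"
          "(h, k) \<in> conn (del_edges G {e}) \<longleftrightarrow> (h, k) \<in> conn (del_edges G' {e'})" using hk' by blast
        then show ?thesis using r c' hk(1,2) ext by blast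
      qed (use c' hk' in blast)
    qed
  qed
  show ?thesis unfolding locally_feynman_def F1 F3 using verts ext by simp
qed

lemma feynmanD:
  assumes "feynman S G"
  shows feynman_pregraph: "pregraph G" and feynman_halfs: "halfs G \<subseteq> S"
    and feynman_locally: "locally_feynman G"
  using assms by (auto simp: feynman_iff)

text \<open>G is only a pregraph here, because the locale is also applied to lifts, whose Feynman
  property is a consequence of the analysis of contraction.\<close>

locale subgraph_contraction =
  fixes S :: "'s set" and \<delta> G :: "'s lgraph"
  assumes feyn: "feynman S \<delta>" and connected: "connected_graph \<delta>"
    and G: "pregraph G" and sub: "gsub \<delta> G"
begin

lemma pre: "pregraph \<delta>"
  using connected by (simp add: connected_graph_def)

lemma nonempty: "halfs \<delta> \<noteq> {}"
  using connected by (simp add: connected_graph_def)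

lemma con: "h \<in> halfs \<delta> \<Longrightarrow> k \<in> halfs \<delta> \<Longrightarrow> (h, k) \<in> conn \<delta>"
  using connected by (simp add: connected_graph_def)

lemma subs: "halfs \<delta> \<subseteq> halfs G" "gverts \<delta> \<subseteq> gverts G" "gedges \<delta> \<subseteq> gedges G"
  using sub by (auto simp: gsub_def)

lemma con_G: "h \<in> halfs \<delta> \<Longrightarrow> k \<in> halfs \<delta> \<Longrightarrow> (h, k) \<in> conn G"
  using con conn_mono[OF subs(2,3)] by blast

lemma card_external: "card (external \<delta>) \<in> {2, 3}"
proof -
  obtain h where h: "h \<in> halfs \<delta>" using nonempty by blast
  have "external \<delta> \<inter> conn \<delta> `` {h} = external \<delta>" using con[OF h] external_subset[of \<delta>] by blast
  then show ?thesis using feynman_locally[OF feyn] h unfolding locally_feynman_def by metis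
qed

lemma finite_external: "finite (external \<delta>)"
  using external_subset[of \<delta>] pregraph_finite[OF pre] finite_subset by blast

lemma no_external_vert: "v \<in> gverts \<delta> \<Longrightarrow> \<not> v \<subseteq> external \<delta>"
  using feynman_locally[OF feyn] by (simp add: locally_feynman_def)

lemma legs_conn:
  "h \<in> external \<delta> \<Longrightarrow> k \<in> external \<delta> \<Longrightarrow> (h, k) \<in> conn (del_edges \<delta> {e})"
proof -
  assume hk: "h \<in> external \<delta>" "k \<in> external \<delta>"
  then have c: "(h, k) \<in> conn \<delta>" using con externalD by metis
  show ?thesis
  proof (cases "e \<in> gedges \<delta>")
    case True
    then show ?thesis using feynman_locally[OF feyn] hk c unfolding locally_feynman_def by blast
  next
    case False
    then have "del_edges \<delta> {e} = \<delta>" by simp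
    then show ?thesis using c by simp
  qed
qed

lemma vert_in_sub: "v \<in> gverts G \<Longrightarrow> x \<in> v \<Longrightarrow> x \<in> halfs \<delta> \<Longrightarrow> v \<in> gverts \<delta>"
  using pregraph_vertE[OF pre] subs(2) pregraph_vert_eq[OF G] by (metis subsetD)

lemma edge_at_sub: "e \<in> gedges G \<Longrightarrow> e \<notin> gedges \<delta> \<Longrightarrow> x \<in> e \<Longrightarrow> x \<in> halfs \<delta> \<Longrightarrow> x \<in> external \<delta>"
  unfolding external_iff using subs(3) pregraph_edge_eq[OF G] by (metis subsetD)

lemma external_in_sub: "x \<in> external G \<Longrightarrow> x \<in> halfs \<delta> \<Longrightarrow> x \<in> external \<delta>"
  using subs(3) by (auto simp: external_iff)

lemma vert_sub_iff: "v \<in> gverts G \<Longrightarrow> v \<in> gverts \<delta> \<longleftrightarrow> v \<inter> halfs \<delta> \<noteq> {}"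
  using vert_in_sub[of v] pregraph_vert_subset[OF pre, of v] pregraph_vert_nonempty[OF pre, of v] by blast

text \<open>A vertex of G meeting \<delta> is a vertex of \<delta>, and the loop condition forbids
  it to consist of legs. Hence the vertex created by a contraction is really new, which lets the
  lift recognise it.\<close>

lemma external_not_vert: "external \<delta> \<notin> gverts G"
proof
  assume v: "external \<delta> \<in> gverts G"
  then obtain x where "x \<in> external \<delta>" using pregraph_vert_nonempty[OF G] by blast
  then have "external \<delta> \<in> gverts \<delta>" using vert_in_sub[OF v] externalD[of x \<delta>] by blast
  then show False using no_external_vert by blast
qed

text \<open>An edge of G that meets \<delta> without belonging to it does so at a leg. If all legs
  are external in G, no such edge exists, so \<delta> is closed in G and, being connected, is a
  component.\<close>

lemma component_iff: "\<delta> \<in> components G \<longleftrightarrow> external \<delta> \<subseteq> external G"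
proof
  assume "\<delta> \<in> components G"
  then obtain h where h: "h \<in> halfs G" "\<delta> = induced G (conn G `` {h})"
    unfolding components_eq[OF G] by blast
  then show "external \<delta> \<subseteq> external G" using external_induced[OF closed_in_class[OF G h(1)]] by simp
next
  assume ext: "external \<delta> \<subseteq> external G"
  have edges: "e \<in> gedges \<delta>" if eG: "e \<in> gedges G" and eD: "e \<inter> halfs \<delta> \<noteq> {}" for e
  proof (rule ccontr)
    assume "e \<notin> gedges \<delta>"
    then obtain x where "x \<in> e" "x \<in> external \<delta>" using edge_at_sub[OF eG] eD by blast
    then show False using subsetD[OF ext] external_edgeD eG by metis
  qed
  have cl: "closed_in G (halfs \<delta>)"
    unfolding closed_in_def
  proof (intro conjI ballI impI subs(1))
    fix x assume x: "x \<in> gverts G \<union> gedges G" "x \<inter> halfs \<delta> \<noteq> {}"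
    then have "x \<in> gverts \<delta> \<or> x \<in> gedges \<delta>" using vert_sub_iff edges by auto
    then show "x \<subseteq> halfs \<delta>" using pregraph_edge_subset[OF pre] pregraph_vert_subset[OF pre] by blast
  qed
  obtain h where h: "h \<in> halfs \<delta>" using nonempty by blast
  have cls: "conn G `` {h} = halfs \<delta>"
  proof (intro subset_antisym subsetI)
    show "k \<in> halfs \<delta>" if "k \<in> conn G `` {h}" for k
      using closed_in_conn[OF cl _ h, of k] that by simp
    show "k \<in> conn G `` {h}" if "k \<in> halfs \<delta>" for k using con_G[OF h that] by simp
  qed
  have "{v \<in> gverts G. v \<subseteq> halfs \<delta>} = gverts \<delta>"
  proof (intro subset_antisym subsetI)
    fix v assume v: "v \<in> {v \<in> gverts G. v \<subseteq> halfs \<delta>}"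
    then have "v \<inter> halfs \<delta> \<noteq> {}" using pregraph_vert_nonempty[OF G, of v] by auto
    then show "v \<in> gverts \<delta>" using vert_sub_iff[of v] v by simp
  qed (use subs(2) pregraph_vert_subset[OF pre] in auto)
  moreover have "{e \<in> gedges G. e \<subseteq> halfs \<delta>} = gedges \<delta>"
  proof (intro subset_antisym subsetI)
    fix e assume e: "e \<in> {e \<in> gedges G. e \<subseteq> halfs \<delta>}"
    then have "e \<inter> halfs \<delta> \<noteq> {}" using pregraph_edge_nonempty[OF G, of e] by auto
    then show "e \<in> gedges \<delta>" using edges[of e] e by simp
  qed (use subs(3) pregraph_edge_subset[OF pre] in auto)
  ultimately have "induced G (conn G `` {h}) = \<delta>" unfolding cls by (simp add: induced_def)
  then show "\<delta> \<in> components G" unfolding components_eq[OF G] using h subs(1) by blast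
qed

subsection \<open>Detached subgraphs\<close>

lemma detached_edges:
  assumes "external \<delta> \<subseteq> external G" "e \<in> gedges G"
  shows "e \<in> gedges \<delta> \<longleftrightarrow> e \<inter> halfs \<delta> \<noteq> {}"
proof
  show "e \<inter> halfs \<delta> \<noteq> {}" if "e \<in> gedges \<delta>"
    using that pregraph_edge_subset[OF pre] pregraph_edge_nonempty[OF pre] by blast
  assume "e \<inter> halfs \<delta> \<noteq> {}"
  show "e \<in> gedges \<delta>"
  proof (rule ccontr)
    assume "e \<notin> gedges \<delta>"
    then obtain x where "x \<in> e" "x \<in> external \<delta>"
      using edge_at_sub[OF assms(2)] \<open>e \<inter> halfs \<delta> \<noteq> {}\<close> by blast
    then show False using subsetD[OF assms(1)] external_edgeD assms(2) by metis
  qed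
qed

lemma contract_detached:
  assumes ext: "external \<delta> \<subseteq> external G"
  shows "contract G \<delta> = \<lparr>halfs = halfs G - halfs \<delta>, gverts = gverts G - gverts \<delta>, gedges = gedges G - gedges \<delta>\<rparr>"
proof -
  have "{v \<in> gverts G. v \<subseteq> halfs G - halfs \<delta>} = gverts G - gverts \<delta>"
    using vert_sub_iff pregraph_vert_subset[OF G] by blast
  moreover have "{e \<in> gedges G. e \<subseteq> halfs G - halfs \<delta>} = gedges G - gedges \<delta>"
    using detached_edges[OF ext] pregraph_edge_subset[OF G] by blast
  ultimately show ?thesis using component_iff ext by (simp add: contract_def induced_def)
qed

lemma closed_complement:
  assumes ext: "external \<delta> \<subseteq> external G"
  shows "closed_in G (halfs G - halfs \<delta>)"
  unfolding closed_in_def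
proof (intro conjI ballI impI)
  fix x assume x: "x \<in> gverts G \<union> gedges G" "x \<inter> (halfs G - halfs \<delta>) \<noteq> {}"
  from x(1) show "x \<subseteq> halfs G - halfs \<delta>"
  proof
    assume v: "x \<in> gverts G"
    then show ?thesis using vert_sub_iff[OF v] pregraph_vert_subset[OF pre] pregraph_vert_subset[OF G v] x(2) by blast
  next
    assume e: "x \<in> gedges G"
    then show ?thesis
      using detached_edges[OF ext e] pregraph_edge_subset[OF pre] pregraph_edge_subset[OF G e] x(2) by blast
  qed
qed blast

lemma contract_detached_induced:
  "external \<delta> \<subseteq> external G \<Longrightarrow> contract G \<delta> = induced G (halfs G - halfs \<delta>)"
  using component_iff by (simp add: contract_def)

lemma components_contract_detached:
  assumes ext: "external \<delta> \<subseteq> external G"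
  shows "components (contract G \<delta>) = components G - {\<delta>}"
proof -
  let ?U = "halfs G - halfs \<delta>"
  have cl: "closed_in G ?U" by (rule closed_complement[OF ext])
  have pU: "pregraph (induced G ?U)" by (rule pregraph_induced(1)[OF G cl])
  have ind: "induced (induced G ?U) (conn (induced G ?U) `` {h}) = induced G (conn G `` {h})" if h: "h \<in> ?U" for h
  proof -
    have "conn (induced G ?U) `` {h} = conn G `` {h}" using conn_induced'[OF G cl h] by auto
    moreover have "conn G `` {h} \<subseteq> ?U" using closed_in_conn[OF cl _ h] by blast
    ultimately show ?thesis by (auto simp: induced_def)
  qed
  have "components (contract G \<delta>) = (\<lambda>h. induced G (conn G `` {h})) ` ?U"
    unfolding contract_detached_induced[OF ext] components_eq[OF pU] using ind by simp
  also have "\<dots> = components G - {\<delta>}"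
  proof (intro subset_antisym subsetI)
    fix K assume "K \<in> (\<lambda>h. induced G (conn G `` {h})) ` ?U"
    then obtain h where h: "h \<in> ?U" "K = induced G (conn G `` {h})" by blast
    then have "h \<in> halfs K" by simp
    then have "K \<noteq> \<delta>" using h(1) by blast
    then show "K \<in> components G - {\<delta>}" unfolding components_eq[OF G] using h by blast
  next
    fix K assume K: "K \<in> components G - {\<delta>}"
    then obtain h where h: "h \<in> halfs G" "K = induced G (conn G `` {h})" unfolding components_eq[OF G] by blast
    have "h \<notin> halfs \<delta>"
    proof
      assume hd: "h \<in> halfs \<delta>"
      have "\<delta> \<in> components G" using component_iff ext by simp
      then obtain k where k: "\<delta> = induced G (conn G `` {k})" unfolding components_eq[OF G] by blast
      then have "(k, h) \<in> conn G" using hd by (metis Image_singleton_iff induced_simps(1))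
      then have "conn G `` {k} = conn G `` {h}" using conn_sym rtrancl_trans by (metis Image_singleton_iff set_eqI)
      then show False using K k h by simp
    qed
    then show "K \<in> (\<lambda>h. induced G (conn G `` {h})) ` ?U" using h by blast
  qed
  finally show ?thesis .
qed

text \<open>G and its contraction have the same components except for \<delta>, and \<delta>
  satisfies the conditions by itself.\<close>

lemma feynman_contract_detached:
  assumes ext: "external \<delta> \<subseteq> external G"
  shows "feynman S G \<longleftrightarrow> feynman S (contract G \<delta>)"
proof -
  have "pregraph (contract G \<delta>)"
    unfolding contract_detached_induced[OF ext] by (rule pregraph_induced(1)[OF G closed_complement[OF ext]])
  moreover have "good_component \<delta>"
  proof -
    obtain h where h: "h \<in> halfs \<delta>" using nonempty by blast
    have "conn \<delta> `` {h} = halfs \<delta>"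
      using con[OF h] pregraph_conn_halfs[OF pre _ h] by blast
    moreover have "induced \<delta> (halfs \<delta>) = \<delta>"
      using pregraph_vert_subset[OF pre] pregraph_edge_subset[OF pre]
      by (cases \<delta>) (auto simp: induced_def)
    ultimately have "\<delta> \<in> components \<delta>" unfolding components_eq[OF pre] using h by (intro image_eqI[of _ _ h]) simp_all
    then show ?thesis using feyn by (simp add: feynman_iff_components)
  qed
  moreover have "components G = insert \<delta> (components (contract G \<delta>))"
    using components_contract_detached[OF ext] component_iff ext by blast
  moreover have "halfs G \<subseteq> S \<longleftrightarrow> halfs (contract G \<delta>) \<subseteq> S"
    using feynman_halfs[OF feyn] subs(1) unfolding contract_detached[OF ext] by auto
  ultimately show ?thesis using G by (simp add: feynman_iff_components)
qed

subsection \<open>Subgraphs with three legs\<close>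

lemma contract_three:
  assumes "\<not> external \<delta> \<subseteq> external G" "card (external \<delta>) = 3"
  shows "contract G \<delta> = \<lparr>halfs = (halfs G - halfs \<delta>) \<union> external \<delta>,
    gverts = (gverts G - gverts \<delta>) \<union> {external \<delta>}, gedges = gedges G - gedges \<delta>\<rparr>"
  using assms component_iff by (simp add: contract_def)

context
  assumes nd: "\<not> external \<delta> \<subseteq> external G" and three: "card (external \<delta>) = 3"
begin

lemma edge_outside: "e \<in> gedges G \<Longrightarrow> e \<notin> gedges \<delta> \<Longrightarrow> e \<subseteq> (halfs G - halfs \<delta>) \<union> external \<delta>"
  using edge_at_sub pregraph_edge_subset[OF G] by blast

lemma pregraph_contract_three: "pregraph (contract G \<delta>)"
  unfolding contract_three[OF nd three] pregraph_def
proof (simp, intro conjI ballI)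
  show "finite (halfs G - halfs \<delta>)" "finite (external \<delta>)" using pregraph_finite[OF G] finite_external by auto
  have "external \<delta> \<noteq> {}" using three by auto
  have un: "\<Union>(gverts G - gverts \<delta>) = halfs G - halfs \<delta>"
  proof (intro subset_antisym subsetI)
    fix x assume "x \<in> \<Union>(gverts G - gverts \<delta>)"
    then obtain v where v: "v \<in> gverts G" "v \<notin> gverts \<delta>" "x \<in> v" by blast
    then show "x \<in> halfs G - halfs \<delta>" using vert_in_sub[OF v(1,3)] pregraph_vert_subset[OF G v(1)] by blast
  next
    fix x assume x: "x \<in> halfs G - halfs \<delta>"
    then obtain v where v: "v \<in> gverts G" "x \<in> v" using pregraph_vertE[OF G, of x] by blast
    then have "v \<notin> gverts \<delta>" using x pregraph_vert_subset[OF pre, of v] by blast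
    then show "x \<in> \<Union>(gverts G - gverts \<delta>)" using v by blast
  qed
  show "partition_on (halfs G - halfs \<delta> \<union> external \<delta>) (insert (external \<delta>) (gverts G - gverts \<delta>))"
    unfolding partition_on_def
  proof (intro conjI)
    show "\<Union>(insert (external \<delta>) (gverts G - gverts \<delta>)) = halfs G - halfs \<delta> \<union> external \<delta>" using un by auto
    show "{} \<notin> insert (external \<delta>) (gverts G - gverts \<delta>)"
      using \<open>external \<delta> \<noteq> {}\<close> pregraph_vert_nonempty[OF G] by blast
    have "v \<inter> external \<delta> = {}" if "v \<in> gverts G - gverts \<delta>" for v
      using un that external_subset[of \<delta>] by blast
    moreover have "disjoint (gverts G - gverts \<delta>)"
      using G unfolding pregraph_def partition_on_def by (meson Diff_subset pairwise_subset)
    ultimately show "disjoint (insert (external \<delta>) (gverts G - gverts \<delta>))"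
      unfolding pairwise_insert disjnt_def by blast
  qed
  show "card (external \<delta>) = 3" by (rule three)
  show "card v = 3" if "v \<in> gverts G - gverts \<delta>" for v using that pregraph_vert_card[OF G] by blast
  show "disjoint (gedges G - gedges \<delta>)" using G unfolding pregraph_def by (meson Diff_subset pairwise_subset)
  show "e \<subseteq> halfs G - halfs \<delta> \<union> external \<delta>" "card e = 2" if "e \<in> gedges G - gedges \<delta>" for e
    using that edge_outside[of e] G by (auto simp: pregraph_def)
qed

lemma external_contract_three: "external (contract G \<delta>) = external G"
proof (intro set_eqI iffI)
  fix x assume x: "x \<in> external (contract G \<delta>)"
  then have H: "x \<in> halfs G - halfs \<delta> \<or> x \<in> external \<delta>" "\<forall>e\<in>gedges G - gedges \<delta>. x \<notin> e"
    using externalD[OF x] external_edgeD[OF x] by (simp_all add: contract_three[OF nd three])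
  have "x \<notin> e" if "e \<in> gedges \<delta>" for e
    using H(1) that pregraph_edge_subset[OF pre that] by (auto simp: external_iff)
  moreover have "x \<in> halfs G" using H(1) externalD[of x \<delta>] subs(1) by blast
  ultimately show "x \<in> external G" using H(2) unfolding external_iff[of x G] by blast
next
  fix x assume x: "x \<in> external G"
  then have "x \<in> halfs G - halfs \<delta> \<or> x \<in> external \<delta>" using external_in_sub[of x] externalD[of x G] by blast
  then show "x \<in> external (contract G \<delta>)"
    using external_edgeD[OF x] by (intro externalI) (simp_all add: contract_three[OF nd three])
qed

text \<open>The map \<pi> sends the half-edges lost by contraction to one leg q, so links inside
  \<delta> become links at the new vertex. Conversely, two legs linked at the new vertex stay
  connected inside \<delta> even after D is deleted; this is where the inseparability of the legs
  enters, for D a single edge.\<close>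

lemma conn_contract_three:
  assumes legs: "\<And>x y. x \<in> external \<delta> \<Longrightarrow> y \<in> external \<delta> \<Longrightarrow> (x, y) \<in> conn (del_edges \<delta> D)"
    and h: "h \<in> halfs (contract G \<delta>)" and k: "k \<in> halfs (contract G \<delta>)"
  shows "(h, k) \<in> conn (del_edges G D) \<longleftrightarrow> (h, k) \<in> conn (del_edges (contract G \<delta>) D)"
proof -
  let ?G' = "contract G \<delta>"
  note eq = contract_three[OF nd three]
  obtain q where q: "q \<in> external \<delta>" using three by fastforce
  define \<pi> where "\<pi> x = (if x \<in> halfs ?G' then x else q)" for x
  have \<pi>_sub: "\<pi> x \<in> external \<delta>" if "x \<in> halfs \<delta>" for x using that q by (auto simp: \<pi>_def eq)
  have \<pi>_out: "\<pi> x = x" if "x \<in> halfs ?G'" for x using that by (simp add: \<pi>_def)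
  have inner: "(\<pi> x, \<pi> y) \<in> linked (del_edges ?G' D)" if "x \<in> halfs \<delta>" "y \<in> halfs \<delta>" for x y
    by (rule linkedI[of "external \<delta>"]) (use \<pi>_sub that in \<open>auto simp: eq\<close>)
  show ?thesis
  proof (rule conn_project)
    fix x y assume "(x, y) \<in> linked (del_edges G D)"
    then have "(\<pi> x, \<pi> y) \<in> linked (del_edges ?G' D)"
    proof (cases rule: linkedE)
      case (1 v)
      then have v: "v \<in> gverts G" by simp
      show ?thesis
      proof (cases "v \<in> gverts \<delta>")
        case True
        then show ?thesis using inner 1 pregraph_vert_subset[OF pre] by blast
      next
        case False
        then have "x \<notin> halfs \<delta>" "y \<notin> halfs \<delta>" using vert_in_sub[OF v] 1 by blast+
        moreover have "x \<in> halfs G" "y \<in> halfs G" using pregraph_vert_subset[OF G v] 1 by blast+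
        ultimately have "\<pi> x = x" "\<pi> y = y" using \<pi>_out by (auto simp: eq)
        moreover have "v \<in> gverts (del_edges ?G' D)" using v False by (simp add: eq)
        ultimately show ?thesis using 1 linkedI by (metis UnI1)
      qed
    next
      case (2 e)
      then have e: "e \<in> gedges G" "e \<notin> D" by simp_all
      show ?thesis
      proof (cases "e \<in> gedges \<delta>")
        case True
        then show ?thesis using inner 2 pregraph_edge_subset[OF pre] by blast
      next
        case False
        then have "x \<in> halfs ?G'" "y \<in> halfs ?G'" using edge_outside[OF e(1)] 2 by (auto simp: eq)
        then have "\<pi> x = x" "\<pi> y = y" using \<pi>_out by auto
        moreover have "e \<in> gedges (del_edges ?G' D)" using e False by (simp add: eq)
        ultimately show ?thesis using 2 linkedI by (metis UnI2)
      qed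
    qed
    then show "(\<pi> x, \<pi> y) \<in> conn (del_edges ?G' D)" by blast
  next
    have mono: "conn (del_edges \<delta> D) \<subseteq> conn (del_edges G D)" using subs by (intro conn_mono) auto
    fix x y assume "(x, y) \<in> linked (del_edges ?G' D)"
    then show "(x, y) \<in> conn (del_edges G D)"
    proof (cases rule: linkedE)
      case (1 v)
      then consider "v \<in> gverts G" | "v = external \<delta>" by (auto simp: eq)
      then show ?thesis
      proof cases
        case 1
        then show ?thesis using \<open>x \<in> v\<close> \<open>y \<in> v\<close> by (intro r_into_rtrancl linkedI[of v]) auto
      next
        case 2
        then show ?thesis using legs \<open>x \<in> v\<close> \<open>y \<in> v\<close> mono by blast
      qed
    next
      case (2 e)
      then show ?thesis by (intro r_into_rtrancl linkedI[of e]) (auto simp: eq)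
    qed
  qed (use \<pi>_out h k in auto)
qed

lemma locally_feynman_contract_three: "locally_feynman G \<longleftrightarrow> locally_feynman (contract G \<delta>)"
proof (rule locally_feynman_transfer)
  let ?G' = "contract G \<delta>"
  note eq = contract_three[OF nd three]
  show "external ?G' = external G" by (rule external_contract_three)
  show "halfs ?G' \<subseteq> halfs G" using subs(1) external_subset[of \<delta>] by (auto simp: eq)
  have legs0: "(x, y) \<in> conn (del_edges \<delta> {})" if "x \<in> external \<delta>" "y \<in> external \<delta>" for x y
    using con[OF externalD externalD] that unfolding del_edges_empty .
  have c0: "(h, k) \<in> conn G \<longleftrightarrow> (h, k) \<in> conn ?G'" if "h \<in> halfs ?G'" "k \<in> halfs ?G'" for h k
    using conn_contract_three[OF legs0 that] unfolding del_edges_empty .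
  then show "(h, k) \<in> conn G \<longleftrightarrow> (h, k) \<in> conn ?G'" if "h \<in> halfs ?G'" "k \<in> halfs ?G'" for h k
    using that by blast
  obtain q where q: "q \<in> external \<delta>" using three by fastforce
  show "\<exists>k\<in>halfs ?G'. (h, k) \<in> conn G" if "h \<in> halfs G" for h
  proof (cases "h \<in> halfs \<delta>")
    case True
    then have "(h, q) \<in> conn G" by (rule con_G[OF _ externalD[OF q]])
    then show ?thesis using q by (auto simp: eq)
  qed (use that in \<open>auto simp: eq\<close>)
  show "(\<forall>v\<in>gverts G. \<not> v \<subseteq> external G) \<longleftrightarrow> (\<forall>v\<in>gverts ?G'. \<not> v \<subseteq> external G)"
  proof -
    \<comment> \<open>A half-edge of \<delta> external in G is a leg of \<delta>, so vertices of
      \<delta> meet the condition already. The new vertex meets it because \<delta> is not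
      detached.\<close>
    have "\<not> v \<subseteq> external G" if "v \<in> gverts \<delta>" for v
      using no_external_vert[OF that] external_in_sub pregraph_vert_subset[OF pre that] by blast
    then show ?thesis using nd subs(2) by (auto simp: eq)
  qed
  have c1: "(h, k) \<in> conn (del_edges G {e}) \<longleftrightarrow> (h, k) \<in> conn (del_edges ?G' {e})"
    if "h \<in> halfs ?G'" "k \<in> halfs ?G'" for h k e
    using conn_contract_three[OF legs_conn that] .
  show "(\<exists>e'\<in>gedges ?G'. \<forall>h\<in>halfs ?G'. \<forall>k\<in>halfs ?G'.
        (h, k) \<in> conn (del_edges G {e}) \<longleftrightarrow> (h, k) \<in> conn (del_edges ?G' {e'})) \<or>
      (\<forall>h\<in>halfs ?G'. \<forall>k\<in>halfs ?G'. (h, k) \<in> conn (del_edges G {e}) \<longleftrightarrow> (h, k) \<in> conn ?G')"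
    if "e \<in> gedges G" for e
  proof (cases "e \<in> gedges \<delta>")
    case True
    then have "del_edges ?G' {e} = ?G'" by (simp add: eq)
    then show ?thesis using c1[of _ _ e] by auto
  next
    case False
    then have "e \<in> gedges ?G'" using that by (simp add: eq)
    then show ?thesis using c1[of _ _ e] by blast
  qed
  show "\<exists>e\<in>gedges G. \<forall>h\<in>halfs ?G'. \<forall>k\<in>halfs ?G'.
        (h, k) \<in> conn (del_edges G {e}) \<longleftrightarrow> (h, k) \<in> conn (del_edges ?G' {e'})" if "e' \<in> gedges ?G'" for e'
  proof -
    have "e' \<in> gedges G" using that by (simp add: eq)
    then show ?thesis using c1[of _ _ e'] by blast
  qed
qed

end

end

subsection \<open>Subgraphs with two legs\<close>

text \<open>Contraction replaces the edges {p, a} and {q, b} by {a, b}. Naming the half-edges makes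
  the situation symmetric under \<open>swapped\<close>, which halves later case
  distinctions.\<close>

locale leg_pair = subgraph_contraction +
  fixes p q a b
  assumes legs: "external \<delta> = {p, q}" "p \<noteq> q"
    and pa: "{p, a} \<in> gedges G" and qb: "{q, b} \<in> gedges G"
    and a: "a \<notin> halfs \<delta>" and b: "b \<notin> halfs \<delta>"
begin

lemma swapped: "leg_pair S \<delta> G q p b a"
  using legs pa qb a b by unfold_locales auto

lemma pq_halfs: "p \<in> halfs \<delta>" "q \<in> halfs \<delta>"
  using externalD[of _ \<delta>] legs by auto

lemma ab_halfs: "a \<in> halfs G" "b \<in> halfs G"
  using pregraph_edge_subset[OF G pa] pregraph_edge_subset[OF G qb] by auto

lemma ab_distinct: "a \<noteq> b"
proof
  assume "a = b"
  then have "{a, p} \<in> gedges G" "{a, q} \<in> gedges G" using pa qb by (simp_all add: insert_commute)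
  then show False using pregraph_mates_unique[OF G] legs(2) by blast
qed

lemma not_detached: "\<not> external \<delta> \<subseteq> external G"
  using legs external_edgeD[OF _ pa, of p] by auto

lemma card_legs: "card (external \<delta>) = 2"
  using legs by simp

lemma edge_cases:
  assumes "e \<in> gedges G"
  obtains "e \<in> gedges \<delta>" | "e = {p, a}" | "e = {q, b}" | "e \<inter> halfs \<delta> = {}"
proof (cases "e \<in> gedges \<delta> \<or> e \<inter> halfs \<delta> = {}")
  case False
  then obtain x where x: "x \<in> e" "x \<in> halfs \<delta>" by blast
  then have "x = p \<or> x = q" using edge_at_sub[OF assms _ x] False legs by blast
  then have "e = {p, a} \<or> e = {q, b}"
    using pregraph_edge_eq[OF G assms pa, of p] pregraph_edge_eq[OF G assms qb, of q] x(1) by auto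
  then show thesis using that by blast
qed (use that in blast)

lemma crossing_not_sub: "{p, a} \<notin> gedges \<delta>" "{q, b} \<notin> gedges \<delta>"
  using pregraph_edge_subset[OF pre] a b by auto

lemma neighbours_eq: "neighbours G \<delta> = {a, b}"
proof (intro subset_antisym subsetI)
  fix k assume "k \<in> neighbours G \<delta>"
  then obtain h where h: "k \<in> halfs G" "k \<notin> halfs \<delta>" "h \<in> {p, q}" "{h, k} \<in> gedges G"
    by (auto simp: neighbours_def legs)
  then show "k \<in> {a, b}" using pregraph_mates_unique[OF G] pa qb by blast
qed (use legs pa qb a b ab_halfs in \<open>auto simp: neighbours_def\<close>)

lemma contract_two: "contract G \<delta> = \<lparr>halfs = halfs G - halfs \<delta>, gverts = gverts G - gverts \<delta>,
    gedges = {e \<in> gedges G. e \<inter> halfs \<delta> = {}} \<union> {{a, b}}\<rparr>"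
  using not_detached component_iff card_legs neighbours_eq by (simp add: contract_def)

lemma no_external: "x \<in> external G \<Longrightarrow> x \<notin> halfs \<delta>"
  using external_in_sub[of x] legs external_edgeD[OF _ pa, of x] external_edgeD[OF _ qb, of x] by auto

lemma far_edge: "e \<in> gedges G \<Longrightarrow> e \<inter> halfs \<delta> = {} \<Longrightarrow> a \<notin> e \<and> b \<notin> e"
  using pregraph_edge_eq[OF G _ pa, of e a] pregraph_edge_eq[OF G _ qb, of e b] pq_halfs by blast

text \<open>In G the half-edge a is already joined to p, so it has no edge to b. Thus the edge
  created by the contraction can be told apart from edges of G.\<close>

lemma new_edge_not_old: "{a, b} \<notin> gedges G"
  using far_edge[of "{a, b}"] a b by auto

lemma pregraph_contract_two: "pregraph (contract G \<delta>)"
  unfolding contract_two pregraph_def lgraph.simps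
proof (intro conjI ballI)
  show "finite (halfs G - halfs \<delta>)" using pregraph_finite[OF G] by auto
  show "partition_on (halfs G - halfs \<delta>) (gverts G - gverts \<delta>)"
    unfolding partition_on_def
  proof (intro conjI subset_antisym subsetI)
    fix x assume "x \<in> \<Union>(gverts G - gverts \<delta>)"
    then obtain v where v: "v \<in> gverts G" "v \<notin> gverts \<delta>" "x \<in> v" by blast
    then show "x \<in> halfs G - halfs \<delta>" using vert_in_sub[OF v(1,3)] pregraph_vert_subset[OF G v(1)] by blast
  next
    fix x assume x: "x \<in> halfs G - halfs \<delta>"
    then obtain v where v: "v \<in> gverts G" "x \<in> v" using pregraph_vertE[OF G, of x] by blast
    then have "v \<notin> gverts \<delta>" using x pregraph_vert_subset[OF pre, of v] by blast
    then show "x \<in> \<Union>(gverts G - gverts \<delta>)" using v by blast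
  next
    show "disjoint (gverts G - gverts \<delta>)"
      using G unfolding pregraph_def partition_on_def by (meson Diff_subset pairwise_subset)
    show "{} \<notin> gverts G - gverts \<delta>" using pregraph_vert_nonempty[OF G] by blast
  qed
  show "card v = 3" if "v \<in> gverts G - gverts \<delta>" for v using that pregraph_vert_card[OF G] by blast
  have "disjoint {e \<in> gedges G. e \<inter> halfs \<delta> = {}}"
    using G unfolding pregraph_def by (auto intro: pairwise_subset)
  moreover have "{a, b} \<inter> e = {}" if "e \<in> {e \<in> gedges G. e \<inter> halfs \<delta> = {}}" for e
    using far_edge that by blast
  ultimately show "disjoint ({e \<in> gedges G. e \<inter> halfs \<delta> = {}} \<union> {{a, b}})"
    unfolding Un_insert_right Un_empty_right pairwise_insert disjnt_def by blast
  fix e assume e: "e \<in> {e \<in> gedges G. e \<inter> halfs \<delta> = {}} \<union> {{a, b}}"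
  show "e \<subseteq> halfs G - halfs \<delta>" "card e = 2"
    using e pregraph_edge_subset[OF G, of e] G ab_halfs a b ab_distinct by (auto simp: pregraph_def)
qed

lemma external_contract_two: "external (contract G \<delta>) = external G"
proof (intro set_eqI iffI)
  fix x assume x: "x \<in> external (contract G \<delta>)"
  then have H: "x \<in> halfs G" "x \<notin> halfs \<delta>" "x \<noteq> a" "x \<noteq> b"
    "\<And>e. e \<in> gedges G \<Longrightarrow> e \<inter> halfs \<delta> = {} \<Longrightarrow> x \<notin> e"
    using externalD[OF x] external_edgeD[OF x] by (auto simp: contract_two)
  show "x \<in> external G"
  proof (rule externalI[OF H(1)])
    fix e assume e: "e \<in> gedges G"
    then show "x \<notin> e"
    proof (cases rule: edge_cases)
      case 1
      then show ?thesis using pregraph_edge_subset[OF pre 1] H(2) by blast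
    qed (use H pq_halfs e in auto)
  qed
next
  fix x assume x: "x \<in> external G"
  have "x \<noteq> a" "x \<noteq> b" using external_edgeD[OF x pa] external_edgeD[OF x qb] by auto
  then show "x \<in> external (contract G \<delta>)"
    using externalD[OF x] external_edgeD[OF x] no_external[OF x] by (intro externalI) (auto simp: contract_two)
qed

text \<open>The set D deleted in G has to match the set D' deleted in \<open>G/\<delta>\<close>. The
  retraction collapses \<delta> to a, so {p, a} becomes a point and {q, b} becomes {a, b}; this is
  why \<open>cut\<close> asks for {q, b}, while cutting {p, a} is obtained by exchanging the
  legs.\<close>

lemma conn_contract_two:
  assumes far: "\<And>e. e \<in> gedges G \<Longrightarrow> e \<inter> halfs \<delta> = {} \<Longrightarrow> e \<in> D \<longleftrightarrow> e \<in> D'"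
    and kept: "{a, b} \<notin> D' \<Longrightarrow> {p, a} \<notin> D \<and> {q, b} \<notin> D \<and> (p, q) \<in> conn (del_edges \<delta> D)"
    and cut: "{a, b} \<in> D' \<Longrightarrow> {q, b} \<in> D"
    and h: "h \<in> halfs (contract G \<delta>)" and k: "k \<in> halfs (contract G \<delta>)"
  shows "(h, k) \<in> conn (del_edges G D) \<longleftrightarrow> (h, k) \<in> conn (del_edges (contract G \<delta>) D')"
proof -
  let ?G' = "contract G \<delta>"
  define \<pi> where "\<pi> x = (if x \<in> halfs \<delta> then a else x)" for x
  have \<pi>_sub: "\<pi> x = a" if "x \<in> halfs \<delta>" for x using that by (simp add: \<pi>_def)
  have \<pi>_out: "\<pi> x = x" if "x \<notin> halfs \<delta>" for x using that by (simp add: \<pi>_def)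
  show ?thesis
  proof (rule conn_project)
    fix x y assume "(x, y) \<in> linked (del_edges G D)"
    then show "(\<pi> x, \<pi> y) \<in> conn (del_edges ?G' D')"
    proof (cases rule: linkedE)
      case (1 v)
      then have v: "v \<in> gverts G" by simp
      show ?thesis
      proof (cases "v \<in> gverts \<delta>")
        case True
        then have "\<pi> x = a" "\<pi> y = a" using \<pi>_sub pregraph_vert_subset[OF pre True] 1 by blast+
        then show ?thesis by simp
      next
        case False
        then have "x \<notin> halfs \<delta>" "y \<notin> halfs \<delta>" using vert_in_sub[OF v] 1 by blast+
        then have "\<pi> x = x" "\<pi> y = y" using \<pi>_out by auto
        moreover have "v \<in> gverts (del_edges ?G' D')" using v False by (simp add: contract_two)
        ultimately show ?thesis using linkedI[of v "del_edges ?G' D'" x y] 1 by auto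
      qed
    next
      case (2 e)
      then have e: "e \<in> gedges G" "e \<notin> D" by simp_all
      from e(1) show ?thesis
      proof (cases rule: edge_cases)
        case 1
        then have "\<pi> x = a" "\<pi> y = a" using \<pi>_sub pregraph_edge_subset[OF pre 1] 2 by blast+
        then show ?thesis by simp
      next
        case pa: 2
        then have "\<pi> x = a" "\<pi> y = a" using \<pi>_sub \<pi>_out pq_halfs a 2 by auto
        then show ?thesis by simp
      next
        case qb: 3
        then have "{a, b} \<in> gedges (del_edges ?G' D')" using cut e(2) by (auto simp: contract_two)
        moreover have "\<pi> x \<in> {a, b}" "\<pi> y \<in> {a, b}" using \<pi>_sub \<pi>_out pq_halfs b 2 qb by auto
        ultimately show ?thesis using linkedI[of "{a, b}" "del_edges ?G' D'" "\<pi> x" "\<pi> y"] by blast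
      next
        case 4
        then have "x \<notin> halfs \<delta>" "y \<notin> halfs \<delta>" using 2 by blast+
        then have "\<pi> x = x" "\<pi> y = y" using \<pi>_out by auto
        moreover have "e \<in> gedges (del_edges ?G' D')" using e 4 far by (auto simp: contract_two)
        ultimately show ?thesis using linkedI[of e "del_edges ?G' D'" x y] 2 by auto
      qed
    qed
  next
    have mono: "conn (del_edges \<delta> D) \<subseteq> conn (del_edges G D)" using subs by (intro conn_mono) auto
    fix x y assume "(x, y) \<in> linked (del_edges ?G' D')"
    then show "(x, y) \<in> conn (del_edges G D)"
    proof (cases rule: linkedE)
      case (1 v)
      then show ?thesis using linkedI[of v "del_edges G D" x y] by (auto simp: contract_two)
    next
      case (2 e)
      then consider "e = {a, b}" "e \<notin> D'" | "e \<in> gedges G" "e \<inter> halfs \<delta> = {}" "e \<notin> D'"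
        by (auto simp: contract_two)
      then show ?thesis
      proof cases
        case 1
        then have k: "{p, a} \<notin> D" "{q, b} \<notin> D" "(p, q) \<in> conn (del_edges \<delta> D)" using kept by auto
        then have "(a, p) \<in> conn (del_edges G D)" "(q, b) \<in> conn (del_edges G D)"
          using linkedI[of "{p, a}" "del_edges G D" a p] linkedI[of "{q, b}" "del_edges G D" q b] pa qb by auto
        moreover have "(p, q) \<in> conn (del_edges G D)" using k(3) mono by blast
        ultimately have ab: "(a, b) \<in> conn (del_edges G D)" by (meson rtrancl_trans)
        then have "(b, a) \<in> conn (del_edges G D)" by (rule conn_sym)
        then show ?thesis using ab 1 2 by auto
      next
        case e: 2
        then have "e \<in> gedges (del_edges G D)" using far by auto
        then show ?thesis using linkedI[of e "del_edges G D" x y] 2 by auto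
      qed
    qed
  qed (use \<pi>_out h k in \<open>auto simp: contract_two\<close>)
qed

lemma conn_contract_two':
  assumes h: "h \<in> halfs (contract G \<delta>)" and k: "k \<in> halfs (contract G \<delta>)"
  shows "(h, k) \<in> conn G \<longleftrightarrow> (h, k) \<in> conn (contract G \<delta>)"
proof -
  have "(p, q) \<in> conn (del_edges \<delta> {})" using con[OF pq_halfs] unfolding del_edges_empty .
  then show ?thesis using conn_contract_two[of "{}" "{}" h k, OF _ _ _ h k] unfolding del_edges_empty by simp
qed

lemma conn_cut_leg:
  assumes "h \<in> halfs (contract G \<delta>)" "k \<in> halfs (contract G \<delta>)"
  shows "(h, k) \<in> conn (del_edges G {{q, b}}) \<longleftrightarrow> (h, k) \<in> conn (del_edges (contract G \<delta>) {{a, b}})"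
proof (rule conn_contract_two[OF _ _ _ assms])
  show "e \<in> {{q, b}} \<longleftrightarrow> e \<in> {{a, b}}" if "e \<in> gedges G" "e \<inter> halfs \<delta> = {}" for e
    using that pq_halfs new_edge_not_old by auto
qed auto

text \<open>Deleting {p, a} or {q, b} has the effect of deleting the new edge {a, b}, deleting an
  edge inside \<delta> has no effect after contraction, and every other edge corresponds to
  itself.\<close>

lemma locally_feynman_contract_two: "locally_feynman G \<longleftrightarrow> locally_feynman (contract G \<delta>)"
proof (rule locally_feynman_transfer)
  let ?G' = "contract G \<delta>"
  show "external ?G' = external G" by (rule external_contract_two)
  show "halfs ?G' \<subseteq> halfs G" by (auto simp: contract_two)
  show "(h, k) \<in> conn G \<longleftrightarrow> (h, k) \<in> conn ?G'" if "h \<in> halfs ?G'" "k \<in> halfs ?G'" for h k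
    using conn_contract_two'[OF that] .
  show "\<exists>k\<in>halfs ?G'. (h, k) \<in> conn G" if "h \<in> halfs G" for h
  proof (cases "h \<in> halfs \<delta>")
    case True
    then have "(h, p) \<in> conn G" using con_G pq_halfs by blast
    moreover have "(p, a) \<in> linked G" using linkedI[of "{p, a}" G p a] pa by simp
    ultimately have "(h, a) \<in> conn G" by (rule rtrancl_into_rtrancl)
    then show ?thesis using ab_halfs a by (auto simp: contract_two)
  qed (use that in \<open>auto simp: contract_two\<close>)
  show "(\<forall>v\<in>gverts G. \<not> v \<subseteq> external G) \<longleftrightarrow> (\<forall>v\<in>gverts ?G'. \<not> v \<subseteq> external G)"
  proof -
    have "\<not> v \<subseteq> external G" if v: "v \<in> gverts \<delta>" for v
    proof -
      obtain x where "x \<in> v" using pregraph_vert_nonempty[OF pre v] by blast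
      then show ?thesis using no_external[of x] pregraph_vert_subset[OF pre v] by blast
    qed
    then show ?thesis using subs(2) by (auto simp: contract_two)
  qed
  interpret sw: leg_pair S \<delta> G q p b a by (rule swapped)
  have cut2: "(h, k) \<in> conn (del_edges G {{p, a}}) \<longleftrightarrow> (h, k) \<in> conn (del_edges ?G' {{a, b}})"
    if "h \<in> halfs ?G'" "k \<in> halfs ?G'" for h k
    using sw.conn_cut_leg[OF that] by (simp add: insert_commute)
  have far: "(h, k) \<in> conn (del_edges G {e}) \<longleftrightarrow> (h, k) \<in> conn (del_edges ?G' {e})"
    if hk: "h \<in> halfs ?G'" "k \<in> halfs ?G'" and e: "e \<in> gedges G" "e \<inter> halfs \<delta> = {}" for h k e
  proof (rule conn_contract_two[OF _ _ _ hk])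
    show "{a, b} \<notin> {e} \<Longrightarrow> {p, a} \<notin> {e} \<and> {q, b} \<notin> {e} \<and> (p, q) \<in> conn (del_edges \<delta> {e})"
      using legs_conn[of p q e] legs e(2) pq_halfs by auto
    show "{a, b} \<in> {e} \<Longrightarrow> {q, b} \<in> {e}" using new_edge_not_old e(1) by simp
  qed simp
  have inner: "(h, k) \<in> conn (del_edges G {e}) \<longleftrightarrow> (h, k) \<in> conn ?G'"
    if hk: "h \<in> halfs ?G'" "k \<in> halfs ?G'" and e: "e \<in> gedges \<delta>" for h k e
  proof -
    have "(h, k) \<in> conn (del_edges G {e}) \<longleftrightarrow> (h, k) \<in> conn (del_edges ?G' {})"
    proof (rule conn_contract_two[OF _ _ _ hk])
      show "f \<in> {e} \<longleftrightarrow> f \<in> {}" if "f \<in> gedges G" "f \<inter> halfs \<delta> = {}" for f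
        using that e pregraph_edge_subset[OF pre e] pregraph_edge_nonempty[OF pre e] by auto
      show "{p, a} \<notin> {e} \<and> {q, b} \<notin> {e} \<and> (p, q) \<in> conn (del_edges \<delta> {e})"
        using legs_conn[of p q e] legs crossing_not_sub e by auto
    qed simp
    then show ?thesis unfolding del_edges_empty .
  qed
  have new: "{a, b} \<in> gedges ?G'" by (simp add: contract_two)
  show "(\<exists>e'\<in>gedges ?G'. \<forall>h\<in>halfs ?G'. \<forall>k\<in>halfs ?G'.
        (h, k) \<in> conn (del_edges G {e}) \<longleftrightarrow> (h, k) \<in> conn (del_edges ?G' {e'})) \<or>
      (\<forall>h\<in>halfs ?G'. \<forall>k\<in>halfs ?G'. (h, k) \<in> conn (del_edges G {e}) \<longleftrightarrow> (h, k) \<in> conn ?G')"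
    if e: "e \<in> gedges G" for e
    using e
  proof (cases rule: edge_cases)
    case 1
    then show ?thesis using inner by blast
  next
    case 2
    then show ?thesis using cut2 new by blast
  next
    case 3
    then show ?thesis using conn_cut_leg new by blast
  next
    case 4
    then have "e \<in> gedges ?G'" using e by (simp add: contract_two)
    then show ?thesis using far[OF _ _ e 4] by blast
  qed
  show "\<exists>e\<in>gedges G. \<forall>h\<in>halfs ?G'. \<forall>k\<in>halfs ?G'.
        (h, k) \<in> conn (del_edges G {e}) \<longleftrightarrow> (h, k) \<in> conn (del_edges ?G' {e'})" if e': "e' \<in> gedges ?G'" for e'
  proof (cases "e' = {a, b}")
    case True
    then show ?thesis using conn_cut_leg qb by blast
  next
    case False
    then have "e' \<in> gedges G" "e' \<inter> halfs \<delta> = {}" using e' by (auto simp: contract_two)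
    then show ?thesis using far by blast
  qed
qed

end

section \<open>Attachment of two-legged subgraphs and the Feynman property under contraction\<close>

context subgraph_contraction
begin

text \<open>G is a mere pregraph here, and the information comes from the contraction: if it is a
  pregraph, its new edge has two elements, and by uniqueness of partners these belong to different
  legs.\<close>

lemma leg_pair_of_neighbours:
  assumes two: "card (external \<delta>) = 2" and nb: "card (neighbours G \<delta>) = 2"
  shows "\<exists>p q a b. leg_pair S \<delta> G p q a b"
proof -
  obtain a b where ab: "neighbours G \<delta> = {a, b}" "a \<noteq> b" using nb by (meson card_2_iff)
  then have "a \<in> neighbours G \<delta>" "b \<in> neighbours G \<delta>" by auto
  then obtain p q where p: "p \<in> external \<delta>" "{p, a} \<in> gedges G" "a \<notin> halfs \<delta>"
    and q: "q \<in> external \<delta>" "{q, b} \<in> gedges G" "b \<notin> halfs \<delta>"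
    unfolding neighbours_def by auto
  have "p \<noteq> q" using pregraph_mates_unique[OF G] p(2) q(2) ab(2) by blast
  then have ext: "external \<delta> = {p, q}" using two p(1) q(1) finite_external
    by (metis card_2_iff card_subset_eq empty_subsetI insert_subset)
  have "leg_pair S \<delta> G p q a b"
    by unfold_locales (fact ext \<open>p \<noteq> q\<close> p(2,3) q(2,3))+
  then show ?thesis by blast
qed

text \<open>A two-legged subgraph attached to the rest of \<open>G\<close> by only one leg would separate the legs of \<open>G\<close>.\<close>

lemma leg_pair_of_feynman:
  assumes lf: "locally_feynman G" and two: "card (external \<delta>) = 2" and nd: "\<not> external \<delta> \<subseteq> external G"
  shows "\<exists>p q a b. leg_pair S \<delta> G p q a b"
proof -
  obtain p where p: "p \<in> external \<delta>" "p \<notin> external G" using nd by blast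
  have "card (external \<delta> - {p}) = 1" using two p(1) by simp
  then obtain q where q': "external \<delta> - {p} = {q}" by (rule card_1_singletonE)
  then have pq: "external \<delta> = {p, q}" "p \<noteq> q" using p(1) by auto
  have ph: "p \<in> halfs \<delta>" "q \<in> halfs \<delta>" using pq externalD[of _ \<delta>] by auto
  obtain e where e: "e \<in> gedges G" "p \<in> e" using p(2) ph subs(1) by (auto simp: external_iff)
  then obtain a where a: "e = {p, a}" "p \<noteq> a" by (rule pregraph_edgeE[OF G])
  have pa: "{p, a} \<in> gedges G" using e a by simp
  have outer: "x = p \<or> x = q" if "e \<in> gedges G" "e \<notin> gedges \<delta>" "x \<in> e" "x \<in> halfs \<delta>" for e x
    using edge_at_sub[OF that] pq by blast
  have paD: "{p, a} \<notin> gedges \<delta>" using external_edgeD[OF p(1)] by blast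
  have F1: "card (external G \<inter> conn G `` {h}) \<in> {2, 3}" if "h \<in> halfs G" for h
    using lf that by (simp add: locally_feynman_def)
  have edge_near: "e \<subseteq> halfs \<delta>" if "e \<in> gedges \<delta>" for e using pregraph_edge_subset[OF pre that] .
  \<comment> \<open>If the partner of p were in \<delta>, it would be the other leg q. Then no edge
    would leave \<delta>, and its component in G would have no external half-edge.\<close>
  have aout: "a \<notin> halfs \<delta>"
  proof
    assume "a \<in> halfs \<delta>"
    then have "a = q" using outer[OF pa paD] a(2) by blast
    then have pqe: "{p, q} \<in> gedges G" using pa by simp
    have cl: "closed_in G (halfs \<delta>)"
      unfolding closed_in_def
    proof (intro conjI ballI impI subs(1))
      fix x assume x: "x \<in> gverts G \<union> gedges G" "x \<inter> halfs \<delta> \<noteq> {}"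
      show "x \<subseteq> halfs \<delta>"
      proof (cases "x \<in> gverts G")
        case True
        then show ?thesis using vert_sub_iff[OF True] x(2) pregraph_vert_subset[OF pre] by blast
      next
        case False
        then have xe: "x \<in> gedges G" using x(1) by blast
        show ?thesis
        proof (cases "x \<in> gedges \<delta>")
          case False
          obtain y where y: "y \<in> x" "y \<in> halfs \<delta>" using x(2) by blast
          then have "y \<in> {p, q}" using outer[OF xe False] by blast
          then have "x = {p, q}" using pregraph_edge_eq[OF G xe pqe y(1)] by blast
          then show ?thesis using ph by blast
        qed (rule edge_near)
      qed
    qed
    have "external G \<inter> conn G `` {p} = {}"
    proof (rule ccontr)
      assume "external G \<inter> conn G `` {p} \<noteq> {}"
      then obtain x where x: "x \<in> external G" "(p, x) \<in> conn G" by blast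
      then have "x \<in> halfs \<delta>" using closed_in_conn[OF cl x(2) ph(1)] by blast
      then have "x \<in> {p, q}" using external_in_sub[OF x(1)] pq by blast
      then show False using external_edgeD[OF x(1) pqe] by blast
    qed
    then show False using F1[of p] ph subs(1) by auto
  qed
  have "q \<notin> external G"
  proof
    assume qx: "q \<in> external G"
    have qG: "q \<in> halfs G" using ph(2) subs(1) by blast
    \<comment> \<open>The component of q has at least two external half-edges, so there is another
      one, k. It lies outside \<delta>, and deleting {p, a} cuts \<delta> off from it, contrary to
      the inseparability of legs in G.\<close>
    have "\<exists>k. k \<in> external G \<inter> conn G `` {q} \<and> k \<noteq> q"
    proof (rule ccontr)
      assume "\<nexists>k. k \<in> external G \<inter> conn G `` {q} \<and> k \<noteq> q"
      then have "external G \<inter> conn G `` {q} \<subseteq> {q}" by blast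
      then have "card (external G \<inter> conn G `` {q}) \<le> 1" using card_mono[of "{q}"] by fastforce
      then show False using F1[OF qG] by auto
    qed
    then obtain k where k: "k \<in> external G" "(q, k) \<in> conn G" "k \<noteq> q" by blast
    have kout: "k \<notin> halfs \<delta>"
      using external_in_sub[OF k(1)] pq(1) k(3) p(2) k(1) by auto
    have qk: "(q, k) \<in> conn (del_edges G {{p, a}})"
      using lf pa qx k(1,2) by (simp add: locally_feynman_def)
    have cl: "closed_in (del_edges G {{p, a}}) (halfs \<delta>)"
      unfolding closed_in_def
    proof (intro conjI ballI impI)
      show "halfs \<delta> \<subseteq> halfs (del_edges G {{p, a}})" using subs(1) by simp
      fix x assume x: "x \<in> gverts (del_edges G {{p, a}}) \<union> gedges (del_edges G {{p, a}})" "x \<inter> halfs \<delta> \<noteq> {}"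
      show "x \<subseteq> halfs \<delta>"
      proof (cases "x \<in> gverts G")
        case True
        then show ?thesis using vert_sub_iff[OF True] x(2) pregraph_vert_subset[OF pre] by blast
      next
        case False
        then have xe: "x \<in> gedges G" "x \<noteq> {p, a}" using x(1) by auto
        show ?thesis
        proof (cases "x \<in> gedges \<delta>")
          case False
          obtain y where y: "y \<in> x" "y \<in> halfs \<delta>" using x(2) by blast
          then have "y = p \<or> y = q" using outer[OF xe(1) False] by blast
          moreover have "y \<noteq> p" using pregraph_edge_eq[OF G xe(1) pa y(1)] xe(2) by auto
          moreover have "y \<noteq> q" using external_edgeD[OF qx xe(1)] y(1) by blast
          ultimately show ?thesis by blast
        qed (rule edge_near)
      qed
    qed
    show False using closed_in_conn[OF cl qk ph(2)] kout by blast
  qed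
  then obtain f where f: "f \<in> gedges G" "q \<in> f" using ph(2) subs(1) by (auto simp: external_iff)
  then obtain b where b: "f = {q, b}" "q \<noteq> b" by (rule pregraph_edgeE[OF G])
  have qb: "{q, b} \<in> gedges G" using f b by simp
  have "b \<notin> halfs \<delta>"
  proof
    assume bD: "b \<in> halfs \<delta>"
    have "q \<in> external \<delta>" using pq by blast
    then have "{q, b} \<notin> gedges \<delta>" using external_edgeD[of q \<delta> "{q, b}"] by blast
    then have "b = p" using outer[OF qb _ _ bD] b(2) by blast
    then have "{p, q} \<in> gedges G" using qb by (simp add: insert_commute)
    then have "a = q" using pregraph_mates_unique[OF G pa] by blast
    then show False using aout ph(2) by blast
  qed
  then have "leg_pair S \<delta> G p q a b" using pq pa qb aout by unfold_locales auto
  then show ?thesis by blast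
qed

text \<open>Both directions matter: from left to right the quotient is an object, from right to left
  the lift of a subobject of the quotient is one.\<close>

lemma feynman_contract: "feynman S G \<longleftrightarrow> feynman S (contract G \<delta>)"
proof (cases "external \<delta> \<subseteq> external G")
  case True
  then show ?thesis by (rule feynman_contract_detached)
next
  case nd: False
  show ?thesis
  proof (cases "card (external \<delta>) = 3")
    case True
    note three = contract_three[OF nd True]
    have "halfs G \<subseteq> S \<longleftrightarrow> halfs (contract G \<delta>) \<subseteq> S"
      using feynman_halfs[OF feyn] external_subset[of \<delta>] by (auto simp: three)
    then show ?thesis
      using G pregraph_contract_three[OF nd True] locally_feynman_contract_three[OF nd True]
      by (simp add: feynman_iff)
  next
    case False
    then have two: "card (external \<delta>) = 2" using card_external by simp
    show ?thesis
    proof (cases "\<exists>p q a b. leg_pair S \<delta> G p q a b")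
      case True
      then obtain p q a b where "leg_pair S \<delta> G p q a b" by blast
      then interpret leg_pair S \<delta> G p q a b .
      have "halfs G \<subseteq> S \<longleftrightarrow> halfs (contract G \<delta>) \<subseteq> S"
        using feynman_halfs[OF feyn] by (auto simp: contract_two)
      then show ?thesis
        using G pregraph_contract_two locally_feynman_contract_two by (simp add: feynman_iff)
    next
      case none: False
      \<comment> \<open>Unless both legs have partners outside, the set of neighbours is not an
        edge. Then neither G nor its contraction is a Feynman graph, and the equivalence holds with
        both sides false.\<close>
      then have "\<not> locally_feynman G" using leg_pair_of_feynman[OF _ two nd] by blast
      moreover have "\<not> pregraph (contract G \<delta>)"
      proof
        assume pc: "pregraph (contract G \<delta>)"
        have "contract G \<delta> = \<lparr>halfs = halfs G - halfs \<delta>, gverts = gverts G - gverts \<delta>,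
            gedges = {e \<in> gedges G. e \<inter> halfs \<delta> = {}} \<union> {neighbours G \<delta>}\<rparr>"
          using nd component_iff False by (simp add: contract_def)
        then have "neighbours G \<delta> \<in> gedges (contract G \<delta>)" by simp
        then have "card (neighbours G \<delta>) = 2" using pc by (simp add: pregraph_def)
        then show False using leg_pair_of_neighbours[OF two] none by blast
      qed
      ultimately show ?thesis by (simp add: feynman_iff)
    qed
  qed
qed

end

subsection \<open>Subgraphs of a contraction\<close>

lemma subgraph_contractionI:
  "feynman S \<delta> \<Longrightarrow> connected_graph \<delta> \<Longrightarrow> feynman S G \<Longrightarrow> gsub \<delta> G \<Longrightarrow> subgraph_contraction S \<delta> G"
  by (simp add: subgraph_contraction_def feynman_pregraph)

context subgraph_contraction
begin

lemma contraction_cases: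
  assumes "locally_feynman G"
  obtains "external \<delta> \<subseteq> external G"
    | "\<not> external \<delta> \<subseteq> external G" "card (external \<delta>) = 3"
    | p q a b where "leg_pair S \<delta> G p q a b"
  using leg_pair_of_feynman[OF assms] card_external by blast

lemma neighbours_not_edge: "neighbours G \<delta> \<notin> gedges G"
proof
  assume N: "neighbours G \<delta> \<in> gedges G"
  then obtain k where k: "k \<in> neighbours G \<delta>" using pregraph_edge_nonempty[OF G] by blast
  then obtain h where h: "h \<in> external \<delta>" "{h, k} \<in> gedges G" by (auto simp: neighbours_def)
  then have "neighbours G \<delta> = {h, k}" using pregraph_edge_eq[OF G N, of "{h, k}" k] k by simp
  then have "h \<in> neighbours G \<delta>" by simp
  then show False using externalD[OF h(1)] by (simp add: neighbours_def)
qed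

lemma halfs_contract_cover: "halfs G \<subseteq> halfs \<delta> \<union> halfs (contract G \<delta>)"
  by (auto simp: contract_def)

lemma external_contract:
  assumes "locally_feynman G"
  shows "external (contract G \<delta>) = (if external \<delta> \<subseteq> external G then external G - halfs \<delta> else external G)"
  using assms
proof (cases rule: contraction_cases)
  case 1
  then show ?thesis
    using external_induced[OF closed_complement[OF 1]] external_subset[of G]
    by (auto simp: contract_detached_induced)
next
  case 2
  then show ?thesis using external_contract_three by simp
next
  case (3 p q a b)
  then show ?thesis using leg_pair.external_contract_two leg_pair.not_detached by metis
qed

text \<open>No vertex or edge of a graph disjoint from \<delta> meets \<delta>, so contraction
  leaves it intact. This keeps the remaining components available during successive
  contractions.\<close>

lemma gsub_contract_disjoint:
  assumes lf: "locally_feynman G" and \<tau>: "pregraph \<tau>" "gsub \<tau> G" and disj: "halfs \<tau> \<inter> halfs \<delta> = {}"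
  shows "gsub \<tau> (contract G \<delta>)"
proof -
  have H: "halfs \<tau> \<subseteq> halfs G - halfs \<delta>" using \<tau>(2) disj by (auto simp: gsub_def)
  have V: "gverts \<tau> \<subseteq> gverts G - gverts \<delta>"
  proof
    fix v assume v: "v \<in> gverts \<tau>"
    then have "v \<subseteq> halfs \<tau>" "v \<noteq> {}" using pregraph_vert_subset[OF \<tau>(1)] pregraph_vert_nonempty[OF \<tau>(1)] by auto
    then have "v \<notin> gverts \<delta>" using pregraph_vert_subset[OF pre, of v] disj by blast
    then show "v \<in> gverts G - gverts \<delta>" using \<tau>(2) v by (auto simp: gsub_def)
  qed
  have E: "e \<in> gedges G \<and> e \<notin> gedges \<delta> \<and> e \<inter> halfs \<delta> = {}" if e: "e \<in> gedges \<tau>" for e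
  proof -
    have "e \<subseteq> halfs \<tau>" "e \<noteq> {}" using e pregraph_edge_subset[OF \<tau>(1)] pregraph_edge_nonempty[OF \<tau>(1)] by auto
    then have "e \<inter> halfs \<delta> = {}" "e \<notin> gedges \<delta>" using pregraph_edge_subset[OF pre, of e] disj by blast+
    then show ?thesis using \<tau>(2) e by (auto simp: gsub_def)
  qed
  show ?thesis using lf
  proof (cases rule: contraction_cases)
    case 1
    then show ?thesis using H V E by (auto simp: gsub_def contract_detached)
  next
    case 2
    then show ?thesis using H V E by (auto simp: gsub_def contract_three)
  next
    case (3 p q a b)
    then show ?thesis using H V E by (auto simp: gsub_def leg_pair.contract_two)
  qed
qed

end

text \<open>The preimage of a subgraph \<open>T\<close> of \<open>G/\<delta>\<close>: vertices and edges of \<open>T\<close> created by the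
  contraction are replaced by \<open>\<delta>\<close> together with the edges of \<open>G\<close> attaching it.\<close>

definition lift_graph :: "'s lgraph \<Rightarrow> 's lgraph \<Rightarrow> 's lgraph \<Rightarrow> 's lgraph" where
  "lift_graph G \<delta> T = \<lparr>halfs = halfs T \<union> halfs \<delta>, gverts = (gverts T - {external \<delta>}) \<union> gverts \<delta>,
     gedges = (gedges T \<inter> gedges G) \<union> gedges \<delta> \<union>
       (if neighbours G \<delta> \<in> gedges T then {e \<in> gedges G. e \<inter> halfs \<delta> \<noteq> {} \<and> \<not> e \<subseteq> halfs \<delta>} else {})\<rparr>"

lemma (in leg_pair) crossing_edges:
  "{e \<in> gedges G. e \<inter> halfs \<delta> \<noteq> {} \<and> \<not> e \<subseteq> halfs \<delta>} = {{p, a}, {q, b}}"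
proof (intro subset_antisym subsetI)
  fix e assume e: "e \<in> {e \<in> gedges G. e \<inter> halfs \<delta> \<noteq> {} \<and> \<not> e \<subseteq> halfs \<delta>}"
  then have "e \<in> gedges G" by simp
  then show "e \<in> {{p, a}, {q, b}}"
  proof (cases rule: edge_cases)
    case 1
    then show ?thesis using e pregraph_edge_subset[OF pre] by blast
  qed (use e in auto)
qed (use pa qb pq_halfs a b in auto)

lemma leg_pair_gsub:
  assumes "leg_pair S \<delta> U p q a b" "gsub U G" "pregraph G"
  shows "leg_pair S \<delta> G p q a b"
proof -
  interpret leg_pair S \<delta> U p q a b by (rule assms(1))
  have *: "gsub \<delta> G" using sub assms(2) by (rule gsub_trans)
  have **: "{p, a} \<in> gedges G" "{q, b} \<in> gedges G" using pa qb assms(2) by (auto simp: gsub_def)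
  show ?thesis
    by unfold_locales (fact feyn connected assms(3) legs a b * **)+
qed

context
  fixes S :: "'s set" and \<delta> U G :: "'s lgraph"
  assumes \<delta>: "feynman S \<delta>" "connected_graph \<delta>" and U: "feynman S U" and G: "feynman S G"
    and \<delta>U: "gsub \<delta> U" and UG: "gsub U G"
begin

interpretation u: subgraph_contraction S \<delta> U
  using \<delta> U \<delta>U by (rule subgraph_contractionI)

interpretation g: subgraph_contraction S \<delta> G
  using \<delta> G gsub_trans[OF \<delta>U UG] by (rule subgraph_contractionI)

lemma detached_gsub: "external \<delta> \<subseteq> external G \<Longrightarrow> external \<delta> \<subseteq> external U"
  using UG u.subs(1) externalD[of _ \<delta>] by (fastforce simp: external_iff gsub_def)

lemma gsub_parts: "halfs U \<subseteq> halfs G" "gverts U \<subseteq> gverts G" "gedges U \<subseteq> gedges G"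
  using UG by (auto simp: gsub_def)

text \<open>\<delta> may be detached in U but attached in G; the vertex or edge created in
  \<open>G/\<delta>\<close> is then simply absent from \<open>U/\<delta>\<close>. If \<delta> is
  attached in U, it is attached in G in the same way, to the same half-edges.\<close>

lemma contract_mono: "gsub (contract U \<delta>) (contract G \<delta>)"
  using feynman_locally[OF U]
proof (cases rule: u.contraction_cases)
  case det: 1
  note Ueq = u.contract_detached[OF det]
  show ?thesis using feynman_locally[OF G]
  proof (cases rule: g.contraction_cases)
    case 1
    then show ?thesis using gsub_parts u.vert_sub_iff g.vert_sub_iff by (auto simp: gsub_def Ueq g.contract_detached)
  next
    case 2
    then show ?thesis using gsub_parts by (auto simp: gsub_def Ueq g.contract_three)
  next
    case (3 p q a b)
    then show ?thesis using gsub_parts u.detached_edges[OF det]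
      by (auto simp: gsub_def Ueq leg_pair.contract_two)
  qed
next
  case 2
  then have "\<not> external \<delta> \<subseteq> external G" using detached_gsub by blast
  then show ?thesis using 2 gsub_parts by (auto simp: gsub_def u.contract_three g.contract_three)
next
  case (3 p q a b)
  have "leg_pair S \<delta> G p q a b" using leg_pair_gsub[OF 3 UG feynman_pregraph[OF G]] .
  then show ?thesis using 3 gsub_parts by (auto simp: gsub_def leg_pair.contract_two)
qed

text \<open>The vertex and the edge that contraction can create do not occur in U, so their presence
  in \<open>U/\<delta>\<close> reveals how \<delta> is attached in U. In the two-legged case the
  edges put back are exactly the edges of G crossing the boundary of \<delta>.\<close>

lemma lift_contract: "lift_graph G \<delta> (contract U \<delta>) = U"
proof -
  have N: "neighbours G \<delta> \<notin> gedges U - gedges \<delta>" using g.neighbours_not_edge gsub_parts by blast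
  have ext: "external \<delta> \<notin> gverts U" by (rule u.external_not_vert)
  have *: "lift_graph G \<delta> (contract U \<delta>) = \<lparr>halfs = halfs U, gverts = gverts U, gedges = gedges U\<rparr>"
    using feynman_locally[OF U]
  proof (cases rule: u.contraction_cases)
    case 1
    have "halfs U - halfs \<delta> \<union> halfs \<delta> = halfs U" "gverts U - gverts \<delta> - {external \<delta>} \<union> gverts \<delta> = gverts U"
      "(gedges U - gedges \<delta>) \<inter> gedges G \<union> gedges \<delta> = gedges U"
      using u.subs gsub_parts ext by auto
    then show ?thesis
      unfolding lift_graph_def u.contract_detached[OF 1] lgraph.simps if_not_P[OF N] Un_empty_right by simp
  next
    case 2
    have "halfs U - halfs \<delta> \<union> external \<delta> \<union> halfs \<delta> = halfs U"
      "gverts U - gverts \<delta> \<union> {external \<delta>} - {external \<delta>} \<union> gverts \<delta> = gverts U"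
      "(gedges U - gedges \<delta>) \<inter> gedges G \<union> gedges \<delta> = gedges U"
      using u.subs gsub_parts ext external_subset[of \<delta>] by auto
    then show ?thesis
      unfolding lift_graph_def u.contract_three[OF 2] lgraph.simps if_not_P[OF N] Un_empty_right
      by (simp only:)
  next
    case (3 p q a b)
    interpret up: leg_pair S \<delta> U p q a b by (rule 3)
    interpret gp: leg_pair S \<delta> G p q a b using leg_pair_gsub[OF 3 UG feynman_pregraph[OF G]] .
    have "halfs U - halfs \<delta> \<union> halfs \<delta> = halfs U" using u.subs by auto
    moreover have "gverts U - gverts \<delta> - {external \<delta>} \<union> gverts \<delta> = gverts U" using u.subs ext by auto
    moreover have "({e \<in> gedges U. e \<inter> halfs \<delta> = {}} \<union> {{a, b}}) \<inter> gedges G \<union> gedges \<delta> \<union> {{p, a}, {q, b}} = gedges U"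
    proof (intro subset_antisym subsetI)
      fix e assume e: "e \<in> gedges U"
      then show "e \<in> ({e \<in> gedges U. e \<inter> halfs \<delta> = {}} \<union> {{a, b}}) \<inter> gedges G \<union> gedges \<delta> \<union> {{p, a}, {q, b}}"
        by (cases rule: up.edge_cases) (use e subsetD[OF gsub_parts(3) e] in simp_all)
    qed (use gp.new_edge_not_old u.subs up.pa up.qb in auto)
    ultimately show ?thesis
      unfolding lift_graph_def up.contract_two gp.neighbours_eq gp.crossing_edges by simp
  qed
  show ?thesis unfolding * by simp
qed

end

context subgraph_contraction
begin

text \<open>The case of a subgraph T of \<open>G/\<delta>\<close> avoiding everything created by the
  contraction: its lift is the disjoint union of T and \<delta>, even if edges of G join the two.
  There \<delta> is detached, so contracting it returns T.\<close>

lemma contract_attach: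
  assumes T: "pregraph T" "gsub T G" and disj: "halfs T \<inter> halfs \<delta> = {}"
    and U: "U = \<lparr>halfs = halfs T \<union> halfs \<delta>, gverts = gverts T \<union> gverts \<delta>, gedges = gedges T \<union> gedges \<delta>\<rparr>"
  shows "pregraph U" "gsub \<delta> U" "gsub U G" "contract U \<delta> = T"
proof -
  have un: "\<Union>(gverts U) = halfs U"
    unfolding U using pregraph_Union_verts[OF T(1)] pregraph_Union_verts[OF pre] by auto
  have e: "e \<subseteq> halfs U" if "e \<in> gedges U" for e
    using that pregraph_edge_subset[OF T(1), of e] pregraph_edge_subset[OF pre, of e] unfolding U by auto
  have sub: "gverts U \<subseteq> gverts G" "gedges U \<subseteq> gedges G" using T(2) subs by (auto simp: U gsub_def)
  show pU: "pregraph U" and "gsub U G" using pregraph_subset[OF G sub un e] by blast+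
  show \<delta>U: "gsub \<delta> U" by (auto simp: U gsub_def)
  interpret u: subgraph_contraction S \<delta> U
    by unfold_locales (fact feyn connected pU \<delta>U)+
  have "external \<delta> \<subseteq> external U"
  proof
    fix x assume x: "x \<in> external \<delta>"
    have "x \<notin> e" if "e \<in> gedges T" for e
      using pregraph_edge_subset[OF T(1) that] externalD[OF x] disj by blast
    then show "x \<in> external U" using externalD[OF x] external_edgeD[OF x]
      by (intro externalI) (auto simp: U)
  qed
  then have c: "contract U \<delta> = \<lparr>halfs = halfs U - halfs \<delta>, gverts = gverts U - gverts \<delta>, gedges = gedges U - gedges \<delta>\<rparr>"
    by (rule u.contract_detached)
  have "v \<notin> gverts \<delta>" if "v \<in> gverts T" for v
    using that pregraph_vert_nonempty[OF pre, of v] pregraph_vert_subset[OF pre, of v]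
      pregraph_vert_subset[OF T(1) that] disj by auto
  moreover have "e \<notin> gedges \<delta>" if "e \<in> gedges T" for e
    using that pregraph_edge_nonempty[OF pre, of e] pregraph_edge_subset[OF pre, of e]
      pregraph_edge_subset[OF T(1) that] disj by auto
  ultimately have "halfs U - halfs \<delta> = halfs T" "gverts U - gverts \<delta> = gverts T" "gedges U - gedges \<delta> = gedges T"
    using disj by (auto simp: U)
  then show "contract U \<delta> = T" unfolding c by simp
qed

lemma contract_lift_three:
  assumes nd: "\<not> external \<delta> \<subseteq> external G" and three: "card (external \<delta>) = 3"
    and T: "feynman S T" "gsub T (contract G \<delta>)" and v: "external \<delta> \<in> gverts T"
  shows "pregraph (lift_graph G \<delta> T)" "gsub \<delta> (lift_graph G \<delta> T)" "gsub (lift_graph G \<delta> T) G"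
    "contract (lift_graph G \<delta> T) \<delta> = T"
proof -
  note eq = contract_three[OF nd three]
  have pT: "pregraph T" by (rule feynman_pregraph[OF T(1)])
  have TG: "halfs T \<subseteq> (halfs G - halfs \<delta>) \<union> external \<delta>" "gverts T \<subseteq> (gverts G - gverts \<delta>) \<union> {external \<delta>}"
    "gedges T \<subseteq> gedges G - gedges \<delta>" using T(2) by (auto simp: gsub_def eq)
  have "neighbours G \<delta> \<notin> gedges T" using neighbours_not_edge TG(3) by blast
  moreover have "gedges T \<inter> gedges G = gedges T" using TG(3) by blast
  ultimately have U: "lift_graph G \<delta> T = \<lparr>halfs = halfs T \<union> halfs \<delta>,
    gverts = (gverts T - {external \<delta>}) \<union> gverts \<delta>, gedges = gedges T \<union> gedges \<delta>\<rparr>"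
    by (simp add: lift_graph_def)
  let ?U = "lift_graph G \<delta> T"
  have XT: "external \<delta> \<subseteq> halfs T" by (rule pregraph_vert_subset[OF pT v])
  have "\<Union>(gverts T - {external \<delta>} \<union> gverts \<delta>) = halfs T \<union> halfs \<delta>"
  proof -
    have "\<Union>(gverts T) = halfs T" "\<Union>(gverts \<delta>) = halfs \<delta>" using pregraph_Union_verts pT pre by auto
    moreover have "insert (external \<delta>) (gverts T - {external \<delta>}) = gverts T" using v by blast
    then have "\<Union>(gverts T) = external \<delta> \<union> \<Union>(gverts T - {external \<delta>})" by (metis Union_insert)
    ultimately show ?thesis using external_subset[of \<delta>] by auto
  qed
  then have un: "\<Union>(gverts ?U) = halfs ?U" unfolding U by simp
  have e: "e \<subseteq> halfs ?U" if "e \<in> gedges ?U" for e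
    using that pregraph_edge_subset[OF pT, of e] pregraph_edge_subset[OF pre, of e] unfolding U by auto
  have sub: "gverts ?U \<subseteq> gverts G" "gedges ?U \<subseteq> gedges G" using TG subs by (auto simp: U)
  show pU: "pregraph ?U" and "gsub ?U G" using pregraph_subset[OF G sub un e] by blast+
  show \<delta>U: "gsub \<delta> ?U" by (auto simp: U gsub_def)
  interpret u: subgraph_contraction S \<delta> ?U
    by unfold_locales (fact feyn connected pU \<delta>U)+
  \<comment> \<open>Were \<delta> detached in the lift, the new vertex of T would have three
    external half-edges, which is impossible in the Feynman graph T.\<close>
  have "\<not> external \<delta> \<subseteq> external ?U"
  proof
    assume ext: "external \<delta> \<subseteq> external ?U"
    have "external \<delta> \<subseteq> external T"
    proof
      fix x assume x: "x \<in> external \<delta>"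
      then show "x \<in> external T" using XT external_edgeD[OF subsetD[OF ext x]] by (intro externalI) (auto simp: U)
    qed
    then show False using feynman_locally[OF T(1)] v by (simp add: locally_feynman_def)
  qed
  then have c: "contract ?U \<delta> = \<lparr>halfs = (halfs ?U - halfs \<delta>) \<union> external \<delta>,
    gverts = (gverts ?U - gverts \<delta>) \<union> {external \<delta>}, gedges = gedges ?U - gedges \<delta>\<rparr>"
    using three by (rule u.contract_three)
  have "(halfs ?U - halfs \<delta>) \<union> external \<delta> = halfs T"
    using TG(1) XT external_subset[of \<delta>] by (auto simp: U)
  moreover have "(gverts ?U - gverts \<delta>) \<union> {external \<delta>} = gverts T" using TG(2) v by (auto simp: U)
  moreover have "gedges ?U - gedges \<delta> = gedges T" using TG(3) by (auto simp: U)
  ultimately show "contract ?U \<delta> = T" unfolding c by simp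
qed

end

context leg_pair
begin

lemma contract_lift_two:
  assumes T: "feynman S T" "gsub T (contract G \<delta>)" and e: "{a, b} \<in> gedges T"
  shows "pregraph (lift_graph G \<delta> T)" "gsub \<delta> (lift_graph G \<delta> T)" "gsub (lift_graph G \<delta> T) G"
    "contract (lift_graph G \<delta> T) \<delta> = T"
proof -
  have pT: "pregraph T" by (rule feynman_pregraph[OF T(1)])
  have TG: "halfs T \<subseteq> halfs G - halfs \<delta>" "gverts T \<subseteq> gverts G - gverts \<delta>"
    "gedges T \<subseteq> {e \<in> gedges G. e \<inter> halfs \<delta> = {}} \<union> {{a, b}}" using T(2) by (auto simp: gsub_def contract_two)
  have "external \<delta> \<notin> gverts T"
  proof
    assume "external \<delta> \<in> gverts T"
    then have "card (external \<delta>) = 3" by (rule pregraph_vert_card[OF pT])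
    then show False using card_legs by simp
  qed
  moreover have "gedges T \<inter> gedges G = gedges T - {{a, b}}" using TG(3) new_edge_not_old by blast
  ultimately have U: "lift_graph G \<delta> T = \<lparr>halfs = halfs T \<union> halfs \<delta>,
    gverts = gverts T \<union> gverts \<delta>, gedges = (gedges T - {{a, b}}) \<union> gedges \<delta> \<union> {{p, a}, {q, b}}\<rparr>"
    using e by (simp add: lift_graph_def neighbours_eq crossing_edges)
  let ?U = "lift_graph G \<delta> T"
  have abT: "a \<in> halfs T" "b \<in> halfs T" using pregraph_edge_subset[OF pT e] by auto
  have un: "\<Union>(gverts ?U) = halfs ?U"
    unfolding U using pregraph_Union_verts[OF pT] pregraph_Union_verts[OF pre] by auto
  have ed: "e \<subseteq> halfs ?U" if "e \<in> gedges ?U" for e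
    using that pregraph_edge_subset[OF pT, of e] pregraph_edge_subset[OF pre, of e] abT pq_halfs unfolding U by auto
  have sub: "gverts ?U \<subseteq> gverts G" "gedges ?U \<subseteq> gedges G" using TG subs pa qb by (auto simp: U)
  show pU: "pregraph ?U" and "gsub ?U G" using pregraph_subset[OF G sub un ed] by blast+
  show \<delta>U: "gsub \<delta> ?U" by (auto simp: U gsub_def)
  have crossing: "{p, a} \<in> gedges ?U" "{q, b} \<in> gedges ?U" by (auto simp: U)
  interpret u: leg_pair S \<delta> ?U p q a b
    by unfold_locales (fact feyn connected pU \<delta>U legs a b crossing)+
  have "halfs ?U - halfs \<delta> = halfs T" using TG(1) by (auto simp: U)
  moreover have "gverts ?U - gverts \<delta> = gverts T" using TG(2) by (auto simp: U)
  moreover have "{e \<in> gedges ?U. e \<inter> halfs \<delta> = {}} \<union> {{a, b}} = gedges T"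
  proof (intro subset_antisym subsetI)
    fix f assume "f \<in> {e \<in> gedges ?U. e \<inter> halfs \<delta> = {}} \<union> {{a, b}}"
    then consider "f = {a, b}" | "f \<in> gedges ?U" "f \<inter> halfs \<delta> = {}" by blast
    then show "f \<in> gedges T"
    proof cases
      case 2
      have "f \<notin> gedges \<delta>" using pregraph_edge_subset[OF pre, of f] pregraph_edge_nonempty[OF pre, of f] 2(2) by blast
      moreover have "f \<noteq> {p, a}" "f \<noteq> {q, b}" using 2(2) pq_halfs by auto
      ultimately show ?thesis using 2(1) by (simp add: U)
    qed (use e in simp)
  next
    fix f assume f: "f \<in> gedges T"
    then show "f \<in> {e \<in> gedges ?U. e \<inter> halfs \<delta> = {}} \<union> {{a, b}}" using TG(3) by (auto simp: U)
  qed
  ultimately show "contract ?U \<delta> = T" unfolding u.contract_two by simp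
qed

end

context subgraph_contraction
begin

lemma contract_lift:
  assumes lf: "locally_feynman G" and T: "feynman S T" "gsub T (contract G \<delta>)"
  shows "pregraph (lift_graph G \<delta> T) \<and> gsub \<delta> (lift_graph G \<delta> T) \<and> gsub (lift_graph G \<delta> T) G \<and>
    contract (lift_graph G \<delta> T) \<delta> = T"
proof -
  have pT: "pregraph T" by (rule feynman_pregraph[OF T(1)])
  have attach: ?thesis if "gsub T G" "halfs T \<inter> halfs \<delta> = {}" "external \<delta> \<notin> gverts T" "neighbours G \<delta> \<notin> gedges T"
  proof -
    have "gedges T \<inter> gedges G = gedges T" using that(1) by (auto simp: gsub_def)
    then have "lift_graph G \<delta> T = \<lparr>halfs = halfs T \<union> halfs \<delta>, gverts = gverts T \<union> gverts \<delta>,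
        gedges = gedges T \<union> gedges \<delta>\<rparr>" using that(3,4) by (simp add: lift_graph_def)
    then show ?thesis using contract_attach[OF pT that(1,2)] by blast
  qed
  show ?thesis using lf
  proof (cases rule: contraction_cases)
    case 1
    have "gsub T G" "halfs T \<inter> halfs \<delta> = {}" "gverts T \<subseteq> gverts G" "gedges T \<subseteq> gedges G"
      using T(2) by (auto simp: gsub_def contract_detached[OF 1])
    then show ?thesis using attach external_not_vert neighbours_not_edge by blast
  next
    case 2
    show ?thesis
    proof (cases "external \<delta> \<in> gverts T")
      case True
      then show ?thesis using contract_lift_three[OF 2 T] by blast
    next
      case False
      then have V: "gverts T \<subseteq> gverts G - gverts \<delta>" and E: "gedges T \<subseteq> gedges G"
        using T(2) by (auto simp: gsub_def contract_three[OF 2])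
      have "halfs T \<inter> halfs \<delta> = {}"
      proof (rule ccontr)
        assume "halfs T \<inter> halfs \<delta> \<noteq> {}"
        then obtain x where x: "x \<in> halfs T" "x \<in> halfs \<delta>" by blast
        then obtain v where v: "v \<in> gverts T" "x \<in> v" using pregraph_vertE[OF pT] by metis
        then have "v \<in> gverts G" "v \<notin> gverts \<delta>" using V by auto
        then show False using vert_in_sub[OF _ v(2) x(2)] by blast
      qed
      moreover have "gsub T G"
        using T(2) V E external_subset[of \<delta>] subs(1) by (auto simp: gsub_def contract_three[OF 2])
      ultimately show ?thesis using attach False neighbours_not_edge E by blast
    qed
  next
    case (3 p q a b)
    interpret leg_pair S \<delta> G p q a b by (rule 3)
    show ?thesis
    proof (cases "{a, b} \<in> gedges T")
      case True
      then show ?thesis using contract_lift_two[OF T] by blast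
    next
      case False
      have "gsub T G" "halfs T \<inter> halfs \<delta> = {}" "gverts T \<subseteq> gverts G"
        using T(2) False by (auto simp: gsub_def contract_two)
      then show ?thesis using attach external_not_vert False neighbours_eq by auto
    qed
  qed
qed

text \<open>\<open>feynman_contract\<close> is used forwards to see that \<open>U/\<delta>\<close>
  is an object, and backwards for the lift, of which only the incidence conditions are known
  beforehand.\<close>

lemma bij_betw_contract:
  assumes fG: "feynman S G"
  shows "bij_betw (\<lambda>U. contract U \<delta>) {U \<in> subgraphs S G. \<delta> \<in> subgraphs S U} (subgraphs S (contract G \<delta>))"
proof (rule bij_betw_byWitness[where f' = "lift_graph G \<delta>"])
  show "\<forall>U\<in>{U \<in> subgraphs S G. \<delta> \<in> subgraphs S U}. lift_graph G \<delta> (contract U \<delta>) = U"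
    using lift_contract[OF feyn connected _ fG] by (simp add: gsub_feynman_iff)
  show "\<forall>T\<in>subgraphs S (contract G \<delta>). contract (lift_graph G \<delta> T) \<delta> = T"
    using contract_lift[OF feynman_locally[OF fG]] by (simp add: gsub_feynman_iff)
  show "(\<lambda>U. contract U \<delta>) ` {U \<in> subgraphs S G. \<delta> \<in> subgraphs S U} \<subseteq> subgraphs S (contract G \<delta>)"
  proof (intro image_subsetI)
    fix U assume "U \<in> {U \<in> subgraphs S G. \<delta> \<in> subgraphs S U}"
    then have U: "feynman S U" "gsub U G" "gsub \<delta> U" by (auto simp: gsub_feynman_iff)
    have "feynman S (contract U \<delta>)"
      using subgraph_contraction.feynman_contract[OF subgraph_contractionI[OF feyn connected U(1,3)]] U(1) by simp
    then show "contract U \<delta> \<in> subgraphs S (contract G \<delta>)"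
      using contract_mono[OF feyn connected U(1) fG U(3,2)] by (simp add: gsub_feynman_iff)
  qed
  show "lift_graph G \<delta> ` subgraphs S (contract G \<delta>) \<subseteq> {U \<in> subgraphs S G. \<delta> \<in> subgraphs S U}"
  proof (intro image_subsetI)
    fix T assume "T \<in> subgraphs S (contract G \<delta>)"
    then have T: "feynman S T" "gsub T (contract G \<delta>)" by (auto simp: gsub_feynman_iff)
    let ?U = "lift_graph G \<delta> T"
    have U: "pregraph ?U" "gsub \<delta> ?U" "gsub ?U G" "contract ?U \<delta> = T"
      using contract_lift[OF feynman_locally[OF fG] T] by auto
    have "subgraph_contraction S \<delta> ?U" by unfold_locales (fact feyn connected U)+
    then have "feynman S ?U" using subgraph_contraction.feynman_contract U(4) T(1) by metis
    then show "?U \<in> {U \<in> subgraphs S G. \<delta> \<in> subgraphs S U}" using U feyn by (simp add: gsub_feynman_iff)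
  qed
qed

end

subsection \<open>Successive contractions\<close>

lemma components_connected:
  assumes "connected_graph \<sigma>"
  shows "components \<sigma> = {\<sigma>}"
proof -
  have p: "pregraph \<sigma>" using assms by (simp add: connected_graph_def)
  have "induced \<sigma> (conn \<sigma> `` {h}) = \<sigma>" if h: "h \<in> halfs \<sigma>" for h
  proof -
    have "conn \<sigma> `` {h} = halfs \<sigma>"
    proof (intro subset_antisym subsetI)
      show "k \<in> halfs \<sigma>" if "k \<in> conn \<sigma> `` {h}" for k using pregraph_conn_halfs[OF p _ h, of k] that by simp
      show "k \<in> conn \<sigma> `` {h}" if "k \<in> halfs \<sigma>" for k using assms h that by (simp add: connected_graph_def)
    qed
    moreover have "{v \<in> gverts \<sigma>. v \<subseteq> halfs \<sigma>} = gverts \<sigma>" "{e \<in> gedges \<sigma>. e \<subseteq> halfs \<sigma>} = gedges \<sigma>"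
      using pregraph_vert_subset[OF p] pregraph_edge_subset[OF p] by auto
    ultimately show ?thesis by (simp add: induced_def)
  qed
  moreover have "halfs \<sigma> \<noteq> {}" using assms by (simp add: connected_graph_def)
  ultimately show ?thesis unfolding components_eq[OF p] by auto
qed

context subgraph_contraction
begin

lemma connected_not_detached:
  assumes "connected_graph G" "\<delta> \<noteq> G"
  shows "\<not> external \<delta> \<subseteq> external G"
  using assms component_iff components_connected by auto

lemma connected_contract:
  assumes c: "connected_graph G" and ne: "\<delta> \<noteq> G" and lf: "locally_feynman G"
  shows "connected_graph (contract G \<delta>)"
proof -
  note nd = connected_not_detached[OF c ne]
  have con: "(h, k) \<in> conn G" if "h \<in> halfs G" "k \<in> halfs G" for h k
    using c that by (simp add: connected_graph_def)
  show ?thesis using lf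
  proof (cases rule: contraction_cases)
    case 2
    have sub': "halfs (contract G \<delta>) \<subseteq> halfs G" using subs(1) externalD[of _ \<delta>] by (auto simp: contract_three[OF 2])
    have "(h, k) \<in> conn (contract G \<delta>)" if hk: "h \<in> halfs (contract G \<delta>)" "k \<in> halfs (contract G \<delta>)" for h k
    proof -
      have "(x, y) \<in> conn (del_edges \<delta> {})" if "x \<in> external \<delta>" "y \<in> external \<delta>" for x y
        using con_G con[of x y] subgraph_contraction.con[OF subgraph_contraction_axioms] externalD that
        unfolding del_edges_empty by metis
      then have "(h, k) \<in> conn (del_edges G {}) \<longleftrightarrow> (h, k) \<in> conn (del_edges (contract G \<delta>) {})"
        using hk by (rule conn_contract_three[OF 2])
      then show ?thesis using con hk sub' unfolding del_edges_empty by blast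
    qed
    moreover have "external \<delta> \<noteq> {}" using 2(2) by auto
    then have "halfs (contract G \<delta>) \<noteq> {}" by (simp add: contract_three[OF 2])
    ultimately show ?thesis using pregraph_contract_three[OF 2] by (simp add: connected_graph_def)
  next
    case (3 p q a b)
    interpret leg_pair S \<delta> G p q a b by (rule 3)
    have "(h, k) \<in> conn (contract G \<delta>)" if hk: "h \<in> halfs (contract G \<delta>)" "k \<in> halfs (contract G \<delta>)" for h k
    proof -
      have "h \<in> halfs G" "k \<in> halfs G" using hk by (auto simp: contract_two)
      then show ?thesis using conn_contract_two'[OF hk] con by blast
    qed
    moreover have "a \<in> halfs (contract G \<delta>)" using ab_halfs a by (simp add: contract_two)
    ultimately show ?thesis using pregraph_contract_two by (auto simp: connected_graph_def)
  qed (use nd in blast)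
qed

end

text \<open>Since \<sigma> is connected, \<delta> \<noteq> \<sigma> means that some leg of \<delta>
  is not external in \<sigma>. Hence \<open>\<sigma>/\<delta>\<close> is again nonempty and
  connected with the legs of \<sigma>, and its contraction falls under the same case as that of
  \<sigma>.\<close>

locale nested_contraction =
  fixes S :: "'s set" and \<delta> \<sigma> G :: "'s lgraph"
  assumes \<delta>: "feynman S \<delta>" "connected_graph \<delta>" and \<sigma>: "feynman S \<sigma>" "connected_graph \<sigma>"
    and G: "feynman S G" and \<delta>\<sigma>: "gsub \<delta> \<sigma>" and \<sigma>G: "gsub \<sigma> G" and ne: "\<delta> \<noteq> \<sigma>"
begin

sublocale d\<sigma>: subgraph_contraction S \<delta> \<sigma>
  using \<delta> \<sigma>(1) \<delta>\<sigma> by (rule subgraph_contractionI)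

sublocale dG: subgraph_contraction S \<delta> G
  using \<delta> G gsub_trans[OF \<delta>\<sigma> \<sigma>G] by (rule subgraph_contractionI)

sublocale sG: subgraph_contraction S \<sigma> G
  using \<sigma> G \<sigma>G by (rule subgraph_contractionI)

lemma feynman_contracts: "feynman S (contract \<sigma> \<delta>)" "feynman S (contract G \<delta>)"
  using d\<sigma>.feynman_contract dG.feynman_contract \<sigma>(1) G by blast+

lemma lf: "locally_feynman \<sigma>" "locally_feynman G"
  using feynman_locally \<sigma>(1) G by blast+

sublocale quot: subgraph_contraction S "contract \<sigma> \<delta>" "contract G \<delta>"
  using feynman_contracts(1) d\<sigma>.connected_contract[OF \<sigma>(2) ne lf(1)] feynman_contracts(2)
    contract_mono[OF \<delta> \<sigma>(1) G \<delta>\<sigma> \<sigma>G] by (rule subgraph_contractionI)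

lemma not_detached: "\<not> external \<delta> \<subseteq> external \<sigma>" "\<not> external \<delta> \<subseteq> external G"
proof -
  show 1: "\<not> external \<delta> \<subseteq> external \<sigma>" by (rule d\<sigma>.connected_not_detached[OF \<sigma>(2) ne])
  then show "\<not> external \<delta> \<subseteq> external G" using detached_gsub[OF \<delta> \<sigma>(1) G \<delta>\<sigma> \<sigma>G] by blast
qed

lemma external_quot: "external (contract \<sigma> \<delta>) = external \<sigma>" "external (contract G \<delta>) = external G"
  using d\<sigma>.external_contract[OF lf(1)] dG.external_contract[OF lf(2)] not_detached by simp_all

text \<open>The vertex created by contracting \<delta> belongs to \<open>\<sigma>/\<delta>\<close>
  and vanishes with it, so the parts of \<open>G/\<delta>\<close> outside
  \<open>\<sigma>/\<delta>\<close> are those of G outside \<sigma>.\<close>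

lemma contract_contract_three:
  assumes three: "card (external \<delta>) = 3"
  shows "contract (contract G \<delta>) (contract \<sigma> \<delta>) = contract G \<sigma>"
proof -
  note Geq = dG.contract_three[OF not_detached(2) three]
  note \<sigma>eq = d\<sigma>.contract_three[OF not_detached(1) three]
  have X: "external \<delta> \<subseteq> halfs \<delta>" "halfs \<delta> \<subseteq> halfs \<sigma>" "halfs \<sigma> \<subseteq> halfs G" "gverts \<delta> \<subseteq> gverts \<sigma>"
    "gedges \<delta> \<subseteq> gedges \<sigma>" "external \<delta> \<notin> gverts G"
    using external_subset[of \<delta>] d\<sigma>.subs sG.subs dG.external_not_vert by auto
  have H: "halfs (contract G \<delta>) - halfs (contract \<sigma> \<delta>) = halfs G - halfs \<sigma>" using X by (auto simp: Geq \<sigma>eq)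
  have V: "gverts (contract G \<delta>) - gverts (contract \<sigma> \<delta>) = gverts G - gverts \<sigma>" using X by (auto simp: Geq \<sigma>eq)
  have E: "gedges (contract G \<delta>) - gedges (contract \<sigma> \<delta>) = gedges G - gedges \<sigma>" using X by (auto simp: Geq \<sigma>eq)
  show ?thesis using lf(2)
  proof (cases rule: sG.contraction_cases)
    case 1
    then have det': "external (contract \<sigma> \<delta>) \<subseteq> external (contract G \<delta>)" by (simp add: external_quot)
    show ?thesis unfolding sG.contract_detached[OF 1] quot.contract_detached[OF det'] H V E by simp
  next
    case 2
    then have two': "\<not> external (contract \<sigma> \<delta>) \<subseteq> external (contract G \<delta>)" "card (external (contract \<sigma> \<delta>)) = 3"
      by (simp_all add: external_quot)
    show ?thesis unfolding sG.contract_three[OF 2] quot.contract_three[OF two'] H V E external_quot by simp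
  next
    case (3 p q a b)
    interpret l: leg_pair S \<sigma> G p q a b by (rule 3)
    have out: "a \<notin> halfs (contract \<sigma> \<delta>)" "b \<notin> halfs (contract \<sigma> \<delta>)" using l.a l.b X by (auto simp: \<sigma>eq)
    have cr: "{p, a} \<in> gedges (contract G \<delta>)" "{q, b} \<in> gedges (contract G \<delta>)"
      using l.pa l.qb l.crossing_not_sub X(5) by (auto simp: Geq)
    have legs: "external (contract \<sigma> \<delta>) = {p, q}" "p \<noteq> q" using l.legs external_quot by simp_all
    interpret l': leg_pair S "contract \<sigma> \<delta>" "contract G \<delta>" p q a b
      by unfold_locales (fact legs out cr)+
    have "{e \<in> gedges (contract G \<delta>). e \<inter> halfs (contract \<sigma> \<delta>) = {}} = {e \<in> gedges G. e \<inter> halfs \<sigma> = {}}"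
    proof (intro subset_antisym subsetI)
      fix e assume "e \<in> {e \<in> gedges (contract G \<delta>). e \<inter> halfs (contract \<sigma> \<delta>) = {}}"
      then have e: "e \<in> gedges G" "e \<notin> gedges \<delta>" "e \<inter> (halfs \<sigma> - halfs \<delta> \<union> external \<delta>) = {}"
        by (auto simp: Geq \<sigma>eq)
      \<comment> \<open>An edge not in \<delta> meets \<delta> only at legs, and the legs of
        \<delta> still belong to \<open>\<sigma>/\<delta>\<close>.\<close>
      have "x \<notin> halfs \<sigma>" if "x \<in> e" for x using dG.edge_at_sub[OF e(1,2) that] e(3) that by blast
      then show "e \<in> {e \<in> gedges G. e \<inter> halfs \<sigma> = {}}" using e(1) by blast
    next
      fix e assume "e \<in> {e \<in> gedges G. e \<inter> halfs \<sigma> = {}}"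
      then have e: "e \<in> gedges G" "e \<inter> halfs \<sigma> = {}" by auto
      have "e \<notin> gedges \<delta>"
        using e(2) X(2) pregraph_edge_subset[OF dG.pre, of e] pregraph_edge_nonempty[OF dG.pre, of e] by blast
      then show "e \<in> {e \<in> gedges (contract G \<delta>). e \<inter> halfs (contract \<sigma> \<delta>) = {}}"
        using e X(1,2) by (auto simp: Geq \<sigma>eq)
    qed
    then show ?thesis unfolding l.contract_two l'.contract_two H V by simp
  qed
qed

lemma contract_contract_two:
  assumes lp: "leg_pair S \<delta> \<sigma> p q a b"
  shows "contract (contract G \<delta>) (contract \<sigma> \<delta>) = contract G \<sigma>"
proof -
  interpret ls: leg_pair S \<delta> \<sigma> p q a b by (rule lp)
  interpret lg: leg_pair S \<delta> G p q a b using leg_pair_gsub[OF lp \<sigma>G feynman_pregraph[OF G]] .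
  note Geq = lg.contract_two and \<sigma>eq = ls.contract_two
  have X: "halfs \<delta> \<subseteq> halfs \<sigma>" "halfs \<sigma> \<subseteq> halfs G" "gverts \<delta> \<subseteq> gverts \<sigma>" "gedges \<delta> \<subseteq> gedges \<sigma>"
    "gedges \<sigma> \<subseteq> gedges G" using d\<sigma>.subs sG.subs by auto
  have H: "halfs (contract G \<delta>) - halfs (contract \<sigma> \<delta>) = halfs G - halfs \<sigma>" using X by (auto simp: Geq \<sigma>eq)
  have V: "gverts (contract G \<delta>) - gverts (contract \<sigma> \<delta>) = gverts G - gverts \<sigma>" using X by (auto simp: Geq \<sigma>eq)
  have E: "gedges (contract G \<delta>) - gedges (contract \<sigma> \<delta>) = gedges G - gedges \<sigma>"
  proof (intro subset_antisym subsetI)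
    fix e assume "e \<in> gedges (contract G \<delta>) - gedges (contract \<sigma> \<delta>)"
    then show "e \<in> gedges G - gedges \<sigma>" by (auto simp: Geq \<sigma>eq)
  next
    fix e assume e: "e \<in> gedges G - gedges \<sigma>"
    then have "e \<in> gedges G" by simp
    \<comment> \<open>An edge meeting \<delta> lies in \<delta> or is one of the two edges attaching
      it, and these belong to \<sigma>.\<close>
    then have "e \<inter> halfs \<delta> = {}"
      by (cases rule: lg.edge_cases) (use e X ls.pa ls.qb in auto)
    moreover have "e \<noteq> {a, b}" using e lg.new_edge_not_old by blast
    ultimately show "e \<in> gedges (contract G \<delta>) - gedges (contract \<sigma> \<delta>)" using e by (simp add: Geq \<sigma>eq)
  qed
  show ?thesis using lf(2)
  proof (cases rule: sG.contraction_cases)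
    case 1
    then have det': "external (contract \<sigma> \<delta>) \<subseteq> external (contract G \<delta>)" by (simp add: external_quot)
    show ?thesis unfolding sG.contract_detached[OF 1] quot.contract_detached[OF det'] H V E by simp
  next
    case 2
    then have two': "\<not> external (contract \<sigma> \<delta>) \<subseteq> external (contract G \<delta>)" "card (external (contract \<sigma> \<delta>)) = 3"
      by (simp_all add: external_quot)
    show ?thesis unfolding sG.contract_three[OF 2] quot.contract_three[OF two'] H V E external_quot by simp
  next
    case (3 p2 q2 a2 b2)
    interpret l: leg_pair S \<sigma> G p2 q2 a2 b2 by (rule 3)
    have out: "a2 \<notin> halfs (contract \<sigma> \<delta>)" "b2 \<notin> halfs (contract \<sigma> \<delta>)" using l.a l.b X by (auto simp: \<sigma>eq)
    have "p2 \<notin> halfs \<delta>" "q2 \<notin> halfs \<delta>" using ls.no_external l.legs by auto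
    moreover have "a2 \<notin> halfs \<delta>" "b2 \<notin> halfs \<delta>" using l.a l.b X by auto
    ultimately have cr: "{p2, a2} \<in> gedges (contract G \<delta>)" "{q2, b2} \<in> gedges (contract G \<delta>)"
      using l.pa l.qb by (auto simp: Geq)
    have legs: "external (contract \<sigma> \<delta>) = {p2, q2}" "p2 \<noteq> q2" using l.legs external_quot by simp_all
    interpret l': leg_pair S "contract \<sigma> \<delta>" "contract G \<delta>" p2 q2 a2 b2
      by unfold_locales (fact legs out cr)+
    have "{e \<in> gedges (contract G \<delta>). e \<inter> halfs (contract \<sigma> \<delta>) = {}} = {e \<in> gedges G. e \<inter> halfs \<sigma> = {}}"
    proof (intro subset_antisym subsetI)
      fix e assume e: "e \<in> {e \<in> gedges (contract G \<delta>). e \<inter> halfs (contract \<sigma> \<delta>) = {}}"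
      \<comment> \<open>The edge created by contracting \<delta> meets
        \<open>\<sigma>/\<delta>\<close>, so every edge avoiding \<open>\<sigma>/\<delta>\<close> is
        an edge of G.\<close>
      have "a \<in> halfs (contract \<sigma> \<delta>)" using ls.ab_halfs ls.a by (simp add: \<sigma>eq)
      then have "e \<noteq> {a, b}" using e by auto
      then have e': "e \<in> gedges G" "e \<inter> halfs \<delta> = {}" "e \<inter> (halfs \<sigma> - halfs \<delta>) = {}"
        using e by (auto simp: Geq \<sigma>eq)
      then show "e \<in> {e \<in> gedges G. e \<inter> halfs \<sigma> = {}}" by blast
    next
      fix e assume "e \<in> {e \<in> gedges G. e \<inter> halfs \<sigma> = {}}"
      then show "e \<in> {e \<in> gedges (contract G \<delta>). e \<inter> halfs (contract \<sigma> \<delta>) = {}}"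
        using X(1) by (auto simp: Geq \<sigma>eq)
    qed
    then show ?thesis unfolding l.contract_two l'.contract_two H V by simp
  qed
qed

lemma contract_contract: "contract (contract G \<delta>) (contract \<sigma> \<delta>) = contract G \<sigma>"
  using lf(1)
  by (cases rule: d\<sigma>.contraction_cases)
    (use not_detached contract_contract_three contract_contract_two in blast)+

end

section \<open>Commutation of disjoint contractions\<close>

locale disjoint_contractions =
  fixes S :: "'s set" and \<delta> \<delta>' G :: "'s lgraph"
  assumes \<delta>: "feynman S \<delta>" "connected_graph \<delta>" and \<delta>': "feynman S \<delta>'" "connected_graph \<delta>'"
    and G: "feynman S G" and sub: "gsub \<delta> G" and sub': "gsub \<delta>' G"
    and disj: "halfs \<delta> \<inter> halfs \<delta>' = {}"
begin

lemma swapped: "disjoint_contractions S \<delta>' \<delta> G"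
  by unfold_locales (use \<delta> \<delta>' G sub sub' disj in auto)

sublocale c1: subgraph_contraction S \<delta> G using \<delta> G sub by (rule subgraph_contractionI)
sublocale c2: subgraph_contraction S \<delta>' G using \<delta>' G sub' by (rule subgraph_contractionI)

lemma lf: "locally_feynman G" using feynman_locally G by blast

lemma feynman_G1: "feynman S (contract G \<delta>)"
  using c1.feynman_contract G by blast

sublocale c12: subgraph_contraction S \<delta>' "contract G \<delta>"
  using \<delta>' feynman_G1 c1.gsub_contract_disjoint[OF lf c2.pre sub'] disj
  by (auto intro!: subgraph_contractionI)

lemma detached_iff: "external \<delta>' \<subseteq> external (contract G \<delta>) \<longleftrightarrow> external \<delta>' \<subseteq> external G"
  using c1.external_contract[OF lf] externalD[of _ \<delta>'] disj by auto

text \<open>The vertices created by a contraction that creates no edge: none for a detached graph,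
  the set of legs for an attached one with three legs. It gives these two cases a common
  formula.\<close>

definition keep :: "'s lgraph \<Rightarrow> 's set set" where
  "keep \<gamma> = (if external \<gamma> \<subseteq> external G then {} else {external \<gamma>})"

end

lemma (in disjoint_contractions) contract_keep:
  assumes "external \<delta> \<subseteq> external G \<or> card (external \<delta>) = 3"
  shows "contract G \<delta> = \<lparr>halfs = (halfs G - halfs \<delta>) \<union> \<Union>(keep \<delta>), gverts = (gverts G - gverts \<delta>) \<union> keep \<delta>,
    gedges = gedges G - gedges \<delta>\<rparr>"
proof (cases "external \<delta> \<subseteq> external G")
  case True
  then show ?thesis by (simp add: keep_def c1.contract_detached)
next
  case False
  then show ?thesis using assms c1.contract_three[OF False] by (simp add: keep_def)
qed

lemma (in disjoint_contractions) contract_keep_second: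
  assumes "external \<delta>' \<subseteq> external G \<or> card (external \<delta>') = 3"
  shows "contract (contract G \<delta>) \<delta>' = \<lparr>halfs = (halfs (contract G \<delta>) - halfs \<delta>') \<union> \<Union>(keep \<delta>'),
    gverts = (gverts (contract G \<delta>) - gverts \<delta>') \<union> keep \<delta>', gedges = gedges (contract G \<delta>) - gedges \<delta>'\<rparr>"
proof (cases "external \<delta>' \<subseteq> external G")
  case True
  then show ?thesis using detached_iff by (simp add: keep_def c12.contract_detached)
next
  case False
  then have "\<not> external \<delta>' \<subseteq> external (contract G \<delta>)" using detached_iff by simp
  then show ?thesis using assms c12.contract_three False by (simp add: keep_def)
qed

lemma (in disjoint_contractions) keep_facts:
  "\<Union>(keep \<delta>) \<subseteq> halfs \<delta>" "\<Union>(keep \<delta>') \<subseteq> halfs \<delta>'" "keep \<delta> \<inter> gverts G = {}" "keep \<delta>' \<inter> gverts G = {}"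
  using external_subset[of \<delta>] external_subset[of \<delta>'] c1.external_not_vert c2.external_not_vert
  by (auto simp: keep_def)

lemma (in disjoint_contractions) commute_keep_keep:
  assumes "external \<delta> \<subseteq> external G \<or> card (external \<delta>) = 3" "external \<delta>' \<subseteq> external G \<or> card (external \<delta>') = 3"
  shows "contract (contract G \<delta>) \<delta>' = contract (contract G \<delta>') \<delta>"
proof -
  interpret sw: disjoint_contractions S \<delta>' \<delta> G by (rule swapped)
  have "(halfs G - halfs \<delta> \<union> \<Union>(keep \<delta>) - halfs \<delta>') \<union> \<Union>(keep \<delta>') =
      (halfs G - halfs \<delta>' \<union> \<Union>(keep \<delta>') - halfs \<delta>) \<union> \<Union>(keep \<delta>)"
    using keep_facts(1,2) disj by blast
  moreover have "(gverts G - gverts \<delta> \<union> keep \<delta> - gverts \<delta>') \<union> keep \<delta>' =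
      (gverts G - gverts \<delta>' \<union> keep \<delta>' - gverts \<delta>) \<union> keep \<delta>"
    using keep_facts(3,4) c1.subs(2) c2.subs(2) by blast
  moreover have "gedges G - gedges \<delta> - gedges \<delta>' = gedges G - gedges \<delta>' - gedges \<delta>" by blast
  ultimately show ?thesis
    unfolding contract_keep_second[OF assms(2)] sw.contract_keep_second[OF assms(1)]
    unfolding contract_keep[OF assms(1)] sw.contract_keep[OF assms(2)] lgraph.simps by simp
qed

text \<open>Contracting \<delta> removes only edges of \<delta>, so \<delta>' stays attached to the
  same half-edges a and b, and the edge created from it is the same in both orders.\<close>

lemma (in disjoint_contractions) commute_keep_two:
  assumes k1: "external \<delta> \<subseteq> external G \<or> card (external \<delta>) = 3" and lp: "leg_pair S \<delta>' G p q a b"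
  shows "contract (contract G \<delta>) \<delta>' = contract (contract G \<delta>') \<delta>"
proof -
  interpret sw: disjoint_contractions S \<delta>' \<delta> G by (rule swapped)
  interpret l: leg_pair S \<delta>' G p q a b by (rule lp)
  have "p \<notin> halfs \<delta>" "q \<notin> halfs \<delta>" using l.pq_halfs disj by auto
  then have "{p, a} \<notin> gedges \<delta>" "{q, b} \<notin> gedges \<delta>" using pregraph_edge_subset[OF c1.pre] by auto
  then have cr: "{p, a} \<in> gedges (contract G \<delta>)" "{q, b} \<in> gedges (contract G \<delta>)"
    using l.pa l.qb by (auto simp: contract_keep[OF k1])
  interpret l2: leg_pair S \<delta>' "contract G \<delta>" p q a b
    by unfold_locales (fact cr l.legs l.a l.b)+
  have "halfs G - halfs \<delta> \<union> \<Union>(keep \<delta>) - halfs \<delta>' = (halfs G - halfs \<delta>' - halfs \<delta>) \<union> \<Union>(keep \<delta>)"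
    using keep_facts(1) disj by blast
  moreover have "gverts G - gverts \<delta> \<union> keep \<delta> - gverts \<delta>' = (gverts G - gverts \<delta>' - gverts \<delta>) \<union> keep \<delta>"
    using keep_facts(3) c2.subs(2) by blast
  moreover have "{a, b} \<notin> gedges \<delta>" using l.new_edge_not_old c1.subs(3) by blast
  then have "{e \<in> gedges G - gedges \<delta>. e \<inter> halfs \<delta>' = {}} \<union> {{a, b}} =
      {e \<in> gedges G. e \<inter> halfs \<delta>' = {}} \<union> {{a, b}} - gedges \<delta>" by blast
  ultimately show ?thesis
    unfolding l2.contract_two sw.contract_keep_second[OF k1]
    unfolding l.contract_two contract_keep[OF k1] lgraph.simps
    by (simp only:)
qed

text \<open>If the contraction of \<open>\<delta>\<close> joined the two legs of \<open>\<delta>'\<close>, then \<open>\<delta> \<oplus> \<delta>'\<close> would be a union of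
  components without external edges.\<close>

lemma (in disjoint_contractions) commute_adjacent:
  assumes lp1: "leg_pair S \<delta> G p q a b" and lp2: "leg_pair S \<delta>' G p' q' a' b'" and a: "a = p'"
  shows "contract (contract G \<delta>) \<delta>' = contract (contract G \<delta>') \<delta>"
proof -
  interpret sw: disjoint_contractions S \<delta>' \<delta> G by (rule swapped)
  interpret l1: leg_pair S \<delta> G p q a b by (rule lp1)
  interpret l2: leg_pair S \<delta>' G p' q' a' b' by (rule lp2)
  have pre: "pregraph G" by (rule feynman_pregraph[OF G])
  have a': "a' = p"
  proof -
    have "{p', p} \<in> gedges G" using l1.pa a by (simp add: insert_commute)
    then show ?thesis using pregraph_mates_unique[OF pre l2.pa] by blast
  qed
  have b: "b \<notin> halfs \<delta>'"
  proof
    assume bh: "b \<in> halfs \<delta>'"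
    have "{q, b} \<notin> gedges \<delta>'" using pregraph_edge_subset[OF c2.pre, of "{q, b}"] l1.pq_halfs disj by auto
    then have "b \<in> external \<delta>'" using c2.edge_at_sub[OF l1.qb _ _ bh] by blast
    then have b': "b = q'" using l2.legs l1.ab_distinct a by auto
    have nd: "\<not> external \<delta>' \<subseteq> external (contract G \<delta>)" using detached_iff l2.not_detached by blast
    then obtain p2 q2 a2 b2 where "leg_pair S \<delta>' (contract G \<delta>) p2 q2 a2 b2"
      using c12.leg_pair_of_feynman[OF feynman_locally[OF feynman_G1] l2.card_legs] by blast
    then interpret l: leg_pair S \<delta>' "contract G \<delta>" p2 q2 a2 b2 .
    have e: "{p', q'} \<in> gedges (contract G \<delta>)" using a b' by (simp add: l1.contract_two)
    have "p2 \<in> {p', q'}" using l.legs(1) l2.legs(1) by auto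
    then have "{p2, a2} = {p', q'}"
      using pregraph_edge_eq[OF c12.G l.pa e, of p2] by blast
    then show False using l.a l2.pq_halfs by auto
  qed
  have b2: "b' \<notin> halfs \<delta>"
  proof
    assume bh: "b' \<in> halfs \<delta>"
    have "{q', b'} \<notin> gedges \<delta>" using pregraph_edge_subset[OF c1.pre, of "{q', b'}"] l2.pq_halfs disj by auto
    then have "b' \<in> external \<delta>" using c1.edge_at_sub[OF l2.qb _ _ bh] by blast
    then have "b' = q" using l1.legs l2.ab_distinct a' by auto
    then have "{q, q'} \<in> gedges G" using l2.qb by (simp add: insert_commute)
    then have "b = q'" using pregraph_mates_unique[OF pre l1.qb] by blast
    then show False using b l2.pq_halfs by blast
  qed
  have "q' \<notin> halfs \<delta>" "q \<notin> halfs \<delta>'" using l1.pq_halfs l2.pq_halfs disj by auto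
  then have cr1: "{p', b} \<in> gedges (contract G \<delta>)" "{q', b'} \<in> gedges (contract G \<delta>)"
    and cr2: "{p, b'} \<in> gedges (contract G \<delta>')" "{q, b} \<in> gedges (contract G \<delta>')"
    using a a' b b2 l1.qb l2.qb by (auto simp: l1.contract_two l2.contract_two)
  \<comment> \<open>In either order the chain from b through \<delta> and \<delta>' to b' ends up as
    the single edge {b, b'}; the first contraction makes b, respectively b', the new partner of the
    other graph.\<close>
  interpret l12: leg_pair S \<delta>' "contract G \<delta>" p' q' b b'
    by unfold_locales (fact cr1 l2.legs b l2.b)+
  interpret l21: leg_pair S \<delta> "contract G \<delta>'" p q b' b
    by unfold_locales (fact cr2 l1.legs b2 l1.b)+
  have "{e \<in> gedges (contract G \<delta>). e \<inter> halfs \<delta>' = {}} = {e \<in> gedges G. e \<inter> halfs \<delta> = {} \<and> e \<inter> halfs \<delta>' = {}}"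
    using a l2.pq_halfs by (auto simp: l1.contract_two)
  moreover have "{e \<in> gedges (contract G \<delta>'). e \<inter> halfs \<delta> = {}} = {e \<in> gedges G. e \<inter> halfs \<delta> = {} \<and> e \<inter> halfs \<delta>' = {}}"
    using a' l1.pq_halfs by (auto simp: l2.contract_two)
  moreover have "halfs (contract G \<delta>) - halfs \<delta>' = halfs (contract G \<delta>') - halfs \<delta>"
    "gverts (contract G \<delta>) - gverts \<delta>' = gverts (contract G \<delta>') - gverts \<delta>"
    by (auto simp: l1.contract_two l2.contract_two)
  ultimately show ?thesis
    unfolding l12.contract_two l21.contract_two by (simp add: insert_commute)
qed

text \<open>If an edge joins \<delta> and \<delta>', a neighbour of \<delta> is a leg of \<delta>',
  and exchanging legs brings this to the form a = p'. Otherwise each contraction leaves the edges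
  attaching the other graph untouched.\<close>

lemma (in disjoint_contractions) commute_two_two:
  assumes lp1: "leg_pair S \<delta> G p q a b" and lp2: "leg_pair S \<delta>' G p' q' a' b'"
  shows "contract (contract G \<delta>) \<delta>' = contract (contract G \<delta>') \<delta>"
proof -
  interpret sw: disjoint_contractions S \<delta>' \<delta> G by (rule swapped)
  interpret l1: leg_pair S \<delta> G p q a b by (rule lp1)
  interpret l2: leg_pair S \<delta>' G p' q' a' b' by (rule lp2)
  have pre: "pregraph G" by (rule feynman_pregraph[OF G])
  have leg2: "x = p' \<or> x = q'" if "{y, x} \<in> gedges G" "y \<in> halfs \<delta>" "x \<in> halfs \<delta>'" for x y
  proof -
    have "{y, x} \<notin> gedges \<delta>'" using pregraph_edge_subset[OF c2.pre, of "{y, x}"] that(2) disj by auto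
    then have "x \<in> external \<delta>'" using c2.edge_at_sub[OF that(1) _ _ that(3)] by blast
    then show ?thesis using l2.legs by auto
  qed
  consider "a = p'" | "a = q'" | "b = p'" | "b = q'" | "a \<notin> halfs \<delta>'" "b \<notin> halfs \<delta>'"
    using leg2[OF l1.pa l1.pq_halfs(1)] leg2[OF l1.qb l1.pq_halfs(2)] by blast
  then show ?thesis
  proof cases
    case 1
    then show ?thesis using commute_adjacent[OF lp1 lp2] by blast
  next
    case 2
    then show ?thesis using commute_adjacent[OF lp1 l2.swapped] by blast
  next
    case 3
    then show ?thesis using commute_adjacent[OF l1.swapped lp2] by blast
  next
    case 4
    then show ?thesis using commute_adjacent[OF l1.swapped l2.swapped] by blast
  next
    case 5
    have far: "x \<notin> halfs \<delta>" if xy: "{y, x} \<in> gedges G" "y \<in> halfs \<delta>'" for x y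
    proof
      assume x: "x \<in> halfs \<delta>"
      have "{y, x} \<notin> gedges \<delta>" using pregraph_edge_subset[OF c1.pre, of "{y, x}"] xy(2) disj by auto
      then have "x \<in> external \<delta>" using c1.edge_at_sub[OF xy(1) _ _ x] by blast
      then have "x = p \<or> x = q" using l1.legs by auto
      moreover have "{x, y} \<in> gedges G" using xy(1) by (simp add: insert_commute)
      ultimately have "y = a \<or> y = b" using pregraph_mates_unique[OF pre l1.pa] pregraph_mates_unique[OF pre l1.qb] by blast
      then show False using 5 xy(2) by blast
    qed
    have a': "a' \<notin> halfs \<delta>" "b' \<notin> halfs \<delta>" using far[OF l2.pa] far[OF l2.qb] l2.pq_halfs by auto
    have "p' \<notin> halfs \<delta>" "q' \<notin> halfs \<delta>" "p \<notin> halfs \<delta>'" "q \<notin> halfs \<delta>'" using l1.pq_halfs l2.pq_halfs disj by auto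
    then have cr1: "{p', a'} \<in> gedges (contract G \<delta>)" "{q', b'} \<in> gedges (contract G \<delta>)"
      and cr2: "{p, a} \<in> gedges (contract G \<delta>')" "{q, b} \<in> gedges (contract G \<delta>')"
      using a' 5 l1.pa l2.pa l1.qb l2.qb by (auto simp: l1.contract_two l2.contract_two)
    interpret l12: leg_pair S \<delta>' "contract G \<delta>" p' q' a' b'
      by unfold_locales (fact cr1 l2.legs l2.a l2.b)+
    interpret l21: leg_pair S \<delta> "contract G \<delta>'" p q a b
      by unfold_locales (fact cr2 l1.legs l1.a l1.b)+
    have "{e \<in> gedges (contract G \<delta>). e \<inter> halfs \<delta>' = {}} \<union> {{a', b'}} =
        {e \<in> gedges (contract G \<delta>'). e \<inter> halfs \<delta> = {}} \<union> {{a, b}}"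
      using 5 a' by (auto simp: l1.contract_two l2.contract_two)
    moreover have "halfs (contract G \<delta>) - halfs \<delta>' = halfs (contract G \<delta>') - halfs \<delta>"
      "gverts (contract G \<delta>) - gverts \<delta>' = gverts (contract G \<delta>') - gverts \<delta>"
      by (auto simp: l1.contract_two l2.contract_two)
    ultimately show ?thesis unfolding l12.contract_two l21.contract_two by simp
  qed
qed

lemma (in disjoint_contractions) contract_commute:
  "contract (contract G \<delta>) \<delta>' = contract (contract G \<delta>') \<delta>"
proof (cases "external \<delta> \<subseteq> external G \<or> card (external \<delta>) = 3")
  case k1: True
  show ?thesis
  proof (cases "external \<delta>' \<subseteq> external G \<or> card (external \<delta>') = 3")
    case True
    then show ?thesis using commute_keep_keep k1 by blast
  next
    case False
    from lf obtain p q a b where "leg_pair S \<delta>' G p q a b"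
      by (cases rule: c2.contraction_cases) (use False in auto)
    then show ?thesis using commute_keep_two[OF k1] by blast
  qed
next
  case False
  from lf obtain p q a b where lp1: "leg_pair S \<delta> G p q a b"
    by (cases rule: c1.contraction_cases) (use False in auto)
  show ?thesis
  proof (cases "external \<delta>' \<subseteq> external G \<or> card (external \<delta>') = 3")
    case True
    then show ?thesis using disjoint_contractions.commute_keep_two[OF swapped _ lp1] by simp
  next
    case False
    from lf obtain p' q' a' b' where "leg_pair S \<delta>' G p' q' a' b'"
      by (cases rule: c2.contraction_cases) (use False in auto)
    then show ?thesis using commute_two_two[OF lp1] by blast
  qed
qed

section \<open>Quotients of Feynman graphs\<close>

definition empty_graph :: "'s lgraph" where
  "empty_graph = \<lparr>halfs = {}, gverts = {}, gedges = {}\<rparr>"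

lemma empty_graph_simps [simp]: "halfs empty_graph = {}" "gverts empty_graph = {}" "gedges empty_graph = {}"
  by (simp_all add: empty_graph_def)

lemma pregraph_empty_iff: "pregraph G \<Longrightarrow> halfs G = {} \<longleftrightarrow> G = empty_graph"
proof
  assume G: "pregraph G" "halfs G = {}"
  have "gverts G = {}" using pregraph_vert_subset[OF G(1)] pregraph_vert_nonempty[OF G(1)] G(2) by blast
  moreover have "gedges G = {}" using pregraph_edge_subset[OF G(1)] pregraph_edge_nonempty[OF G(1)] G(2) by blast
  ultimately show "G = empty_graph" using G(2) by (cases G) (simp add: empty_graph_def)
qed simp

lemma components_empty [simp]: "components empty_graph = {}"
  by (simp add: components_def)

lemma feynman_empty: "feynman S empty_graph"
  by (auto simp: feynman_def partition_on_def)

lemma gsub_empty: "gsub empty_graph G"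
  by (simp add: gsub_def)

lemma component_props:
  assumes G: "pregraph G" and \<delta>: "\<delta> \<in> components G"
  shows component_gsub: "gsub \<delta> G" and component_connected: "connected_graph \<delta>"
    and component_external: "external \<delta> \<subseteq> external G"
proof -
  obtain h where h: "h \<in> halfs G" "\<delta> = induced G (conn G `` {h})" using \<delta> unfolding components_eq[OF G] by blast
  have cl: "closed_in G (conn G `` {h})" by (rule closed_in_class[OF G h(1)])
  show "gsub \<delta> G" using pregraph_induced(2)[OF G cl] h(2) by simp
  show "external \<delta> \<subseteq> external G" using external_induced[OF cl] h(2) by simp
  have "(x, y) \<in> conn \<delta>" if xy: "x \<in> halfs \<delta>" "y \<in> halfs \<delta>" for x y
  proof -
    have m: "x \<in> conn G `` {h}" "(h, x) \<in> conn G" "(h, y) \<in> conn G" using xy h(2) by auto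
    then have "(x, y) \<in> conn G" using conn_sym rtrancl_trans by metis
    then show ?thesis using conn_induced'[OF G cl m(1)] h(2) by simp
  qed
  moreover have "h \<in> halfs \<delta>" using h(2) by simp
  ultimately show "connected_graph \<delta>"
    using pregraph_induced(1)[OF G cl] h(2) by (auto simp: connected_graph_def)
qed

lemma component_feynman:
  assumes "feynman S G" "\<delta> \<in> components G"
  shows "feynman S \<delta>"
proof -
  have G: "pregraph G" by (rule feynman_pregraph[OF assms(1)])
  note props = component_props[OF G assms(2)]
  have "pregraph \<delta>" using props(2) by (simp add: connected_graph_def)
  moreover have "halfs \<delta> \<subseteq> S" using props(1) feynman_halfs[OF assms(1)] by (auto simp: gsub_def)
  moreover have "good_component \<delta>" using assms by (simp add: feynman_iff_components)
  ultimately show ?thesis using components_connected[OF props(2)] by (simp add: feynman_iff_components)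
qed

lemma components_disjoint:
  assumes G: "pregraph G" and \<delta>: "\<delta> \<in> components G" "\<delta>' \<in> components G" "\<delta> \<noteq> \<delta>'"
  shows "halfs \<delta> \<inter> halfs \<delta>' = {}"
proof (rule ccontr)
  assume "halfs \<delta> \<inter> halfs \<delta>' \<noteq> {}"
  obtain h where h: "\<delta> = induced G (conn G `` {h})" using \<delta>(1) unfolding components_eq[OF G] by blast
  obtain k where k: "\<delta>' = induced G (conn G `` {k})" using \<delta>(2) unfolding components_eq[OF G] by blast
  obtain x where "(h, x) \<in> conn G" "(k, x) \<in> conn G" using \<open>halfs \<delta> \<inter> halfs \<delta>' \<noteq> {}\<close> h k by auto
  then have "(h, y) \<in> conn G \<longleftrightarrow> (k, y) \<in> conn G" for y using conn_sym rtrancl_trans by metis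
  then have "conn G `` {h} = conn G `` {k}" by auto
  then show False using h k \<delta>(3) by simp
qed

lemma finite_components: "pregraph G \<Longrightarrow> finite (components G)"
  by (simp add: components_eq pregraph_finite)

lemma component_of:
  assumes "pregraph G" "h \<in> halfs G"
  obtains \<delta> where "\<delta> \<in> components G" "h \<in> halfs \<delta>"
  using assms components_eq[OF assms(1)] by (metis Image_singleton_iff image_eqI induced_simps(1) rtrancl.rtrancl_refl)

lemma components_eq_empty_iff: "pregraph G \<Longrightarrow> components G = {} \<longleftrightarrow> G = empty_graph"
  using pregraph_empty_iff component_of components_empty by (metis empty_iff ex_in_conv)

lemma component_contraction:
  assumes "feynman S G" "feynman S \<gamma>" "gsub \<gamma> G" "\<delta> \<in> components \<gamma>"
  shows "subgraph_contraction S \<delta> G"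
proof (rule subgraph_contractionI[OF component_feynman[OF assms(2,4)] _ assms(1)])
  note p = component_props[OF feynman_pregraph[OF assms(2)] assms(4)]
  show "connected_graph \<delta>" "gsub \<delta> G" using p gsub_trans[OF p(1) assms(3)] by blast+
qed

lemma contract_component:
  assumes G: "feynman S G" and \<gamma>: "feynman S \<gamma>" "gsub \<gamma> G" and \<delta>: "\<delta> \<in> components \<gamma>"
  shows "feynman S (contract G \<delta>)" "feynman S (contract \<gamma> \<delta>)" "gsub (contract \<gamma> \<delta>) (contract G \<delta>)"
    "components (contract \<gamma> \<delta>) = components \<gamma> - {\<delta>}"
proof -
  interpret g: subgraph_contraction S \<delta> G by (rule component_contraction[OF G \<gamma> \<delta>])
  interpret c: subgraph_contraction S \<delta> \<gamma> by (rule component_contraction[OF \<gamma>(1) \<gamma>(1) gsub_refl \<delta>])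
  show "feynman S (contract G \<delta>)" using g.feynman_contract G by simp
  show "feynman S (contract \<gamma> \<delta>)" using c.feynman_contract \<gamma>(1) by simp
  show "gsub (contract \<gamma> \<delta>) (contract G \<delta>)" using contract_mono[OF g.feyn g.connected \<gamma>(1) G c.sub \<gamma>(2)] .
  show "components (contract \<gamma> \<delta>) = components \<gamma> - {\<delta>}"
    by (rule c.components_contract_detached[OF component_props(3)[OF feynman_pregraph[OF \<gamma>(1)] \<delta>]])
qed

section \<open>Well-definedness of the iterated contraction\<close>

abbreviation contract_fold :: "'s lgraph \<Rightarrow> 's lgraph \<Rightarrow> 's lgraph" where
  "contract_fold \<equiv> \<lambda>\<delta> G. contract G \<delta>"

text \<open>Commutation is available only for intermediate results that are Feynman graphs still
  containing the components yet to be contracted. Uniqueness of the result of a run is therefore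
  proved by strong induction on the set of contracted components, simultaneously with these two
  invariants.\<close>

lemma fold_graph_contract:
  assumes G: "feynman S G" and \<gamma>: "feynman S \<gamma>" "gsub \<gamma> G" and A: "A \<subseteq> components \<gamma>"
  shows "\<exists>y. (\<forall>y'. fold_graph contract_fold G A y' \<longleftrightarrow> y' = y) \<and> feynman S y \<and>
    (\<forall>\<delta>\<in>components \<gamma> - A. gsub \<delta> y)"
proof -
  have p\<gamma>: "pregraph \<gamma>" by (rule feynman_pregraph[OF \<gamma>(1)])
  have "finite A" using A finite_components[OF p\<gamma>] finite_subset by blast
  then show ?thesis using A
  proof (induction A rule: finite_psubset_induct)
    case (psubset A)
    note comp = component_props[OF p\<gamma>]
    show ?case
    proof (cases "A = {}")
      case True
      have "fold_graph contract_fold G {} y' \<longleftrightarrow> y' = G" for y'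
        by (auto elim: fold_graph.cases intro: fold_graph.emptyI)
      moreover have "gsub \<delta> G" if "\<delta> \<in> components \<gamma>" for \<delta> using comp(1)[OF that] \<gamma>(2) by (rule gsub_trans)
      ultimately show ?thesis using True G by (intro exI[of _ G]) simp
    next
      case False
      define P where "P B y \<longleftrightarrow> (\<forall>y'. fold_graph contract_fold G B y' \<longleftrightarrow> y' = y) \<and> feynman S y \<and>
        (\<forall>\<delta>\<in>components \<gamma> - B. gsub \<delta> y)" for B y
      have IH: "\<exists>y. P B y" if "B \<subset> A" for B
        unfolding P_def using psubset.IH[OF that] psubset.prems that by blast
      \<comment> \<open>The last contraction of a run over A may be any element of A. Two choices x
        and x' are compared through the result z for A without both, on which the two contractions
        commute.\<close>
      have comm: "contract y x = contract y' x'"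
        if x: "x \<in> A" "x' \<in> A" and y: "P (A - {x}) y" "P (A - {x'}) y'" for x x' y y'
      proof (cases "x = x'")
        case True
        have "fold_graph contract_fold G (A - {x}) y" using y(1) unfolding P_def by blast
        then have "y = y'" using y(2) True unfolding P_def by blast
        then show ?thesis using True by simp
      next
        case False
        let ?B = "A - {x} - {x'}"
        have "?B \<subset> A" using x by blast
        then obtain z where z: "P ?B z" using IH by blast
        then have fz: "fold_graph contract_fold G ?B z" unfolding P_def by blast
        have 1: "insert x' ?B = A - {x}" "insert x ?B = A - {x'}" using x False by auto
        have "fold_graph contract_fold G (insert x' ?B) (contract z x')"
          using fz by (intro fold_graph.insertI) auto
        then have yz: "y = contract z x'" using y(1) unfolding P_def 1 by simp
        have "fold_graph contract_fold G (insert x ?B) (contract z x)"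
          using fz by (intro fold_graph.insertI) auto
        then have y'z: "y' = contract z x" using y(2) unfolding P_def 1 by simp
        have xc: "x \<in> components \<gamma>" "x' \<in> components \<gamma>" using x psubset.prems by auto
        have "gsub x z" "gsub x' z" using z xc unfolding P_def by auto
        moreover have "feynman S z" using z unfolding P_def by blast
        ultimately have "disjoint_contractions S x x' z"
          using component_feynman[OF \<gamma>(1)] comp(2) components_disjoint[OF p\<gamma> xc False] xc
          by (simp add: disjoint_contractions_def)
        then show ?thesis unfolding yz y'z using disjoint_contractions.contract_commute by metis
      qed
      obtain x where x: "x \<in> A" using False by blast
      then have "A - {x} \<subset> A" by blast
      then obtain y where y: "P (A - {x}) y" using IH by blast
      have xc: "x \<in> components \<gamma>" using x psubset.prems by blast
      have fy: "feynman S y" and xy: "gsub x y" and fold_y: "fold_graph contract_fold G (A - {x}) y"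
        using y xc unfolding P_def by auto
      interpret c: subgraph_contraction S x y
        by (rule subgraph_contractionI[OF component_feynman[OF \<gamma>(1) xc] comp(2)[OF xc] fy xy])
      have "P A (contract y x)" unfolding P_def
      proof (intro conjI allI ballI iffI)
        have "fold_graph contract_fold G (insert x (A - {x})) (contract y x)"
          using fold_y by (intro fold_graph.insertI) auto
        then have "fold_graph contract_fold G A (contract y x)" using x by (simp add: insert_absorb)
        then show "fold_graph contract_fold G A y'" if "y' = contract y x" for y' using that by simp
        show "y' = contract y x" if f: "fold_graph contract_fold G A y'" for y'
          using f
        proof (cases rule: fold_graph.cases)
          case (insertI x' B z)
          then have B: "x' \<in> A" "B = A - {x'}" by auto
          then have "B \<subset> A" by blast
          then obtain w where w: "P B w" using IH by blast
          then have "z = w" using insertI unfolding P_def by blast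
          then have "contract w x' = contract y x" using comm[OF B(1) x _ y] w B(2) by simp
          then show ?thesis using insertI \<open>z = w\<close> by simp
        qed (use False in simp)
        show "feynman S (contract y x)" using c.feynman_contract fy by simp
        fix \<delta> assume \<delta>: "\<delta> \<in> components \<gamma> - A"
        then have \<delta>': "\<delta> \<in> components \<gamma>" "\<delta> \<noteq> x" using x by auto
        have "gsub \<delta> y" using y \<delta> unfolding P_def by blast
        moreover have "pregraph \<delta>" using comp(2)[OF \<delta>'(1)] by (simp add: connected_graph_def)
        moreover have "halfs \<delta> \<inter> halfs x = {}" by (rule components_disjoint[OF p\<gamma> \<delta>'(1) xc \<delta>'(2)])
        ultimately show "gsub \<delta> (contract y x)" using c.gsub_contract_disjoint feynman_locally[OF fy] by blast
      qed
      then show ?thesis unfolding P_def by blast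
    qed
  qed
qed

lemma graph_quotient_iff:
  assumes "feynman S G" "feynman S \<gamma>" "gsub \<gamma> G"
  shows "fold_graph contract_fold G (components \<gamma>) y \<longleftrightarrow> y = graph_quotient G \<gamma>"
proof -
  obtain z where z: "\<And>y. fold_graph contract_fold G (components \<gamma>) y \<longleftrightarrow> y = z"
    using fold_graph_contract[OF assms subset_refl] by blast
  have "(THE y. fold_graph contract_fold G (components \<gamma>) y) = z" by (rule the_equality) (simp_all add: z)
  then have "graph_quotient G \<gamma> = z"
    using finite_components[OF feynman_pregraph[OF assms(2)]] by (simp add: graph_quotient_def Finite_Set.fold_def)
  then show ?thesis using z by simp
qed

lemma graph_quotient_empty: "graph_quotient G empty_graph = G"
  by (simp add: graph_quotient_def)

text \<open>Contracting a component within \<gamma> itself just deletes it, so the right-hand side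
  folds over the remaining components. Such a run from \<open>G/\<delta>\<close> is a run from G
  that begins with \<delta>, and all runs from G have the same result.\<close>

lemma graph_quotient_contract:
  assumes G: "feynman S G" and \<gamma>: "feynman S \<gamma>" "gsub \<gamma> G" and \<delta>: "\<delta> \<in> components \<gamma>"
  shows "graph_quotient G \<gamma> = graph_quotient (contract G \<delta>) (contract \<gamma> \<delta>)"
proof -
  note c = contract_component[OF G \<gamma> \<delta>]
  have "fold_graph contract_fold G (insert \<delta> B) y"
    if "fold_graph contract_fold (contract G \<delta>) B y" "\<delta> \<notin> B" for B y
    using that
  proof (induction rule: fold_graph.induct)
    case emptyI
    show ?case by (rule fold_graph.insertI[OF _ fold_graph.emptyI]) simp
  next
    case (insertI x B y)
    then have "fold_graph contract_fold G (insert x (insert \<delta> B)) (contract y x)"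
      by (intro fold_graph.insertI) auto
    then show ?case by (simp add: insert_commute)
  qed
  moreover have "fold_graph contract_fold (contract G \<delta>) (components \<gamma> - {\<delta>}) (graph_quotient (contract G \<delta>) (contract \<gamma> \<delta>))"
    using graph_quotient_iff[OF c(1-3)] unfolding c(4) by blast
  ultimately have "fold_graph contract_fold G (insert \<delta> (components \<gamma> - {\<delta>})) (graph_quotient (contract G \<delta>) (contract \<gamma> \<delta>))"
    by blast
  then show ?thesis using graph_quotient_iff[OF G \<gamma>] \<delta> by (simp add: insert_absorb)
qed

text \<open>Peeling off one component changes the ambient graph as well, so the property has to be a
  relation between G and \<gamma>; the number of components of \<gamma> decreases.\<close>

lemma quotient_induct [consumes 3, case_names empty contract]:
  assumes "feynman S G" "feynman S \<gamma>" "gsub \<gamma> G"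
    and "\<And>G. feynman S G \<Longrightarrow> P G empty_graph"
    and "\<And>G \<gamma> \<delta>. feynman S G \<Longrightarrow> feynman S \<gamma> \<Longrightarrow> gsub \<gamma> G \<Longrightarrow> \<delta> \<in> components \<gamma> \<Longrightarrow>
      P (contract G \<delta>) (contract \<gamma> \<delta>) \<Longrightarrow> P G \<gamma>"
  shows "P G \<gamma>"
  using assms(1-3)
proof (induction "card (components \<gamma>)" arbitrary: G \<gamma> rule: less_induct)
  case less
  note p\<gamma> = feynman_pregraph[OF less.prems(2)]
  show ?case
  proof (cases "components \<gamma> = {}")
    case True
    then have "\<gamma> = empty_graph" using components_eq_empty_iff[OF p\<gamma>] by simp
    then show ?thesis using assms(4) less.prems(1) by simp
  next
    case False
    then obtain \<delta> where \<delta>: "\<delta> \<in> components \<gamma>" by blast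
    note c = contract_component[OF less.prems \<delta>]
    have "card (components (contract \<gamma> \<delta>)) < card (components \<gamma>)"
      unfolding c(4) using \<delta> finite_components[OF p\<gamma>] by (rule card_Diff1_less[rotated])
    then have "P (contract G \<delta>) (contract \<gamma> \<delta>)" using less.hyps c by blast
    then show ?thesis using assms(5) less.prems \<delta> by blast
  qed
qed

section \<open>General quotients, by induction on components\<close>

lemma feynman_graph_quotient:
  assumes "feynman S G" "feynman S \<gamma>" "gsub \<gamma> G"
  shows "feynman S (graph_quotient G \<gamma>)"
  using assms
  by (induction rule: quotient_induct) (simp_all add: graph_quotient_empty graph_quotient_contract)

lemma graph_quotient_self:
  assumes "feynman S G"
  shows "graph_quotient G G = empty_graph"
proof -
  \<comment> \<open>The diagonal case is phrased as an implication so that the induction, which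
    varies both graphs, applies; equality persists when both are contracted.\<close>
  have "\<gamma> = G \<longrightarrow> graph_quotient G \<gamma> = empty_graph" if "feynman S G" "feynman S \<gamma>" "gsub \<gamma> G" for G \<gamma>
    using that by (induction rule: quotient_induct) (auto simp: graph_quotient_empty graph_quotient_contract)
  then show ?thesis using assms gsub_refl by blast
qed

text \<open>Bounds the size of an extension by the sizes of its subobject and its quotient. It is a
  cover and not a partition, because the legs of an attached three-legged component occur in
  both.\<close>

lemma halfs_graph_quotient_cover:
  assumes "feynman S G" "feynman S \<gamma>" "gsub \<gamma> G"
  shows "halfs G \<subseteq> halfs \<gamma> \<union> halfs (graph_quotient G \<gamma>)"
  using assms
proof (induction rule: quotient_induct)
  case (contract G \<gamma> \<delta>)
  interpret c: subgraph_contraction S \<delta> \<gamma> by (rule component_contraction[OF contract(2,2) gsub_refl contract(4)])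
  interpret g: subgraph_contraction S \<delta> G by (rule component_contraction[OF contract(1-4)])
  have "contract \<gamma> \<delta> = \<lparr>halfs = halfs \<gamma> - halfs \<delta>, gverts = gverts \<gamma> - gverts \<delta>, gedges = gedges \<gamma> - gedges \<delta>\<rparr>"
    by (rule c.contract_detached[OF component_props(3)[OF feynman_pregraph[OF contract(2)] contract(4)]])
  then show ?case
    using g.halfs_contract_cover c.subs(1) contract(5) graph_quotient_contract[OF contract(1-4)] by auto
qed (simp add: graph_quotient_empty)

text \<open>\<delta> may be a proper part of a component \<sigma> of T. Then
  \<open>\<sigma>/\<delta>\<close> is a component of \<open>T/\<delta>\<close>; contracting it first
  and using \<open>contract_contract\<close> in both G and T leads to the quotient of
  \<open>G/\<sigma>\<close> by \<open>T/\<sigma>\<close>.\<close>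

lemma graph_quotient_contract_connected:
  assumes G: "feynman S G" and T: "feynman S T" "gsub T G" and \<delta>: "feynman S \<delta>" "connected_graph \<delta>" "gsub \<delta> T"
  shows "graph_quotient (contract G \<delta>) (contract T \<delta>) = graph_quotient G T"
proof -
  have pT: "pregraph T" by (rule feynman_pregraph[OF T(1)])
  interpret dT: subgraph_contraction S \<delta> T using \<delta>(1,2) T(1) \<delta>(3) by (rule subgraph_contractionI)
  interpret dG: subgraph_contraction S \<delta> G using \<delta>(1,2) G gsub_trans[OF \<delta>(3) T(2)] by (rule subgraph_contractionI)
  obtain h where h: "h \<in> halfs \<delta>" using dT.nonempty by blast
  then have "h \<in> halfs T" using dT.subs(1) by blast
  then obtain \<sigma> where \<sigma>: "\<sigma> \<in> components T" "h \<in> halfs \<sigma>" using component_of[OF pT] by metis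
  note comp = component_props[OF pT \<sigma>(1)]
  show ?thesis
  proof (cases "\<delta> = \<sigma>")
    case True
    then show ?thesis using graph_quotient_contract[OF G T] \<sigma>(1) by simp
  next
    case ne: False
    obtain k where k: "\<sigma> = induced T (conn T `` {k})" using \<sigma>(1) unfolding components_eq[OF pT] by blast
    have "halfs \<delta> \<subseteq> halfs \<sigma>"
    proof
      fix x assume "x \<in> halfs \<delta>"
      then have "(h, x) \<in> conn T" using dT.con_G h by blast
      moreover have "(k, h) \<in> conn T" using \<sigma>(2) k by simp
      ultimately show "x \<in> halfs \<sigma>" using k by (auto intro: rtrancl_trans)
    qed
    moreover have "gverts \<delta> \<subseteq> gverts \<sigma>"
      using calculation k dT.subs(2) pregraph_vert_subset[OF dT.pre] by fastforce
    moreover have "gedges \<delta> \<subseteq> gedges \<sigma>"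
      using calculation(1) k dT.subs(3) pregraph_edge_subset[OF dT.pre] by fastforce
    ultimately have \<delta>\<sigma>: "gsub \<delta> \<sigma>" by (simp add: gsub_def)
    have f\<sigma>: "feynman S \<sigma>" by (rule component_feynman[OF T(1) \<sigma>(1)])
    interpret nT: nested_contraction S \<delta> \<sigma> T
      by unfold_locales (fact \<delta>(1,2) f\<sigma> comp(2) T(1) \<delta>\<sigma> comp(1) ne)+
    interpret nG: nested_contraction S \<delta> \<sigma> G
      by unfold_locales (fact \<delta>(1,2) f\<sigma> comp(2) G \<delta>\<sigma> gsub_trans[OF comp(1) T(2)] ne)+
    have "external (contract \<sigma> \<delta>) \<subseteq> external (contract T \<delta>)" unfolding nT.external_quot by (rule comp(3))
    then have c: "contract \<sigma> \<delta> \<in> components (contract T \<delta>)" using nT.quot.component_iff by simp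
    have "gsub (contract T \<delta>) (contract G \<delta>)" using contract_mono[OF \<delta>(1,2) T(1) G \<delta>(3) T(2)] .
    then have "graph_quotient (contract G \<delta>) (contract T \<delta>) =
      graph_quotient (contract (contract G \<delta>) (contract \<sigma> \<delta>)) (contract (contract T \<delta>) (contract \<sigma> \<delta>))"
      using graph_quotient_contract[OF nG.feynman_contracts(2) nT.feynman_contracts(2) _ c] by blast
    also have "\<dots> = graph_quotient (contract G \<sigma>) (contract T \<sigma>)"
      by (simp only: nG.contract_contract nT.contract_contract)
    also have "\<dots> = graph_quotient G T" using graph_quotient_contract[OF G T \<sigma>(1)] by simp
    finally show ?thesis .
  qed
qed

text \<open>Contracting a component \<delta> of \<gamma> replaces T by \<open>T/\<delta>\<close>, so
  T is generalised in the induction. In T the graph \<delta> is only a connected subgraph, which is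
  where \<open>graph_quotient_contract_connected\<close> enters.\<close>

lemma graph_quotient_graph_quotient:
  assumes "feynman S G" "feynman S \<gamma>" "gsub \<gamma> G" "feynman S T" "gsub \<gamma> T" "gsub T G"
  shows "graph_quotient (graph_quotient G \<gamma>) (graph_quotient T \<gamma>) = graph_quotient G T"
proof -
  have "\<forall>T. feynman S T \<longrightarrow> gsub \<gamma> T \<longrightarrow> gsub T G \<longrightarrow>
    graph_quotient (graph_quotient G \<gamma>) (graph_quotient T \<gamma>) = graph_quotient G T"
    using assms(1-3)
  proof (induction rule: quotient_induct)
    case (contract G \<gamma> \<delta>)
    note p\<gamma> = feynman_pregraph[OF contract(2)]
    have \<delta>: "feynman S \<delta>" "connected_graph \<delta>" "gsub \<delta> \<gamma>"
      using component_feynman[OF contract(2,4)] component_props[OF p\<gamma> contract(4)] by blast+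
    show ?case
    proof (intro allI impI)
      fix T assume T: "feynman S T" "gsub \<gamma> T" "gsub T G"
      note cT = contract_component[OF T(1) contract(2) T(2) contract(4)]
      have \<delta>T: "gsub \<delta> T" using \<delta>(3) T(2) by (rule gsub_trans)
      have m: "gsub (contract T \<delta>) (contract G \<delta>)" using contract_mono[OF \<delta>(1,2) T(1) contract(1) \<delta>T T(3)] .
      show "graph_quotient (graph_quotient G \<gamma>) (graph_quotient T \<gamma>) = graph_quotient G T"
        unfolding graph_quotient_contract[OF contract(1-4)] graph_quotient_contract[OF T(1) contract(2) T(2) contract(4)]
        using contract(5) cT(1,3) m graph_quotient_contract_connected[OF contract(1) T(1,3) \<delta>(1,2) \<delta>T] by simp
    qed
  qed (simp add: graph_quotient_empty)
  then show ?thesis using assms(4-6) by blast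
qed

text \<open>The bijection for one component \<delta> restricts to the graphs containing \<gamma>: T
  contains \<gamma> if and only if \<open>T/\<delta>\<close> contains
  \<open>\<gamma>/\<delta>\<close>, the converse using uniqueness of lifts in G. It is then composed
  with the bijection for \<open>\<gamma>/\<delta>\<close>.\<close>

lemma bij_betw_graph_quotient:
  assumes "feynman S G" "feynman S \<gamma>" "gsub \<gamma> G"
  shows "bij_betw (\<lambda>T. graph_quotient T \<gamma>) {T \<in> subgraphs S G. \<gamma> \<in> subgraphs S T} (subgraphs S (graph_quotient G \<gamma>))"
  using assms
proof (induction rule: quotient_induct)
  case (empty G)
  have "{T \<in> subgraphs S G. empty_graph \<in> subgraphs S T} = subgraphs S G"
    using feynman_empty gsub_empty by (auto simp: gsub_feynman_iff)
  then show ?case by (simp add: graph_quotient_empty bij_betw_def)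
next
  case (contract G \<gamma> \<delta>)
  note p\<gamma> = feynman_pregraph[OF contract(2)]
  have \<delta>: "feynman S \<delta>" "connected_graph \<delta>" "gsub \<delta> \<gamma>"
    using component_feynman[OF contract(2,4)] component_props[OF p\<gamma> contract(4)] by blast+
  interpret g: subgraph_contraction S \<delta> G by (rule component_contraction[OF contract(1-4)])
  let ?c = "\<lambda>T. contract T \<delta>"
  let ?above = "{T \<in> subgraphs S G. \<delta> \<in> subgraphs S T}"
  have b: "bij_betw ?c ?above (subgraphs S (?c G))" using g.bij_betw_contract contract(1) by blast
  have iff: "\<gamma> \<in> subgraphs S T \<longleftrightarrow> ?c \<gamma> \<in> subgraphs S (?c T)" if T: "T \<in> ?above" for T
  proof
    have T': "feynman S T" "gsub T G" "gsub \<delta> T" using T by (auto simp: gsub_feynman_iff)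
    show "?c \<gamma> \<in> subgraphs S (?c T)" if "\<gamma> \<in> subgraphs S T"
      using contract_component[OF T'(1) contract(2) _ contract(4)] that by (simp add: gsub_feynman_iff)
    interpret t: subgraph_contraction S \<delta> T using \<delta>(1,2) T'(1,3) by (rule subgraph_contractionI)
    assume "?c \<gamma> \<in> subgraphs S (?c T)"
    then obtain U where U: "U \<in> subgraphs S T" "\<delta> \<in> subgraphs S U" "?c U = ?c \<gamma>"
      using t.bij_betw_contract[OF T'(1)] unfolding bij_betw_def by force
    have "U \<in> ?above" using U T'(2) gsub_trans by (auto simp: gsub_feynman_iff)
    moreover have "\<gamma> \<in> ?above" using contract(2,3) \<delta> by (simp add: gsub_feynman_iff)
    ultimately have "U = \<gamma>" using b U(3) by (auto simp: bij_betw_def dest: inj_onD)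
    then show "\<gamma> \<in> subgraphs S T" using U(1) by simp
  qed
  have sub: "{T \<in> subgraphs S G. \<gamma> \<in> subgraphs S T} = {T \<in> ?above. ?c \<gamma> \<in> subgraphs S (?c T)}"
  proof -
    have "\<delta> \<in> subgraphs S T" if "\<gamma> \<in> subgraphs S T" for T
      using that \<delta> gsub_trans by (auto simp: gsub_feynman_iff)
    then show ?thesis using iff by blast
  qed
  have "bij_betw ?c {T \<in> ?above. ?c \<gamma> \<in> subgraphs S (?c T)} {U \<in> subgraphs S (?c G). ?c \<gamma> \<in> subgraphs S U}"
    using b unfolding bij_betw_def by (auto simp: inj_on_def)
  then have "bij_betw ((\<lambda>U. graph_quotient U (?c \<gamma>)) \<circ> ?c) {T \<in> subgraphs S G. \<gamma> \<in> subgraphs S T}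
      (subgraphs S (graph_quotient (?c G) (?c \<gamma>)))"
    unfolding sub using contract(5) by (rule bij_betw_trans)
  note b2 = this
  have eq: "((\<lambda>U. graph_quotient U (?c \<gamma>)) \<circ> ?c) T = graph_quotient T \<gamma>"
    if "T \<in> {T \<in> subgraphs S G. \<gamma> \<in> subgraphs S T}" for T
    using graph_quotient_contract[of S T \<gamma> \<delta>] that contract(2,4) by (simp add: gsub_feynman_iff)
  show ?case unfolding graph_quotient_contract[OF contract(1-4)]
    by (rule bij_betw_cong[THEN iffD1, OF eq b2])
qed

section \<open>Relabelling Feynman graphs\<close>

definition map_graph :: "('s \<Rightarrow> 's) \<Rightarrow> 's lgraph \<Rightarrow> 's lgraph" where
  "map_graph \<phi> G = \<lparr>halfs = \<phi> ` halfs G, gverts = (`) \<phi> ` gverts G, gedges = (`) \<phi> ` gedges G\<rparr>"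

lemma map_graph_simps [simp]:
  "halfs (map_graph \<phi> G) = \<phi> ` halfs G" "gverts (map_graph \<phi> G) = (`) \<phi> ` gverts G"
  "gedges (map_graph \<phi> G) = (`) \<phi> ` gedges G"
  by (simp_all add: map_graph_def)

lemma map_graph_comp: "map_graph \<phi> (map_graph \<psi> G) = map_graph (\<phi> \<circ> \<psi>) G"
  by (simp add: map_graph_def image_comp image_image)

lemma map_graph_id: "map_graph id G = G"
  by (simp add: map_graph_def)

lemma map_graph_inv: "bij \<phi> \<Longrightarrow> map_graph (inv \<phi>) (map_graph \<phi> G) = G"
  by (simp add: map_graph_comp bij_is_inj map_graph_id)

lemma map_graph_inv': "bij \<phi> \<Longrightarrow> map_graph \<phi> (map_graph (inv \<phi>) G) = G"
  by (simp add: map_graph_comp bij_is_surj map_graph_id surj_iff[THEN iffD1])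

lemma map_graph_empty: "map_graph \<phi> empty_graph = empty_graph"
  by (simp add: map_graph_def empty_graph_def)

lemma gsub_map_graph: "gsub \<gamma> G \<Longrightarrow> gsub (map_graph \<phi> \<gamma>) (map_graph \<phi> G)"
  by (auto simp: gsub_def)

text \<open>The labels of A \<union> B outside A are matched with those outside B, which are equally
  many, and all other labels are fixed. A permutation of all labels acts injectively on every graph,
  so equivariance of the constructions holds without side conditions on label sets.\<close>

lemma ex_permutation_extending:
  fixes f :: "'s \<Rightarrow> 's"
  assumes "finite A" "bij_betw f A B"
  shows "\<exists>\<phi>. bij \<phi> \<and> (\<forall>x\<in>A. \<phi> x = f x)"
proof -
  have fB: "finite B" "card A = card B" using assms bij_betw_finite bij_betw_same_card by blast+
  let ?U = "A \<union> B"
  have "card (?U - A) = card ?U - card A" "card (?U - B) = card ?U - card B"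
    using assms(1) fB(1) by (auto intro!: card_Diff_subset)
  then obtain g where g: "bij_betw g (?U - A) (?U - B)"
    using assms(1) fB by (metis finite_Diff finite_UnI finite_same_card_bij)
  define \<phi> where "\<phi> x = (if x \<in> A then f x else if x \<in> ?U then g x else x)" for x
  have "bij_betw \<phi> A B" using assms(2) by (rule bij_betw_cong[THEN iffD1, rotated]) (simp add: \<phi>_def)
  moreover have "bij_betw \<phi> (?U - A) (?U - B)" using g by (rule bij_betw_cong[THEN iffD1, rotated]) (auto simp: \<phi>_def)
  ultimately have "bij_betw \<phi> (A \<union> (?U - A)) (B \<union> (?U - B))" by (rule bij_betw_combine) blast
  moreover have "A \<union> (?U - A) = ?U" "B \<union> (?U - B) = ?U" by auto
  ultimately have "bij_betw \<phi> ?U ?U" by simp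
  moreover have "bij_betw \<phi> (- ?U) (- ?U)"
    by (rule bij_betw_cong[THEN iffD1, OF _ bij_betw_id]) (simp add: \<phi>_def)
  ultimately have "bij_betw \<phi> (?U \<union> - ?U) (?U \<union> - ?U)" by (rule bij_betw_combine) blast
  then have "bij \<phi>" by (simp only: Compl_partition)
  moreover have "\<forall>x\<in>A. \<phi> x = f x" by (simp add: \<phi>_def)
  ultimately show ?thesis by blast
qed

lemma linked_map_graph: "(h, k) \<in> linked G \<Longrightarrow> (\<phi> h, \<phi> k) \<in> linked (map_graph \<phi> G)"
  unfolding linked_def by auto

lemma conn_map_graph: "(h, k) \<in> conn G \<Longrightarrow> (\<phi> h, \<phi> k) \<in> conn (map_graph \<phi> G)"
  by (induction rule: rtrancl_induct) (auto intro: linked_map_graph rtrancl_into_rtrancl)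

context
  fixes \<phi> :: "'s \<Rightarrow> 's"
  assumes \<phi>: "bij \<phi>"
begin

lemma inj_\<phi>: "inj \<phi>"
  using \<phi> by (rule bij_is_inj)

lemma inj_image_\<phi>: "inj ((`) \<phi>)"
  by (rule injI) (simp add: inj_image_eq_iff[OF inj_\<phi>])

lemma conn_map_graph_iff: "(\<phi> h, \<phi> k) \<in> conn (map_graph \<phi> G) \<longleftrightarrow> (h, k) \<in> conn G"
proof
  assume "(\<phi> h, \<phi> k) \<in> conn (map_graph \<phi> G)"
  then have "(inv \<phi> (\<phi> h), inv \<phi> (\<phi> k)) \<in> conn (map_graph (inv \<phi>) (map_graph \<phi> G))" by (rule conn_map_graph)
  then show "(h, k) \<in> conn G" using map_graph_inv[OF \<phi>] inj_\<phi> by simp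
qed (rule conn_map_graph)

lemma class_map_graph: "conn (map_graph \<phi> G) `` {\<phi> h} = \<phi> ` (conn G `` {h})"
proof (intro subset_antisym subsetI)
  fix y assume y: "y \<in> conn (map_graph \<phi> G) `` {\<phi> h}"
  obtain k where k: "y = \<phi> k" using \<phi> by (metis bij_pointE)
  then have "(h, k) \<in> conn G" using y conn_map_graph_iff by simp
  then show "y \<in> \<phi> ` (conn G `` {h})" using k by simp
qed (auto intro: conn_map_graph)

lemma external_map_graph: "external (map_graph \<phi> G) = \<phi> ` external G"
  by (simp add: external_def image_set_diff[OF inj_\<phi>] image_Union)

lemma neighbours_map_graph: "neighbours (map_graph \<phi> G) (map_graph \<phi> \<gamma>) = \<phi> ` neighbours G \<gamma>"
proof -
  have e: "{\<phi> h, \<phi> k} \<in> (`) \<phi> ` gedges G \<longleftrightarrow> {h, k} \<in> gedges G" for h k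
    using inj_image_mem_iff[OF inj_image_\<phi>, of "{h, k}" "gedges G"] by simp
  have d: "\<phi> k \<in> \<phi> ` halfs G - \<phi> ` halfs \<gamma> \<longleftrightarrow> k \<in> halfs G - halfs \<gamma>" for k
    by (simp add: inj_image_mem_iff[OF inj_\<phi>])
  show ?thesis
    unfolding neighbours_def external_map_graph map_graph_simps
  proof (intro subset_antisym subsetI)
    fix y assume y: "y \<in> {k \<in> \<phi> ` halfs G - \<phi> ` halfs \<gamma>. \<exists>h\<in>\<phi> ` external \<gamma>. {h, k} \<in> (`) \<phi> ` gedges G}"
    then obtain k h where k: "y = \<phi> k" "h \<in> external \<gamma>" "{\<phi> h, \<phi> k} \<in> (`) \<phi> ` gedges G" by blast
    then have "k \<in> halfs G - halfs \<gamma>" "{h, k} \<in> gedges G" using y d[of k] e[of h k] by simp_all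
    then show "y \<in> \<phi> ` {k \<in> halfs G - halfs \<gamma>. \<exists>h\<in>external \<gamma>. {h, k} \<in> gedges G}" using k by blast
  next
    fix y assume "y \<in> \<phi> ` {k \<in> halfs G - halfs \<gamma>. \<exists>h\<in>external \<gamma>. {h, k} \<in> gedges G}"
    then obtain k h where k: "y = \<phi> k" "k \<in> halfs G - halfs \<gamma>" "h \<in> external \<gamma>" "{h, k} \<in> gedges G" by blast
    then have "\<phi> k \<in> \<phi> ` halfs G - \<phi> ` halfs \<gamma>" "{\<phi> h, \<phi> k} \<in> (`) \<phi> ` gedges G"
      using d[of k] e[of h k] by simp_all
    then show "y \<in> {k \<in> \<phi> ` halfs G - \<phi> ` halfs \<gamma>. \<exists>h\<in>\<phi> ` external \<gamma>. {h, k} \<in> (`) \<phi> ` gedges G}"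
      unfolding k(1) mem_Collect_eq by (intro conjI bexI[of _ "\<phi> h"] imageI k(3))
  qed
qed

lemma induced_map_graph: "induced (map_graph \<phi> G) (\<phi> ` K) = map_graph \<phi> (induced G K)"
proof -
  have "{x \<in> (`) \<phi> ` A. x \<subseteq> \<phi> ` K} = (`) \<phi> ` {x \<in> A. x \<subseteq> K}" for A
    using inj_image_subset_iff[OF inj_\<phi>] by blast
  then show ?thesis by (simp add: induced_def map_graph_def)
qed

lemma pregraph_map_graph:
  assumes G: "pregraph G"
  shows "pregraph (map_graph \<phi> G)"
proof -
  have c: "card (\<phi> ` x) = card x" for x using inj_on_subset[OF inj_\<phi>] by (intro card_image) blast
  have i: "inj_on \<phi> A" for A using inj_\<phi> by (rule inj_on_subset) simp
  have d: "disjoint ((`) \<phi> ` A)" if "disjoint A" for A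
    using that i by (intro disjoint_image)
  have "partition_on (\<phi> ` halfs G) ((`) \<phi> ` gverts G)"
    using G d unfolding pregraph_def partition_on_def by (auto simp flip: image_Union)
  moreover have "\<phi> ` e \<subseteq> \<phi> ` halfs G" if "e \<in> gedges G" for e
    using pregraph_edge_subset[OF G that] by (rule image_mono)
  ultimately show ?thesis using G d c unfolding pregraph_def map_graph_simps by simp
qed

lemma components_map_graph:
  assumes G: "pregraph G"
  shows "components (map_graph \<phi> G) = map_graph \<phi> ` components G"
  unfolding components_eq[OF G] components_eq[OF pregraph_map_graph[OF G]]
  by (simp add: image_image class_map_graph induced_map_graph)

lemma locally_feynman_map_graph:
  assumes lf: "locally_feynman G"
  shows "locally_feynman (map_graph \<phi> G)"
  unfolding locally_feynman_def
proof (intro conjI ballI impI)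
  have c: "card (\<phi> ` x) = card x" for x using inj_on_subset[OF inj_\<phi>] by (intro card_image) blast
  show "card (external (map_graph \<phi> G) \<inter> conn (map_graph \<phi> G) `` {y}) \<in> {2, 3}"
    if y: "y \<in> halfs (map_graph \<phi> G)" for y
  proof -
    obtain h where h: "h \<in> halfs G" "y = \<phi> h" using y by auto
    have "external (map_graph \<phi> G) \<inter> conn (map_graph \<phi> G) `` {y} = \<phi> ` (external G \<inter> conn G `` {h})"
      unfolding external_map_graph h(2) class_map_graph image_Int[OF inj_\<phi>] ..
    then have "card (external (map_graph \<phi> G) \<inter> conn (map_graph \<phi> G) `` {y}) =
      card (external G \<inter> conn G `` {h})" by (simp only: c)
    moreover have "card (external G \<inter> conn G `` {h}) \<in> {2, 3}" using lf h(1) by (simp add: locally_feynman_def)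
    ultimately show ?thesis by simp
  qed
  show "\<not> v \<subseteq> external (map_graph \<phi> G)" if "v \<in> gverts (map_graph \<phi> G)" for v
    using that lf unfolding external_map_graph locally_feynman_def by (auto simp: inj_image_subset_iff[OF inj_\<phi>])
  fix e h k assume e: "e \<in> gedges (map_graph \<phi> G)" and hk: "h \<in> external (map_graph \<phi> G)"
    "k \<in> external (map_graph \<phi> G)" "(h, k) \<in> conn (map_graph \<phi> G)"
  obtain e' where e': "e' \<in> gedges G" "e = \<phi> ` e'" using e by auto
  obtain h' k' where hk': "h' \<in> external G" "k' \<in> external G" "h = \<phi> h'" "k = \<phi> k'"
    using hk(1,2) unfolding external_map_graph by blast
  have "(h', k') \<in> conn G" using hk(3) hk' conn_map_graph_iff by simp
  then have "(h', k') \<in> conn (del_edges G {e'})" using lf e'(1) hk'(1,2) by (simp add: locally_feynman_def)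
  then have "(h, k) \<in> conn (map_graph \<phi> (del_edges G {e'}))" using conn_map_graph hk'(3,4) by metis
  moreover have "map_graph \<phi> (del_edges G {e'}) = del_edges (map_graph \<phi> G) {e}"
    using image_set_diff[OF inj_image_\<phi>, of "gedges G" "{e'}"] e'(2) by (simp add: map_graph_def)
  ultimately show "(h, k) \<in> conn (del_edges (map_graph \<phi> G) {e})" by simp
qed

lemma feynman_map_graph: "feynman S G \<Longrightarrow> \<phi> ` halfs G \<subseteq> S' \<Longrightarrow> feynman S' (map_graph \<phi> G)"
  using pregraph_map_graph locally_feynman_map_graph by (simp add: feynman_iff)

lemma contract_map_graph:
  assumes G: "pregraph G"
  shows "contract (map_graph \<phi> G) (map_graph \<phi> \<delta>) = map_graph \<phi> (contract G \<delta>)"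
proof -
  have inj: "inj (map_graph \<phi>)" using map_graph_inv[OF \<phi>] by (metis injI)
  have comp: "map_graph \<phi> \<delta> \<in> components (map_graph \<phi> G) \<longleftrightarrow> \<delta> \<in> components G"
    unfolding components_map_graph[OF G] by (rule inj_image_mem_iff[OF inj])
  have card: "card (\<phi> ` external \<delta>) = card (external \<delta>)"
    using inj_on_subset[OF inj_\<phi>] by (intro card_image) blast
  have diff: "\<phi> ` A - \<phi> ` B = \<phi> ` (A - B)" for A B by (rule image_set_diff[OF inj_\<phi>, symmetric])
  have diff': "(`) \<phi> ` A - (`) \<phi> ` B = (`) \<phi> ` (A - B)" for A B
    by (rule image_set_diff[OF inj_image_\<phi>, symmetric])
  have "e \<inter> halfs \<delta> = {} \<longleftrightarrow> \<phi> ` e \<inter> \<phi> ` halfs \<delta> = {}" for e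
    by (simp flip: image_Int[OF inj_\<phi>])
  then have far: "{e \<in> (`) \<phi> ` gedges G. e \<inter> \<phi> ` halfs \<delta> = {}} = (`) \<phi> ` {e \<in> gedges G. e \<inter> halfs \<delta> = {}}"
    by blast
  show ?thesis
    unfolding contract_def comp card neighbours_map_graph external_map_graph map_graph_simps diff diff' far
      induced_map_graph
    by (simp add: map_graph_def image_Un)
qed

text \<open>A permutation of all labels can move S, so the induction is carried out over the full
  label set.\<close>

lemma graph_quotient_map_graph:
  assumes "feynman UNIV G" "feynman UNIV \<gamma>" "gsub \<gamma> G"
  shows "graph_quotient (map_graph \<phi> G) (map_graph \<phi> \<gamma>) = map_graph \<phi> (graph_quotient G \<gamma>)"
  using assms
proof (induction rule: quotient_induct)
  case (empty G)
  then show ?case by (simp add: map_graph_empty graph_quotient_empty)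
next
  case (contract G \<gamma> \<delta>)
  have f: "feynman UNIV (map_graph \<phi> G)" "feynman UNIV (map_graph \<phi> \<gamma>)"
    using feynman_map_graph contract(1,2) by blast+
  have p: "pregraph G" "pregraph \<gamma>" using contract(1,2) by (blast intro: feynman_pregraph)+
  have "map_graph \<phi> \<delta> \<in> components (map_graph \<phi> \<gamma>)"
    unfolding components_map_graph[OF p(2)] using contract(4) by (rule imageI)
  then show ?case
    using graph_quotient_contract[OF f gsub_map_graph[OF contract(3)]] contract(5)
    by (simp add: contract_map_graph p graph_quotient_contract[OF contract(1-4)])
qed

end

text \<open>The half-edge sets are finite, so an isomorphism extends to a permutation of all labels.
  Isomorphic graphs are thus relabellings of each other, and every equivariant construction respects
  them.\<close>

lemma graph_iso_iff:
  assumes X: "pregraph X" and Y: "pregraph Y"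
  shows "graph_iso X Y \<longleftrightarrow> (\<exists>\<phi>. bij \<phi> \<and> Y = map_graph \<phi> X)"
proof
  assume "graph_iso X Y"
  then obtain f where f: "bij_betw f (halfs X) (halfs Y)" "(`) f ` gverts X = gverts Y" "(`) f ` gedges X = gedges Y"
    by (auto simp: graph_iso_def)
  obtain \<phi> where \<phi>: "bij \<phi>" "\<And>x. x \<in> halfs X \<Longrightarrow> \<phi> x = f x"
    using ex_permutation_extending[OF pregraph_finite[OF X] f(1)] by blast
  have im: "\<phi> ` A = f ` A" if "A \<subseteq> halfs X" for A using \<phi>(2) that by (intro image_cong) auto
  have "halfs (map_graph \<phi> X) = halfs Y" using im[OF subset_refl] f(1) by (simp add: bij_betw_def)
  moreover have "gverts (map_graph \<phi> X) = gverts Y"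
    unfolding map_graph_simps f(2)[symmetric]
    by (rule image_cong[OF refl], rule im, rule pregraph_vert_subset[OF X])
  moreover have "gedges (map_graph \<phi> X) = gedges Y"
    unfolding map_graph_simps f(3)[symmetric]
    by (rule image_cong[OF refl], rule im, rule pregraph_edge_subset[OF X])
  ultimately have "Y = map_graph \<phi> X" by simp
  then show "\<exists>\<phi>. bij \<phi> \<and> Y = map_graph \<phi> X" using \<phi>(1) by blast
next
  assume "\<exists>\<phi>. bij \<phi> \<and> Y = map_graph \<phi> X"
  then obtain \<phi> where \<phi>: "bij \<phi>" "Y = map_graph \<phi> X" by blast
  then have "bij_betw \<phi> (halfs X) (halfs Y)" using inj_on_subset[OF bij_is_inj] by (auto simp: bij_betw_def)
  then show "graph_iso X Y" unfolding graph_iso_def using \<phi>(2) by (intro exI[of _ \<phi>]) simp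
qed

lemma graph_iso_map_graph: "pregraph X \<Longrightarrow> bij \<phi> \<Longrightarrow> graph_iso X (map_graph \<phi> X)"
  using graph_iso_iff pregraph_map_graph by blast

lemma graph_iso_sym:
  assumes "pregraph X" "pregraph Y" "graph_iso X Y"
  shows "graph_iso Y X"
proof -
  obtain \<phi> where \<phi>: "bij \<phi>" "Y = map_graph \<phi> X" using assms graph_iso_iff by blast
  then have "X = map_graph (inv \<phi>) Y" by (simp add: map_graph_inv)
  then show ?thesis using graph_iso_map_graph[OF assms(2) bij_imp_bij_inv[OF \<phi>(1)]] by simp
qed

lemma graph_iso_trans:
  assumes "pregraph X" "pregraph Y" "pregraph Z" "graph_iso X Y" "graph_iso Y Z"
  shows "graph_iso X Z"
proof -
  obtain \<phi> where \<phi>: "bij \<phi>" "Y = map_graph \<phi> X" using assms graph_iso_iff by blast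
  obtain \<psi> where \<psi>: "bij \<psi>" "Z = map_graph \<psi> Y" using assms graph_iso_iff by blast
  have "Z = map_graph (\<psi> \<circ> \<phi>) X" using \<phi> \<psi> by (simp add: map_graph_comp)
  then show ?thesis using graph_iso_map_graph[OF assms(1) bij_comp[OF \<phi>(1) \<psi>(1)]] by simp
qed

section \<open>The Hall axioms for Feynman graphs\<close>

lemma feynman_UNIV: "feynman S G \<Longrightarrow> feynman UNIV G"
  by (simp add: feynman_iff)

lemma finite_graphs_on: "finite V \<Longrightarrow> finite {G. halfs G \<subseteq> V \<and> pregraph G}"
proof -
  assume V: "finite V"
  have "{G. halfs G \<subseteq> V \<and> pregraph G} \<subseteq>
    (\<lambda>(H, W, E). \<lparr>halfs = H, gverts = W, gedges = E\<rparr>) ` (Pow V \<times> Pow (Pow V) \<times> Pow (Pow V))"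
  proof
    fix G :: "'a lgraph" assume "G \<in> {G. halfs G \<subseteq> V \<and> pregraph G}"
    then have G: "halfs G \<subseteq> V" "pregraph G" by auto
    have "G = (\<lambda>(H, W, E). \<lparr>halfs = H, gverts = W, gedges = E\<rparr>) (halfs G, gverts G, gedges G)" by simp
    moreover have "(halfs G, gverts G, gedges G) \<in> Pow V \<times> Pow (Pow V) \<times> Pow (Pow V)"
    proof -
      have "gverts G \<subseteq> Pow V" using order_trans[OF pregraph_vert_subset[OF G(2)] G(1)] by blast
      moreover have "gedges G \<subseteq> Pow V" using order_trans[OF pregraph_edge_subset[OF G(2)] G(1)] by blast
      ultimately show ?thesis using G(1) by simp
    qed
    ultimately show "G \<in> (\<lambda>(H, W, E). \<lparr>halfs = H, gverts = W, gedges = E\<rparr>) `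
      (Pow V \<times> Pow (Pow V) \<times> Pow (Pow V))" by (rule image_eqI)
  qed
  then show ?thesis by (rule finite_subset) (simp add: V)
qed

lemma objs_LFG: "G \<in> objs (LFG S) \<longleftrightarrow> feynman S G"
  by (simp add: LFG_def)

lemma LFG_simps:
  "isom (LFG S) = graph_iso" "zero_obj (LFG S) = empty_graph" "subobjs (LFG S) = subgraphs S"
  "quotient_obj (LFG S) = graph_quotient"
  by (simp_all add: LFG_def empty_graph_def)

text \<open>A graph with at most n half-edges can be relabelled into a fixed n-element subset of S,
  on which only finitely many graphs exist. An upper bound is the right form because the half-edges
  of an extension are only covered by those of its two parts.\<close>

lemma finite_graph_classes:
  assumes S: "infinite S"
  shows "finite {iso_class (LFG S) G | G. feynman S G \<and> card (halfs G) \<le> n}"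
proof -
  obtain V where V: "V \<subseteq> S" "finite V" "card V = n" using infinite_arbitrarily_large[OF S] by blast
  have "{iso_class (LFG S) G | G. feynman S G \<and> card (halfs G) \<le> n} \<subseteq>
    iso_class (LFG S) ` {G. halfs G \<subseteq> V \<and> pregraph G}"
  proof clarify
    fix G assume G: "feynman S G" "card (halfs G) \<le> n"
    have p: "pregraph G" by (rule feynman_pregraph[OF G(1)])
    obtain W where W: "W \<subseteq> V" "card W = card (halfs G)" "finite W"
      using obtain_subset_with_card_n[of "card (halfs G)" V] G(2) V(3) by metis
    obtain f where "bij_betw f (halfs G) W"
      using finite_same_card_bij[OF pregraph_finite[OF p] W(3)] W(2) by metis
    then obtain \<phi> where \<phi>: "bij \<phi>" "\<phi> ` halfs G = W"
      using ex_permutation_extending[OF pregraph_finite[OF p]] by (metis bij_betw_imp_surj_on image_cong)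
    have f: "feynman S (map_graph \<phi> G)" using feynman_map_graph[OF \<phi>(1) G(1)] \<phi>(2) W(1) V(1) by blast
    have pm: "pregraph (map_graph \<phi> G)" by (rule feynman_pregraph[OF f])
    have iso: "graph_iso G (map_graph \<phi> G)" using graph_iso_map_graph[OF p \<phi>(1)] .
    have "graph_iso G Z \<longleftrightarrow> graph_iso (map_graph \<phi> G) Z" if "feynman S Z" for Z
      using graph_iso_trans[OF p pm feynman_pregraph[OF that] iso]
        graph_iso_trans[OF pm p feynman_pregraph[OF that] graph_iso_sym[OF p pm iso]] by blast
    then have "iso_class (LFG S) G = iso_class (LFG S) (map_graph \<phi> G)"
      unfolding iso_class_def objs_LFG LFG_simps by blast
    moreover have "map_graph \<phi> G \<in> {G. halfs G \<subseteq> V \<and> pregraph G}" using pm \<phi>(2) W(1) by simp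
    ultimately show "iso_class (LFG S) G \<in> iso_class (LFG S) ` {G. halfs G \<subseteq> V \<and> pregraph G}" by blast
  qed
  then show ?thesis by (rule finite_subset) (intro finite_imageI finite_graphs_on V(2))
qed

lemma hall_category_LFG:
  assumes S: "infinite S"
  shows "hall_category (LFG S)"
proof (unfold_locales, unfold objs_LFG LFG_simps)
  fix X Y Z :: "'a lgraph"
  assume X: "feynman S X"
  note pX = feynman_pregraph[OF X]
  show "graph_iso X X" using graph_iso_map_graph[OF pX bij_id] by (simp add: map_graph_id)
  show "graph_iso Y X" if "feynman S Y" "graph_iso X Y"
    using graph_iso_sym[OF pX feynman_pregraph] that by blast
  show "graph_iso X Z" if "feynman S Y" "feynman S Z" "graph_iso X Y" "graph_iso Y Z"
    using graph_iso_trans[OF pX feynman_pregraph feynman_pregraph] that by blast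
  show "finite (subgraphs S X)"
    by (rule finite_subset[OF _ finite_graphs_on[OF pregraph_finite[OF pX]]])
      (auto simp: subgraphs_def feynman_pregraph)
  show "empty_graph \<in> subgraphs S X" by (simp add: gsub_feynman_iff feynman_empty gsub_empty)
  show "graph_quotient X empty_graph = X" by (rule graph_quotient_empty)
  show "X \<in> subgraphs S X" by (simp add: gsub_feynman_iff X gsub_refl)
  show "graph_quotient X X = empty_graph" by (rule graph_quotient_self[OF X])
  show "X = empty_graph" if "graph_iso empty_graph X"
    using that pregraph_empty_iff[OF pX] by (auto simp: graph_iso_def bij_betw_def)
  show "\<exists>h. bij_betw h (subgraphs S X) (subgraphs S Y) \<and>
      (\<forall>N\<in>subgraphs S X. graph_iso N (h N) \<and> graph_iso (graph_quotient X N) (graph_quotient Y (h N)))"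
    if Y: "feynman S Y" "graph_iso X Y"
  proof -
    obtain \<phi> where \<phi>: "bij \<phi>" "Y = map_graph \<phi> X"
      using Y graph_iso_iff[OF pX feynman_pregraph] by blast
    then have X': "X = map_graph (inv \<phi>) Y" by (simp add: map_graph_inv)
    have sub: "map_graph \<psi> N \<in> subgraphs S (map_graph \<psi> A)"
      if "bij \<psi>" "N \<in> subgraphs S A" "feynman S (map_graph \<psi> A)" for \<psi> N A
    proof -
      have N: "feynman S N" "gsub N A" using that(2) by (auto simp: gsub_feynman_iff)
      have g: "gsub (map_graph \<psi> N) (map_graph \<psi> A)" by (rule gsub_map_graph[OF N(2)])
      have "\<psi> ` halfs N \<subseteq> S" using g feynman_halfs[OF that(3)]
        unfolding gsub_def map_graph_simps by (meson order_trans)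
      then show ?thesis using g feynman_map_graph[OF that(1) N(1)] by (simp add: gsub_feynman_iff)
    qed
    \<comment> \<open>The inverse permutation supplies the inverse map; the subgraphs obtained have
      labels in S because they lie in X or Y.\<close>
    have "bij_betw (map_graph \<phi>) (subgraphs S X) (subgraphs S Y)"
    proof (rule bij_betw_byWitness[where f' = "map_graph (inv \<phi>)"])
      show "map_graph \<phi> ` subgraphs S X \<subseteq> subgraphs S Y" using sub[OF \<phi>(1)] Y(1) \<phi>(2) by auto
      show "map_graph (inv \<phi>) ` subgraphs S Y \<subseteq> subgraphs S X"
        using sub[OF bij_imp_bij_inv[OF \<phi>(1)], of _ Y] X X' by auto
    qed (simp_all add: map_graph_inv[OF \<phi>(1)] map_graph_inv'[OF \<phi>(1)])
    moreover have "graph_iso N (map_graph \<phi> N) \<and> graph_iso (graph_quotient X N) (graph_quotient Y (map_graph \<phi> N))"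
      if "N \<in> subgraphs S X" for N
    proof -
      have N: "feynman S N" "gsub N X" using that by (auto simp: gsub_feynman_iff)
      have "graph_quotient Y (map_graph \<phi> N) = map_graph \<phi> (graph_quotient X N)"
        unfolding \<phi>(2) using graph_quotient_map_graph[OF \<phi>(1)] feynman_UNIV X N by blast
      then show ?thesis
        using graph_iso_map_graph[OF _ \<phi>(1)] feynman_pregraph[OF N(1)]
          feynman_pregraph[OF feynman_graph_quotient[OF X N]] by simp
    qed
    ultimately show ?thesis by blast
  qed
  fix N assume "N \<in> subgraphs S X"
  then have N: "feynman S N" "gsub N X" by (auto simp: gsub_feynman_iff)
  show "feynman S N" by (rule N(1))
  show "feynman S (graph_quotient X N)" by (rule feynman_graph_quotient[OF X N])
  show "A \<in> subgraphs S X" if "A \<in> subgraphs S N" for A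
    using that gsub_trans[OF _ N(2)] by (simp add: gsub_feynman_iff)
  show "bij_betw (\<lambda>M. graph_quotient M N) {M \<in> subgraphs S X. N \<in> subgraphs S M} (subgraphs S (graph_quotient X N))"
    by (rule bij_betw_graph_quotient[OF X N])
  show "graph_quotient (graph_quotient X N) (graph_quotient M N) = graph_quotient X M"
    if "M \<in> subgraphs S X" "N \<in> subgraphs S M" for M
    using that graph_quotient_graph_quotient[OF X N] by (simp add: gsub_feynman_iff)
next
  show e: "feynman S empty_graph" by (rule feynman_empty)
  have z: "zero_class (LFG S) = {empty_graph}"
  proof -
    have "graph_iso empty_graph X \<longleftrightarrow> X = empty_graph" if "feynman S X" for X
      using pregraph_empty_iff[OF feynman_pregraph[OF that]] by (auto simp: graph_iso_def bij_betw_def)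
    then show ?thesis using e by (auto simp: zero_class_def iso_class_def objs_LFG LFG_simps)
  qed
  have j: "join (LFG S) empty_graph empty_graph = empty_graph" "apart (LFG S) empty_graph empty_graph"
    by (simp_all add: LFG_def empty_graph_def)
  have "oplus (LFG S) {empty_graph} {empty_graph} = iso_class (LFG S) empty_graph"
    unfolding oplus_def iso_class_def using j by simp
  then show "oplus (LFG S) (zero_class (LFG S)) (zero_class (LFG S)) = zero_class (LFG S)"
    unfolding z using z by (simp add: zero_class_def LFG_simps)
next
  fix A B :: "'a lgraph"
  assume A: "feynman S A" and B: "feynman S B"
  have iso_card: "card (halfs X) = card (halfs Y)" if "graph_iso X Y" for X Y :: "'a lgraph"
    using that bij_betw_same_card by (auto simp: graph_iso_def)
  have "card (halfs E) \<le> card (halfs A) + card (halfs B)"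
    if E: "feynman S E" "N \<in> subgraphs S E" "graph_iso A N" "graph_iso B (graph_quotient E N)" for E N
  proof -
    have N: "feynman S N" "gsub N E" using E(2) by (auto simp: gsub_feynman_iff)
    have "finite (halfs N)" "finite (halfs (graph_quotient E N))"
      using pregraph_finite[OF feynman_pregraph] N(1) feynman_graph_quotient[OF E(1) N] by blast+
    then have "card (halfs E) \<le> card (halfs N \<union> halfs (graph_quotient E N))"
      using halfs_graph_quotient_cover[OF E(1) N] by (intro card_mono) auto
    also have "\<dots> \<le> card (halfs N) + card (halfs (graph_quotient E N))" by (rule card_Un_le)
    finally show ?thesis using iso_card[OF E(3)] iso_card[OF E(4)] by simp
  qed
  then show "finite {iso_class (LFG S) E | E. feynman S E \<and>
      (\<exists>N\<in>subgraphs S E. graph_iso A N \<and> graph_iso B (graph_quotient E N))}"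
    by (intro finite_subset[OF _ finite_graph_classes[OF S, of "card (halfs A) + card (halfs B)"]]) blast
qed

theorem mainTheorem1:
  fixes S :: "'s set" and S' :: "'t set"
  assumes "infinite S" and "infinite S'"
  shows
    "(let C = LRF S in
      ((\<forall>A \<in> Iso C. \<forall>B \<in> Iso C.
          bullet C (delta C B) (delta C A)
            = (\<Sum>N\<in>{N \<in> Sub C B. iso_class C N = A}. delta C (quot_class C B N)) \<and>
          box C (delta C B) (delta C A)
            = sum' (\<lambda>E. \<Sum>N\<in>{N \<in> Sub C E. iso_class C N = B \<and> quot_class C E N = A}. delta C E)
                   (Iso C) \<and>
          star C (delta C A) (delta C B)
            = (\<Sum>N\<in>{N \<in> Sub C B. quot_class C B N = A}. delta C (iso_class C N))) \<and>
      right_action C (bullet C) \<and>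
      (\<forall>X \<in> primitives C. \<forall>g \<in> hall C.
          dual_iso C (- bullet C g X) = elimination C X (dual_iso C g)) \<and>
      right_action C (box C) \<and>
      (\<forall>f \<in> hall C. \<forall>g \<in> hall C. box C g f = top_insertion C g f) \<and>
      left_action C (box C) \<and>
      (\<forall>f \<in> hall C. \<forall>g \<in> hall C. box C g f = insertion C g f) \<and>
      left_action C (star C) \<and>
      (\<forall>X \<in> primitives C. \<forall>g \<in> hall C.
          dual_iso C (star C X g) = - top_elimination C (dual_iso C g) X))) \<and>
     (let C = LFG S' in
      ((\<forall>A \<in> Iso C. \<forall>B \<in> Iso C.
          bullet C (delta C B) (delta C A)
            = (\<Sum>N\<in>{N \<in> Sub C B. iso_class C N = A}. delta C (quot_class C B N)) \<and>
          box C (delta C B) (delta C A)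
            = sum' (\<lambda>E. \<Sum>N\<in>{N \<in> Sub C E. iso_class C N = B \<and> quot_class C E N = A}. delta C E)
                   (Iso C) \<and>
          star C (delta C A) (delta C B)
            = (\<Sum>N\<in>{N \<in> Sub C B. quot_class C B N = A}. delta C (iso_class C N))) \<and>
      right_action C (bullet C) \<and>
      (\<forall>X \<in> primitives C. \<forall>g \<in> hall C.
          dual_iso C (- bullet C g X) = elimination C X (dual_iso C g)) \<and>
      right_action C (box C) \<and>
      (\<forall>f \<in> hall C. \<forall>g \<in> hall C. box C g f = top_insertion C g f) \<and>
      left_action C (box C) \<and>
      (\<forall>f \<in> hall C. \<forall>g \<in> hall C. box C g f = insertion C g f) \<and>
      left_action C (star C) \<and>
      (\<forall>X \<in> primitives C. \<forall>g \<in> hall C.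
          dual_iso C (star C X g) = - top_elimination C (dual_iso C g) X)))"
  unfolding Let_def
  by (rule conjI[OF hall_category.hecke_correspondence[OF hall_category_LRF[OF assms(1)]]
        hall_category.hecke_correspondence[OF hall_category_LFG[OF assms(2)]]])

end
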